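(* Let $A$ be a uniform algebra on a compact space $X$, let $I$ be a closed ideal in $A$, and set $S=\operatorname{hull}(I)$. Then there exist a uniform algebra $\widetilde A$ on a compact space $\widetilde X$ and a surjective continuous map $\widetilde\pi:\widetilde X\to X$, obtained from $A$ by a system of root extensions, and there exists an ideal $\widetilde I$ in $\widetilde A$ such that, setting $\widetilde S=\widetilde\pi^{-1}(S)$ and $\widetilde\pi^*(f)=f\circ\widetilde\pi$ for $f\in A$, the following hold: (i) $\widetilde\pi$ takes $\widetilde S$ homeomorphically onto $S$. (ii) $\widetilde\pi^*$ induces an isometric isomorphism of $A|S$ onto $\widetilde A|\widetilde S$, given by $f|S\mapsto(\widetilde\pi^*f)|\widetilde S$ (with supremum norms on $S$ and $\widetilde S$). (iii) $\widetilde I$ is a closed ideal in $\widetilde A$ such that $\operatorname{hull}(\widetilde I)=\widetilde S$, such that $\widetilde I\cap\widetilde\pi^*(A)=\widetilde\pi^*(I)$, and such that $\widetilde A/\widetilde I$ is isometrically isomorphic as a Banach algebra to $A/I$; consequently, there is an order-preserving bijective correspondence between the closed ideals of $\widetilde A$ containing $\widetilde I$ and the closed ideals of $A$ containing $I$. (iv) Every function in $\widetilde I$ has a square root in $\widetilde I$. (v) If $A$ is normal, then $\widetilde A$ is normal and has bounded relative units at every point of $\widetilde X\setminus\widetilde S$, and hence every point of $\widetilde X\setminus\widetilde S$ is a generalized peak point for $\widetilde A$. If $X$ is metrizable, then, in addition, $\widetilde X$ can be taken to be metrizable provided condition (iv) is replaced by (iv$'$) there is a dense subset $\mathscr{F}$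 of $\widetilde I$ such that every function in $\mathscr{F}$ has a square root in $\mathscr{F}$.
   Context: All spaces are Hausdorff. A uniform algebra on a compact space $X$ is a closed subalgebra of $C(X)$ (continuous complex-valued functions, supremum norm) containing the constants and separating the points of $X$. The hull of an ideal $I$ of a uniform algebra on $X$ is the common zero set in $X$ of the functions in $I$. $A|L$ denotes the set of restrictions to $L$ of functions in $A$. A uniform algebra $A$ on $X$ is natural if its maximal ideal space is $X$ (identifying points with evaluation functionals); it is normal if it is natural and for each pair of disjoint closed sets $K_0,K_1\subset X$ there is $f\in A$ with $f=1$ on $K_1$ and $f=0$ on $K_0$. $A$ has bounded relative units at $x\in X$ if there is $C\ge1$ such that for each compact $E\subset X\setminus\{x\}$ there is $f\in A$ vanishing on a neighborhood of $x$ with $f|E=1$ and $\|f\|_X\le C$. A point $x$ is a generalized peak point for $A$ if for every neighborhood $U$ of $x$ there is $f\in A$ with $f(x)=\|f\|=1$ and $|f(y)|<1$ for every $y\in X\setminus U$. Single extension. Let $A$ be a uniform algebra on $X$ and $\mathscr{F}\subset A$ nonempty. Give $\mathbb{C}^{\mathscr{F}}$ the product topology; let $p_1:X\times\mathbb{C}^{\mathscr{F}}\to X$ and, for $f\in\mathscr{F}$, $p_f:X\times\mathbb{C}^{\mathscr{F}}\to\mathbb{C}$ be $p_1(x,(z_g)_g)=x$, $p_f(x,(z_g)_g)=z_f$. Let $X_{\mathscr{F}}=\{y\in X\times\mathbb{C}^{\mathscr{F}}: (p_f(y))^2=f(p_1(y))\text{ for all }f\in\mathscr{F}\}$ and let $A_{\mathscr{F}}$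 be the uniform algebra on $X_{\mathscr{F}}$ generated by $\{f\circ p_1:f\in A\}\cup\{p_f:f\in\mathscr{F}\}$. $A_{\mathscr{F}}$ is the $\mathscr{F}$-extension of $A$ and $\pi=p_1|X_{\mathscr{F}}$ is the associated (surjective) map onto $X$. System of root extensions. For an infinite ordinal $\tau$, it consists of compact spaces $X_\alpha$, uniform algebras $A_\alpha$ on $X_\alpha$, and continuous surjections $\pi_{\alpha,\beta}:X_\beta\to X_\alpha$ $(0\le\alpha\le\beta\le\tau)$ such that: (1) $\pi_{\alpha,\beta}^*(f)=f\circ\pi_{\alpha,\beta}$ defines a homomorphism of $A_\alpha$ into $A_\beta$; (2) $\pi_{\alpha,\beta}\circ\pi_{\beta,\gamma}=\pi_{\alpha,\gamma}$ for $\alpha\le\beta\le\gamma$, and $\pi_{\alpha,\alpha}$ is the identity; (3) for each $\alpha<\tau$ there is a subset $\mathscr{F}_\alpha\subset A_\alpha$ such that $A_{\alpha+1}$ is the $\mathscr{F}_\alpha$-extension of $A_\alpha$ and $\pi_{\alpha,\alpha+1}$ is the associated surjection; (4) for $\gamma$ a limit ordinal, $X_\gamma$ is the inverse limit of $\{X_\alpha,\pi_{\alpha,\beta}\}_{\alpha\le\beta<\gamma}$ with the associated maps $\pi_{\alpha,\gamma}$, and $A_\gamma$ is the closure in $C(X_\gamma)$ of $\bigcup_{\alpha<\gamma}\pi_{\alpha,\gamma}^*(A_\alpha)$. $\widetilde A$ (on $\widetilde X$) and $\widetilde\pi:\widetilde X\to X$ are said to be obtained from $A$ by a system of root extensions if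 there is a system of root extensions, for some infinite ordinal $\tau$, with $A_0=A$, $A_\tau=\widetilde A$ and $\pi_{0,\tau}=\widetilde\pi$. *)

theory Defs
  imports "HOL-Analysis.Analysis" "HOL-Algebra.QuotRing" "HOL-Algebra.Module"
begin

section \<open>Uniform algebras\<close>

text \<open>
  For compact \<open>X\<close> this is \<open>C(X)\<close> with the supremum metric. Its elements are extensional, that is,
  equal to \<^const>\<open>undefined\<close> outside \<^term>\<open>topspace X\<close>, so that equality of elements is equality as
  functions on \<open>X\<close>.
\<close>
abbreviation cspace :: "'a topology \<Rightarrow> ('a \<Rightarrow> complex) metric" where
  "cspace X \<equiv> cfunspace X euclidean_metric"

definition sup_norm :: "'a set \<Rightarrow> ('a \<Rightarrow> complex) \<Rightarrow> real" where
  "sup_norm S f = (if S = {} then 0 else (SUP x\<in>S. cmod (f x)))"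

definition closed_unital_subalgebra :: "'a topology \<Rightarrow> ('a \<Rightarrow> complex) set \<Rightarrow> bool" where
  "closed_unital_subalgebra X A \<longleftrightarrow>
     A \<subseteq> mspace (cspace X) \<and>
     closedin (mtopology_of (cspace X)) A \<and>
     (\<forall>c. (\<lambda>x\<in>topspace X. c) \<in> A) \<and>
     (\<forall>f\<in>A. \<forall>g\<in>A. (\<lambda>x\<in>topspace X. f x + g x) \<in> A) \<and>
     (\<forall>f\<in>A. \<forall>g\<in>A. (\<lambda>x\<in>topspace X. f x * g x) \<in> A)"

definition uniform_algebra :: "'a topology \<Rightarrow> ('a \<Rightarrow> complex) set \<Rightarrow> bool" where
  "uniform_algebra X A \<longleftrightarrow>
     compact_space X \<and> Hausdorff_space X \<and> closed_unital_subalgebra X A \<and>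
     (\<forall>x\<in>topspace X. \<forall>y\<in>topspace X. x \<noteq> y \<longrightarrow> (\<exists>f\<in>A. f x \<noteq> f y))"

definition generated_uniform_algebra ::
    "'a topology \<Rightarrow> ('a \<Rightarrow> complex) set \<Rightarrow> ('a \<Rightarrow> complex) set" where
  "generated_uniform_algebra X G = \<Inter>{B. closed_unital_subalgebra X B \<and> G \<subseteq> B}"

record 'b normed_algebra = "(complex, 'b) module" +
  nrm :: "'b \<Rightarrow> real"

definition function_algebra :: "'a set \<Rightarrow> ('a \<Rightarrow> complex) set \<Rightarrow> ('a \<Rightarrow> complex) normed_algebra" where
  "function_algebra S B =
     \<lparr>carrier = B,
      mult = (\<lambda>f g. \<lambda>x\<in>S. f x * g x),
      one = (\<lambda>x\<in>S. 1),
      zero = (\<lambda>x\<in>S. 0),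
      add = (\<lambda>f g. \<lambda>x\<in>S. f x + g x),
      smult = (\<lambda>c f. \<lambda>x\<in>S. c * f x),
      nrm = sup_norm S\<rparr>"

definition quotient_algebra :: "'b normed_algebra \<Rightarrow> 'b set \<Rightarrow> 'b set normed_algebra" where
  "quotient_algebra M I =
     \<lparr>carrier = carrier (M Quot I),
      mult = mult (M Quot I),
      one = one (M Quot I),
      zero = zero (M Quot I),
      add = add (M Quot I),
      smult = (\<lambda>c K. \<Union>f\<in>K. I +>\<^bsub>M\<^esub> (c \<odot>\<^bsub>M\<^esub> f)),
      nrm = (\<lambda>K. INF f\<in>K. nrm M f)\<rparr>"

definition isometric_isomorphism ::
    "'b normed_algebra \<Rightarrow> 'c normed_algebra \<Rightarrow> ('b \<Rightarrow> 'c) \<Rightarrow> bool" where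
  "isometric_isomorphism M N \<phi> \<longleftrightarrow>
     \<phi> \<in> ring_iso M N \<and>
     (\<forall>c. \<forall>f\<in>carrier M. \<phi> (c \<odot>\<^bsub>M\<^esub> f) = c \<odot>\<^bsub>N\<^esub> \<phi> f) \<and>
     (\<forall>f\<in>carrier M. nrm N (\<phi> f) = nrm M f)"

text \<open>
  Ring ideals are automatically algebra ideals here, because a uniform algebra contains the constants;
  and closed in \<open>C(X)\<close> is the same as closed in the closed subset \<open>A\<close>.
\<close>
definition closed_ideal :: "'a topology \<Rightarrow> ('a \<Rightarrow> complex) set \<Rightarrow> ('a \<Rightarrow> complex) set \<Rightarrow> bool" where
  "closed_ideal X A I \<longleftrightarrow>
     ideal I (function_algebra (topspace X) A) \<and> closedin (mtopology_of (cspace X)) I"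

definition hull_of :: "'a topology \<Rightarrow> ('a \<Rightarrow> complex) set \<Rightarrow> 'a set" where
  "hull_of X I = {x \<in> topspace X. \<forall>f\<in>I. f x = 0}"

definition restrictions :: "('a \<Rightarrow> complex) set \<Rightarrow> 'a set \<Rightarrow> ('a \<Rightarrow> complex) set" where
  "restrictions A L = (\<lambda>f. restrict f L) ` A"

definition pullback :: "'b topology \<Rightarrow> ('b \<Rightarrow> 'a) \<Rightarrow> ('a \<Rightarrow> complex) \<Rightarrow> 'b \<Rightarrow> complex" where
  "pullback Y p f = restrict (f \<circ> p) (topspace Y)"

definition character :: "'a topology \<Rightarrow> ('a \<Rightarrow> complex) set \<Rightarrow> (('a \<Rightarrow> complex) \<Rightarrow> complex) \<Rightarrow> bool" where
  "character X A \<phi> \<longleftrightarrow>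
     (\<forall>f\<in>A. \<forall>g\<in>A. \<phi> (\<lambda>x\<in>topspace X. f x + g x) = \<phi> f + \<phi> g) \<and>
     (\<forall>c. \<forall>f\<in>A. \<phi> (\<lambda>x\<in>topspace X. c * f x) = c * \<phi> f) \<and>
     (\<forall>f\<in>A. \<forall>g\<in>A. \<phi> (\<lambda>x\<in>topspace X. f x * g x) = \<phi> f * \<phi> g) \<and>
     (\<exists>f\<in>A. \<phi> f \<noteq> 0)"

text \<open>
  The maximal ideal space is the set of characters. Evaluation at a point is a character, distinct
  points give distinct characters as \<open>A\<close> separates points, and the resulting injection of the compact
  space \<open>X\<close> is a homeomorphism onto its image; so only surjectivity has to be required.
\<close>
definition natural_algebra :: "'a topology \<Rightarrow> ('a \<Rightarrow> complex) set \<Rightarrow> bool" where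
  "natural_algebra X A \<longleftrightarrow>
     uniform_algebra X A \<and>
     (\<forall>\<phi>. character X A \<phi> \<longrightarrow> (\<exists>x\<in>topspace X. \<forall>f\<in>A. \<phi> f = f x))"

definition normal_algebra :: "'a topology \<Rightarrow> ('a \<Rightarrow> complex) set \<Rightarrow> bool" where
  "normal_algebra X A \<longleftrightarrow>
     natural_algebra X A \<and>
     (\<forall>K0 K1. closedin X K0 \<and> closedin X K1 \<and> K0 \<inter> K1 = {} \<longrightarrow>
        (\<exists>f\<in>A. (\<forall>x\<in>K1. f x = 1) \<and> (\<forall>x\<in>K0. f x = 0)))"

definition bounded_relative_units_at :: "'a topology \<Rightarrow> ('a \<Rightarrow> complex) set \<Rightarrow> 'a \<Rightarrow> bool" where
  "bounded_relative_units_at X A x \<longleftrightarrow>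
     (\<exists>C\<ge>1. \<forall>E. compactin X E \<and> E \<subseteq> topspace X - {x} \<longrightarrow>
        (\<exists>f\<in>A. (\<exists>U. openin X U \<and> x \<in> U \<and> (\<forall>y\<in>U. f y = 0)) \<and>
               (\<forall>y\<in>E. f y = 1) \<and> sup_norm (topspace X) f \<le> C))"

definition generalized_peak_point :: "'a topology \<Rightarrow> ('a \<Rightarrow> complex) set \<Rightarrow> 'a \<Rightarrow> bool" where
  "generalized_peak_point X A x \<longleftrightarrow>
     (\<forall>U. openin X U \<and> x \<in> U \<longrightarrow>
        (\<exists>f\<in>A. f x = 1 \<and> sup_norm (topspace X) f = 1 \<and>
               (\<forall>y\<in>topspace X - U. cmod (f y) < 1)))"


section \<open>Systems of root extensions\<close>

definition root_space ::
    "'a topology \<Rightarrow> ('a \<Rightarrow> complex) set \<Rightarrow> ('a \<times> (('a \<Rightarrow> complex) \<Rightarrow> complex)) topology" where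
  "root_space X F =
     subtopology (prod_topology X (product_topology (\<lambda>_. euclidean) F))
       {y. \<forall>f\<in>F. (snd y f)\<^sup>2 = f (fst y)}"

definition root_algebra ::
    "'a topology \<Rightarrow> ('a \<Rightarrow> complex) set \<Rightarrow> ('a \<Rightarrow> complex) set \<Rightarrow>
     ('a \<times> (('a \<Rightarrow> complex) \<Rightarrow> complex) \<Rightarrow> complex) set" where
  "root_algebra X A F =
     generated_uniform_algebra (root_space X F)
       (pullback (root_space X F) fst ` A \<union>
        (\<lambda>f. restrict (\<lambda>y. snd y f) (topspace (root_space X F))) ` F)"

text \<open>
  Up to a homeomorphism \<open>h\<close>, \<open>B\<close> on \<open>Y\<close> is the \<open>F\<close>-extension of \<open>A\<close> on \<open>X\<close>, with associated
  surjection \<open>p\<close>. The identification along \<open>h\<close> is forced by typing: the points of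
  \<^term>\<open>root_space X F\<close> have another type than those of \<open>X\<close>, whereas all the spaces of a system of
  extensions have to be of one type.
\<close>
definition is_root_extension ::
    "'a topology \<Rightarrow> ('a \<Rightarrow> complex) set \<Rightarrow> ('a \<Rightarrow> complex) set \<Rightarrow>
     'b topology \<Rightarrow> ('b \<Rightarrow> complex) set \<Rightarrow> ('b \<Rightarrow> 'a) \<Rightarrow> bool" where
  "is_root_extension X A F Y B p \<longleftrightarrow>
     F \<noteq> {} \<and> F \<subseteq> A \<and>
     (\<exists>h. homeomorphic_map Y (root_space X F) h \<and>
          (\<forall>y\<in>topspace Y. fst (h y) = p y) \<and>
          B = pullback Y h ` root_algebra X A F)"

definition immediate_successor :: "'i rel \<Rightarrow> 'i \<Rightarrow> 'i \<Rightarrow> bool" where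
  "immediate_successor r \<alpha> \<beta> \<longleftrightarrow> wo_rel.isMinim r (aboveS r \<alpha>) \<beta>"

definition limit_element :: "'i rel \<Rightarrow> 'i \<Rightarrow> bool" where
  "limit_element r \<gamma> \<longleftrightarrow>
     \<gamma> \<in> Field r \<and> underS r \<gamma> \<noteq> {} \<and> (\<forall>\<alpha>. \<not> immediate_successor r \<alpha> \<gamma>)"

definition inverse_limit ::
    "'i rel \<Rightarrow> 'i set \<Rightarrow> ('i \<Rightarrow> 'y topology) \<Rightarrow> ('i \<Rightarrow> 'i \<Rightarrow> 'y \<Rightarrow> 'y) \<Rightarrow> ('i \<Rightarrow> 'y) topology" where
  "inverse_limit r J X p =
     subtopology (product_topology X J)
       {t. \<forall>\<alpha>\<in>J. \<forall>\<beta>\<in>J. (\<alpha>, \<beta>) \<in> r \<longrightarrow> p \<alpha> \<beta> (t \<beta>) = t \<alpha>}"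

text \<open>
  The ordinals \<open>\<alpha> \<le> \<tau>\<close> are represented by the elements of a well-order \<open>r\<close> with greatest element \<open>\<tau>\<close>;
  \<open>\<tau>\<close> is infinite iff \<open>r\<close> is. Here \<open>p \<alpha> \<beta>\<close> is the map from \<open>X \<beta>\<close> to \<open>X \<alpha>\<close>. At a limit \<open>\<gamma>\<close>, the
  space \<open>X \<gamma>\<close> is the inverse limit of its predecessors in the sense that \<open>y \<mapsto> (p \<alpha> \<gamma> y)\<^sub>\<alpha>\<close> is a
  homeomorphism onto the space of threads.
\<close>
definition root_extension_system ::
    "'i rel \<Rightarrow> 'i \<Rightarrow> ('i \<Rightarrow> 'y topology) \<Rightarrow> ('i \<Rightarrow> ('y \<Rightarrow> complex) set) \<Rightarrow>
     ('i \<Rightarrow> 'i \<Rightarrow> 'y \<Rightarrow> 'y) \<Rightarrow> bool" where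
  "root_extension_system r \<tau> X A p \<longleftrightarrow>
     Well_order r \<and> infinite (Field r) \<and> \<tau> \<in> Field r \<and> (\<forall>\<alpha>\<in>Field r. (\<alpha>, \<tau>) \<in> r) \<and>
     (\<forall>\<alpha>\<in>Field r. uniform_algebra (X \<alpha>) (A \<alpha>)) \<and>
     (\<forall>\<alpha> \<beta>. (\<alpha>, \<beta>) \<in> r \<longrightarrow>
        continuous_map (X \<beta>) (X \<alpha>) (p \<alpha> \<beta>) \<and>
        p \<alpha> \<beta> ` topspace (X \<beta>) = topspace (X \<alpha>) \<and>
        pullback (X \<beta>) (p \<alpha> \<beta>) \<in>
          ring_hom (function_algebra (topspace (X \<alpha>)) (A \<alpha>))
                   (function_algebra (topspace (X \<beta>)) (A \<beta>))) \<and>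
     (\<forall>\<alpha> \<beta> \<gamma>. (\<alpha>, \<beta>) \<in> r \<and> (\<beta>, \<gamma>) \<in> r \<longrightarrow>
        (\<forall>x\<in>topspace (X \<gamma>). p \<alpha> \<beta> (p \<beta> \<gamma> x) = p \<alpha> \<gamma> x)) \<and>
     (\<forall>\<alpha>\<in>Field r. \<forall>x\<in>topspace (X \<alpha>). p \<alpha> \<alpha> x = x) \<and>
     (\<forall>\<alpha> \<beta>. immediate_successor r \<alpha> \<beta> \<and> \<alpha> \<in> Field r \<longrightarrow>
        (\<exists>F\<subseteq>A \<alpha>. is_root_extension (X \<alpha>) (A \<alpha>) F (X \<beta>) (A \<beta>) (p \<alpha> \<beta>))) \<and>
     (\<forall>\<gamma>. limit_element r \<gamma> \<longrightarrow>
        homeomorphic_map (X \<gamma>) (inverse_limit r (underS r \<gamma>) X p)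
          (\<lambda>y. \<lambda>\<alpha>\<in>underS r \<gamma>. p \<alpha> \<gamma> y) \<and>
        A \<gamma> = mtopology_of (cspace (X \<gamma>)) closure_of
                (\<Union>\<alpha>\<in>underS r \<gamma>. pullback (X \<gamma>) (p \<alpha> \<gamma>) ` A \<alpha>))"

text \<open>
  \<open>A'\<close> on \<open>X'\<close> and \<open>p' : X' \<rightarrow> X\<close> are obtained from \<open>A\<close> on \<open>X\<close> by a system of root extensions
  indexed by \<open>r\<close>. As the points of \<open>X\<close> may have another type than those of the spaces of the system,
  the initial algebra \<open>A\<^sub>0\<close> on \<open>X\<^sub>0\<close> is identified with \<open>A\<close> along a homeomorphism \<open>h : X\<^sub>0 \<rightarrow> X\<close>.
\<close>
definition obtained_by_root_extensions ::
    "'i rel \<Rightarrow> 'a topology \<Rightarrow> ('a \<Rightarrow> complex) set \<Rightarrow>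
     'y topology \<Rightarrow> ('y \<Rightarrow> complex) set \<Rightarrow> ('y \<Rightarrow> 'a) \<Rightarrow> bool" where
  "obtained_by_root_extensions r X A X' A' p' \<longleftrightarrow>
     (\<exists>\<tau> o' Xs As ps h.
        root_extension_system r \<tau> Xs As ps \<and>
        o' \<in> Field r \<and> (\<forall>\<alpha>\<in>Field r. (o', \<alpha>) \<in> r) \<and>
        homeomorphic_map (Xs o') X h \<and> As o' = pullback (Xs o') h ` A \<and>
        Xs \<tau> = X' \<and> As \<tau> = A' \<and>
        (\<forall>y\<in>topspace X'. p' y = h (ps o' \<tau> y)))"

end

theory Submission
  imports Defs
begin

text \<open>
  At every stage of the construction, square roots are adjoined to functions in the closed ideal
  generated by \<open>I\<close> and by all the roots adjoined before. All these roots vanish over the hull of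
  \<open>I\<close>, so that nothing changes there. The roots are ordered by the stage at which they are adjoined;
  changing the sign of one of them can be realized by a move of the point that fixes the base point
  and all earlier roots. Averaging over these moves, the latest root first, shows that every function
  of the tower is a function of \<open>A\<close> up to the ideal, and that the quotient norm does not decrease.

  With \<open>\<omega>\<^sub>1\<close> stages and roots of all functions of the ideal, a function of the final ideal is a
  uniform limit of functions from countably many stages, hence comes from one stage, and has a root
  at the next one. If \<open>X\<close> is metrizable, \<open>\<omega>\<close> stages with countable dense families keep it so.
  Normality passes up the tower, and iterated roots of a function of the ideal that is \<open>1\<close> near a
  point have norm arbitrarily close to \<open>1\<close>, which gives bounded relative units and peaking functions.
\<close>

section \<open>Algebras and ideals of functions on a set\<close>

text \<open>Two facts carry the algebra. Since radicands lie in the ideal, the square of a root is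
  again a function of \<open>I\<close> plus a sum of roots with coefficients; otherwise products
  would leave the form "base function plus roots with coefficients". And the averaging is a
  contraction that keeps the base part and kills the rest; therefore the sum of the two closed
  subspaces is closed, and the form survives uniform limits. Reversing a sign can force changes in
  later roots, whose radicands depend on it; this is why all roots, also those of one stage, are
  linearly ordered and the latest is treated first.

  The remaining obstacle is size. All stages have to live in one type, although each stage may
  adjoin a root for every function of an ideal. Every function of a stage is denoted by a countably
  branching term over base functions and root indices, and there are no more such terms than
  functions from the base type to the complex numbers; so these functions can serve as indices at
  every stage.

  Approximation alone does not reach the top ideal from below: approximants at earlier stages must
  first be moved into the ideals there, which the norm equality of the quotients permits.\<close>

definition unif_closed :: "'a set \<Rightarrow> ('a \<Rightarrow> complex) set \<Rightarrow> bool" where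
  "unif_closed T P \<longleftrightarrow> (\<forall>f. (\<forall>e>0. \<exists>g\<in>P. \<forall>x\<in>T. cmod (f x - g x) < e) \<longrightarrow> f \<in> P)"

text \<open>Boundedness on \<open>T\<close> is a clause of its own because \<open>T\<close> carries
  no topology here; it is what lets products pass to uniform limits.\<close>

definition fun_alg :: "'a set \<Rightarrow> ('a \<Rightarrow> complex) set \<Rightarrow> bool" where
  "fun_alg T P \<longleftrightarrow> unif_closed T P \<and> (\<forall>c. (\<lambda>x. c) \<in> P) \<and>
     (\<forall>f\<in>P. \<forall>g\<in>P. (\<lambda>x. f x + g x) \<in> P) \<and> (\<forall>f\<in>P. \<forall>g\<in>P. (\<lambda>x. f x * g x) \<in> P) \<and>
     (\<forall>f\<in>P. \<exists>M. \<forall>x\<in>T. cmod (f x) \<le> M)"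

definition fun_ideal :: "'a set \<Rightarrow> ('a \<Rightarrow> complex) set \<Rightarrow> ('a \<Rightarrow> complex) set \<Rightarrow> bool" where
  "fun_ideal T P Q \<longleftrightarrow> unif_closed T Q \<and> Q \<subseteq> P \<and> (\<lambda>x. 0) \<in> Q \<and>
     (\<forall>f\<in>Q. \<forall>g\<in>Q. (\<lambda>x. f x + g x) \<in> Q) \<and> (\<forall>f\<in>P. \<forall>g\<in>Q. (\<lambda>x. f x * g x) \<in> Q)"

lemma unif_closedD: "unif_closed T P \<Longrightarrow> (\<And>e. e > 0 \<Longrightarrow> \<exists>g\<in>P. \<forall>x\<in>T. cmod (f x - g x) < e) \<Longrightarrow> f \<in> P"
  unfolding unif_closed_def by blast

text \<open>Values outside \<open>T\<close> are invisible to the approximation condition, so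
  \<open>f\<close> itself approximates \<open>g\<close> with every error. This takes the place of
  equality of extensional functions.\<close>

lemma unif_closed_cong: "unif_closed T P \<Longrightarrow> f \<in> P \<Longrightarrow> (\<And>x. x \<in> T \<Longrightarrow> f x = g x) \<Longrightarrow> g \<in> P"
  by (erule unif_closedD) (auto intro!: bexI[of _ f])

lemma fun_algD:
  assumes "fun_alg T P"
  shows "unif_closed T P" "(\<lambda>x. c) \<in> P" "f \<in> P \<Longrightarrow> g \<in> P \<Longrightarrow> (\<lambda>x. f x + g x) \<in> P"
    "f \<in> P \<Longrightarrow> g \<in> P \<Longrightarrow> (\<lambda>x. f x * g x) \<in> P" "f \<in> P \<Longrightarrow> \<exists>M. \<forall>x\<in>T. cmod (f x) \<le> M"
  using assms unfolding fun_alg_def by blast+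

lemma fun_idealD:
  assumes "fun_ideal T P Q"
  shows "unif_closed T Q" "f \<in> Q \<Longrightarrow> f \<in> P" "(\<lambda>x. 0) \<in> Q" "f \<in> Q \<Longrightarrow> g \<in> Q \<Longrightarrow> (\<lambda>x. f x + g x) \<in> Q"
    "f \<in> P \<Longrightarrow> g \<in> Q \<Longrightarrow> (\<lambda>x. f x * g x) \<in> Q" "f \<in> P \<Longrightarrow> g \<in> Q \<Longrightarrow> (\<lambda>x. g x * f x) \<in> Q"
proof -
  show "f \<in> P \<Longrightarrow> g \<in> Q \<Longrightarrow> (\<lambda>x. f x * g x) \<in> Q" using assms unfolding fun_ideal_def by blast
  then show "f \<in> P \<Longrightarrow> g \<in> Q \<Longrightarrow> (\<lambda>x. g x * f x) \<in> Q" by (simp add: mult.commute)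
qed (use assms in \<open>unfold fun_ideal_def, blast+\<close>)

lemma fun_alg_diff: "fun_alg T P \<Longrightarrow> f \<in> P \<Longrightarrow> g \<in> P \<Longrightarrow> (\<lambda>x. f x - g x) \<in> P"
  using fun_algD(3)[of T P f "\<lambda>x. (-1) * g x"] fun_algD(4)[of T P "\<lambda>x. -1" g] fun_algD(2)[of T P "-1"] by simp

lemma fun_alg_power: "fun_alg T P \<Longrightarrow> f \<in> P \<Longrightarrow> (\<lambda>x. f x ^ n) \<in> P"
  by (induction n) (auto intro: fun_algD)

lemma fun_alg_sum: "fun_alg T P \<Longrightarrow> (\<And>i. i \<in> N \<Longrightarrow> f i \<in> P) \<Longrightarrow> (\<lambda>x. \<Sum>i\<in>N. f i x) \<in> P"
  by (induction N rule: infinite_finite_induct) (auto intro: fun_algD)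

lemma fun_alg_prod: "fun_alg T P \<Longrightarrow> (\<And>i. i \<in> N \<Longrightarrow> f i \<in> P) \<Longrightarrow> (\<lambda>x. \<Prod>i\<in>N. f i x) \<in> P"
  by (induction N rule: infinite_finite_induct) (auto intro: fun_algD)

lemma fun_ideal_diff:
  assumes "fun_alg T P" "fun_ideal T P Q" "f \<in> Q" "g \<in> Q" shows "(\<lambda>x. f x - g x) \<in> Q"
  using fun_idealD(4)[OF assms(2,3) fun_idealD(5)[OF assms(2) fun_algD(2)[OF assms(1), of "-1"] assms(4)]] by simp

lemma fun_ideal_sum: "fun_ideal T P Q \<Longrightarrow> (\<And>i. i \<in> N \<Longrightarrow> f i \<in> Q) \<Longrightarrow> (\<lambda>x. \<Sum>i\<in>N. f i x) \<in> Q"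
  by (induction N rule: infinite_finite_induct) (auto intro: fun_idealD(3,4))

text \<open>Uniform limits are a constructor instead of a closure taken at the end. A generated
  closed algebra thus has a single induction principle, and closures of intermediate algebras need
  no separate treatment.\<close>

inductive_set gen :: "'a set \<Rightarrow> ('a \<Rightarrow> complex) set \<Rightarrow> ('a \<Rightarrow> complex) set" for T G where
  gen_base: "f \<in> G \<Longrightarrow> f \<in> gen T G"
| gen_const: "(\<lambda>x. c) \<in> gen T G"
| gen_add: "f \<in> gen T G \<Longrightarrow> g \<in> gen T G \<Longrightarrow> (\<lambda>x. f x + g x) \<in> gen T G"
| gen_mult: "f \<in> gen T G \<Longrightarrow> g \<in> gen T G \<Longrightarrow> (\<lambda>x. f x * g x) \<in> gen T G"
| gen_lim: "(\<And>e::real. e > 0 \<Longrightarrow> \<exists>g. g \<in> gen T G \<and> (\<forall>x\<in>T. cmod (f x - g x) < e)) \<Longrightarrow> f \<in> gen T G"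

inductive_set igen :: "'a set \<Rightarrow> ('a \<Rightarrow> complex) set \<Rightarrow> ('a \<Rightarrow> complex) set \<Rightarrow> ('a \<Rightarrow> complex) set"
  for T P G where
  igen_base: "f \<in> G \<Longrightarrow> f \<in> igen T P G"
| igen_zero: "(\<lambda>x. 0) \<in> igen T P G"
| igen_add: "f \<in> igen T P G \<Longrightarrow> g \<in> igen T P G \<Longrightarrow> (\<lambda>x. f x + g x) \<in> igen T P G"
| igen_mult: "f \<in> P \<Longrightarrow> g \<in> igen T P G \<Longrightarrow> (\<lambda>x. f x * g x) \<in> igen T P G"
| igen_lim: "(\<And>e::real. e > 0 \<Longrightarrow> \<exists>g. g \<in> igen T P G \<and> (\<forall>x\<in>T. cmod (f x - g x) < e)) \<Longrightarrow> f \<in> igen T P G"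

lemma gen_least: 
  assumes f: "f \<in> gen T G" and P: "fun_alg T P" and G: "G \<subseteq> P" shows "f \<in> P"
  using f
proof (induction rule: gen.induct)
  case (gen_lim f)
  show ?case by (rule unif_closedD[OF fun_algD(1)[OF P]]) (use gen_lim in blast)
qed (use fun_algD[OF P] G in auto)

lemma unif_closed_gen: "unif_closed T (gen T G)"
  unfolding unif_closed_def by (intro allI impI gen_lim) blast

lemma bounded_limit:
  assumes "\<exists>g. (\<exists>M. \<forall>x\<in>T. cmod (g x) \<le> M) \<and> (\<forall>x\<in>T. cmod (f x - g x) < e)"
  shows "\<exists>M. \<forall>x\<in>T. cmod (f x) \<le> M"
proof -
  obtain g M where "\<forall>x\<in>T. cmod (g x) \<le> M" and "\<forall>x\<in>T. cmod (f x - g x) < e" using assms by blast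
  then have "\<forall>x\<in>T. cmod (f x) \<le> M + e"
    by (smt (verit) norm_triangle_sub)
  then show ?thesis by blast
qed

lemma gen_bounded:
  assumes "\<And>g. g \<in> G \<Longrightarrow> \<exists>M. \<forall>x\<in>T. cmod (g x) \<le> M" and "f \<in> gen T G"
  shows "\<exists>M. \<forall>x\<in>T. cmod (f x) \<le> M"
  using assms(2)
proof (induction rule: gen.induct)
  case (gen_base f) then show ?case using assms(1) by blast
next
  case (gen_const c) then show ?case by auto
next
  case (gen_add f g)
  then obtain M N where "\<forall>x\<in>T. cmod (f x) \<le> M" "\<forall>x\<in>T. cmod (g x) \<le> N" by blast
  then have "\<forall>x\<in>T. cmod (f x + g x) \<le> M + N" by (meson add_mono norm_triangle_ineq order_trans)
  then show ?case by blast
next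
  case (gen_mult f g)
  then obtain M N where "\<forall>x\<in>T. cmod (f x) \<le> M" "\<forall>x\<in>T. cmod (g x) \<le> N" by blast
  then have "\<forall>x\<in>T. cmod (f x * g x) \<le> M * N"
    by (metis norm_mult mult_mono' norm_ge_zero)
  then show ?case by blast
next
  case (gen_lim f)
  then show ?case using bounded_limit[of T f 1] by (meson zero_less_one)
qed

lemma fun_alg_gen:
  assumes "\<And>g. g \<in> G \<Longrightarrow> \<exists>M. \<forall>x\<in>T. cmod (g x) \<le> M"
  shows "fun_alg T (gen T G)"
  unfolding fun_alg_def using unif_closed_gen gen_const gen_add gen_mult gen_bounded[OF assms] by blast

lemma igen_least: 
  assumes f: "f \<in> igen T P G" and Q: "fun_ideal T P Q" and G: "G \<subseteq> Q" shows "f \<in> Q"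
  using f
proof (induction rule: igen.induct)
  case (igen_lim f)
  show ?case by (rule unif_closedD[OF fun_idealD(1)[OF Q]]) (use igen_lim in blast)
qed (use fun_idealD[OF Q] G in auto)

lemma unif_closed_igen: "unif_closed T (igen T P G)"
  unfolding unif_closed_def by (intro allI impI igen_lim) blast

lemma fun_ideal_igen:
  assumes P: "fun_alg T P" and G: "G \<subseteq> P"
  shows "fun_ideal T P (igen T P G)"
proof -
  have "f \<in> P" if "f \<in> igen T P G" for f
    using that
  proof (induction rule: igen.induct)
    case (igen_lim f)
    show ?case by (rule unif_closedD[OF fun_algD(1)[OF P]]) (use igen_lim in blast)
  qed (use fun_algD[OF P] G in auto)
  then show ?thesis
    unfolding fun_ideal_def using unif_closed_igen igen_zero igen_add igen_mult by blast
qed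

text \<open>Completeness. The limit is taken pointwise by \<open>lim\<close>; its arbitrary values
  outside \<open>T\<close> do no harm, since membership in \<open>P\<close> depends on
  \<open>T\<close> only.\<close>

lemma unif_closed_limit:
  assumes P: "unif_closed T P" and f: "\<And>n::nat. f n \<in> P"
    and C: "\<And>e. e > 0 \<Longrightarrow> \<exists>N. \<forall>m\<ge>N. \<forall>n\<ge>N. \<forall>x\<in>T. cmod (f m x - f n x) \<le> e"
  obtains g where "g \<in> P" "\<And>e. e > 0 \<Longrightarrow> \<exists>N. \<forall>n\<ge>N. \<forall>x\<in>T. cmod (f n x - g x) \<le> e"
proof -
  define g where "g x = lim (\<lambda>n. f n x)" for x
  have lim: "(\<lambda>n. f n x) \<longlonglongrightarrow> g x" if "x \<in> T" for x
  proof -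
    have "Cauchy (\<lambda>n. f n x)"
      unfolding Cauchy_def dist_norm
    proof (intro allI impI)
      fix e :: real assume "e > 0"
      then obtain N where "\<forall>m\<ge>N. \<forall>n\<ge>N. \<forall>x\<in>T. cmod (f m x - f n x) \<le> e/2" using C[of "e/2"] by auto
      then show "\<exists>M. \<forall>m\<ge>M. \<forall>n\<ge>M. cmod (f m x - f n x) < e" using that \<open>e > 0\<close>
        by (intro exI[of _ N]) (smt (verit) field_sum_of_halves)
    qed
    then show ?thesis unfolding g_def using Cauchy_convergent convergent_LIMSEQ_iff by blast
  qed
  have unif: "\<exists>N. \<forall>n\<ge>N. \<forall>x\<in>T. cmod (f n x - g x) \<le> e" if e: "e > 0" for e
  proof -
    obtain N where N: "\<forall>m\<ge>N. \<forall>n\<ge>N. \<forall>x\<in>T. cmod (f m x - f n x) \<le> e" using C[OF e] by metis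
    have "cmod (f m x - g x) \<le> e" if "m \<ge> N" "x \<in> T" for m x
    proof (rule LIMSEQ_le_const2)
      show "(\<lambda>n. cmod (f m x - f n x)) \<longlonglongrightarrow> cmod (f m x - g x)"
        using lim[OF \<open>x \<in> T\<close>] by (intro tendsto_intros)
      show "\<exists>N. \<forall>n\<ge>N. cmod (f m x - f n x) \<le> e" using N that by blast
    qed
    then show ?thesis by blast
  qed
  have "g \<in> P"
  proof (rule unif_closedD[OF P])
    fix e :: real assume "e > 0"
    then obtain N where "\<forall>n\<ge>N. \<forall>x\<in>T. cmod (f n x - g x) \<le> e/2" using unif[of "e/2"] by auto
    then have "\<forall>x\<in>T. cmod (g x - f N x) < e" using \<open>e > 0\<close> by (subst norm_minus_commute) fastforce
    then show "\<exists>h\<in>P. \<forall>x\<in>T. cmod (g x - h x) < e" using f by blast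
  qed
  then show ?thesis using that unif by blast
qed

section \<open>Adjoining square roots of elements of an ideal\<close>

text \<open>Isolates what the algebra of roots needs from a tower: functions \<open>r w\<close>
  indexed along a well-founded total order, squares in the ideal generated by \<open>PI\<close> and
  strictly earlier roots, and for each root a move of the points that reverses its sign. Neither
  topology nor stages occur.\<close>

locale multiroot =
  fixes X :: "'a set" and PA PI :: "('a \<Rightarrow> complex) set" and Y :: "'y set" and \<pi> :: "'y \<Rightarrow> 'a"
    and V :: "'w set" and r :: "'w \<Rightarrow> 'y \<Rightarrow> complex" and prec :: "'w rel"
    and lower :: "'w \<Rightarrow> 'w set"
    and BB JJ :: "'w set \<Rightarrow> ('y \<Rightarrow> complex) set"
  defines "lower w \<equiv> {v\<in>V. (v, w) \<in> prec}"
    and "BB D \<equiv> gen Y ((\<lambda>a y. a (\<pi> y)) ` PA \<union> r ` D)"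
    and "JJ D \<equiv> igen Y (BB D) ((\<lambda>a y. a (\<pi> y)) ` PI \<union> r ` D)"
  assumes PA: "fun_alg X PA" and PI: "fun_ideal X PA PI" and surj: "\<pi> ` Y = X"
    and wf: "wf prec" and trans: "trans prec"
    and total: "\<And>v w. v \<in> V \<Longrightarrow> w \<in> V \<Longrightarrow> v = w \<or> (v, w) \<in> prec \<or> (w, v) \<in> prec"
    and bdd: "\<And>w. w \<in> V \<Longrightarrow> \<exists>M. \<forall>y\<in>Y. cmod (r w y) \<le> M"
    and sq: "\<And>w. w \<in> V \<Longrightarrow> (\<lambda>y. r w y * r w y) \<in> JJ (lower w)"
    and flip: "\<And>w y. w \<in> V \<Longrightarrow> y \<in> Y \<Longrightarrow>
       \<exists>y'\<in>Y. \<pi> y' = \<pi> y \<and> (\<forall>v\<in>lower w. r v y' = r v y) \<and> r w y' = - r w y"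
begin

text \<open>A normal form: in each summand the latest root is split off and occurs to the first
  power, and its coefficient involves base functions and strictly earlier roots only. These are the
  functions that the averaging annihilates.\<close>

definition HH :: "'w set \<Rightarrow> ('y \<Rightarrow> complex) set" where
  "HH D = {h. (\<exists>N c. finite N \<and> N \<subseteq> D \<and> (\<forall>w\<in>N. c w \<in> BB (lower w)) \<and> h = (\<lambda>y. \<Sum>w\<in>N. c w y * r w y))}"

definition cH :: "'w set \<Rightarrow> ('y \<Rightarrow> complex) set" where
  "cH D = {f. \<forall>e>0. \<exists>h\<in>HH D. \<forall>y\<in>Y. cmod (f y - h y) < e}"

lemma HH_I: "finite N \<Longrightarrow> N \<subseteq> D \<Longrightarrow> (\<And>w. w \<in> N \<Longrightarrow> c w \<in> BB (lower w)) \<Longrightarrow> h = (\<lambda>y. \<Sum>w\<in>N. c w y * r w y) \<Longrightarrow> h \<in> HH D"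
  unfolding HH_def by blast

lemma HH_E:
  assumes "h \<in> HH D"
  obtains N c where "finite N" "N \<subseteq> D" "\<forall>w\<in>N. c w \<in> BB (lower w)" "h = (\<lambda>y. \<Sum>w\<in>N. c w y * r w y)"
  using assms unfolding HH_def by blast

lemma cH_iff: "f \<in> cH D \<longleftrightarrow> (\<forall>e>0. \<exists>h\<in>HH D. \<forall>y\<in>Y. cmod (f y - h y) < e)"
  by (simp add: cH_def)

lemma lower_sub: "lower w \<subseteq> V" by (auto simp: lower_def)

lemma BB_fun_alg: assumes "D \<subseteq> V" shows "fun_alg Y (BB D)"
  unfolding BB_def
proof (rule fun_alg_gen)
  fix g assume "g \<in> (\<lambda>a y. a (\<pi> y)) ` PA \<union> r ` D"
  then show "\<exists>M. \<forall>x\<in>Y. cmod (g x) \<le> M"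
  proof
    assume "g \<in> (\<lambda>a y. a (\<pi> y)) ` PA"
    then obtain a where a: "a \<in> PA" "g = (\<lambda>y. a (\<pi> y))" by blast
    then obtain M where "\<forall>x\<in>X. cmod (a x) \<le> M" using fun_algD(5)[OF PA] by blast
    then show ?thesis using a surj by auto
  qed (use bdd assms in auto)
qed

lemmas BB = fun_algD[OF BB_fun_alg]

lemma BB_pi: "a \<in> PA \<Longrightarrow> (\<lambda>y. a (\<pi> y)) \<in> BB D"
  unfolding BB_def by (rule gen_base) auto

lemma BB_r: "w \<in> D \<Longrightarrow> r w \<in> BB D"
  unfolding BB_def by (rule gen_base) auto

lemma BB_mono: assumes "f \<in> BB D" "D \<subseteq> E" "E \<subseteq> V" shows "f \<in> BB E"
  using assms(1)[unfolded BB_def] BB_fun_alg[OF assms(3)]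
  by (rule gen_least) (use assms(2) BB_pi BB_r in auto)

lemma JJ_fun_ideal: assumes "D \<subseteq> V" shows "fun_ideal Y (BB D) (JJ D)"
  unfolding JJ_def
  by (rule fun_ideal_igen[OF BB_fun_alg[OF assms]]) (use BB_pi BB_r fun_idealD(2)[OF PI] in auto)

lemmas JJ = fun_idealD[OF JJ_fun_ideal]

lemma JJ_r: "w \<in> D \<Longrightarrow> (r w) \<in> JJ D"
  unfolding JJ_def by (rule igen_base) auto

text \<open>Functions built from the base and the roots in \<open>D\<close> cannot tell apart points
  that agree in these data. In the limit case, an approximation within half the difference of the
  two values would contradict that difference.\<close>

lemma BB_eq: assumes "f \<in> BB D" "y \<in> Y" "y' \<in> Y" "\<pi> y' = \<pi> y" "\<And>v. v \<in> D \<Longrightarrow> r v y' = r v y"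
  shows "f y' = f y"
  using assms(1)[unfolded BB_def]
proof (induction rule: gen.induct)
  case (gen_lim f)
  show ?case
  proof (rule ccontr)
    assume "f y' \<noteq> f y"
    then have e: "cmod (f y' - f y) / 2 > 0" by simp
    from gen_lim[OF e] obtain g where "g y' = g y" "\<forall>x\<in>Y. cmod (f x - g x) < cmod (f y' - f y) / 2" by blast
    then have "cmod (f y' - g y) < cmod (f y' - f y) / 2" "cmod (f y - g y) < cmod (f y' - f y) / 2"
      using assms(2,3) by metis+
    then show False using norm_triangle_ineq4[of "f y' - g y" "f y - g y"] by simp
  qed
qed (use assms in auto)

lemma HH_add:
  assumes "f \<in> HH D" "g \<in> HH D" "D \<subseteq> V" shows "(\<lambda>y. f y + g y) \<in> HH D"
proof -
  obtain N c M d where N: "finite N" "N \<subseteq> D" "\<forall>w\<in>N. c w \<in> BB (lower w)" "f = (\<lambda>y. \<Sum>w\<in>N. c w y * r w y)"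
    and M: "finite M" "M \<subseteq> D" "\<forall>w\<in>M. d w \<in> BB (lower w)" "g = (\<lambda>y. \<Sum>w\<in>M. d w y * r w y)"
    using assms(1,2) by (elim HH_E)
  define c' d' where "c' w = (if w \<in> N then c w else (\<lambda>y. 0))" and "d' w = (if w \<in> M then d w else (\<lambda>y. 0))" for w
  have c': "(\<lambda>y. c' w y + d' w y) \<in> BB (lower w)" if "w \<in> N \<union> M" for w
  proof (rule BB(3)[OF lower_sub])
    show "c' w \<in> BB (lower w)" "d' w \<in> BB (lower w)"
      unfolding c'_def d'_def using N(3) M(3) BB(2)[OF lower_sub, of 0] by auto
  qed
  have "f y + g y = (\<Sum>w\<in>N \<union> M. (c' w y + d' w y) * r w y)" for y
  proof -
    have "(\<Sum>w\<in>N. c w y * r w y) = (\<Sum>w\<in>N \<union> M. c' w y * r w y)"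
      using N(1) M(1) by (intro sum.mono_neutral_cong_left) (auto simp: c'_def)
    moreover have "(\<Sum>w\<in>M. d w y * r w y) = (\<Sum>w\<in>N \<union> M. d' w y * r w y)"
      using N(1) M(1) by (intro sum.mono_neutral_cong_left) (auto simp: d'_def)
    ultimately show ?thesis by (simp add: N(4) M(4) sum.distrib distrib_right)
  qed
  then show ?thesis using N(1,2) M(1,2) c'
    by (intro HH_I[of "N \<union> M" _ "\<lambda>w y. c' w y + d' w y"]) auto
qed

lemma HH_single: "w \<in> D \<Longrightarrow> c \<in> BB (lower w) \<Longrightarrow> (\<lambda>y. c y * r w y) \<in> HH D"
  by (rule HH_I[of "{w}" _ "\<lambda>_. c"]) auto

lemma HH_zero: "(\<lambda>y. 0) \<in> HH D"
  by (rule HH_I[of "{}"]) auto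

lemma HH_pi: assumes "h \<in> HH D" "a \<in> PA" shows "(\<lambda>y. a (\<pi> y) * h y) \<in> HH D"
proof -
  obtain N c where N: "finite N" "N \<subseteq> D" "\<forall>w\<in>N. c w \<in> BB (lower w)" "h = (\<lambda>y. \<Sum>w\<in>N. c w y * r w y)"
    using assms(1) by (elim HH_E)
  then show ?thesis 
    by (intro HH_I[of N _ "\<lambda>w y. a (\<pi> y) * c w y"])
      (auto simp: sum_distrib_left mult.assoc intro!: BB(4)[OF lower_sub BB_pi] assms)
qed

lemma HH_mono: "h \<in> HH D \<Longrightarrow> D \<subseteq> E \<Longrightarrow> h \<in> HH E"
  unfolding HH_def by blast

lemma HH_JJ: assumes "h \<in> HH D" "D \<subseteq> V" "\<And>w. w \<in> D \<Longrightarrow> lower w \<subseteq> D" shows "h \<in> JJ D"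
proof -
  obtain N c where N: "finite N" "N \<subseteq> D" "\<forall>w\<in>N. c w \<in> BB (lower w)" "h = (\<lambda>y. \<Sum>w\<in>N. c w y * r w y)"
    using assms(1) by (elim HH_E)
  have "(\<lambda>y. c w y * r w y) \<in> JJ D" if w: "w \<in> N" for w
  proof (rule JJ(5)[OF assms(2)])
    show "c w \<in> BB D" using N w assms(2) assms(3)[of w] by (auto intro: BB_mono[of "c w" "lower w" D])
    show "r w \<in> JJ D" using N w by (intro JJ_r) auto
  qed
  then show ?thesis unfolding N(4) by (rule fun_ideal_sum[OF JJ_fun_ideal[OF assms(2)]])
qed

lemma cH_HH: "h \<in> HH D \<Longrightarrow> h \<in> cH D" unfolding cH_iff by (auto intro!: bexI[of _ h])

lemma unif_closed_cH: "unif_closed Y (cH D)"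
  unfolding unif_closed_def
proof (intro allI impI)
  fix f assume f: "\<forall>e>0. \<exists>g\<in>cH D. \<forall>x\<in>Y. cmod (f x - g x) < e"
  show "f \<in> cH D" unfolding cH_iff
  proof (intro allI impI)
    fix e :: real assume "e > 0"
    then have e2: "e / 2 > 0" by simp
    obtain g where g: "g \<in> cH D" "\<forall>x\<in>Y. cmod (f x - g x) < e/2" using f[rule_format, OF e2] ..
    obtain h where h: "h \<in> HH D" "\<forall>x\<in>Y. cmod (g x - h x) < e/2" using g(1)[unfolded cH_iff, rule_format, OF e2] ..
    have "\<forall>x\<in>Y. cmod (f x - h x) < e"
      using g(2) h(2) norm_diff_triangle_less[of _ _ "e/2" _ "e/2"] by fastforce
    then show "\<exists>h\<in>HH D. \<forall>y\<in>Y. cmod (f y - h y) < e" using h by blast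
  qed
qed

lemma cH_mono: "h \<in> cH D \<Longrightarrow> D \<subseteq> E \<Longrightarrow> h \<in> cH E"
  unfolding cH_iff using HH_mono by metis

lemma cH_add:
  assumes "f \<in> cH D" "g \<in> cH D" "D \<subseteq> V" shows "(\<lambda>y. f y + g y) \<in> cH D"
  unfolding cH_iff
proof (intro allI impI)
  fix e :: real assume "e > 0"
  then have e2: "e / 2 > 0" by simp
  obtain h where h: "h \<in> HH D" "\<forall>x\<in>Y. cmod (f x - h x) < e/2" using assms(1)[unfolded cH_iff, rule_format, OF e2] ..
  obtain k where k: "k \<in> HH D" "\<forall>x\<in>Y. cmod (g x - k x) < e/2" using assms(2)[unfolded cH_iff, rule_format, OF e2] ..
  have "\<forall>x\<in>Y. cmod ((f x + g x) - (h x + k x)) < e"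
  proof (intro ballI)
    fix x assume "x \<in> Y"
    then have "cmod (f x - h x) + cmod (g x - k x) < e" using h(2) k(2) by fastforce
    then show "cmod ((f x + g x) - (h x + k x)) < e" by (rule le_less_trans[OF norm_diff_triangle_ineq])
  qed
  then show "\<exists>h\<in>HH D. \<forall>y\<in>Y. cmod ((f y + g y) - h y) < e" by (rule bexI[OF _ HH_add[OF h(1) k(1) assms(3)]])
qed

lemma cH_pi: assumes "h \<in> cH D" "a \<in> PA" shows "(\<lambda>y. a (\<pi> y) * h y) \<in> cH D"
  unfolding cH_iff
proof (intro allI impI)
  fix e :: real assume "e > 0"
  obtain M where M: "\<forall>x\<in>X. cmod (a x) \<le> M" using fun_algD(5)[OF PA assms(2)] by blast
  define M' where "M' = max M 1"
  then have "M' > 0" by simp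
  then obtain k where k: "k \<in> HH D" "\<forall>x\<in>Y. cmod (h x - k x) < e / M'" using assms \<open>e > 0\<close> unfolding cH_iff by (meson divide_pos_pos)
  have "cmod (a (\<pi> y) * h y - a (\<pi> y) * k y) < e" if "y \<in> Y" for y
  proof -
    have "cmod (a (\<pi> y)) \<le> M'" using M surj that unfolding M'_def by fastforce
    then have "cmod (a (\<pi> y)) * cmod (h y - k y) \<le> M' * cmod (h y - k y)" by (simp add: mult_right_mono)
    also have "\<dots> < e" using k(2) that \<open>M' > 0\<close> by (simp add: pos_less_divide_eq mult.commute)
    finally show ?thesis unfolding right_diff_distrib[symmetric] norm_mult .
  qed
  then show "\<exists>k\<in>HH D. \<forall>y\<in>Y. cmod (a (\<pi> y) * h y - k y) < e" by (intro bexI[OF _ HH_pi[OF k(1) assms(2)]] ballI)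
qed

text \<open>Averaging over the flip at the largest root in the sum removes that root.\<close>

lemma contraction_HH:
  assumes "h \<in> HH V" "a \<in> PA" and c: "\<And>y. y \<in> Y \<Longrightarrow> cmod (a (\<pi> y) + h y) \<le> C" and x: "x \<in> X"
  shows "cmod (a x) \<le> C"
proof -
  obtain N c where N: "finite N" "N \<subseteq> V" "\<forall>w\<in>N. c w \<in> BB (lower w)" "h = (\<lambda>y. \<Sum>w\<in>N. c w y * r w y)"
    using assms(1) by (elim HH_E)
  have *: "finite N \<Longrightarrow> N \<subseteq> V \<Longrightarrow> \<forall>w\<in>N. c w \<in> BB (lower w) \<Longrightarrow>
      (\<And>y. y \<in> Y \<Longrightarrow> cmod (a (\<pi> y) + (\<Sum>w\<in>N. c w y * r w y)) \<le> C) \<Longrightarrow> \<forall>y\<in>Y. cmod (a (\<pi> y)) \<le> C" for N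
  proof (induction "card N" arbitrary: N)
    case 0 then show ?case by simp
  next
    case (Suc n)
    then have ne: "N \<noteq> {}" by auto
    \<comment> \<open>Well-foundedness of \<open>prec\<close> yields earliest roots, not latest
      ones. On the finite set \<open>N\<close> the converse relation is finite and acyclic, hence
      well-founded as well.\<close>
    have "\<exists>w\<in>N. \<forall>v\<in>N. (w, v) \<notin> prec"
    proof -
      have "finite {(v,w). v \<in> N \<and> w \<in> N \<and> (w,v) \<in> prec}" (is "finite ?R")
        by (rule finite_subset[of _ "N \<times> N"]) (use \<open>finite N\<close> in auto)
      moreover have "acyclic ?R"
      proof -
        have "?R \<subseteq> prec\<inverse>" by auto
        moreover have "acyclic (prec\<inverse>)" using wf wf_acyclic by (simp add: acyclic_converse)
        ultimately show ?thesis by (rule acyclic_subset[rotated])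
      qed
      ultimately have "wf ?R" by (simp add: finite_acyclic_wf)
      then obtain z where z: "z \<in> N" "\<And>y. (y, z) \<in> ?R \<Longrightarrow> y \<notin> N"
        using ne by (rule wfE_min') blast
      have "(z, v) \<notin> prec" if "v \<in> N" for v using z(2)[of v] z(1) that by blast
      then show ?thesis using z(1) by blast
    qed
    then obtain w where w: "w \<in> N" "\<forall>v\<in>N. (w, v) \<notin> prec" ..
    have wV: "w \<in> V" using w(1) Suc.prems(2) by blast
    have low: "v \<in> lower w" if "v \<in> N - {w}" for v
      using total[of v w] that w Suc.prems(2) unfolding lower_def by auto
    have "cmod (a (\<pi> y) + (\<Sum>v\<in>N - {w}. c v y * r v y)) \<le> C" (is "cmod ?s \<le> C") if y: "y \<in> Y" for y
    proof -
      obtain y' where y': "y' \<in> Y" "\<pi> y' = \<pi> y" "\<forall>v\<in>lower w. r v y' = r v y" "r w y' = - r w y"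
        using flip[OF wV y] by blast
      \<comment> \<open>The coefficient of \<open>v\<close> involves only roots before
        \<open>v\<close>, hence before \<open>w\<close>, and the move fixes these; so only the sign
        of the last summand changes.\<close>
      have eq: "c v y' = c v y" if v: "v \<in> N" for v
      proof (rule BB_eq[of "c v" "lower v"])
        fix u assume "u \<in> lower v"
        then have "u \<in> lower w" using low[of v] v trans unfolding lower_def trans_def by (cases "v = w") auto
        then show "r u y' = r u y" using y'(3) by blast
      qed (use Suc.prems(3) v y y' in auto)
      have split: "(\<Sum>v\<in>N. c v z * r v z) = (\<Sum>v\<in>N - {w}. c v z * r v z) + c w z * r w z" for z
        using Suc.prems(1) w(1) by (simp add: sum.remove)
      have s': "(\<Sum>v\<in>N - {w}. c v y' * r v y') = (\<Sum>v\<in>N - {w}. c v y * r v y)"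
        by (rule sum.cong[OF refl]) (metis DiffD1 eq low y'(3))
      have sy': "(\<Sum>v\<in>N. c v y' * r v y') = (\<Sum>v\<in>N - {w}. c v y * r v y) - c w y * r w y"
        using split[of y'] unfolding s' eq[OF w(1)] y'(4) by simp
      have 1: "cmod (?s - c w y * r w y) \<le> C"
        using Suc.prems(4)[OF y'(1)] unfolding sy' y'(2) by (simp only: add_diff_eq)
      have 2: "cmod (?s + c w y * r w y) \<le> C"
        using Suc.prems(4)[OF y] unfolding split by (simp only: add.assoc)
      have "cmod ((?s - c w y * r w y) + (?s + c w y * r w y)) \<le> C + C"
        by (rule order_trans[OF norm_triangle_ineq add_mono[OF 1 2]])
      moreover have "(?s - c w y * r w y) + (?s + c w y * r w y) = 2 * ?s" by (simp only: mult_2) simp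
      ultimately show ?thesis by (simp only: norm_mult norm_numeral)
    qed
    note red = this
    show ?case
    proof (rule Suc.hyps(1)[of "N - {w}"])
      show "n = card (N - {w})" using Suc.hyps(2) w(1) by simp
      show "finite (N - {w})" using Suc.prems(1) by simp
      show "N - {w} \<subseteq> V" using Suc.prems(2) by blast
      show "\<forall>w\<in>N - {w}. c w \<in> BB (lower w)" using Suc.prems(3) by blast
    qed (rule red)
  qed
  have "\<forall>y\<in>Y. cmod (a (\<pi> y)) \<le> C" by (rule *[OF N(1,2,3)]) (use c[unfolded N(4)] in blast)
  then show ?thesis using x surj by auto
qed

lemma contraction:
  assumes "h \<in> cH V" "a \<in> PA" and c: "\<And>y. y \<in> Y \<Longrightarrow> cmod (a (\<pi> y) + h y) \<le> C" and x: "x \<in> X"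
  shows "cmod (a x) \<le> C"
proof (rule field_le_epsilon)
  fix e :: real assume "e > 0"
  then obtain k where k: "k \<in> HH V" "\<forall>y\<in>Y. cmod (h y - k y) < e" using assms(1) unfolding cH_iff by blast
  show "cmod (a x) \<le> C + e"
  proof (rule contraction_HH[OF k(1) assms(2) _ x])
    fix y assume y: "y \<in> Y"
    have "cmod (a (\<pi> y) + k y) \<le> cmod (a (\<pi> y) + h y) + cmod (h y - k y)"
      using norm_triangle_ineq4[of "a (\<pi> y) + h y" "h y - k y"] by simp
    then show "cmod (a (\<pi> y) + k y) \<le> C + e" using c[OF y] k(2) y by fastforce
  qed
qed

text \<open>A sum of closed subspaces need not be closed. Here \<open>contraction\<close> bounds the
  base part by the whole function, so the base parts of a convergent sequence are uniformly Cauchy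
  on \<open>X\<close>, and the remainders then converge in \<open>cH D\<close>.\<close>

lemma unif_closed_sum:
  assumes D: "D \<subseteq> V" and Q: "unif_closed X Q" and QA: "\<And>a. a \<in> Q \<Longrightarrow> a \<in> PA"
  shows "unif_closed Y {f. \<exists>a\<in>Q. \<exists>h\<in>cH D. f = (\<lambda>y. a (\<pi> y) + h y)}"
  unfolding unif_closed_def
proof (intro allI impI)
  fix f assume f: "\<forall>e>0. \<exists>g\<in>{f. \<exists>a\<in>Q. \<exists>h\<in>cH D. f = (\<lambda>y. a (\<pi> y) + h y)}. \<forall>x\<in>Y. cmod (f x - g x) < e"
  have "\<exists>a h. a \<in> Q \<and> h \<in> cH D \<and> (\<forall>x\<in>Y. cmod (f x - (a (\<pi> x) + h x)) < inverse (Suc n))" for n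
  proof -
    have "inverse (real (Suc n)) > 0" by simp
    from f[rule_format, OF this] show ?thesis by blast
  qed
  then obtain a h where ah: "\<And>n. a n \<in> Q" "\<And>n. (h n) \<in> cH D" "\<And>n x. x\<in>Y \<Longrightarrow> cmod (f x - (a n (\<pi> x) + h n x)) < inverse (Suc n)"
    by metis
  have neg: "(\<lambda>y. - h n y) \<in> cH V" for n
    using cH_pi[OF cH_mono[OF ah(2) D] fun_algD(2)[OF PA, of "-1"]] by simp
  \<comment> \<open>\<open>contraction\<close> is applied to the difference of two decompositions,
    both within \<open>1 / (N + 1)\<close> of \<open>f\<close>.\<close>
  have close: "cmod (a m x - a n x) \<le> 2 * inverse (Suc N)" if "m \<ge> N" "n \<ge> N" "x \<in> X" for m n N x
  proof (rule contraction[OF cH_add[OF cH_mono[OF ah(2) D] neg, of m n]])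
    show "(\<lambda>x. a m x - a n x) \<in> PA" using fun_alg_diff[OF PA] QA ah(1) by blast
    fix y assume y: "y \<in> Y"
    have i: "inverse (real (Suc k)) \<le> inverse (Suc N)" if "k \<ge> N" for k using that by (intro le_imp_inverse_le) auto
    have "cmod ((f y - (a n (\<pi> y) + h n y)) - (f y - (a m (\<pi> y) + h m y))) \<le> inverse (Suc N) + inverse (Suc N)"
      using ah(3)[OF y, of n] ah(3)[OF y, of m] i[OF that(1)] i[OF that(2)]
      by (intro order_trans[OF norm_triangle_ineq4]) linarith
    then show "cmod (a m (\<pi> y) - a n (\<pi> y) + (h m y + - h n y)) \<le> 2 * inverse (Suc N)"
      by (simp add: algebra_simps)
  qed (use that in auto)
  have Cau: "\<exists>N. \<forall>m\<ge>N. \<forall>n\<ge>N. \<forall>x\<in>X. cmod (a m x - a n x) \<le> e" if e: "e > 0" for e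
  proof -
    obtain N where "inverse (real (Suc N)) < e / 2" using reals_Archimedean[of "e/2"] e by auto
    then have "2 * inverse (real (Suc N)) \<le> e" by simp
    then have "\<forall>m\<ge>N. \<forall>n\<ge>N. \<forall>x\<in>X. cmod (a m x - a n x) \<le> e" using close order_trans by blast
    then show ?thesis ..
  qed
  obtain b where b: "b \<in> Q" "\<And>e. e > 0 \<Longrightarrow> \<exists>N. \<forall>n\<ge>N. \<forall>x\<in>X. cmod (a n x - b x) \<le> e"
    using unif_closed_limit[of X Q a, OF Q ah(1) Cau] by auto
  have "(\<lambda>y. f y - b (\<pi> y)) \<in> cH D"
  proof (rule unif_closedD[OF unif_closed_cH])
    fix e :: real assume "e > 0"
    then obtain N where N: "\<forall>n\<ge>N. \<forall>x\<in>X. cmod (a n x - b x) \<le> e/2" using b(2)[of "e/2"] by auto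
    obtain M where M: "inverse (Suc M) < e/2" using reals_Archimedean[of "e/2"] \<open>e > 0\<close> by auto
    define n where "n = max M N"
    have "inverse (real (Suc n)) \<le> inverse (Suc M)" unfolding n_def by (rule le_imp_inverse_le) auto
    then have n: "inverse (Suc n) < e/2" using M by (rule le_less_trans)
    have "cmod ((f y - b (\<pi> y)) - h n y) < e" if y: "y \<in> Y" for y
    proof -
      have "cmod (a n (\<pi> y) - b (\<pi> y)) \<le> e/2" using N surj y unfolding n_def by auto
      then have "cmod ((f y - (a n (\<pi> y) + h n y)) + (a n (\<pi> y) - b (\<pi> y))) < e"
        using ah(3)[OF y, of n] n by (intro le_less_trans[OF norm_triangle_ineq]) linarith
      then show ?thesis by (simp add: algebra_simps)
    qed
    then show "\<exists>g\<in>cH D. \<forall>x\<in>Y. cmod ((f x - b (\<pi> x)) - g x) < e" using ah(2) by blast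
  qed
  then show "f \<in> {f. \<exists>a\<in>Q. \<exists>h\<in>cH D. f = (\<lambda>y. a (\<pi> y) + h y)}" using b(1)
    by (intro CollectI bexI[of _ b] bexI[of _ "\<lambda>y. f y - b (\<pi> y)"]) auto
qed


section \<open>Decomposition into base functions and limits of sums of roots\<close>

definition SS :: "('a \<Rightarrow> complex) set \<Rightarrow> 'w set \<Rightarrow> ('y \<Rightarrow> complex) set" where
  "SS Q D = {f. \<exists>a\<in>Q. \<exists>h\<in>cH D. f = (\<lambda>y. a (\<pi> y) + h y)}"

lemma SS_I: "a \<in> Q \<Longrightarrow> h \<in> cH D \<Longrightarrow> (\<And>y. f y = a (\<pi> y) + h y) \<Longrightarrow> f \<in> SS Q D"
  unfolding SS_def by blast

lemma SS_E:
  assumes "f \<in> SS Q D"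
  obtains a h where "a \<in> Q" "h \<in> cH D" "f = (\<lambda>y. a (\<pi> y) + h y)"
  using assms unfolding SS_def by blast

lemma cH_zero: "(\<lambda>y. 0) \<in> cH D"
  by (rule cH_HH[OF HH_zero])

lemma unif_closed_SS: "D \<subseteq> V \<Longrightarrow> unif_closed X Q \<Longrightarrow> Q \<subseteq> PA \<Longrightarrow> unif_closed Y (SS Q D)"
  unfolding SS_def by (rule unif_closed_sum) auto

lemma unif_closed_PI: "unif_closed X PI" and PI_PA: "PI \<subseteq> PA"
  using PI unfolding fun_ideal_def by auto

lemma SS_add:
  assumes "D \<subseteq> V" "\<And>a b. a \<in> Q \<Longrightarrow> b \<in> Q \<Longrightarrow> (\<lambda>x. a x + b x) \<in> Q" "f \<in> SS Q D" "g \<in> SS Q D"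
  shows "(\<lambda>y. f y + g y) \<in> SS Q D"
proof -
  obtain a h where a: "a \<in> Q" "h \<in> cH D" "f = (\<lambda>y. a (\<pi> y) + h y)" using assms(3) by (rule SS_E)
  obtain b k where b: "b \<in> Q" "k \<in> cH D" "g = (\<lambda>y. b (\<pi> y) + k y)" using assms(4) by (rule SS_E)
  show ?thesis
    by (rule SS_I[OF assms(2)[OF a(1) b(1)] cH_add[OF a(2) b(2) assms(1)]]) (simp add: a b)
qed

lemma SS_mono: assumes "f \<in> SS Q D" "D \<subseteq> E" shows "f \<in> SS Q E"
proof -
  obtain a h where a: "a \<in> Q" "h \<in> cH D" "f = (\<lambda>y. a (\<pi> y) + h y)" using assms(1) by (rule SS_E)
  show ?thesis by (rule SS_I[OF a(1) cH_mono[OF a(2) assms(2)]]) (simp add: a)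
qed

lemma cH_JJ: assumes "h \<in> cH D" "D \<subseteq> V" "\<And>w. w \<in> D \<Longrightarrow> lower w \<subseteq> D" shows "h \<in> JJ D"
proof (rule unif_closedD[OF JJ(1)[OF assms(2)]])
  fix e :: real assume "e > 0"
  then obtain k where k: "k \<in> HH D" "\<forall>y\<in>Y. cmod (h y - k y) < e" using assms(1) unfolding cH_iff by blast
  show "\<exists>g\<in>JJ D. \<forall>x\<in>Y. cmod (h x - g x) < e" 
    using HH_JJ[OF k(1) assms(2)] assms(3) k(2) by blast
qed

text \<open>Multiplication by a bounded function is uniformly continuous, so a statement on products
  extends from \<open>HH\<close> to its closure, one factor at a time. The bound
  \<open>max M 1\<close> avoids a division by zero.\<close>

lemma cH_times:
  assumes S: "unif_closed Y S" and k: "\<forall>y\<in>Y. cmod (k y) \<le> M" and HS: "\<And>h. h \<in> HH D \<Longrightarrow> (\<lambda>y. h y * k y) \<in> S"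
    and h: "h \<in> cH D"
  shows "(\<lambda>y. h y * k y) \<in> S"
proof (rule unif_closedD[OF S])
  fix e :: real assume "e > 0"
  define M' where "M' = max M 1"
  then have M': "M' > 0" by simp
  then have "e / M' > 0" using \<open>e > 0\<close> by simp
  then obtain l where l: "l \<in> HH D" "\<forall>y\<in>Y. cmod (h y - l y) < e / M'" using h[unfolded cH_iff] by blast
  have "\<forall>y\<in>Y. cmod (h y * k y - l y * k y) < e"
  proof
    fix y assume y: "y \<in> Y"
    have "cmod (h y - l y) * cmod (k y) \<le> cmod (h y - l y) * M'"
      using k y unfolding M'_def by (intro mult_left_mono) (auto simp: le_max_iff_disj)
    also have "\<dots> < e" using l(2) y M' by (simp add: pos_less_divide_eq)
    finally show "cmod (h y * k y - l y * k y) < e" unfolding left_diff_distrib[symmetric] norm_mult .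
  qed
  then show "\<exists>g\<in>S. \<forall>x\<in>Y. cmod (h x * k x - g x) < e" by (rule bexI[OF _ HS[OF l(1)]])
qed

text \<open>Everything depends on the product of two summands. For different roots, the earlier one
  is absorbed into the coefficient of the later one, which is again in normal form. For equal roots,
  the square lies in \<open>JJ (lower w)\<close>, and the induction hypothesis places it in
  \<open>SS PI\<close>. So products of elements of \<open>cH D\<close> lie in
  \<open>SS PI D\<close>; this makes \<open>SS PA D\<close> a closed algebra and
  \<open>SS PI D\<close> a closed ideal, and the generated sets \<open>BB D\<close> and
  \<open>JJ D\<close> are contained in them by minimality.\<close>

lemma decomposition_step:
  assumes D: "D \<subseteq> V" and low: "\<And>w. w \<in> D \<Longrightarrow> lower w \<subseteq> D"
    and IH: "\<And>w. w \<in> D \<Longrightarrow> JJ (lower w) \<subseteq> SS PI (lower w)"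
  shows "BB D \<subseteq> SS PA D" and "JJ D \<subseteq> SS PI D"
proof -
  note PIadd = fun_idealD(4)[OF PI]
  note uSI = unif_closed_SS[OF D unif_closed_PI PI_PA]
  have SIadd: "(\<lambda>y. f y + g y) \<in> SS PI D" if "f \<in> SS PI D" "g \<in> SS PI D" for f g
    by (rule SS_add[OF D _ that]) (rule PIadd)
  have SI0: "(\<lambda>y. 0) \<in> SS PI D"
    by (rule SS_I[OF fun_idealD(3)[OF PI] cH_zero]) simp
  have sing: "(\<lambda>y. (c y * r w y) * (d y * r v y)) \<in> SS PI D"
    if w: "w \<in> D" "c \<in> BB (lower w)" and v: "v \<in> D" "d \<in> BB (lower v)" and vw: "v = w \<or> (v, w) \<in> prec" for c d v w
    using vw
  proof
    assume "(v, w) \<in> prec"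
    then have "v \<in> lower w" using v(1) D unfolding lower_def by blast
    moreover have "lower v \<subseteq> lower w" using \<open>(v, w) \<in> prec\<close> trans unfolding lower_def trans_def by blast
    ultimately have "(\<lambda>y. c y * (d y * r v y)) \<in> BB (lower w)"
      using BB_mono[OF v(2) _ lower_sub] w(2) by (intro BB(4)[OF lower_sub] BB_r) auto
    then have "(\<lambda>y. (c y * (d y * r v y)) * r w y) \<in> cH D" by (intro cH_HH HH_single w)
    then show ?thesis by (rule SS_I[OF fun_idealD(3)[OF PI]]) (simp add: mult_ac)
  next
    assume eq: "v = w"
    have "(\<lambda>y. (c y * d y) * (r w y * r w y)) \<in> JJ (lower w)"
    proof (rule JJ(5)[OF lower_sub])
      show "(\<lambda>y. c y * d y) \<in> BB (lower w)" using w v unfolding eq by (intro BB(4)[OF lower_sub])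
      show "(\<lambda>y. r w y * r w y) \<in> JJ (lower w)" using w D by (intro sq) auto
    qed
    then have "(\<lambda>y. (c y * d y) * (r w y * r w y)) \<in> SS PI D" using IH[OF w(1)] SS_mono[OF _ low[OF w(1)]] by blast
    then show ?thesis unfolding eq by (rule unif_closed_cong[OF uSI]) (simp add: mult_ac)
  qed
  have sing: "(\<lambda>y. (c y * r w y) * (d y * r v y)) \<in> SS PI D"
    if w: "w \<in> D" "c \<in> BB (lower w)" and v: "v \<in> D" "d \<in> BB (lower v)" for c d v w
  proof -
    have "v = w \<or> (v, w) \<in> prec \<or> (w, v) \<in> prec" using total w v D by blast
    moreover have "(\<lambda>y. (d y * r v y) * (c y * r w y)) \<in> SS PI D" if "(w, v) \<in> prec"
      using sing[OF v w] that by blast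
    ultimately show ?thesis using sing[OF w v] unif_closed_cong[OF uSI, of "\<lambda>y. (d y * r v y) * (c y * r w y)" "\<lambda>y. (c y * r w y) * (d y * r v y)"]
      by auto
  qed
  have sum_SI: "(\<lambda>y. \<Sum>i\<in>N. f i y) \<in> SS PI D" if "finite N" "\<And>i. i \<in> N \<Longrightarrow> f i \<in> SS PI D" for N :: "'w set" and f
    using that
  proof (induction N)
    case empty then show ?case using SI0 by simp
  next
    case (insert i N)
    have "(\<lambda>y. f i y + (\<Sum>i\<in>N. f i y)) \<in> SS PI D" by (rule SIadd) (use insert in auto)
    then show ?case using insert by simp
  qed
  have HH_HH: "(\<lambda>y. h y * k y) \<in> SS PI D" if hk: "h \<in> HH D" "k \<in> HH D" for h k
  proof -
    obtain N c where N: "finite N" "N \<subseteq> D" "\<forall>w\<in>N. c w \<in> BB (lower w)" "h = (\<lambda>y. \<Sum>w\<in>N. c w y * r w y)"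
      using hk(1) by (elim HH_E)
    obtain M d where M: "finite M" "M \<subseteq> D" "\<forall>w\<in>M. d w \<in> BB (lower w)" "k = (\<lambda>y. \<Sum>w\<in>M. d w y * r w y)"
      using hk(2) by (elim HH_E)
    show ?thesis unfolding N(4) M(4) sum_product
      using N(2,3) M(2,3) by (intro sum_SI[OF N(1)] sum_SI[OF M(1)] sing) blast+
  qed
  have cB: "h \<in> BB D" if "h \<in> cH D" for h
    using JJ(2)[OF D cH_JJ[OF that D low]] .
  have cbd: "\<exists>M. \<forall>y\<in>Y. cmod (h y) \<le> M" if "h \<in> cH D" for h
    using BB(5)[OF D cB[OF that]] .
  have HH_cH: "(\<lambda>y. h y * k y) \<in> SS PI D" if h: "h \<in> cH D" and k: "k \<in> HH D" for h k
  proof -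
    obtain M where "\<forall>y\<in>Y. cmod (k y) \<le> M" using cbd[OF cH_HH[OF k]] ..
    then show ?thesis by (rule cH_times[OF uSI _ HH_HH[OF _ k] h])
  qed
  have cH_cH: "(\<lambda>y. h y * k y) \<in> SS PI D" if h: "h \<in> cH D" and k: "k \<in> cH D" for h k
  proof -
    obtain M where M: "\<forall>y\<in>Y. cmod (k y) \<le> M" using cbd[OF k] ..
    have "(\<lambda>y. l y * k y) \<in> SS PI D" if "l \<in> HH D" for l
      using HH_cH[OF k that] by (simp add: mult.commute)
    then show ?thesis by (rule cH_times[OF uSI M _ h])
  qed
  note uSA = unif_closed_SS[OF D fun_algD(1)[OF PA] order_refl]
  have ASI: "SS PI D \<subseteq> SS PA D" using PI_PA unfolding SS_def by blast
  have SAB: "SS PA D \<subseteq> BB D"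
  proof
    fix f assume "f \<in> SS PA D"
    then obtain a h where a: "a \<in> PA" "h \<in> cH D" "f = (\<lambda>y. a (\<pi> y) + h y)" by (rule SS_E)
    show "f \<in> BB D" unfolding a(3) by (rule BB(3)[OF D BB_pi[OF a(1)] cB[OF a(2)]])
  qed
  \<comment> \<open>\<open>Q\<close> will be \<open>PA\<close>, which gives closure under products,
    and \<open>PI\<close>, which gives the ideal property. The product of the two root parts
    contributes a base function in \<open>PI\<close>, hence the condition
    \<open>PI \<subseteq> Q\<close>.\<close>
  have mixed: "(\<lambda>y. f y * g y) \<in> SS Q D"
    if f: "f \<in> SS PA D" and g: "g \<in> SS Q D" and Q: "PI \<subseteq> Q" "Q \<subseteq> PA" "\<And>a b. a \<in> Q \<Longrightarrow> b \<in> Q \<Longrightarrow> (\<lambda>x. a x + b x) \<in> Q"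
      "\<And>a b. a \<in> PA \<Longrightarrow> b \<in> Q \<Longrightarrow> (\<lambda>x. a x * b x) \<in> Q" for f g Q
  proof -
    obtain a h where a: "a \<in> PA" "h \<in> cH D" "f = (\<lambda>y. a (\<pi> y) + h y)" using f by (rule SS_E)
    obtain b k where b: "b \<in> Q" "k \<in> cH D" "g = (\<lambda>y. b (\<pi> y) + k y)" using g by (rule SS_E)
    obtain i l where i: "i \<in> PI" "l \<in> cH D" "(\<lambda>y. h y * k y) = (\<lambda>y. i (\<pi> y) + l y)"
      using cH_cH[OF a(2) b(2)] by (rule SS_E)
    have bA: "b \<in> PA" and iQ: "i \<in> Q" using b(1) i(1) Q by auto
    have "(\<lambda>x. a x * b x + i x) \<in> Q" by (intro Q(3,4) a(1) b(1) iQ)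
    moreover have "(\<lambda>y. (a (\<pi> y) * k y + b (\<pi> y) * h y) + l y) \<in> cH D"
      by (intro cH_add D cH_pi a b bA i)
    moreover have "f y * g y = (a (\<pi> y) * b (\<pi> y) + i (\<pi> y)) + ((a (\<pi> y) * k y + b (\<pi> y) * h y) + l y)" for y
      using fun_cong[OF i(3), of y] by (simp add: a(3) b(3) algebra_simps)
    ultimately show ?thesis by (rule SS_I)
  qed
  have fun_algSA: "fun_alg Y (SS PA D)"
    unfolding fun_alg_def
  proof (intro conjI allI ballI)
    show "(\<lambda>x. c) \<in> SS PA D" for c by (rule SS_I[OF fun_algD(2)[OF PA, of c] cH_zero]) simp
    show "(\<lambda>x. f x + g x) \<in> SS PA D" if "f \<in> SS PA D" "g \<in> SS PA D" for f g
      by (rule SS_add[OF D fun_algD(3)[OF PA] that])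
    show "(\<lambda>x. f x * g x) \<in> SS PA D" if "f \<in> SS PA D" "g \<in> SS PA D" for f g
      by (rule mixed[OF that PI_PA order_refl fun_algD(3)[OF PA] fun_algD(4)[OF PA]])
    show "\<exists>M. \<forall>x\<in>Y. cmod (f x) \<le> M" if "f \<in> SS PA D" for f
      using BB(5)[OF D] SAB that by blast
  qed (rule uSA)
  have r1: "(\<lambda>y. 1 * r w y) \<in> cH D" if "w \<in> D" for w
    by (rule cH_HH[OF HH_single[OF that]]) (rule BB(2)[OF lower_sub])
  have rS: "r ` D \<subseteq> SS PI D"
  proof
    fix g assume "g \<in> r ` D"
    then obtain w where w: "w \<in> D" "g = r w" by blast
    show "g \<in> SS PI D" by (rule SS_I[OF fun_idealD(3)[OF PI] r1[OF w(1)]]) (simp add: w(2))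
  qed
  have piS: "(\<lambda>a y. a (\<pi> y)) ` Q \<subseteq> SS Q D" for Q
    by (auto intro: SS_I[OF _ cH_zero])
  show BS: "BB D \<subseteq> SS PA D"
  proof
    fix f assume "f \<in> BB D"
    then show "f \<in> SS PA D" unfolding BB_def
      by (rule gen_least[OF _ fun_algSA]) (use rS ASI piS in blast)
  qed
  have Q: "fun_ideal Y (BB D) (SS PI D)"
    unfolding fun_ideal_def
  proof (intro conjI ballI)
    show "(\<lambda>x. f x * g x) \<in> SS PI D" if "f \<in> BB D" "g \<in> SS PI D" for f g
      by (rule mixed[OF _ that(2) order_refl PI_PA PIadd fun_idealD(5)[OF PI]]) (use that BS in auto)
    show "(\<lambda>x. f x + g x) \<in> SS PI D" if "f \<in> SS PI D" "g \<in> SS PI D" for f g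
      by (rule SIadd[OF that])
    show "SS PI D \<subseteq> BB D" using ASI SAB by (rule order_trans)
  qed (rule uSI SI0)+
  show "JJ D \<subseteq> SS PI D"
  proof (intro subsetI)
    fix f assume "f \<in> JJ D"
    then show "f \<in> SS PI D" unfolding JJ_def
      by (rule igen_least[OF _ Q Un_least[OF piS rS]])
  qed
qed

text \<open>Transfinite induction along \<open>prec\<close>; \<open>lower w\<close> is downward
  closed by transitivity, so \<open>decomposition_step\<close> applies to it.\<close>

lemma JJ_lower: "w \<in> V \<Longrightarrow> JJ (lower w) \<subseteq> SS PI (lower w)"
proof (induction w rule: wf_induct_rule[OF wf])
  case (1 w)
  show ?case
  proof (rule decomposition_step(2)[OF lower_sub])
    show "lower v \<subseteq> lower w" if "v \<in> lower w" for v
      using that trans unfolding lower_def trans_def by blast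
    show "JJ (lower v) \<subseteq> SS PI (lower v)" if "v \<in> lower w" for v
      using that by (intro 1) (auto simp: lower_def)
  qed
qed

lemma BB_decomp: "BB V \<subseteq> SS PA V" and JJ_decomp: "JJ V \<subseteq> SS PI V"
  using decomposition_step[OF order_refl lower_sub JJ_lower] by auto

text \<open>The root part of the decomposition lies in the ideal, so every class modulo
  \<open>JJ V\<close> is represented by a base function.\<close>

lemma quotient_surj:
  assumes "g \<in> BB V" shows "\<exists>a\<in>PA. (\<lambda>y. g y - a (\<pi> y)) \<in> JJ V"
proof -
  have "g \<in> SS PA V" using assms BB_decomp by blast
  then obtain a h where a: "a \<in> PA" "h \<in> cH V" "g = (\<lambda>y. a (\<pi> y) + h y)" by (rule SS_E)
  have "(\<lambda>y. g y - a (\<pi> y)) = h" unfolding a(3) by simp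
  then show ?thesis using cH_JJ[OF a(2) order_refl lower_sub] a(1) by auto
qed

text \<open>If \<open>k\<close> is the base part of \<open>h\<close>, then \<open>a - k\<close> is
  the base part of \<open>a - h\<close>, and the averaging bounds it by \<open>C\<close>. So a class
  of base functions has no smaller quotient norm above than below; the case \<open>C = 0\<close>
  will give injectivity on quotients.\<close>

lemma quotient_norm:
  assumes a: "a \<in> PA" and h: "h \<in> JJ V" and C: "\<And>y. y \<in> Y \<Longrightarrow> cmod (a (\<pi> y) - h y) \<le> C"
  shows "\<exists>k\<in>PI. \<forall>x\<in>X. cmod (a x - k x) \<le> C"
proof -
  have "h \<in> SS PI V" using h JJ_decomp by blast
  then obtain k l where k: "k \<in> PI" "l \<in> cH V" "h = (\<lambda>y. k (\<pi> y) + l y)" by (rule SS_E)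
  have neg: "(\<lambda>y. - l y) \<in> cH V"
    using cH_pi[OF k(2) fun_algD(2)[OF PA, of "-1"]] by simp
  have "cmod (a x - k x) \<le> C" if "x \<in> X" for x
  proof (rule contraction[OF neg _ _ that])
    show "(\<lambda>x. a x - k x) \<in> PA" using fun_alg_diff[OF PA a] k(1) PI_PA by blast
    show "cmod (a (\<pi> y) - k (\<pi> y) + - l y) \<le> C" if "y \<in> Y" for y
      using C[OF that] unfolding k(3) by (simp add: algebra_simps)
  qed
  then show ?thesis using k(1) by blast
qed

lemma JJ_vanish:
  assumes f: "f \<in> JJ D" and y: "y \<in> Y" "\<And>v. v \<in> D \<Longrightarrow> r v y = 0" "\<And>k. k \<in> PI \<Longrightarrow> k (\<pi> y) = 0"
  shows "f y = 0"
  using f[unfolded JJ_def]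
proof (induction rule: igen.induct)
  case (igen_lim f)
  show ?case
  proof (rule ccontr)
    assume "f y \<noteq> 0"
    then have "cmod (f y) > 0" by simp
    from igen_lim[OF this] obtain g where "g y = 0" "\<forall>x\<in>Y. cmod (f x - g x) < cmod (f y)" by blast
    then show False using y(1) by fastforce
  qed
qed (use y in auto)

text \<open>All roots vanish over the common zeros of \<open>PI\<close>, by induction along
  \<open>prec\<close>: the square of \<open>r w\<close> lies in an ideal all of whose generators
  vanish at \<open>y\<close>.\<close>

lemma vanish:
  assumes y: "y \<in> Y" and k: "\<And>k. k \<in> PI \<Longrightarrow> k (\<pi> y) = 0" and f: "f \<in> JJ V"
  shows "f y = 0"
proof -
  have "w \<in> V \<longrightarrow> r w y = 0" for w
  proof (induction w rule: wf_induct_rule[OF wf])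
    case (1 w)
    show ?case
    proof
      assume "w \<in> V"
      have "r v y = 0" if "v \<in> lower w" for v using 1 that by (auto simp: lower_def)
      have "r w y * r w y = 0" by (rule JJ_vanish[OF sq[OF \<open>w \<in> V\<close>] y]) fact+
      then show "r w y = 0" by simp
    qed
  qed
  then have z: "r v y = 0" if "v \<in> V" for v using that by blast
  show ?thesis by (rule JJ_vanish[OF f y]) fact+
qed

end

section \<open>Cardinalities and well-orders\<close>

text \<open>Stated for types, so that it propagates along the type constructors from which the codes
  below are built.\<close>

definition at_most_continuum :: "'x itself \<Rightarrow> bool" where
  "at_most_continuum _ \<longleftrightarrow> (\<exists>f :: 'x \<Rightarrow> nat set. inj f)"

lemma at_most_continuum_I: "inj (f :: 'x \<Rightarrow> nat set) \<Longrightarrow> at_most_continuum TYPE('x)"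
  unfolding at_most_continuum_def by blast

lemma at_most_continuum_inj: "at_most_continuum TYPE('y) \<Longrightarrow> inj (f :: 'x \<Rightarrow> 'y) \<Longrightarrow> at_most_continuum TYPE('x)"
  unfolding at_most_continuum_def using inj_compose by blast

lemma at_most_continuum_nat_set: "at_most_continuum TYPE(nat set)"
  by (rule at_most_continuum_I[of id]) simp

lemma at_most_continuum_nat: "at_most_continuum TYPE(nat)"
  by (rule at_most_continuum_I[of "\<lambda>n. {n}"]) (simp add: inj_def)

lemma at_most_continuum_bool: "at_most_continuum TYPE(bool)"
  by (rule at_most_continuum_I[of "\<lambda>b. if b then {0} else {}"]) (simp add: inj_def)

text \<open>A countable family of subsets of \<open>nat\<close> becomes one subset when each element
  is tagged with the number of its index.\<close>

lemma at_most_continuum_fun: assumes "at_most_continuum TYPE('x)" shows "at_most_continuum TYPE('c::countable \<Rightarrow> 'x)"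
proof -
  obtain f :: "'x \<Rightarrow> nat set" where f: "inj f" using assms unfolding at_most_continuum_def by blast
  define h :: "('c \<Rightarrow> 'x) \<Rightarrow> nat set" where "h g = {prod_encode (to_nat c, m) | c m. m \<in> f (g c)}" for g
  have mem: "prod_encode (to_nat c, m) \<in> h g \<longleftrightarrow> m \<in> f (g c)" for c m g
    unfolding h_def by (auto simp: prod_encode_eq)
  have "inj h"
  proof (rule injI)
    fix g g' assume "h g = h g'"
    then have "f (g c) = f (g' c)" for c using mem by (metis subsetI subset_antisym)
    then show "g = g'" using f by (simp add: inj_eq fun_eq_iff)
  qed
  then show ?thesis by (rule at_most_continuum_I)
qed

lemma at_most_continuum_prod: assumes "at_most_continuum TYPE('x)" "at_most_continuum TYPE('z)" shows "at_most_continuum TYPE('x \<times> 'z)"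
proof -
  obtain f :: "'x \<Rightarrow> nat set" where f: "inj f" using assms(1) unfolding at_most_continuum_def by blast
  obtain g :: "'z \<Rightarrow> nat set" where g: "inj g" using assms(2) unfolding at_most_continuum_def by blast
  have "inj (\<lambda>p b. if b then f (fst p) else g (snd p))"
  proof (rule injI)
    fix p q assume eq: "(\<lambda>b. if b then f (fst p) else g (snd p)) = (\<lambda>b. if b then f (fst q) else g (snd q))"
    have "f (fst p) = f (fst q)" using fun_cong[OF eq, of True] by simp
    moreover have "g (snd p) = g (snd q)" using fun_cong[OF eq, of False] by simp
    ultimately show "p = q" using f g by (simp add: inj_eq prod_eq_iff)
  qed
  then show ?thesis by (rule at_most_continuum_inj[OF at_most_continuum_fun[OF at_most_continuum_nat_set]])
qed

lemma at_most_continuum_option: assumes "at_most_continuum TYPE('x)" shows "at_most_continuum TYPE('x option)"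
proof -
  have "inj (\<lambda>z :: 'x option. (z = None, case z of None \<Rightarrow> undefined | Some x \<Rightarrow> x))"
    by (auto simp: inj_def split: option.splits)
  then show ?thesis by (rule at_most_continuum_inj[OF at_most_continuum_prod[OF at_most_continuum_bool assms]])
qed

lemma at_most_continuum_real: "at_most_continuum TYPE(real)"
proof -
  have "(UNIV :: real set) \<lesssim> (UNIV :: nat set set)"
    using nat_sets_eqpoll_reals eqpoll_imp_lepoll eqpoll_sym by blast
  then show ?thesis unfolding lepoll_def at_most_continuum_def by blast
qed

lemma at_most_continuum_complex: "at_most_continuum TYPE(complex)"
proof -
  have "inj (\<lambda>z. (Re z, Im z))" by (auto simp: inj_def complex_eq_iff)
  then show ?thesis by (rule at_most_continuum_inj[OF at_most_continuum_prod[OF at_most_continuum_real at_most_continuum_real]])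
qed

lemma at_most_continuum_imp_complex: assumes "at_most_continuum TYPE('x)" obtains f :: "'x \<Rightarrow> complex" where "inj f"
proof -
  obtain f :: "'x \<Rightarrow> nat set" where f: "inj f" using assms unfolding at_most_continuum_def by blast
  have "(UNIV :: nat set set) \<lesssim> (UNIV :: real set)"
    using nat_sets_eqpoll_reals eqpoll_imp_lepoll by blast
  then obtain g :: "nat set \<Rightarrow> real" where g: "inj g" unfolding lepoll_def by blast
  have "inj (\<lambda>x. complex_of_real (g (f x)))" using f g by (simp add: inj_def)
  then show ?thesis by (rule that)
qed

text \<open>Terms for the elements of a uniform algebra: its generators, sums, products and limits of
  sequences. There are no more of them than there are functions to \<open>\<complex>\<close> on the underlying space.\<close>

datatype 'k alg_term = Bs 'k | Ad "'k alg_term" "'k alg_term" | Ml "'k alg_term" "'k alg_term" | Lm "nat \<Rightarrow> 'k alg_term"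

text \<open>Reads a term along a path of branch choices. The kinds of nodes are numbered 0 to 3; in
  a binary node \<open>0\<close> goes left and every other number right; a leaf ignores the rest of
  the path. The answers on all paths determine the term, and there are only countably many
  paths.\<close>

primrec lab :: "'k alg_term \<Rightarrow> nat list \<Rightarrow> nat \<times> 'k option" where
  "lab (Bs k) = (\<lambda>l. (0, Some k))"
| "lab (Ad s t) = (\<lambda>l. case l of [] \<Rightarrow> (1, None) | n # l' \<Rightarrow> if n = 0 then lab s l' else lab t l')"
| "lab (Ml s t) = (\<lambda>l. case l of [] \<Rightarrow> (2, None) | n # l' \<Rightarrow> if n = 0 then lab s l' else lab t l')"
| "lab (Lm s) = (\<lambda>l. case l of [] \<Rightarrow> (3, None) | n # l' \<Rightarrow> lab (s n) l')"

lemma lab_inj: "lab t = lab t' \<Longrightarrow> t = t'"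
proof (induction t arbitrary: t')
  case (Bs k)
  from fun_cong[OF Bs, of "[]"] show ?case by (cases t') auto
next
  case (Ad s t)
  from fun_cong[OF Ad(3), of "[]"] obtain s1 t1 where t': "t' = Ad s1 t1" by (cases t') auto
  have "lab s = lab s1" using fun_cong[OF Ad(3), of "0 # l" for l] unfolding t' by auto
  moreover have "lab t = lab t1" using fun_cong[OF Ad(3), of "1 # l" for l] unfolding t' by auto
  ultimately show ?case unfolding t' using Ad(1,2) by blast
next
  case (Ml s t)
  from fun_cong[OF Ml(3), of "[]"] obtain s1 t1 where t': "t' = Ml s1 t1" by (cases t') auto
  have "lab s = lab s1" using fun_cong[OF Ml(3), of "0 # l" for l] unfolding t' by auto
  moreover have "lab t = lab t1" using fun_cong[OF Ml(3), of "1 # l" for l] unfolding t' by auto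
  ultimately show ?case unfolding t' using Ml(1,2) by blast
next
  case (Lm s)
  from fun_cong[OF Lm(2), of "[]"] obtain s1 where t': "t' = Lm s1" by (cases t') auto
  have "lab (s n) = lab (s1 n)" for n using fun_cong[OF Lm(2), of "n # l" for l] unfolding t' by auto
  then have "s n = s1 n" for n using Lm(1) by blast
  then show ?case unfolding t' by auto
qed

text \<open>The leaves carry functions, of which there may be more than complex numbers, so a term
  is coded pointwise: at \<open>a\<close> every leaf function is replaced by its value at
  \<open>a\<close>. What remains has a code of continuum size, hence one complex number, and all
  points together recover the leaves.\<close>

lemma alg_term_inj: obtains e :: "(('a \<Rightarrow> complex) \<times> bool) alg_term \<Rightarrow> ('a \<Rightarrow> complex)" where "inj e"
proof -
  have "at_most_continuum TYPE(nat list \<Rightarrow> nat \<times> (complex \<times> bool) option)"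
    by (intro at_most_continuum_fun at_most_continuum_prod at_most_continuum_option at_most_continuum_nat at_most_continuum_bool at_most_continuum_complex)
  then obtain f :: "(nat list \<Rightarrow> nat \<times> (complex \<times> bool) option) \<Rightarrow> complex" where f: "inj f"
    by (rule at_most_continuum_imp_complex)
  define e where "e t a = f (\<lambda>l. (fst (lab t l), map_option (\<lambda>(k, b). (k a, b)) (snd (lab t l))))"
    for t :: "(('a \<Rightarrow> complex) \<times> bool) alg_term" and a
  have "inj e"
  proof (rule injI, rule lab_inj, rule ext)
    fix t t' :: "(('a \<Rightarrow> complex) \<times> bool) alg_term" and l
    assume "e t = e t'"
    then have "f (\<lambda>l. (fst (lab t l), map_option (\<lambda>(k, b). (k a, b)) (snd (lab t l)))) =
      f (\<lambda>l. (fst (lab t' l), map_option (\<lambda>(k, b). (k a, b)) (snd (lab t' l))))" for a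
      unfolding e_def by (rule fun_cong)
    then have "(\<lambda>l. (fst (lab t l), map_option (\<lambda>(k, b). (k a, b)) (snd (lab t l)))) =
      (\<lambda>l. (fst (lab t' l), map_option (\<lambda>(k, b). (k a, b)) (snd (lab t' l))))" for a
      using f by (simp only: inj_eq)
    from fun_cong[OF this, of l] have *: "fst (lab t l) = fst (lab t' l)"
      "\<And>a. map_option (\<lambda>(k, b). (k a, b)) (snd (lab t l)) = map_option (\<lambda>(k, b). (k a, b)) (snd (lab t' l))"
      by auto
    have "snd (lab t l) = snd (lab t' l)"
      using *(2) by (cases "snd (lab t l)"; cases "snd (lab t' l)") (auto simp: fun_eq_iff)
    then show "lab t l = lab t' l" using *(1) by (simp add: prod_eq_iff)
  qed
  then show ?thesis by (rule that)
qed

text \<open>Serves to merge a stage, an element of \<open>nat set\<close>, and the code of a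
  function into one index, again point by point.\<close>

lemma pair_inj: obtains p :: "nat set \<times> ('a \<Rightarrow> complex) \<Rightarrow> ('a \<Rightarrow> complex)" where "inj p"
proof -
  obtain f :: "nat set \<times> complex \<Rightarrow> complex" where f: "inj f"
    using at_most_continuum_imp_complex[OF at_most_continuum_prod[OF at_most_continuum_nat_set at_most_continuum_complex]] by blast
  have "inj (\<lambda>(b, k :: 'a \<Rightarrow> complex) a. f (b, k a))"
  proof (rule injI)
    fix p q :: "nat set \<times> ('a \<Rightarrow> complex)"
    assume eq: "(case p of (b, k) \<Rightarrow> \<lambda>a. f (b, k a)) = (case q of (b, k) \<Rightarrow> \<lambda>a. f (b, k a))"
    obtain b k b' k' where pq: "p = (b, k)" "q = (b', k')" by (meson surj_pair)
    have "f (b, k a) = f (b', k' a)" for a using fun_cong[OF eq, of a] unfolding pq by simp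
    then have "(b, k a) = (b', k' a)" for a using f by (simp only: inj_eq)
    then show "p = q" unfolding pq by auto
  qed
  then show ?thesis by (rule that)
qed

text \<open>The sets \<open>{..<n}\<close> under inclusion, with \<open>UNIV\<close> on top, have
  order type \<omega> + 1. They are placed in \<open>nat set\<close> because the uncountable order
  below needs a type of that size and the tower is built over one type of stages.\<close>

lemma omega_order:
  obtains r :: "nat set rel" and \<tau> where "Well_order r" "\<tau> \<in> Field r" "\<And>\<alpha>. \<alpha> \<in> Field r \<Longrightarrow> (\<alpha>, \<tau>) \<in> r"
    "infinite (Field r)" "\<And>\<alpha>. \<alpha> \<in> underS r \<tau> \<Longrightarrow> \<exists>\<beta>\<in>underS r \<tau>. (\<alpha>, \<beta>) \<in> r \<and> \<alpha> \<noteq> \<beta>" 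
    "countable (underS r \<tau>)" "\<And>\<alpha>. \<alpha> \<in> underS r \<tau> \<Longrightarrow> countable (underS r \<alpha>)"
proof -
  define Z :: "nat set set" where "Z = insert UNIV (range lessThan)"
  define r where "r = {(a, b). a \<in> Z \<and> b \<in> Z \<and> a \<subseteq> b}"
  have Fr: "Field r = Z" unfolding r_def Field_def by auto
  have chain: "a \<subseteq> b \<or> b \<subseteq> a" if "a \<in> Z" "b \<in> Z" for a b
    using that unfolding Z_def by auto
  have lin: "Linear_order r"
    unfolding linear_order_on_def partial_order_on_def preorder_on_def Fr refl_on_def trans_def antisym_def total_on_def
    using chain by (auto simp: r_def)
  have wf: "wf (r - Id)"
  proof (rule wf_subset)
    define m :: "nat set \<Rightarrow> nat \<times> nat" where "m a = (if a = UNIV then (1, 0) else (0, card a))" for a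
    show "wf (inv_image (less_than <*lex*> less_than) m)" by auto
    show "r - Id \<subseteq> inv_image (less_than <*lex*> less_than) m"
    proof (rule subrelI)
      fix a b assume "(a, b) \<in> r - Id"
      then have ab: "a \<in> Z" "b \<in> Z" "a \<subset> b" unfolding r_def by auto
      then obtain n where n: "a = {..<n}" unfolding Z_def by blast
      have "infinite (UNIV :: nat set)" by simp
      then have "a \<noteq> UNIV" unfolding n by (metis finite_lessThan)
      then show "(a, b) \<in> inv_image (less_than <*lex*> less_than) m"
        using ab psubset_card_mono[of b a] unfolding m_def Z_def by (auto simp: n)
    qed
  qed
  have inf: "infinite (range (lessThan :: nat \<Rightarrow> nat set))"
    by (rule range_inj_infinite) (simp add: inj_def lessThan_eq_iff)
  have uT: "underS r UNIV = range lessThan" 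
  proof -
    have "{..<n} \<noteq> UNIV" for n :: nat using infinite_UNIV_nat finite_lessThan by metis
    then show ?thesis unfolding underS_def r_def Z_def by auto
  qed
  show ?thesis
  proof (rule that[of r UNIV])
    show "Well_order r" using lin wf by (simp add: well_order_on_def)
    show "infinite (Field r)" unfolding Fr Z_def using inf by simp
    show "\<exists>\<beta>\<in>underS r UNIV. (\<alpha>, \<beta>) \<in> r \<and> \<alpha> \<noteq> \<beta>" if a: "\<alpha> \<in> underS r UNIV" for \<alpha>
    proof -
      obtain n where n: "\<alpha> = {..<n}" using a unfolding uT by blast
      have "(\<alpha>, {..<Suc n}) \<in> r" "\<alpha> \<noteq> {..<Suc n}" unfolding r_def Z_def n by (auto simp: lessThan_eq_iff)
      then show ?thesis unfolding uT by blast
    qed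
    show "countable (underS r UNIV)" unfolding uT by simp
    then show "countable (underS r \<alpha>)" if "\<alpha> \<in> underS r UNIV" for \<alpha>
      by (rule countable_subset[rotated]) (use that in \<open>auto simp: underS_def r_def Z_def\<close>)
    show "UNIV \<in> Field r" unfolding Fr Z_def by simp
    show "(\<alpha>, UNIV) \<in> r" if "\<alpha> \<in> Field r" for \<alpha> using that[unfolded Fr] by (auto simp: r_def Z_def)
  qed
qed

text \<open>The least \<tau> with uncountably many predecessors gives the order type omega_1 + 1. A
  countable set of predecessors is bounded, since otherwise the predecessors of \<tau> would be a
  countable union of countable initial segments; a last predecessor is excluded for the same
  reason.\<close>

lemma omega1_order:
  obtains r :: "nat set rel" and \<tau> where "Well_order r" "\<tau> \<in> Field r" "\<And>\<alpha>. \<alpha> \<in> Field r \<Longrightarrow> (\<alpha>, \<tau>) \<in> r"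
    "infinite (Field r)" "\<And>\<alpha>. \<alpha> \<in> underS r \<tau> \<Longrightarrow> \<exists>\<beta>\<in>underS r \<tau>. (\<alpha>, \<beta>) \<in> r \<and> \<alpha> \<noteq> \<beta>"
    "\<And>C. countable C \<Longrightarrow> C \<subseteq> underS r \<tau> \<Longrightarrow> \<exists>\<beta>\<in>underS r \<tau>. \<forall>\<alpha>\<in>C. (\<alpha>, \<beta>) \<in> r"
proof -
  obtain r0 where r0: "well_order_on (UNIV - {{} :: nat set}) r0" using well_order_on by blast
  \<comment> \<open>In an arbitrary well-order of this set every element might have only countably
    many predecessors. The empty set, put on top, certainly has uncountably many.\<close>
  define r1 where "r1 = r0 \<union> {(a, {}) | a. True}"
  have F0: "Field r0 = UNIV - {{}}" using well_order_on_Field[OF r0] by simp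
  have r0_sub: "(a, b) \<in> r0 \<Longrightarrow> a \<noteq> {} \<and> b \<noteq> {}" for a b using F0 unfolding Field_def by blast
  have F1: "Field r1 = UNIV" unfolding r1_def Field_def by auto
  have lin0: "linear_order_on (UNIV - {{}}) r0" and wf0: "wf (r0 - Id)" using r0 by (auto simp: well_order_on_def)
  have r0': "refl_on (UNIV - {{}}) r0" "trans r0" "antisym r0" "total_on (UNIV - {{}}) r0"
    using lin0 unfolding linear_order_on_def partial_order_on_def preorder_on_def by auto
  have r0_ne: "({}, b) \<notin> r0" "(a, {}) \<notin> r0" for a b using r0_sub by blast+
  have r1_iff: "(a, b) \<in> r1 \<longleftrightarrow> b = {} \<or> (a, b) \<in> r0" for a b unfolding r1_def by auto
  have alg_term: "refl_on UNIV r1" "trans r1" "antisym r1" "total_on UNIV r1"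
  proof -
    show "refl_on UNIV r1" using r0'(1) unfolding refl_on_def r1_iff by auto
    show "trans r1" unfolding trans_def r1_iff using r0'(2)[unfolded trans_def] r0_ne by blast
    show "antisym r1" unfolding antisym_def r1_iff using r0'(3)[unfolded antisym_def] r0_ne by blast
    show "total_on UNIV r1" using r0'(4) unfolding total_on_def r1_iff by auto
  qed
  then have lin: "Linear_order r1"
    unfolding linear_order_on_def partial_order_on_def preorder_on_def F1 by simp
  have wf: "wf (r1 - Id)"
  proof (rule wf_subset)
    have "wf ({(a, {}) | a :: nat set. a \<noteq> {}})" unfolding wf_def by blast
    then show "wf ((r0 - Id) \<union> {(a, {}) | a. a \<noteq> {}})"
      by (intro wf_Un wf0) (use r0_sub in blast)+
    show "r1 - Id \<subseteq> (r0 - Id) \<union> {(a, {}) | a. a \<noteq> {}}" unfolding r1_def by auto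
  qed
  have wo: "Well_order r1" using lin wf by (simp add: well_order_on_def)
  have "underS r1 {} = UNIV - {{}}" unfolding underS_def r1_def using r0_sub by auto
  moreover have "uncountable (UNIV - {{} :: nat set})"
  proof -
    have "uncountable (UNIV :: nat set set)"
    proof
      assume "countable (UNIV :: nat set set)"
      moreover have "(UNIV :: real set) \<lesssim> (UNIV :: nat set set)"
        using nat_sets_eqpoll_reals eqpoll_imp_lepoll eqpoll_sym by blast
      ultimately have "countable (UNIV :: real set)" using countable_lepoll by blast
      then show False using uncountable_UNIV_real by blast
    qed
    then show ?thesis using uncountable_minus_countable[of UNIV "{{}}"] by simp
  qed
  ultimately have "{} \<in> {t. uncountable (underS r1 t)}" by simp
  then obtain \<tau> where \<tau>: "\<tau> \<in> {t. uncountable (underS r1 t)}" "\<And>y. (y, \<tau>) \<in> r1 - Id \<Longrightarrow> y \<notin> {t. uncountable (underS r1 t)}"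
    by (rule wfE_min[OF wf]) blast
  define r where "r = Restr r1 (under r1 \<tau>)"
  have Fr: "Field r = under r1 \<tau>" unfolding r_def Field_def under_def using alg_term(1) by (auto simp: refl_on_def)
  have uS: "underS r \<tau> = underS r1 \<tau>" unfolding r_def underS_def under_def using alg_term(1) by (auto simp: refl_on_def)
  have cnt: "countable (underS r1 \<alpha>)" if "\<alpha> \<in> underS r1 \<tau>" for \<alpha> using \<tau>(2)[of \<alpha>] that by (auto simp: underS_def)
  have rr: "(\<alpha>, \<beta>) \<in> r" if "(\<alpha>, \<beta>) \<in> r1" "\<alpha> \<in> underS r1 \<tau>" "\<beta> \<in> underS r1 \<tau>" for \<alpha> \<beta>
    using that unfolding r_def under_def underS_def by auto
  have cofin: "\<exists>\<beta>\<in>underS r \<tau>. \<forall>\<alpha>\<in>C. (\<alpha>, \<beta>) \<in> r" if C: "countable C" "C \<subseteq> underS r \<tau>" for C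
  proof (rule ccontr)
    assume neg: "\<not> ?thesis"
    have "underS r1 \<tau> \<subseteq> (\<Union>\<alpha>\<in>C. underS r1 \<alpha>)"
    proof
      fix \<beta> assume b: "\<beta> \<in> underS r1 \<tau>"
      then obtain \<alpha> where a: "\<alpha> \<in> C" "(\<alpha>, \<beta>) \<notin> r" using neg uS by blast
      then have "(\<alpha>, \<beta>) \<notin> r1" using rr[OF _ _ b] C(2) uS by blast
      then have "(\<beta>, \<alpha>) \<in> r1 \<and> \<alpha> \<noteq> \<beta>" using alg_term(1,4) unfolding total_on_def refl_on_def by (cases "\<alpha> = \<beta>") auto
      then show "\<beta> \<in> (\<Union>\<alpha>\<in>C. underS r1 \<alpha>)" using a(1) unfolding underS_def by blast
    qed
    moreover have "countable (\<Union>\<alpha>\<in>C. underS r1 \<alpha>)" using C cnt unfolding uS by (intro countable_UN) auto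
    ultimately have "countable (underS r1 \<tau>)" by (rule countable_subset)
    then show False using \<tau>(1) by simp
  qed
  have succ: "\<exists>\<beta>\<in>underS r \<tau>. (\<alpha>, \<beta>) \<in> r \<and> \<alpha> \<noteq> \<beta>" if a: "\<alpha> \<in> underS r \<tau>" for \<alpha>
  proof (rule ccontr)
    assume neg: "\<not> ?thesis"
    have "underS r1 \<tau> \<subseteq> insert \<alpha> (underS r1 \<alpha>)"
    proof
      fix \<beta> assume b: "\<beta> \<in> underS r1 \<tau>"
      then have "(\<alpha>, \<beta>) \<notin> r \<or> \<alpha> = \<beta>" using neg uS by blast
      then have "(\<alpha>, \<beta>) \<notin> r1 \<or> \<alpha> = \<beta>" using rr a b uS by blast
      then show "\<beta> \<in> insert \<alpha> (underS r1 \<alpha>)" using alg_term(4) unfolding total_on_def underS_def by blast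
    qed
    moreover have "countable (insert \<alpha> (underS r1 \<alpha>))" using cnt a uS by simp
    ultimately have "countable (underS r1 \<tau>)" by (rule countable_subset)
    then show False using \<tau>(1) by simp
  qed
  show ?thesis
  proof (rule that[of r \<tau>])
    show "Well_order r" unfolding r_def by (rule Well_order_Restr[OF wo])
    show "\<tau> \<in> Field r" unfolding Fr under_def using alg_term(1) by (auto simp: refl_on_def)
    show "(\<alpha>, \<tau>) \<in> r" if "\<alpha> \<in> Field r" for \<alpha>
      using that unfolding Fr unfolding r_def under_def using alg_term(1) by (auto simp: refl_on_def)
    have "infinite (underS r1 \<tau>)" using \<tau>(1) countable_finite by blast
    moreover have "underS r1 \<tau> \<subseteq> Field r" unfolding Fr underS_def under_def by blast
    ultimately show "infinite (Field r)" using finite_subset by blast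
  qed (fact succ cofin)+
qed

section \<open>Uniform algebras as algebras of functions\<close>

declare mspace_cfunspace [simp del]

lemma mspace_cspace_iff:
  assumes "compact_space X"
  shows "f \<in> mspace (cspace X) \<longleftrightarrow> f \<in> extensional (topspace X) \<and> continuous_map X euclidean f"
  using compactin_mspace_cfunspace[of X euclidean_metric] assms
  by (auto simp: compact_space_def)

lemma closure_cspace:
  assumes X: "compact_space X" and B: "B \<subseteq> mspace (cspace X)"
  shows "f \<in> mtopology_of (cspace X) closure_of B \<longleftrightarrow>
    f \<in> mspace (cspace X) \<and> (\<forall>e>0. \<exists>g\<in>B. \<forall>x\<in>topspace X. cmod (f x - g x) < e)"
proof -
  interpret M: Metric_space "mspace (cspace X)" "mdist (cspace X)" by (rule Metric_space_mspace_mdist)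
  have 1: "(\<forall>e>0. \<exists>g\<in>B. \<forall>x\<in>topspace X. cmod (f x - g x) < e) \<longleftrightarrow> (\<forall>e>0. \<exists>g\<in>B. mdist (cspace X) f g < e)"
    if f: "f \<in> mspace (cspace X)"
  proof (intro iffI allI impI)
    fix e :: real assume L: "\<forall>e>0. \<exists>g\<in>B. \<forall>x\<in>topspace X. cmod (f x - g x) < e" and e: "e > 0"
    then obtain g where g: "g \<in> B" "\<forall>x\<in>topspace X. cmod (f x - g x) < e/2" using half_gt_zero by blast
    have "mdist (cspace X) f g \<le> e/2"
      by (rule mdist_cfunspace_le) (use e g(2) in \<open>auto simp: dist_norm less_imp_le\<close>)
    then show "\<exists>g\<in>B. mdist (cspace X) f g < e" using g(1) e by (intro bexI[of _ g]) auto
  next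
    fix e :: real assume L: "\<forall>e>0. \<exists>g\<in>B. mdist (cspace X) f g < e" and e: "e > 0"
    then obtain g where g: "g \<in> B" "mdist (cspace X) f g < e" by blast
    have "cmod (f x - g x) < e" if "x \<in> topspace X" for x
      using mdist_cfunspace_imp_mdist_le[OF f _ order_refl that, of g] g B by (auto simp: dist_norm)
    then show "\<exists>g\<in>B. \<forall>x\<in>topspace X. cmod (f x - g x) < e" using g(1) by blast
  qed
  have "f \<in> mtopology_of (cspace X) closure_of B \<longleftrightarrow> f \<in> mspace (cspace X) \<and> (\<forall>e>0. \<exists>g\<in>B. mdist (cspace X) f g < e)"
    unfolding mtopology_of_def M.metric_closure_of M.in_mball using B by blast
  then show ?thesis using 1 by blast
qed

lemma closedin_cspace:
  assumes X: "compact_space X" and B: "B \<subseteq> mspace (cspace X)"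
  shows "closedin (mtopology_of (cspace X)) B \<longleftrightarrow>
    (\<forall>f\<in>mspace (cspace X). (\<forall>e>0. \<exists>g\<in>B. \<forall>x\<in>topspace X. cmod (f x - g x) < e) \<longrightarrow> f \<in> B)"
proof -
  have "closedin (mtopology_of (cspace X)) B \<longleftrightarrow> mtopology_of (cspace X) closure_of B \<subseteq> B"
    using closure_of_subset_eq[of B "mtopology_of (cspace X)"] B by (simp add: topspace_mtopology_of)
  then show ?thesis using closure_cspace[OF X B] by blast
qed


lemma continuous_uniform_limit:
  fixes f :: "'a \<Rightarrow> complex"
  assumes lim: "\<And>e. e > 0 \<Longrightarrow> \<exists>g. continuous_map X euclidean g \<and> (\<forall>x\<in>topspace X. cmod (f x - g x) < e)"
  shows "continuous_map X euclidean f"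
  unfolding continuous_map_def
proof (intro conjI allI impI)
  fix U :: "complex set" assume "openin euclidean U"
  then have U: "open U" by simp
  show "openin X {x \<in> topspace X. f x \<in> U}"
  proof (subst openin_subopen, intro ballI)
    fix x assume x: "x \<in> {x \<in> topspace X. f x \<in> U}"
    then obtain e where e: "e > 0" "ball (f x) e \<subseteq> U" using U open_contains_ball by blast
    then have "e / 3 > 0" by simp
    from lim[OF this] obtain g where g: "continuous_map X euclidean g" "\<forall>x\<in>topspace X. cmod (f x - g x) < e/3" by blast
    have op: "openin X {y \<in> topspace X. g y \<in> ball (g x) (e/3)}"
      by (rule openin_continuous_map_preimage[OF g(1)]) simp
    have "{y \<in> topspace X. g y \<in> ball (g x) (e/3)} \<subseteq> {x \<in> topspace X. f x \<in> U}"
    proof safe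
      fix y assume y: "y \<in> topspace X" "g y \<in> ball (g x) (e/3)"
      have "cmod (f x - g x) < e/3" "cmod (f y - g y) < e/3" "cmod (g x - g y) < e/3"
        using g(2) x y by (auto simp: dist_norm)
      moreover have "cmod (f x - f y) \<le> cmod (f x - g x) + cmod (g x - g y) + cmod (g y - f y)"
        using norm_triangle_ineq[of "f x - g x" "g x - f y"] norm_triangle_ineq[of "g x - g y" "g y - f y"] by simp
      ultimately have "f y \<in> ball (f x) e" by (simp add: dist_norm norm_minus_commute)
      then show "f y \<in> U" using e(2) by blast
    qed
    then show "\<exists>T. openin X T \<and> x \<in> T \<and> T \<subseteq> {x \<in> topspace X. f x \<in> U}"
      using op x e(1) by (intro exI[of _ "{y \<in> topspace X. g y \<in> ball (g x) (e/3)}"]) auto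
  qed
qed auto

text \<open>Replacing an algebra of extensional functions by all functions that agree with one of them on \<open>T\<close>
  frees the pointwise operations from restrictions.\<close>

definition sat :: "'a set \<Rightarrow> ('a \<Rightarrow> complex) set \<Rightarrow> ('a \<Rightarrow> complex) set" where
  "sat T B = {f. restrict f T \<in> B}"

lemma sat_addI: "(\<lambda>x\<in>T. restrict f T x + restrict g T x) \<in> B \<Longrightarrow> (\<lambda>x. f x + g x) \<in> sat T B"
  and sat_multI: "(\<lambda>x\<in>T. restrict f T x * restrict g T x) \<in> B \<Longrightarrow> (\<lambda>x. f x * g x) \<in> sat T B"
  unfolding sat_def by (simp_all cong: restrict_cong)

lemma restrict_mspace: "compact_space X \<Longrightarrow> restrict f (topspace X) \<in> mspace (cspace X) \<longleftrightarrow> continuous_map X euclidean f"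
  using mspace_cspace_iff[of X] continuous_map_eq[of X euclidean f "restrict f (topspace X)"]
    continuous_map_eq[of X euclidean "restrict f (topspace X)" f] by auto

lemma unif_closed_sat:
  assumes X: "compact_space X" and B: "B \<subseteq> mspace (cspace X)"
  shows "closedin (mtopology_of (cspace X)) B \<longleftrightarrow> unif_closed (topspace X) (sat (topspace X) B)" (is "_ \<longleftrightarrow> unif_closed ?T ?B")
proof
  have sB: "g \<in> sat ?T B" if "g \<in> B" for g
  proof -
    have "g \<in> extensional ?T" using that B mspace_cspace_iff[OF X] by blast
    then show ?thesis using that by (simp add: sat_def extensional_restrict)
  qed
  assume cl: "closedin (mtopology_of (cspace X)) B"
  show "unif_closed ?T ?B"
    unfolding unif_closed_def
  proof (intro allI impI)
    fix f assume f: "\<forall>e>0. \<exists>g\<in>?B. \<forall>x\<in>?T. cmod (f x - g x) < e"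
    have f': "\<forall>e>0. \<exists>g\<in>B. \<forall>x\<in>?T. cmod (restrict f ?T x - g x) < e"
    proof (intro allI impI)
      fix e :: real assume "e > 0"
      then obtain g where g: "g \<in> ?B" "\<forall>x\<in>?T. cmod (f x - g x) < e" using f by blast
      then show "\<exists>g\<in>B. \<forall>x\<in>?T. cmod (restrict f ?T x - g x) < e"
        by (intro bexI[of _ "restrict g ?T"]) (auto simp: sat_def)
    qed
    have "continuous_map X euclidean (restrict f ?T)"
      by (rule continuous_uniform_limit) (use f' B mspace_cspace_iff[OF X] in blast)
    then have "restrict f ?T \<in> mspace (cspace X)" by (simp add: mspace_cspace_iff[OF X])
    then show "f \<in> ?B" using cl f' unfolding closedin_cspace[OF X B] sat_def by blast
  qed
next
  assume u: "unif_closed ?T ?B"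
  have sB: "g \<in> sat ?T B" if "g \<in> B" for g
  proof -
    have "g \<in> extensional ?T" using that B mspace_cspace_iff[OF X] by blast
    then show ?thesis using that by (simp add: sat_def extensional_restrict)
  qed
  show "closedin (mtopology_of (cspace X)) B"
    unfolding closedin_cspace[OF X B]
  proof (intro ballI impI)
    fix f assume f: "f \<in> mspace (cspace X)" "\<forall>e>0. \<exists>g\<in>B. \<forall>x\<in>?T. cmod (f x - g x) < e"
    have "f \<in> ?B" by (rule unif_closedD[OF u]) (use f(2) sB in blast)
    moreover have "f \<in> extensional ?T" using f(1) mspace_cspace_iff[OF X] by blast
    ultimately show "f \<in> B" by (simp add: sat_def extensional_restrict)
  qed
qed

lemma sat_ext: "B \<subseteq> extensional T \<Longrightarrow> f \<in> B \<Longrightarrow> f \<in> sat T B"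
  by (auto simp: sat_def extensional_restrict subset_iff)

lemma unif_closed_restrict: assumes "unif_closed T P" shows "restrict f T \<in> P \<longleftrightarrow> f \<in> P"
proof
  show "f \<in> P" if "restrict f T \<in> P" by (rule unif_closed_cong[OF assms that]) simp
  show "restrict f T \<in> P" if "f \<in> P" by (rule unif_closed_cong[OF assms that]) simp
qed

lemma sat_Int_ext: "unif_closed T P \<Longrightarrow> sat T (P \<inter> extensional T) = P"
  unfolding sat_def by (simp add: unif_closed_restrict)

lemma bounded_continuous:
  assumes "compact_space X" "continuous_map X euclidean (f :: 'a \<Rightarrow> complex)"
  shows "\<exists>M. \<forall>x\<in>topspace X. cmod (f x) \<le> M"
proof -
  have "compactin euclidean (f ` topspace X)" using assms image_compactin compact_space_def by metis
  then have "bounded (f ` topspace X)" by (simp add: compact_imp_bounded)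
  then show ?thesis unfolding bounded_iff by auto
qed

lemma closed_unital_subalgebra_iff:
  assumes X: "compact_space X"
  shows "closed_unital_subalgebra X B \<longleftrightarrow> B \<subseteq> mspace (cspace X) \<and> fun_alg (topspace X) (sat (topspace X) B)"
    (is "_ \<longleftrightarrow> _ \<and> fun_alg ?T ?B")
proof -
  have "closed_unital_subalgebra X B \<longleftrightarrow> fun_alg ?T ?B" if B: "B \<subseteq> mspace (cspace X)"
  proof
    assume c: "closed_unital_subalgebra X B"
    show "fun_alg ?T ?B" unfolding fun_alg_def
    proof (intro conjI allI ballI)
      show "unif_closed ?T ?B" using c unif_closed_sat[OF X B] unfolding closed_unital_subalgebra_def by blast
      show "(\<lambda>x. c) \<in> ?B" for c using c unfolding closed_unital_subalgebra_def sat_def by blast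
      show "(\<lambda>x. f x + g x) \<in> ?B" if "f \<in> ?B" "g \<in> ?B" for f g
        by (rule sat_addI) (use c that in \<open>unfold closed_unital_subalgebra_def sat_def, blast\<close>)
      show "(\<lambda>x. f x * g x) \<in> ?B" if "f \<in> ?B" "g \<in> ?B" for f g
        by (rule sat_multI) (use c that in \<open>unfold closed_unital_subalgebra_def sat_def, blast\<close>)
      show "\<exists>M. \<forall>x\<in>?T. cmod (f x) \<le> M" if "f \<in> ?B" for f
      proof (rule bounded_continuous[OF X])
        show "continuous_map X euclidean f" using that B restrict_mspace[OF X] unfolding sat_def by blast
      qed
    qed
  next
    assume F: "fun_alg ?T ?B"
    have ext: "B \<subseteq> extensional ?T" using B mspace_cspace_iff[OF X] by blast
    show "closed_unital_subalgebra X B"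
      unfolding closed_unital_subalgebra_def
    proof (intro conjI allI ballI)
      show "closedin (mtopology_of (cspace X)) B" using F unif_closed_sat[OF X B] unfolding fun_alg_def by blast
      show "(\<lambda>x\<in>?T. c) \<in> B" for c using fun_algD(2)[OF F] unfolding sat_def by simp
      show "(\<lambda>x\<in>?T. f x + g x) \<in> B" "(\<lambda>x\<in>?T. f x * g x) \<in> B" if "f \<in> B" "g \<in> B" for f g
        using fun_algD(3,4)[OF F sat_ext[OF ext that(1)] sat_ext[OF ext that(2)]] unfolding sat_def by simp_all
    qed (rule B)
  qed
  then show ?thesis unfolding closed_unital_subalgebra_def by blast
qed

lemma uniform_algebra_iff:
  "uniform_algebra X A \<longleftrightarrow> compact_space X \<and> Hausdorff_space X \<and> A \<subseteq> mspace (cspace X) \<and> fun_alg (topspace X) (sat (topspace X) A) \<and>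
     (\<forall>x\<in>topspace X. \<forall>y\<in>topspace X. x \<noteq> y \<longrightarrow> (\<exists>f\<in>A. f x \<noteq> f y))"
  unfolding uniform_algebra_def by (cases "compact_space X") (simp_all add: closed_unital_subalgebra_iff)

lemma continuous_map_mult_complex:
  fixes f :: "'a \<Rightarrow> complex"
  assumes "continuous_map X euclidean f" "continuous_map X euclidean g"
  shows "continuous_map X euclidean (\<lambda>x. f x * g x)"
proof -
  have "continuous_map X (prod_topology euclidean euclidean) (\<lambda>x. (f x, g x))"
    using assms by (rule continuous_map_pairedI)
  then have "continuous_map X euclidean (\<lambda>x. (f x, g x))" by (simp only: prod_topology_euclidean)
  moreover have "continuous_map euclidean euclidean (\<lambda>p :: complex \<times> complex. fst p * snd p)"
    by (simp add: continuous_map_iff_continuous2 continuous_intros)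
  ultimately have "continuous_map X euclidean ((\<lambda>p. fst p * snd p) \<circ> (\<lambda>x. (f x, g x)))"
    by (rule continuous_map_compose)
  then show ?thesis by (simp add: comp_def)
qed

lemma gen_continuous:
  assumes G: "\<And>g. g \<in> G \<Longrightarrow> continuous_map X euclidean g" and f: "f \<in> gen (topspace X) G"
  shows "continuous_map X euclidean f"
  using f
proof (induction rule: gen.induct)
  case (gen_lim f)
  show ?case by (rule continuous_uniform_limit) (use gen_lim in blast)
next
  case (gen_mult f g)
  show ?case by (rule continuous_map_mult_complex) (use gen_mult in blast)+
qed (auto intro: G continuous_intros)

lemma fun_alg_gen_continuous:
  assumes X: "compact_space X" and G: "\<And>g. g \<in> G \<Longrightarrow> continuous_map X euclidean g"
  shows "fun_alg (topspace X) (gen (topspace X) G)"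
  by (rule fun_alg_gen) (use bounded_continuous[OF X] G in blast)

text \<open>Identifies the intersection of all closed unital subalgebras with the inductive closure,
  which opens the algebras of root extensions to induction and to \<open>gen_map\<close>.\<close>

lemma generated_eq:
  assumes X: "compact_space X" and G: "G \<subseteq> mspace (cspace X)"
  shows "generated_uniform_algebra X G = gen (topspace X) G \<inter> extensional (topspace X)" (is "_ = gen ?T G \<inter> _")
proof
  have Gc: "continuous_map X euclidean g" if "g \<in> G" for g using that G mspace_cspace_iff[OF X] by blast
  have Ge: "G \<subseteq> extensional ?T" using G mspace_cspace_iff[OF X] by blast
  have fa: "fun_alg ?T (gen ?T G)" by (rule fun_alg_gen_continuous[OF X]) (rule Gc)
  have sub: "gen ?T G \<inter> extensional ?T \<subseteq> mspace (cspace X)"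
  proof
    fix f assume f: "f \<in> gen ?T G \<inter> extensional ?T"
    have "continuous_map X euclidean f" by (rule gen_continuous[OF Gc]) (use f in auto)
    then show "f \<in> mspace (cspace X)" using f by (simp add: mspace_cspace_iff[OF X])
  qed
  have "closed_unital_subalgebra X (gen ?T G \<inter> extensional ?T)"
    unfolding closed_unital_subalgebra_iff[OF X] using sub fa by (simp add: sat_Int_ext[OF fun_algD(1)[OF fa]])
  moreover have "G \<subseteq> gen ?T G \<inter> extensional ?T" using gen_base Ge by blast
  ultimately show "generated_uniform_algebra X G \<subseteq> gen ?T G \<inter> extensional ?T"
    unfolding generated_uniform_algebra_def by blast
  show "gen ?T G \<inter> extensional ?T \<subseteq> generated_uniform_algebra X G"
    unfolding generated_uniform_algebra_def
  proof (intro subsetI InterI, clarify)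
    fix f B assume f: "f \<in> gen ?T G" "f \<in> extensional ?T" and B: "closed_unital_subalgebra X B" "G \<subseteq> B"
    have "f \<in> sat ?T B"
      by (rule gen_least[OF f(1)]) (use B(1)[unfolded closed_unital_subalgebra_iff[OF X]] B(2) Ge in \<open>auto simp: sat_def extensional_restrict subset_iff\<close>)
    then show "f \<in> B" using f(2) by (simp add: sat_def extensional_restrict)
  qed
qed

section \<open>Uniform algebras as rings and their closed ideals\<close>

lemma cring_function_algebra:
  assumes A: "uniform_algebra X A"
  shows "cring (function_algebra (topspace X) A)" (is "cring ?R")
proof -
  let ?T = "topspace X"
  have c: "closed_unital_subalgebra X A" and X: "compact_space X" using A unfolding uniform_algebra_def by auto
  have ext: "A \<subseteq> extensional ?T" using A mspace_cspace_iff[OF X] unfolding uniform_algebra_iff by blast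
  note cl = c[unfolded closed_unital_subalgebra_def]
  have const: "(\<lambda>x\<in>?T. k) \<in> A" for k using cl by blast
  have add: "(\<lambda>x\<in>?T. f x + g x) \<in> A" and mult: "(\<lambda>x\<in>?T. f x * g x) \<in> A" if "f \<in> A" "g \<in> A" for f g
    using cl that by blast+
  have neg: "(\<lambda>x\<in>?T. - f x) \<in> A" if "f \<in> A" for f
  proof -
    have "(\<lambda>x\<in>?T. (\<lambda>x\<in>?T. -1) x * f x) \<in> A" using mult[OF const that] .
    also have "(\<lambda>x\<in>?T. (\<lambda>x\<in>?T. -1) x * f x) = (\<lambda>x\<in>?T. - f x)" by (auto simp: restrict_def)
    finally show ?thesis .
  qed
  have eqI: "f = g" if "f \<in> extensional ?T" "g \<in> extensional ?T" "\<And>x. x \<in> ?T \<Longrightarrow> f x = g x" for f g :: "'a \<Rightarrow> complex"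
    using that by (rule extensionalityI)
  show ?thesis
  proof (rule cringI)
    show "abelian_group ?R"
    proof (rule abelian_groupI)
      show "\<exists>y\<in>carrier ?R. y \<oplus>\<^bsub>?R\<^esub> x = \<zero>\<^bsub>?R\<^esub>" if "x \<in> carrier ?R" for x
        using that neg[of x] by (intro bexI[of _ "\<lambda>t\<in>?T. - x t"]) (auto simp: function_algebra_def restrict_def)
      show "\<zero>\<^bsub>?R\<^esub> \<oplus>\<^bsub>?R\<^esub> x = x" if "x \<in> carrier ?R" for x
        using that ext by (auto simp: function_algebra_def intro!: eqI)
    qed (use add const in \<open>auto simp: function_algebra_def restrict_def fun_eq_iff add_ac\<close>)
    show "comm_monoid ?R"
    proof (rule comm_monoidI)
      show "\<one>\<^bsub>?R\<^esub> \<otimes>\<^bsub>?R\<^esub> x = x" if "x \<in> carrier ?R" for x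
        using that ext by (auto simp: function_algebra_def intro!: eqI)
    qed (use mult const in \<open>auto simp: function_algebra_def restrict_def fun_eq_iff mult_ac\<close>)
  qed (auto simp: function_algebra_def restrict_def fun_eq_iff distrib_right)
qed

text \<open>A ring ideal is an additive subgroup, whereas \<open>fun_ideal\<close> does not mention
  negatives; they arise from multiplication by the constant \<open>-1\<close>.\<close>

lemma closed_ideal_iff:
  assumes A: "uniform_algebra X A"
  shows "closed_ideal X A I \<longleftrightarrow> I \<subseteq> mspace (cspace X) \<and> fun_ideal (topspace X) (sat (topspace X) A) (sat (topspace X) I)"
    (is "_ \<longleftrightarrow> _ \<and> fun_ideal ?T ?A ?I")
proof -
  have X: "compact_space X" and AM: "A \<subseteq> mspace (cspace X)" using A unfolding uniform_algebra_iff by auto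
  have ext: "A \<subseteq> extensional ?T" using AM mspace_cspace_iff[OF X] by blast
  let ?R = "function_algebra ?T A"
  interpret R: cring ?R by (rule cring_function_algebra[OF A])
  show ?thesis
  proof
    assume I: "closed_ideal X A I"
    then interpret ideal I ?R unfolding closed_ideal_def by blast
    have IA: "I \<subseteq> A" using a_subset by (simp add: function_algebra_def)
    then have IM: "I \<subseteq> mspace (cspace X)" using AM by blast
    have "fun_ideal ?T ?A ?I"
      unfolding fun_ideal_def
    proof (intro conjI ballI)
      show "unif_closed ?T ?I" using I unif_closed_sat[OF X IM] unfolding closed_ideal_def by blast
      show "?I \<subseteq> ?A" using IA unfolding sat_def by blast
      show "(\<lambda>x. 0) \<in> ?I" using zero_closed unfolding sat_def function_algebra_def by simp
      show "(\<lambda>x. f x + g x) \<in> ?I" if "f \<in> ?I" "g \<in> ?I" for f g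
        by (rule sat_addI) (use that a_closed[of "restrict f ?T" "restrict g ?T"] in \<open>simp add: sat_def function_algebra_def\<close>)
      show "(\<lambda>x. f x * g x) \<in> ?I" if "f \<in> ?A" "g \<in> ?I" for f g
        by (rule sat_multI) (use that I_l_closed[of "restrict g ?T" "restrict f ?T"] in \<open>simp add: sat_def function_algebra_def\<close>)
    qed
    then show "I \<subseteq> mspace (cspace X) \<and> fun_ideal ?T ?A ?I" using IM by blast
  next
    assume "I \<subseteq> mspace (cspace X) \<and> fun_ideal ?T ?A ?I"
    then have IM: "I \<subseteq> mspace (cspace X)" and F: "fun_ideal ?T ?A ?I" by auto
    have Iext: "I \<subseteq> extensional ?T" using IM mspace_cspace_iff[OF X] by blast
    have IA: "I \<subseteq> A"
    proof
      fix f assume f: "f \<in> I"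
      then have "f \<in> ?A" using fun_idealD(2)[OF F sat_ext[OF Iext]] by blast
      then show "f \<in> A" using f Iext by (auto simp: sat_def extensional_restrict subset_iff)
    qed
    have mult: "(\<lambda>x\<in>?T. f x * g x) \<in> I" if "f \<in> A" "g \<in> I" for f g
      using fun_idealD(5)[OF F sat_ext[OF ext that(1)] sat_ext[OF Iext that(2)]] unfolding sat_def by simp
    have add: "(\<lambda>x\<in>?T. f x + g x) \<in> I" if "f \<in> I" "g \<in> I" for f g
      using fun_idealD(4)[OF F sat_ext[OF Iext that(1)] sat_ext[OF Iext that(2)]] unfolding sat_def by simp
    have zero: "(\<lambda>x\<in>?T. 0) \<in> I" using fun_idealD(3)[OF F] unfolding sat_def by simp
    have cm: "(\<lambda>x\<in>?T. -1) \<in> A" using fun_algD(2)[of ?T ?A "-1"] A unfolding uniform_algebra_iff sat_def by auto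
    have neg: "\<ominus>\<^bsub>?R\<^esub> f \<in> I" if f: "f \<in> I" for f
    proof -
      have "(\<lambda>x\<in>?T. (\<lambda>x\<in>?T. -1) x * f x) \<in> I" by (rule mult[OF cm f])
      moreover have "\<ominus>\<^bsub>?R\<^esub> f = (\<lambda>x\<in>?T. (\<lambda>x\<in>?T. -1) x * f x)"
      proof (rule R.minus_equality)
        show "(\<lambda>x\<in>?T. (\<lambda>x\<in>?T. -1) x * f x) \<oplus>\<^bsub>?R\<^esub> f = \<zero>\<^bsub>?R\<^esub>" by (auto simp: function_algebra_def restrict_def)
        show "f \<in> carrier ?R" "(\<lambda>x\<in>?T. (\<lambda>x\<in>?T. -1) x * f x) \<in> carrier ?R"
          using f IA mult[OF cm f] by (auto simp: function_algebra_def)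
      qed
      ultimately show ?thesis by simp
    qed
    have "ideal I ?R"
    proof (rule idealI[OF R.ring_axioms])
      show "subgroup I (add_monoid ?R)"
      proof (rule group.subgroupI[OF R.a_group])
        show "I \<subseteq> carrier (add_monoid ?R)" using IA by (simp add: function_algebra_def)
        show "I \<noteq> {}" using zero by blast
        show "inv\<^bsub>add_monoid ?R\<^esub> f \<in> I" if "f \<in> I" for f using neg[OF that] unfolding a_inv_def .
        show "f \<otimes>\<^bsub>add_monoid ?R\<^esub> g \<in> I" if "f \<in> I" "g \<in> I" for f g
          using add[OF that] by (simp add: function_algebra_def)
      qed
      show "x \<otimes>\<^bsub>?R\<^esub> a \<in> I" "a \<otimes>\<^bsub>?R\<^esub> x \<in> I" if "a \<in> I" "x \<in> carrier ?R" for a x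
        using mult[of x a] that by (simp_all add: function_algebra_def mult.commute)
    qed
    moreover have "closedin (mtopology_of (cspace X)) I" using unif_closed_sat[OF X IM] fun_idealD(1)[OF F] by blast
    ultimately show "closed_ideal X A I" unfolding closed_ideal_def by blast
  qed
qed

text \<open>A substitution has to be checked on generators only. It transports functions between
  stages, along the homeomorphism of a root extension, and from the first stage to the base.\<close>

lemma gen_map:
  assumes \<phi>: "\<And>y. y \<in> T' \<Longrightarrow> \<phi> y \<in> T" and G: "\<And>g. g \<in> G \<Longrightarrow> (\<lambda>y. g (\<phi> y)) \<in> gen T' G'" and f: "f \<in> gen T G"
  shows "(\<lambda>y. f (\<phi> y)) \<in> gen T' G'"
  using f
proof (induction rule: gen.induct)
  case (gen_lim f)
  show ?case
  proof (rule gen.gen_lim)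
    fix e :: real assume "e > 0"
    then obtain g where g: "(\<lambda>y. g (\<phi> y)) \<in> gen T' G'" "\<forall>x\<in>T. cmod (f x - g x) < e" using gen_lim by blast
    then show "\<exists>g. g \<in> gen T' G' \<and> (\<forall>x\<in>T'. cmod (f (\<phi> x) - g x) < e)" using \<phi> by (intro exI[of _ "\<lambda>y. g (\<phi> y)"]) auto
  qed
next
  case (gen_base f) then show ?case by (rule G)
next
  case (gen_const c) show ?case by (rule gen.gen_const)
next
  case (gen_add f g) then show ?case using gen.gen_add by blast
next
  case (gen_mult f g) then show ?case using gen.gen_mult by blast
qed

lemma igen_map:
  assumes \<phi>: "\<And>y. y \<in> T' \<Longrightarrow> \<phi> y \<in> T" and P: "\<And>f. f \<in> P \<Longrightarrow> (\<lambda>y. f (\<phi> y)) \<in> P'"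
    and G: "\<And>g. g \<in> G \<Longrightarrow> (\<lambda>y. g (\<phi> y)) \<in> igen T' P' G'" and f: "f \<in> igen T P G"
  shows "(\<lambda>y. f (\<phi> y)) \<in> igen T' P' G'"
  using f
proof (induction rule: igen.induct)
  case (igen_lim f)
  show ?case
  proof (rule igen.igen_lim)
    fix e :: real assume "e > 0"
    then obtain g where g: "(\<lambda>y. g (\<phi> y)) \<in> igen T' P' G'" "\<forall>x\<in>T. cmod (f x - g x) < e" using igen_lim by blast
    then show "\<exists>g. g \<in> igen T' P' G' \<and> (\<forall>x\<in>T'. cmod (f (\<phi> x) - g x) < e)" using \<phi> by (intro exI[of _ "\<lambda>y. g (\<phi> y)"]) auto
  qed
next
  case (igen_base f) then show ?case by (rule G)
next
  case igen_zero show ?case by (rule igen.igen_zero)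
next
  case (igen_add f g) then show ?case using igen.igen_add by blast
next
  case (igen_mult f g)
  show ?case by (rule igen.igen_mult[OF P[OF igen_mult(1)] igen_mult(3)])
qed

section \<open>Towers of root extensions\<close>

text \<open>
  The whole tower lives in one type: a point of stage \<open>\<alpha>\<close> is a pair of a base point and a family of
  values of the roots adjoined before \<open>\<alpha>\<close>, the root of \<open>f \<in> F \<beta>\<close> having the index \<open>code \<beta> f\<close>. The maps
  of the system only forget coordinates.
\<close>

definition tower_index :: "'i rel \<Rightarrow> ('i \<Rightarrow> 'f \<Rightarrow> 'w) \<Rightarrow> ('i \<Rightarrow> 'f set) \<Rightarrow> 'i \<Rightarrow> 'w set" where
  "tower_index r code F \<alpha> = {code \<beta> f | \<beta> f. \<beta> \<in> underS r \<alpha> \<and> f \<in> F \<beta>}"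

text \<open>The equations of all earlier stages are imposed at once, so no recursion on \<alpha> is
  needed. A radicand of stage \<beta> is evaluated at the point cut down to the coordinates of that
  stage.\<close>

definition tower_set :: "'a set \<Rightarrow> 'i rel \<Rightarrow> ('i \<Rightarrow> ('a \<times> ('w \<Rightarrow> complex) \<Rightarrow> complex) \<Rightarrow> 'w) \<Rightarrow>
    ('i \<Rightarrow> ('a \<times> ('w \<Rightarrow> complex) \<Rightarrow> complex) set) \<Rightarrow> 'i \<Rightarrow> ('a \<times> ('w \<Rightarrow> complex)) set" where
  "tower_set X r code F \<alpha> = {y. fst y \<in> X \<and> snd y \<in> extensional (tower_index r code F \<alpha>) \<and>
     (\<forall>\<beta>\<in>underS r \<alpha>. \<forall>f\<in>F \<beta>. (snd y (code \<beta> f))\<^sup>2 = f (fst y, restrict (snd y) (tower_index r code F \<beta>)))}"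

definition tower_alg :: "'a set \<Rightarrow> ('a \<Rightarrow> complex) set \<Rightarrow> 'i rel \<Rightarrow> ('i \<Rightarrow> ('a \<times> ('w \<Rightarrow> complex) \<Rightarrow> complex) \<Rightarrow> 'w) \<Rightarrow>
    ('i \<Rightarrow> ('a \<times> ('w \<Rightarrow> complex) \<Rightarrow> complex) set) \<Rightarrow> 'i \<Rightarrow> ('a \<times> ('w \<Rightarrow> complex) \<Rightarrow> complex) set" where
  "tower_alg X PA r code F \<alpha> = gen (tower_set X r code F \<alpha>) ((\<lambda>a y. a (fst y)) ` PA \<union> (\<lambda>w y. snd y w) ` tower_index r code F \<alpha>)"

definition tower_ideal :: "'a set \<Rightarrow> ('a \<Rightarrow> complex) set \<Rightarrow> ('a \<Rightarrow> complex) set \<Rightarrow> 'i rel \<Rightarrow> ('i \<Rightarrow> ('a \<times> ('w \<Rightarrow> complex) \<Rightarrow> complex) \<Rightarrow> 'w) \<Rightarrow>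
    ('i \<Rightarrow> ('a \<times> ('w \<Rightarrow> complex) \<Rightarrow> complex) set) \<Rightarrow> 'i \<Rightarrow> ('a \<times> ('w \<Rightarrow> complex) \<Rightarrow> complex) set" where
  "tower_ideal X PA PI r code F \<alpha> = igen (tower_set X r code F \<alpha>) (tower_alg X PA r code F \<alpha>)
     ((\<lambda>a y. a (fst y)) ` PI \<union> (\<lambda>w y. snd y w) ` tower_index r code F \<alpha>)"

locale tower =
  fixes X :: "'a set" and PA PI :: "('a \<Rightarrow> complex) set" and r :: "'i rel" and \<tau> :: 'i
    and F :: "'i \<Rightarrow> ('a \<times> ('w \<Rightarrow> complex) \<Rightarrow> complex) set"
    and code :: "'i \<Rightarrow> ('a \<times> ('w \<Rightarrow> complex) \<Rightarrow> complex) \<Rightarrow> 'w"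
  assumes PA: "fun_alg X PA" and PI: "fun_ideal X PA PI"
    and wo: "Well_order r" and \<tau>: "\<tau> \<in> Field r" and \<tau>_max: "\<And>\<alpha>. \<alpha> \<in> Field r \<Longrightarrow> (\<alpha>, \<tau>) \<in> r"
    and code_inj: "\<And>\<beta> \<gamma> f g. \<beta> \<in> underS r \<tau> \<Longrightarrow> \<gamma> \<in> underS r \<tau> \<Longrightarrow> f \<in> F \<beta> \<Longrightarrow> g \<in> F \<gamma> \<Longrightarrow>
      code \<beta> f = code \<gamma> g \<Longrightarrow> \<beta> = \<gamma> \<and> f = g"
    and F_sub: "\<And>\<beta>. \<beta> \<in> underS r \<tau> \<Longrightarrow> F \<beta> \<subseteq> tower_ideal X PA PI r code F \<beta>"
begin

abbreviation "W \<equiv> tower_index r code F"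
abbreviation "Y \<equiv> tower_set X r code F"
abbreviation "AA \<equiv> tower_alg X PA r code F"
abbreviation "II \<equiv> tower_ideal X PA PI r code F"

definition trunc :: "'i \<Rightarrow> 'a \<times> ('w \<Rightarrow> complex) \<Rightarrow> 'a \<times> ('w \<Rightarrow> complex)" where
  "trunc \<alpha> y = (fst y, restrict (snd y) (W \<alpha>))"

lemma r_props: "refl_on (Field r) r" "trans r" "antisym r" "total_on (Field r) r" "wf (r - Id)"
  using wo unfolding well_order_on_def linear_order_on_def partial_order_on_def preorder_on_def by auto

lemma rI: "(\<alpha>, \<beta>) \<in> r \<Longrightarrow> \<alpha> \<in> Field r \<and> \<beta> \<in> Field r"
  by (auto simp: Field_def)

lemma r_refl: "\<alpha> \<in> Field r \<Longrightarrow> (\<alpha>, \<alpha>) \<in> r"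
  using r_props(1) by (auto simp: refl_on_def)

lemma r_trans: "(\<alpha>, \<beta>) \<in> r \<Longrightarrow> (\<beta>, \<gamma>) \<in> r \<Longrightarrow> (\<alpha>, \<gamma>) \<in> r"
  using r_props(2) by (auto dest: transD)

lemma r_total: "\<alpha> \<in> Field r \<Longrightarrow> \<beta> \<in> Field r \<Longrightarrow> \<alpha> \<noteq> \<beta> \<Longrightarrow> (\<alpha>, \<beta>) \<in> r \<or> (\<beta>, \<alpha>) \<in> r"
  using r_props(4) by (auto simp: total_on_def)

lemma underS_iff: "\<beta> \<in> underS r \<alpha> \<longleftrightarrow> (\<beta>, \<alpha>) \<in> r \<and> \<beta> \<noteq> \<alpha>"
  by (auto simp: underS_def)

lemma underS_trans: "\<gamma> \<in> underS r \<beta> \<Longrightarrow> (\<beta>, \<alpha>) \<in> r \<Longrightarrow> \<gamma> \<in> underS r \<alpha>"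
  using r_props(2,3) unfolding underS_iff by (meson antisymD transD)

lemma underS_\<tau>: "\<beta> \<in> underS r \<alpha> \<Longrightarrow> \<beta> \<in> underS r \<tau>"
  using underS_trans[of \<beta> \<alpha> \<tau>] \<tau>_max rI unfolding underS_iff by blast

lemma underS_Field: "\<beta> \<in> underS r \<alpha> \<Longrightarrow> \<beta> \<in> Field r"
  using rI unfolding underS_iff by blast

lemma W_iff: "w \<in> W \<alpha> \<longleftrightarrow> (\<exists>\<beta>\<in>underS r \<alpha>. \<exists>f\<in>F \<beta>. w = code \<beta> f)"
  unfolding tower_index_def by blast

lemma W_mono: "(\<alpha>, \<beta>) \<in> r \<Longrightarrow> W \<alpha> \<subseteq> W \<beta>"
  using underS_trans unfolding tower_index_def by blast

lemma W_\<tau>: "\<alpha> \<in> Field r \<Longrightarrow> W \<alpha> \<subseteq> W \<tau>"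
  by (rule W_mono[OF \<tau>_max])

lemma Y_iff: "y \<in> Y \<alpha> \<longleftrightarrow> fst y \<in> X \<and> snd y \<in> extensional (W \<alpha>) \<and>
     (\<forall>\<beta>\<in>underS r \<alpha>. \<forall>f\<in>F \<beta>. (snd y (code \<beta> f))\<^sup>2 = f (trunc \<beta> y))"
  unfolding tower_set_def trunc_def by blast

lemma fst_pm [simp]: "fst (trunc \<alpha> y) = fst y" and snd_pm: "snd (trunc \<alpha> y) = restrict (snd y) (W \<alpha>)"
  by (simp_all add: trunc_def)

lemma pm_pm: "(\<alpha>, \<beta>) \<in> r \<Longrightarrow> trunc \<alpha> (trunc \<beta> y) = trunc \<alpha> y"
  using W_mono[of \<alpha> \<beta>] unfolding trunc_def by (simp add: Int_absorb1)

lemma pm_id: "y \<in> Y \<alpha> \<Longrightarrow> trunc \<alpha> y = y"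
  unfolding Y_iff trunc_def by (simp add: extensional_restrict prod_eq_iff)

lemma snd_pm_code: "\<gamma> \<in> underS r \<alpha> \<Longrightarrow> f \<in> F \<gamma> \<Longrightarrow> snd (trunc \<alpha> y) (code \<gamma> f) = snd y (code \<gamma> f)"
  unfolding snd_pm by (rule restrict_apply') (auto simp: W_iff)

lemma pm_Y: assumes "y \<in> Y \<beta>" "(\<alpha>, \<beta>) \<in> r" shows "trunc \<alpha> y \<in> Y \<alpha>"
  unfolding Y_iff
proof (intro conjI ballI)
  show "fst (trunc \<alpha> y) \<in> X" using assms(1) unfolding Y_iff by simp
  show "snd (trunc \<alpha> y) \<in> extensional (W \<alpha>)" by (simp add: snd_pm)
  fix \<gamma> f assume g: "\<gamma> \<in> underS r \<alpha>" "f \<in> F \<gamma>"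
  have "(\<gamma>, \<alpha>) \<in> r" using g unfolding underS_iff by blast
  moreover have "\<gamma> \<in> underS r \<beta>" using underS_trans[OF g(1) assms(2)] .
  then have "(snd y (code \<gamma> f))\<^sup>2 = f (trunc \<gamma> y)" using assms(1) g(2) unfolding Y_iff by blast
  ultimately show "(snd (trunc \<alpha> y) (code \<gamma> f))\<^sup>2 = f (trunc \<gamma> (trunc \<alpha> y))"
    unfolding snd_pm_code[OF g] by (simp add: pm_pm)
qed

lemma AA_pi: "a \<in> PA \<Longrightarrow> (\<lambda>y. a (fst y)) \<in> AA \<alpha>"
  unfolding tower_alg_def by (rule gen_base) blast

lemma AA_r: "w \<in> W \<alpha> \<Longrightarrow> (\<lambda>y. snd y w) \<in> AA \<alpha>"
  unfolding tower_alg_def by (rule gen_base) blast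

lemma II_pi: "a \<in> PI \<Longrightarrow> (\<lambda>y. a (fst y)) \<in> II \<alpha>"
  unfolding tower_ideal_def by (rule igen_base) blast

lemma II_r: "w \<in> W \<alpha> \<Longrightarrow> (\<lambda>y. snd y w) \<in> II \<alpha>"
  unfolding tower_ideal_def by (rule igen_base) blast

lemma snd_pm_W: "w \<in> W \<alpha> \<Longrightarrow> (\<lambda>y. snd (trunc \<alpha> y) w) = (\<lambda>y. snd y w)"
  by (simp add: snd_pm)

lemma AA_gen_map:
  assumes g: "g \<in> AA \<alpha>" and m: "\<And>y. y \<in> T \<Longrightarrow> trunc \<alpha> y \<in> Y \<alpha>"
    and G: "(\<lambda>a y. a (fst y)) ` PA \<union> (\<lambda>w y. snd y w) ` W \<alpha> \<subseteq> G"
  shows "(\<lambda>y. g (trunc \<alpha> y)) \<in> gen T G"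
proof (rule gen_map[where \<phi> = "trunc \<alpha>" and T = "Y \<alpha>", OF _ _ g[unfolded tower_alg_def]])
  show "trunc \<alpha> y \<in> Y \<alpha>" if "y \<in> T" for y by (rule m[OF that])
  fix h assume "h \<in> (\<lambda>a y. a (fst y)) ` PA \<union> (\<lambda>w y. snd y w) ` W \<alpha>"
  then have "(\<lambda>y. h (trunc \<alpha> y)) = h" using snd_pm_W by auto
  then show "(\<lambda>y. h (trunc \<alpha> y)) \<in> gen T G"
    using \<open>h \<in> _\<close> G by (intro gen_base) auto
qed

lemma AA_mono: assumes "g \<in> AA \<alpha>" "(\<alpha>, \<beta>) \<in> r" shows "(\<lambda>y. g (trunc \<alpha> y)) \<in> AA \<beta>"
  unfolding tower_alg_def[of _ _ _ _ _ \<beta>]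
  by (rule AA_gen_map[OF assms(1) pm_Y[OF _ assms(2)]]) (use W_mono[OF assms(2)] in auto)

lemma II_gen_map:
  assumes g: "g \<in> II \<alpha>" and m: "\<And>y. y \<in> T \<Longrightarrow> trunc \<alpha> y \<in> Y \<alpha>"
    and P: "\<And>f. f \<in> AA \<alpha> \<Longrightarrow> (\<lambda>y. f (trunc \<alpha> y)) \<in> P"
    and G: "(\<lambda>a y. a (fst y)) ` PI \<union> (\<lambda>w y. snd y w) ` W \<alpha> \<subseteq> G"
  shows "(\<lambda>y. g (trunc \<alpha> y)) \<in> igen T P G"
proof (rule igen_map[where \<phi> = "trunc \<alpha>" and T = "Y \<alpha>" and P = "AA \<alpha>", OF _ _ _ g[unfolded tower_ideal_def]])
  show "trunc \<alpha> y \<in> Y \<alpha>" if "y \<in> T" for y by (rule m[OF that])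
  show "(\<lambda>y. f (trunc \<alpha> y)) \<in> P" if "f \<in> AA \<alpha>" for f by (rule P[OF that])
  fix h assume "h \<in> (\<lambda>a y. a (fst y)) ` PI \<union> (\<lambda>w y. snd y w) ` W \<alpha>"
  then have "(\<lambda>y. h (trunc \<alpha> y)) = h" using snd_pm_W by auto
  then show "(\<lambda>y. h (trunc \<alpha> y)) \<in> igen T P G"
    using \<open>h \<in> _\<close> G by (intro igen_base) auto
qed

lemma II_mono: assumes "g \<in> II \<alpha>" "(\<alpha>, \<beta>) \<in> r" shows "(\<lambda>y. g (trunc \<alpha> y)) \<in> II \<beta>"
  unfolding tower_ideal_def[of _ _ _ _ _ _ \<beta>]
proof (rule II_gen_map[OF assms(1)])
  show "trunc \<alpha> y \<in> Y \<alpha>" if "y \<in> Y \<beta>" for y by (rule pm_Y[OF that assms(2)])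
  show "(\<lambda>y. f (trunc \<alpha> y)) \<in> AA \<beta>" if "f \<in> AA \<alpha>" for f by (rule AA_mono[OF that assms(2)])
qed (use W_mono[OF assms(2)] in auto)

text \<open>The conditional form breaks a circle: coordinates are bounded because their radicands
  are, and radicands are bounded because they lie in algebras generated by bounded coordinates of
  earlier stages.\<close>

lemma AA_fun_alg_if:
  assumes "\<And>w. w \<in> W \<alpha> \<Longrightarrow> \<exists>M. \<forall>y\<in>Y \<alpha>. cmod (snd y w) \<le> M"
  shows "fun_alg (Y \<alpha>) (AA \<alpha>)"
  unfolding tower_alg_def
proof (rule fun_alg_gen)
  fix g assume "g \<in> (\<lambda>a y. a (fst y)) ` PA \<union> (\<lambda>w y. snd y w) ` W \<alpha>"
  then show "\<exists>M. \<forall>y\<in>Y \<alpha>. cmod (g y) \<le> M"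
  proof
    assume "g \<in> (\<lambda>a y. a (fst y)) ` PA"
    then obtain a where a: "a \<in> PA" "g = (\<lambda>y. a (fst y))" by blast
    obtain M where "\<forall>x\<in>X. cmod (a x) \<le> M" using fun_algD(5)[OF PA a(1)] ..
    moreover have "fst y \<in> X" if "y \<in> Y \<alpha>" for y using that unfolding Y_iff by blast
    ultimately show ?thesis unfolding a(2) by blast
  next
    assume "g \<in> (\<lambda>w y. snd y w) ` W \<alpha>"
    then show ?thesis using assms by blast
  qed
qed

lemma II_fun_ideal_if: assumes "fun_alg (Y \<alpha>) (AA \<alpha>)" shows "fun_ideal (Y \<alpha>) (AA \<alpha>) (II \<alpha>)"
  unfolding tower_ideal_def
proof (rule fun_ideal_igen[OF assms])
  show "(\<lambda>a y. a (fst y)) ` PI \<union> (\<lambda>w y. snd y w) ` W \<alpha> \<subseteq> AA \<alpha>"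
    by (intro Un_least image_subsetI AA_pi AA_r fun_idealD(2)[OF PI])
qed

lemma coord_bounded: "\<alpha> \<in> Field r \<Longrightarrow> w \<in> W \<alpha> \<Longrightarrow> \<exists>M. \<forall>y\<in>Y \<alpha>. cmod (snd y w) \<le> M"
proof (induction \<alpha> arbitrary: w rule: wf_induct_rule[OF r_props(5)])
  case (1 \<alpha>)
  obtain \<beta> f where b: "\<beta> \<in> underS r \<alpha>" "f \<in> F \<beta>" "w = code \<beta> f" using 1(3) unfolding W_iff by blast
  have "(\<beta>, \<alpha>) \<in> r - Id" using b(1) unfolding underS_iff by blast
  from 1(1)[OF this underS_Field[OF b(1)]] have fa: "fun_alg (Y \<beta>) (AA \<beta>)" by (rule AA_fun_alg_if)
  have "f \<in> AA \<beta>" using F_sub[OF underS_\<tau>[OF b(1)]] b(2) fun_idealD(2)[OF II_fun_ideal_if[OF fa]] by blast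
  then obtain M where M: "\<forall>y\<in>Y \<beta>. cmod (f y) \<le> M" using fun_algD(5)[OF fa] by blast
  have "cmod (snd y w) \<le> sqrt (max M 0)" if y: "y \<in> Y \<alpha>" for y
  proof -
    have "(snd y w)\<^sup>2 = f (trunc \<beta> y)" using y b unfolding Y_iff by blast
    moreover have "trunc \<beta> y \<in> Y \<beta>" using pm_Y[OF y] b(1) unfolding underS_iff by blast
    ultimately have "(cmod (snd y w))\<^sup>2 \<le> M" using M by (metis norm_power)
    then show ?thesis by (intro real_le_rsqrt) simp
  qed
  then show ?case by blast
qed

lemma AA_fun_alg: "\<alpha> \<in> Field r \<Longrightarrow> fun_alg (Y \<alpha>) (AA \<alpha>)"
  by (rule AA_fun_alg_if[OF coord_bounded])

lemma II_fun_ideal: "\<alpha> \<in> Field r \<Longrightarrow> fun_ideal (Y \<alpha>) (AA \<alpha>) (II \<alpha>)"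
  by (rule II_fun_ideal_if[OF AA_fun_alg])

lemma F_AA: "\<beta> \<in> underS r \<tau> \<Longrightarrow> f \<in> F \<beta> \<Longrightarrow> f \<in> AA \<beta>"
  using F_sub fun_idealD(2)[OF II_fun_ideal[OF underS_Field]] by blast

text \<open>The choice is unique for indices in \<open>W \<tau>\<close>, because
  \<open>code_inj\<close> separates both stages and radicands.\<close>

definition decode :: "'w \<Rightarrow> 'i \<times> ('a \<times> ('w \<Rightarrow> complex) \<Rightarrow> complex)" where
  "decode w = (SOME p. fst p \<in> underS r \<tau> \<and> snd p \<in> F (fst p) \<and> w = code (fst p) (snd p))"

definition stage :: "'w \<Rightarrow> 'i" where "stage w = fst (decode w)"

definition radicand :: "'w \<Rightarrow> 'a \<times> ('w \<Rightarrow> complex) \<Rightarrow> complex" where "radicand w = snd (decode w)"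

lemma decode_W: assumes "w \<in> W \<tau>" shows "stage w \<in> underS r \<tau>" "radicand w \<in> F (stage w)" "w = code (stage w) (radicand w)"
proof -
  obtain \<beta> f where "\<beta> \<in> underS r \<tau>" "f \<in> F \<beta>" "w = code \<beta> f" using assms unfolding W_iff by blast
  then have "\<exists>p. fst p \<in> underS r \<tau> \<and> snd p \<in> F (fst p) \<and> w = code (fst p) (snd p)" by (intro exI[of _ "(\<beta>, f)"]) simp
  from someI_ex[OF this] show "stage w \<in> underS r \<tau>" "radicand w \<in> F (stage w)" "w = code (stage w) (radicand w)"
    unfolding stage_def radicand_def decode_def by auto
qed

lemma st_fn_code: assumes "\<beta> \<in> underS r \<tau>" "f \<in> F \<beta>" shows "stage (code \<beta> f) = \<beta>" "radicand (code \<beta> f) = f"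
proof -
  have "code \<beta> f \<in> W \<tau>" using assms unfolding W_iff by blast
  from code_inj[OF assms(1) decode_W(1)[OF this] assms(2) decode_W(2)[OF this] decode_W(3)[OF this]]
  show "stage (code \<beta> f) = \<beta>" "radicand (code \<beta> f) = f" by auto
qed

lemma W_st: "\<alpha> \<in> Field r \<Longrightarrow> w \<in> W \<alpha> \<longleftrightarrow> w \<in> W \<tau> \<and> stage w \<in> underS r \<alpha>"
proof
  assume "\<alpha> \<in> Field r" "w \<in> W \<alpha>"
  then obtain \<beta> f where b: "\<beta> \<in> underS r \<alpha>" "f \<in> F \<beta>" "w = code \<beta> f" unfolding W_iff by blast
  then show "w \<in> W \<tau> \<and> stage w \<in> underS r \<alpha>" using st_fn_code[OF underS_\<tau>[OF b(1)] b(2)] W_\<tau>[OF \<open>\<alpha> \<in> Field r\<close>] \<open>w \<in> W \<alpha>\<close> by auto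
next
  assume "w \<in> W \<tau> \<and> stage w \<in> underS r \<alpha>"
  then show "w \<in> W \<alpha>" using decode_W[of w] unfolding W_iff[of w \<alpha>] by blast
qed

section \<open>Points with prescribed roots\<close>

lemma W_lt_st: "w \<in> W \<tau> \<Longrightarrow> W (stage w) \<subseteq> W \<tau>"
  by (rule W_\<tau>[OF underS_Field[OF decode_W(1)]])

lemma Y_sq: assumes "y \<in> Y \<alpha>" "\<alpha> \<in> Field r" "w \<in> W \<alpha>" shows "(snd y w)\<^sup>2 = radicand w (trunc (stage w) y)"
proof -
  have "w \<in> W \<tau>" "stage w \<in> underS r \<alpha>" using W_st assms by auto
  then show ?thesis using assms(1) decode_W[of w] unfolding Y_iff by metis
qed

text \<open>Roots may be prescribed on any set of indices that contains all indices on which its own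
  radicands depend; the others are chosen stage by stage as principal square roots. Surjectivity of
  the projections and the existence of sign changes are both obtained in this way.\<close>

lemma extension:
  assumes x: "x \<in> X" and D: "D \<subseteq> W \<tau>" and low: "\<And>w. w \<in> D \<Longrightarrow> W (stage w) \<subseteq> D"
    and sq: "\<And>w. w \<in> D \<Longrightarrow> (z w)\<^sup>2 = radicand w (x, restrict z (W (stage w)))"
  shows "\<exists>y\<in>Y \<tau>. fst y = x \<and> (\<forall>w\<in>D. snd y w = z w)"
proof -
  \<comment> \<open>The recursion runs over stages: \<open>h (stage v) v\<close> is the value
    already chosen at the stage of \<open>v\<close>. A value \<open>u \<beta> w\<close> with
    \<open>w\<close> not of stage \<beta> is never read.\<close>
  define H where "H h \<beta> w = (if w \<in> D then z w else csqrt (radicand w (x, \<lambda>v\<in>W \<beta>. h (stage v) v)))"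
    for h :: "'i \<Rightarrow> 'w \<Rightarrow> complex" and \<beta> w
  define u where "u = wfrec (r - Id) H"
  have u: "u \<beta> w = H u \<beta> w" if "\<beta> \<in> underS r \<tau>" for \<beta> w
  proof -
    have "u \<beta> = H (cut u (r - Id) \<beta>) \<beta>" unfolding u_def by (rule wfrec[OF r_props(5)])
    moreover have "cut u (r - Id) \<beta> (stage v) v = u (stage v) v" if "v \<in> W \<beta>" for v
    proof -
      have "stage v \<in> underS r \<beta>" using that W_st[OF underS_Field[OF \<open>\<beta> \<in> underS r \<tau>\<close>]] by blast
      then show ?thesis unfolding cut_def underS_iff by auto
    qed
    then have "(\<lambda>v\<in>W \<beta>. cut u (r - Id) \<beta> (stage v) v) = (\<lambda>v\<in>W \<beta>. u (stage v) v)" by (rule restrict_ext)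
    ultimately show ?thesis unfolding H_def by simp
  qed
  define z' where "z' = (\<lambda>w\<in>W \<tau>. u (stage w) w)"
  have z'D: "z' w = z w" if "w \<in> D" for w
    using u[OF decode_W(1)] that D unfolding z'_def H_def by auto
  have z'sq: "(z' w)\<^sup>2 = radicand w (x, restrict z' (W (stage w)))" if w: "w \<in> W \<tau>" for w
  proof (cases "w \<in> D")
    case True
    then have "restrict z' (W (stage w)) = restrict z (W (stage w))" using z'D low[OF True] by (intro restrict_ext) auto
    then show ?thesis using z'D[OF True] sq[OF True] by simp
  next
    case False
    have "restrict z' (W (stage w)) = (\<lambda>v\<in>W (stage w). u (stage v) v)"
      using W_lt_st[OF w] unfolding z'_def by (intro restrict_ext) auto
    moreover have "z' w = H u (stage w) w" using u[OF decode_W(1)[OF w]] w unfolding z'_def by simp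
    ultimately show ?thesis using False unfolding H_def by simp
  qed
  have "(x, z') \<in> Y \<tau>"
    unfolding Y_iff
  proof (intro conjI ballI)
    show "fst (x, z') \<in> X" using x by simp
    show "snd (x, z') \<in> extensional (W \<tau>)" unfolding z'_def by simp
    fix \<beta> f assume b: "\<beta> \<in> underS r \<tau>" "f \<in> F \<beta>"
    then have "code \<beta> f \<in> W \<tau>" unfolding W_iff by blast
    from z'sq[OF this] show "(snd (x, z') (code \<beta> f))\<^sup>2 = f (trunc \<beta> (x, z'))"
      unfolding st_fn_code[OF b] trunc_def by simp
  qed
  then show ?thesis using z'D by (intro bexI[of _ "(x, z')"]) auto
qed

lemma pm_surj: assumes "\<alpha> \<in> Field r" "y \<in> Y \<alpha>" shows "\<exists>y'\<in>Y \<tau>. trunc \<alpha> y' = y"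
proof -
  have "\<exists>y'\<in>Y \<tau>. fst y' = fst y \<and> (\<forall>w\<in>W \<alpha>. snd y' w = snd y w)"
  proof (rule extension)
    show "fst y \<in> X" using assms(2) unfolding Y_iff by blast
    show "W \<alpha> \<subseteq> W \<tau>" using W_\<tau>[OF assms(1)] .
    show "W (stage w) \<subseteq> W \<alpha>" if "w \<in> W \<alpha>" for w
      using that W_st[OF assms(1)] W_mono unfolding underS_iff by blast
    show "(snd y w)\<^sup>2 = radicand w (fst y, restrict (snd y) (W (stage w)))" if "w \<in> W \<alpha>" for w
      using Y_sq[OF assms(2,1) that] unfolding trunc_def .
  qed
  then obtain y' where y': "y' \<in> Y \<tau>" "fst y' = fst y" "\<forall>w\<in>W \<alpha>. snd y' w = snd y w" by blast
  have "restrict (snd y') (W \<alpha>) = restrict (snd y) (W \<alpha>)" using y'(3) by (intro restrict_ext) auto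
  then have "trunc \<alpha> y' = trunc \<alpha> y" using y'(2) unfolding trunc_def by simp
  then show ?thesis using y'(1) pm_id[OF assms(2)] by auto
qed

lemma pm_image: assumes "(\<alpha>, \<beta>) \<in> r" shows "trunc \<alpha> ` Y \<beta> = Y \<alpha>"
proof
  show "trunc \<alpha> ` Y \<beta> \<subseteq> Y \<alpha>" using pm_Y[OF _ assms] by blast
  show "Y \<alpha> \<subseteq> trunc \<alpha> ` Y \<beta>"
  proof
    fix y assume y: "y \<in> Y \<alpha>"
    have ab: "\<alpha> \<in> Field r" "\<beta> \<in> Field r" using rI[OF assms] by auto
    obtain y' where y': "y' \<in> Y \<tau>" "trunc \<alpha> y' = y" using pm_surj[OF ab(1) y] by blast
    have "trunc \<alpha> (trunc \<beta> y') = y" using pm_pm[OF assms] y'(2) by simp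
    then show "y \<in> trunc \<alpha> ` Y \<beta>" using pm_Y[OF y'(1) \<tau>_max[OF ab(2)]] by blast
  qed
qed

lemma fst_image: assumes "\<alpha> \<in> Field r" shows "fst ` Y \<alpha> = X"
proof
  show "fst ` Y \<alpha> \<subseteq> X" by (auto simp: Y_iff)
  show "X \<subseteq> fst ` Y \<alpha>"
  proof
    fix x assume x: "x \<in> X"
    have "\<exists>y\<in>Y \<tau>. fst y = x \<and> (\<forall>w\<in>{}. snd y w = undefined)" by (rule extension[OF x]) auto
    then obtain y where y: "y \<in> Y \<tau>" "fst y = x" by blast
    then have "fst (trunc \<alpha> y) = x" "trunc \<alpha> y \<in> Y \<alpha>" using pm_Y[OF y(1) \<tau>_max[OF assms]] by auto
    then show "x \<in> fst ` Y \<alpha>" by blast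
  qed
qed

text \<open>The averaging removes one root at a time, so roots of the same stage must be comparable
  too; an arbitrary well-order of the index type breaks these ties.\<close>

definition wo_index :: "'w rel" where "wo_index = (SOME R. well_order_on UNIV R)"

lemma wo_index: "well_order_on UNIV wo_index"
  unfolding wo_index_def by (rule someI_ex[OF well_order_on])

definition prec :: "'w rel" where
  "prec = {(v, w). v \<in> W \<tau> \<and> w \<in> W \<tau> \<and> ((stage v, stage w) \<in> r - Id \<or> stage v = stage w \<and> (v, w) \<in> wo_index - Id)}"

lemma wf_prec: "wf prec"
proof (rule wf_subset)
  have "wf (wo_index - Id)" using wo_index by (simp add: well_order_on_def)
  then show "wf (inv_image ((r - Id) <*lex*> (wo_index - Id)) (\<lambda>w. (stage w, w)))" using r_props(5) by blast
  show "prec \<subseteq> inv_image ((r - Id) <*lex*> (wo_index - Id)) (\<lambda>w. (stage w, w))" unfolding prec_def by auto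
qed

lemma trans_prec: "trans prec"
proof -
  have w: "trans wo_index" "antisym wo_index"
    using wo_index unfolding well_order_on_def linear_order_on_def partial_order_on_def preorder_on_def by auto
  have 1: "trans (r - Id)" "trans (wo_index - Id)" using r_props w trans_diff_Id by auto
  show ?thesis
  proof (rule transI)
    fix u v w assume "(u, v) \<in> prec" "(v, w) \<in> prec"
    then show "(u, w) \<in> prec" using transD[OF 1(1), of "stage u" "stage v" "stage w"] transD[OF 1(2), of u v w] unfolding prec_def by auto
  qed
qed

lemma total_prec: assumes "v \<in> W \<tau>" "w \<in> W \<tau>" shows "v = w \<or> (v, w) \<in> prec \<or> (w, v) \<in> prec"
proof -
  have "total_on UNIV wo_index" using wo_index unfolding well_order_on_def linear_order_on_def by auto
  then have "v \<noteq> w \<Longrightarrow> (v, w) \<in> wo_index \<or> (w, v) \<in> wo_index" by (simp add: total_on_def)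
  moreover have "stage v \<noteq> stage w \<Longrightarrow> (stage v, stage w) \<in> r \<or> (stage w, stage v) \<in> r"
    by (rule r_total[OF underS_Field[OF decode_W(1)] underS_Field[OF decode_W(1)]]) (use assms in auto)
  ultimately show ?thesis using assms unfolding prec_def by auto
qed

lemma st_prec: "(v, w) \<in> prec \<Longrightarrow> (stage v, stage w) \<in> r"
  using r_refl[OF underS_Field[OF decode_W(1)]] unfolding prec_def by auto

text \<open>Reversing the root \<open>w\<close> keeps its square. The radicands of \<open>w\<close>
  and of the roots before it involve only stages strictly before that of \<open>w\<close>, so all
  equations up to \<open>w\<close> still hold, and \<open>extension\<close> chooses the later roots
  anew.\<close>

lemma flip:
  assumes \<delta>: "\<delta> \<in> Field r" and w: "w \<in> W \<delta>" and y: "y \<in> Y \<delta>"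
  shows "\<exists>y'\<in>Y \<delta>. fst y' = fst y \<and> (\<forall>v\<in>{v\<in>W \<delta>. (v, w) \<in> prec}. snd y' v = snd y v) \<and> snd y' w = - snd y w"
proof -
  define L where "L = {v\<in>W \<delta>. (v, w) \<in> prec}"
  have wt: "w \<in> W \<tau>" "stage w \<in> underS r \<delta>" using W_st[OF \<delta>] w by auto
  have Lw: "w \<notin> L" unfolding L_def prec_def by auto
  have low: "W (stage v) \<subseteq> L" if v: "v \<in> W \<delta>" "(stage v, stage w) \<in> r" for v
  proof
    fix u assume u: "u \<in> W (stage v)"
    have vt: "v \<in> W \<tau>" "stage v \<in> underS r \<delta>" using W_st[OF \<delta>] v by auto
    have ut: "u \<in> W \<tau>" "stage u \<in> underS r (stage v)" using W_st[OF underS_Field[OF vt(2)]] u by auto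
    have "stage u \<in> underS r (stage w)" by (rule underS_trans[OF ut(2) v(2)])
    then have "(u, w) \<in> prec" using ut(1) wt(1) unfolding prec_def underS_iff by auto
    moreover have "u \<in> W \<delta>" using W_mono[of "stage v" \<delta>] vt(2) u unfolding underS_iff by blast
    ultimately show "u \<in> L" unfolding L_def by blast
  qed
  define z where "z = (snd y)(w := - snd y w)"
  have rz: "restrict z (W (stage v)) = restrict (snd y) (W (stage v))" if "v \<in> W \<delta>" "(stage v, stage w) \<in> r" for v
    using low[OF that] Lw unfolding z_def by (intro restrict_ext) auto
  have stv: "v \<in> W \<delta>" "(stage v, stage w) \<in> r" if "v \<in> insert w L" for v
    using that w st_prec r_refl[OF underS_Field[OF wt(2)]] unfolding L_def by auto
  have "\<exists>y'\<in>Y \<tau>. fst y' = fst y \<and> (\<forall>v\<in>insert w L. snd y' v = z v)"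
  proof (rule extension)
    show "fst y \<in> X" using y unfolding Y_iff by blast
    show "insert w L \<subseteq> W \<tau>" using stv(1) W_\<tau>[OF \<delta>] by blast
    show "W (stage v) \<subseteq> insert w L" if "v \<in> insert w L" for v using low[OF stv[OF that]] by blast
    show "(z v)\<^sup>2 = radicand v (fst y, restrict z (W (stage v)))" if "v \<in> insert w L" for v
    proof -
      have "(z v)\<^sup>2 = (snd y v)\<^sup>2" unfolding z_def by simp
      then show ?thesis using Y_sq[OF y \<delta> stv(1)[OF that]] unfolding rz[OF stv[OF that]] trunc_def by simp
    qed
  qed
  then obtain y' where y': "y' \<in> Y \<tau>" "fst y' = fst y" "\<forall>v\<in>insert w L. snd y' v = z v" by blast
  have p: "snd (trunc \<delta> y') v = z v" if "v \<in> insert w L" for v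
  proof -
    have "snd y' v = z v" using y'(3) that by blast
    then show ?thesis using stv(1)[OF that] by (simp add: snd_pm)
  qed
  show ?thesis
  proof (intro bexI[of _ "trunc \<delta> y'"] conjI ballI)
    show "fst (trunc \<delta> y') = fst y" using y' by simp
    show "snd (trunc \<delta> y') w = - snd y w" using p[of w] by (simp add: z_def)
    show "snd (trunc \<delta> y') v = snd y v" if v: "v \<in> {v\<in>W \<delta>. (v, w) \<in> prec}" for v
    proof -
      have "v \<in> L" using v unfolding L_def .
      then show ?thesis using p[of v] Lw by (auto simp: z_def)
    qed
    show "trunc \<delta> y' \<in> Y \<delta>" by (rule pm_Y[OF y'(1) \<tau>_max[OF \<delta>]])
  qed
qed

text \<open>The square of the root \<open>w\<close> is its radicand, which belongs to the ideal of
  an earlier stage; all indices of that stage precede \<open>w\<close>, so the pulled back radicand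
  lies in the ideal generated by \<open>PI\<close> and the roots before \<open>w\<close>.\<close>

lemma multiroot:
  assumes \<delta>: "\<delta> \<in> Field r"
  shows "multiroot X PA PI (Y \<delta>) fst (W \<delta>) (\<lambda>w y. snd y w) prec"
proof -
  have low: "W (stage w) \<subseteq> {v\<in>W \<delta>. (v, w) \<in> prec}" if w: "w \<in> W \<delta>" for w
  proof
    fix u assume u: "u \<in> W (stage w)"
    have wt: "w \<in> W \<tau>" "stage w \<in> underS r \<delta>" using W_st[OF \<delta>] w by auto
    have ut: "u \<in> W \<tau>" "stage u \<in> underS r (stage w)" using W_st[OF underS_Field[OF wt(2)]] u by auto
    then have "(u, w) \<in> prec" using ut(1) wt(1) unfolding prec_def underS_iff by auto
    moreover have "u \<in> W \<delta>" using W_mono[of "stage w" \<delta>] wt(2) u unfolding underS_iff by blast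
    ultimately show "u \<in> {v\<in>W \<delta>. (v, w) \<in> prec}" by blast
  qed
  show ?thesis
  proof (rule multiroot.intro[OF PA PI fst_image[OF \<delta>] wf_prec trans_prec])
    show "v = w \<or> (v, w) \<in> prec \<or> (w, v) \<in> prec" if "v \<in> W \<delta>" "w \<in> W \<delta>" for v w
      using total_prec W_\<tau>[OF \<delta>] that by blast
    show "\<exists>M. \<forall>y\<in>Y \<delta>. cmod (snd y w) \<le> M" if "w \<in> W \<delta>" for w by (rule coord_bounded[OF \<delta> that])
    show "\<exists>y'\<in>Y \<delta>. fst y' = fst y \<and> (\<forall>v\<in>{v \<in> W \<delta>. (v, w) \<in> prec}. snd y' v = snd y v) \<and> snd y' w = - snd y w"
      if "w \<in> W \<delta>" "y \<in> Y \<delta>" for w y by (rule flip[OF \<delta> that])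
    fix w assume w: "w \<in> W \<delta>"
    have wt: "w \<in> W \<tau>" "stage w \<in> underS r \<delta>" using W_st[OF \<delta>] w by auto
    let ?L = "{v\<in>W \<delta>. (v, w) \<in> prec}"
    let ?B = "gen (Y \<delta>) ((\<lambda>a y. a (fst y)) ` PA \<union> (\<lambda>w y. snd y w) ` ?L)"
    have m: "trunc (stage w) y \<in> Y (stage w)" if "y \<in> Y \<delta>" for y
      using pm_Y[OF that] wt(2) unfolding underS_iff by blast
    have fII: "radicand w \<in> II (stage w)" using F_sub[OF decode_W(1)[OF wt(1)]] decode_W(2)[OF wt(1)] by blast
    have sub: "(\<lambda>a y. a (fst y)) ` Q \<union> (\<lambda>w y. snd y w) ` W (stage w) \<subseteq> (\<lambda>a y. a (fst y)) ` Q \<union> (\<lambda>w y. snd y w) ` ?L" for Q :: "('a \<Rightarrow> complex) set"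
      using low[OF w] by blast
    have "(\<lambda>y. radicand w (trunc (stage w) y)) \<in> igen (Y \<delta>) ?B ((\<lambda>a y. a (fst y)) ` PI \<union> (\<lambda>w y. snd y w) ` ?L)"
    proof (rule II_gen_map[OF fII])
      show "trunc (stage w) y \<in> Y (stage w)" if "y \<in> Y \<delta>" for y by (rule m[OF that])
      show "(\<lambda>y. f (trunc (stage w) y)) \<in> ?B" if "f \<in> AA (stage w)" for f
        by (rule AA_gen_map[OF that _ sub]) (rule m)
    qed (rule sub)
    then show "(\<lambda>y. snd y w * snd y w) \<in> igen (Y \<delta>) ?B ((\<lambda>a y. a (fst y)) ` PI \<union> (\<lambda>w y. snd y w) ` ?L)"
      by (rule unif_closed_cong[OF unif_closed_igen]) (use Y_sq[OF _ \<delta> w] in \<open>simp add: power2_eq_square\<close>)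
  qed
qed

lemma quotient_surj:
  assumes "\<delta> \<in> Field r" "g \<in> AA \<delta>" shows "\<exists>a\<in>PA. (\<lambda>y. g y - a (fst y)) \<in> II \<delta>"
  unfolding tower_ideal_def tower_alg_def
  by (rule multiroot.quotient_surj[OF multiroot[OF assms(1)]]) (rule assms(2)[unfolded tower_alg_def])

lemma quotient_norm:
  assumes "\<delta> \<in> Field r" "a \<in> PA" "h \<in> II \<delta>" "\<And>y. y \<in> Y \<delta> \<Longrightarrow> cmod (a (fst y) - h y) \<le> C"
  shows "\<exists>k\<in>PI. \<forall>x\<in>X. cmod (a x - k x) \<le> C"
  by (rule multiroot.quotient_norm[OF multiroot[OF assms(1)] assms(2) assms(3)[unfolded tower_ideal_def tower_alg_def]]) (rule assms(4))

lemma vanish: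
  assumes "\<delta> \<in> Field r" "y \<in> Y \<delta>" "\<And>k. k \<in> PI \<Longrightarrow> k (fst y) = 0" "f \<in> II \<delta>"
  shows "f y = 0"
proof (rule multiroot.vanish[OF multiroot[OF assms(1)] assms(2) _ assms(4)[unfolded tower_ideal_def tower_alg_def]])
  show "k (fst y) = 0" if "k \<in> PI" for k by (rule assms(3)[OF that])
qed

end

section \<open>The tower as a system of uniform algebras\<close>

locale root_tower =
  fixes X :: "'a topology" and A I :: "('a \<Rightarrow> complex) set" and r :: "'i rel" and \<tau> :: 'i
    and F :: "'i \<Rightarrow> ('a \<times> ('w \<Rightarrow> complex) \<Rightarrow> complex) set"
    and code :: "'i \<Rightarrow> ('a \<times> ('w \<Rightarrow> complex) \<Rightarrow> complex) \<Rightarrow> 'w"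
  assumes A: "uniform_algebra X A" and I: "closed_ideal X A I"
    and T: "tower (topspace X) (sat (topspace X) A) (sat (topspace X) I) r \<tau> F code"
    and F_ext: "\<And>\<beta>. \<beta> \<in> underS r \<tau> \<Longrightarrow> F \<beta> \<subseteq> extensional (tower_set (topspace X) r code F \<beta>)"
    and F_ne: "\<And>\<beta>. \<beta> \<in> underS r \<tau> \<Longrightarrow> F \<beta> \<noteq> {}"
begin

sublocale tower "topspace X" "sat (topspace X) A" "sat (topspace X) I" r \<tau> F code
  by (rule T)

definition PT :: "'i \<Rightarrow> ('a \<times> ('w \<Rightarrow> complex)) topology" where
  "PT \<alpha> = prod_topology X (product_topology (\<lambda>_. euclidean) (W \<alpha>))"

definition TT :: "'i \<Rightarrow> ('a \<times> ('w \<Rightarrow> complex)) topology" where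
  "TT \<alpha> = subtopology (PT \<alpha>) (Y \<alpha>)"

definition As :: "'i \<Rightarrow> ('a \<times> ('w \<Rightarrow> complex) \<Rightarrow> complex) set" where
  "As \<alpha> = AA \<alpha> \<inter> extensional (Y \<alpha>)"

definition Is :: "'i \<Rightarrow> ('a \<times> ('w \<Rightarrow> complex) \<Rightarrow> complex) set" where
  "Is \<alpha> = II \<alpha> \<inter> extensional (Y \<alpha>)"

lemma X_props: "compact_space X" "Hausdorff_space X" "A \<subseteq> mspace (cspace X)" "I \<subseteq> mspace (cspace X)"
  using A I closed_ideal_iff[OF A] unfolding uniform_algebra_iff by auto

lemma A_cont: "a \<in> sat (topspace X) A \<Longrightarrow> continuous_map X euclidean a"
  using X_props(3) restrict_mspace[OF X_props(1)] unfolding sat_def by blast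

lemma topspace_PT: "topspace (PT \<alpha>) = {y. fst y \<in> topspace X \<and> snd y \<in> extensional (W \<alpha>)}"
  unfolding PT_def by (auto simp: PiE_def)

lemma Y_PT: "Y \<alpha> \<subseteq> topspace (PT \<alpha>)"
  unfolding topspace_PT by (auto simp: Y_iff)

lemma topspace_TT [simp]: "topspace (TT \<alpha>) = Y \<alpha>"
  unfolding TT_def using Y_PT by auto

lemma cont_fst: "continuous_map (PT \<alpha>) X fst"
  unfolding PT_def by (rule continuous_map_fst)

lemma cont_coord: "w \<in> W \<alpha> \<Longrightarrow> continuous_map (PT \<alpha>) euclidean (\<lambda>y. snd y w)"
  using continuous_map_compose[OF continuous_map_snd continuous_map_product_projection, of w "W \<alpha>" X "\<lambda>_. euclidean"]
  unfolding PT_def by (simp add: comp_def)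

lemma cont_into_PT:
  assumes "continuous_map Z X (\<lambda>y. fst (f y))" "\<And>w. w \<in> W \<alpha> \<Longrightarrow> continuous_map Z euclidean (\<lambda>y. snd (f y) w)"
    and "\<And>y. y \<in> topspace Z \<Longrightarrow> snd (f y) \<in> extensional (W \<alpha>)"
  shows "continuous_map Z (PT \<alpha>) f"
proof -
  have "continuous_map Z (product_topology (\<lambda>_. euclidean) (W \<alpha>)) (\<lambda>y. snd (f y))"
    unfolding continuous_map_componentwise using assms(2,3) by auto
  from continuous_map_pairedI[OF assms(1) this] show ?thesis unfolding PT_def by simp
qed

lemma cont_pm_PT: assumes "(\<alpha>, \<beta>) \<in> r" shows "continuous_map (PT \<beta>) (PT \<alpha>) (trunc \<alpha>)"
proof (rule cont_into_PT)
  show "continuous_map (PT \<beta>) X (\<lambda>y. fst (trunc \<alpha> y))" using cont_fst[of \<beta>] by simp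
  show "continuous_map (PT \<beta>) euclidean (\<lambda>y. snd (trunc \<alpha> y) w)" if "w \<in> W \<alpha>" for w
    using cont_coord[of w \<beta>] W_mono[OF assms] that snd_pm_W[OF that] by auto
qed (simp add: snd_pm)

lemma cont_pm: assumes "(\<alpha>, \<beta>) \<in> r" shows "continuous_map (TT \<beta>) (TT \<alpha>) (trunc \<alpha>)"
  unfolding TT_def[of \<alpha>]
  by (rule continuous_map_into_subtopology)
    (use cont_pm_PT[OF assms] pm_Y[OF _ assms] in \<open>auto simp: TT_def[of \<beta>] intro: continuous_map_from_subtopology\<close>)

lemma cont_fst_TT: "continuous_map (TT \<alpha>) X fst"
  unfolding TT_def by (rule continuous_map_from_subtopology[OF cont_fst])

lemma cont_coord_TT: "w \<in> W \<alpha> \<Longrightarrow> continuous_map (TT \<alpha>) euclidean (\<lambda>y. snd y w)"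
  unfolding TT_def by (rule continuous_map_from_subtopology[OF cont_coord])

lemma AA_cont: assumes "f \<in> AA \<alpha>" shows "continuous_map (TT \<alpha>) euclidean f"
proof (rule gen_continuous)
  show "f \<in> gen (topspace (TT \<alpha>)) ((\<lambda>a y. a (fst y)) ` sat (topspace X) A \<union> (\<lambda>w y. snd y w) ` W \<alpha>)"
    using assms by (simp add: tower_alg_def)
  fix g assume "g \<in> (\<lambda>a y. a (fst y)) ` sat (topspace X) A \<union> (\<lambda>w y. snd y w) ` W \<alpha>"
  then show "continuous_map (TT \<alpha>) euclidean g"
  proof
    assume "g \<in> (\<lambda>a y. a (fst y)) ` sat (topspace X) A"
    then obtain a where a: "a \<in> sat (topspace X) A" "g = a \<circ> fst" by (auto simp: comp_def)
    show ?thesis unfolding a(2) by (rule continuous_map_compose[OF cont_fst_TT A_cont[OF a(1)]])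
  next
    assume "g \<in> (\<lambda>w y. snd y w) ` W \<alpha>"
    then show ?thesis using cont_coord_TT by blast
  qed
qed

text \<open>A radicand is continuous only on the space of its own stage. Its equation therefore
  defines a closed set inside the set of points whose truncation lies in \<open>Y \<beta>\<close>,
  which is closed by induction.\<close>

lemma Y_closed: "\<alpha> \<in> Field r \<Longrightarrow> closedin (PT \<alpha>) (Y \<alpha>)"
proof (induction \<alpha> rule: wf_induct_rule[OF r_props(5)])
  case (1 \<alpha>)
  define C where "C p = {y \<in> topspace (PT \<alpha>). trunc (fst p) y \<in> Y (fst p) \<and> (snd y (code (fst p) (snd p)))\<^sup>2 = snd p (trunc (fst p) y)}" for p
  have C: "closedin (PT \<alpha>) (C (\<beta>, f))" if b: "\<beta> \<in> underS r \<alpha>" "f \<in> F \<beta>" for \<beta> f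
  proof -
    have r: "(\<beta>, \<alpha>) \<in> r" "\<beta> \<in> Field r" using b underS_Field unfolding underS_iff by auto
    define B where "B = {y \<in> topspace (PT \<alpha>). trunc \<beta> y \<in> Y \<beta>}"
    have B: "closedin (PT \<alpha>) B" unfolding B_def
      by (rule closedin_continuous_map_preimage[OF cont_pm_PT[OF r(1)]]) (rule 1, use b r in \<open>auto simp: underS_iff\<close>)
    have w: "code \<beta> f \<in> W \<alpha>" using b unfolding W_iff by blast
    let ?S = "subtopology (PT \<alpha>) B"
    have tS: "topspace ?S = B" unfolding B_def by auto
    have c1: "continuous_map ?S euclidean (\<lambda>y. snd y (code \<beta> f) * snd y (code \<beta> f))"
      by (rule continuous_map_mult_complex) (rule continuous_map_from_subtopology[OF cont_coord[OF w]])+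
    have "continuous_map ?S (TT \<beta>) (trunc \<beta>)"
      unfolding TT_def
      by (rule continuous_map_into_subtopology[OF continuous_map_from_subtopology[OF cont_pm_PT[OF r(1)]]]) (auto simp: B_def)
    then have c2: "continuous_map ?S euclidean (f \<circ> trunc \<beta>)"
      by (rule continuous_map_compose[OF _ AA_cont[OF F_AA[OF underS_\<tau>[OF b(1)] b(2)]]])
    have "closedin ?S {y \<in> topspace ?S. snd y (code \<beta> f) * snd y (code \<beta> f) = (f \<circ> trunc \<beta>) y}"
      by (rule closedin_continuous_maps_eq[OF _ c1 c2]) simp
    then have "closedin (PT \<alpha>) {y \<in> topspace ?S. snd y (code \<beta> f) * snd y (code \<beta> f) = (f \<circ> trunc \<beta>) y}"
      by (rule closedin_trans_full[OF _ B])
    moreover have "{y \<in> topspace ?S. snd y (code \<beta> f) * snd y (code \<beta> f) = (f \<circ> trunc \<beta>) y} = C (\<beta>, f)"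
      unfolding tS C_def B_def by (auto simp: power2_eq_square)
    ultimately show ?thesis by simp
  qed
  have Yeq: "Y \<alpha> = \<Inter> (insert (topspace (PT \<alpha>)) (C ` (SIGMA \<beta>:underS r \<alpha>. F \<beta>)))"
  proof (intro equalityI subsetI)
    fix y assume y: "y \<in> Y \<alpha>"
    have "y \<in> C (\<beta>, f)" if b: "\<beta> \<in> underS r \<alpha>" "f \<in> F \<beta>" for \<beta> f
    proof -
      have "y \<in> topspace (PT \<alpha>)" using y Y_PT by blast
      moreover have "trunc \<beta> y \<in> Y \<beta>" using pm_Y[OF y] b(1) unfolding underS_iff by blast
      moreover have "(snd y (code \<beta> f))\<^sup>2 = f (trunc \<beta> y)" using y b unfolding Y_iff by blast
      ultimately show ?thesis unfolding C_def by simp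
    qed
    then show "y \<in> \<Inter> (insert (topspace (PT \<alpha>)) (C ` (SIGMA \<beta>:underS r \<alpha>. F \<beta>)))" using y Y_PT by auto
  next
    fix y assume y: "y \<in> \<Inter> (insert (topspace (PT \<alpha>)) (C ` (SIGMA \<beta>:underS r \<alpha>. F \<beta>)))"
    have "(snd y (code \<beta> f))\<^sup>2 = f (trunc \<beta> y)" if b: "\<beta> \<in> underS r \<alpha>" "f \<in> F \<beta>" for \<beta> f
    proof -
      have "y \<in> C (\<beta>, f)" using y b by blast
      then show ?thesis unfolding C_def by simp
    qed
    moreover have "y \<in> topspace (PT \<alpha>)" using y by blast
    ultimately show "y \<in> Y \<alpha>" unfolding Y_iff topspace_PT by blast
  qed
  show ?case unfolding Yeq by (rule closedin_Inter) (use C in auto)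
qed

text \<open>Tychonoff: a closed subset of the product of \<open>X\<close> with closed discs whose
  radii bound the roots.\<close>

lemma TT_compact: assumes \<alpha>: "\<alpha> \<in> Field r" shows "compact_space (TT \<alpha>)"
  unfolding TT_def
proof (rule compact_space_subtopology)
  have "\<forall>w\<in>W \<alpha>. \<exists>M. \<forall>y\<in>Y \<alpha>. cmod (snd y w) \<le> M" using coord_bounded[OF \<alpha>] by blast
  then obtain R where R: "\<And>w y. w \<in> W \<alpha> \<Longrightarrow> y \<in> Y \<alpha> \<Longrightarrow> cmod (snd y w) \<le> R w" by metis
  let ?K = "topspace X \<times> PiE (W \<alpha>) (\<lambda>w. cball 0 (R w))"
  have "compactin X (topspace X)" using X_props(1) by (simp add: compact_space_def)
  then have "compactin (PT \<alpha>) ?K"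
    unfolding PT_def compactin_Times compactin_PiE by simp
  moreover have "Y \<alpha> \<subseteq> ?K"
  proof
    fix y assume y: "y \<in> Y \<alpha>"
    then have "fst y \<in> topspace X" "snd y \<in> extensional (W \<alpha>)" unfolding Y_iff by auto
    moreover have "snd y w \<in> cball 0 (R w)" if "w \<in> W \<alpha>" for w using R[OF that y] by simp
    ultimately show "y \<in> ?K" by (cases y) (auto simp: PiE_def)
  qed
  ultimately show "compactin (PT \<alpha>) (Y \<alpha>)" using Y_closed[OF \<alpha>] by (rule closed_compactin)
qed

lemma TT_Hausdorff: "Hausdorff_space (TT \<alpha>)"
  unfolding TT_def PT_def
  by (intro Hausdorff_space_subtopology) (simp add: Hausdorff_space_prod_topology Hausdorff_space_product_topology X_props)

lemma sat_As: "\<alpha> \<in> Field r \<Longrightarrow> sat (Y \<alpha>) (As \<alpha>) = AA \<alpha>"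
  unfolding As_def by (rule sat_Int_ext[OF fun_algD(1)[OF AA_fun_alg]])

lemma sat_Is: "\<alpha> \<in> Field r \<Longrightarrow> sat (Y \<alpha>) (Is \<alpha>) = II \<alpha>"
  unfolding Is_def by (rule sat_Int_ext[OF fun_idealD(1)[OF II_fun_ideal]])

lemma As_restrict: assumes "\<alpha> \<in> Field r" shows "restrict f (Y \<alpha>) \<in> As \<alpha> \<longleftrightarrow> f \<in> AA \<alpha>"
  using sat_As[OF assms] unfolding sat_def by blast

lemma As_mspace: assumes "\<alpha> \<in> Field r" shows "As \<alpha> \<subseteq> mspace (cspace (TT \<alpha>))"
  using AA_cont unfolding As_def by (auto simp: mspace_cspace_iff[OF TT_compact[OF assms]])

lemma AA_separates:
  assumes "x \<in> Y \<alpha>" "y \<in> Y \<alpha>" "x \<noteq> y" shows "\<exists>f\<in>AA \<alpha>. f x \<noteq> f y"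
proof (cases "fst x = fst y")
  case True
  then have "snd x \<noteq> snd y" using assms(3) by (simp add: prod_eq_iff)
  then obtain w where "w \<in> W \<alpha>" "snd x w \<noteq> snd y w"
    using assms(1,2) unfolding Y_iff by (metis extensionalityI)
  then show ?thesis using AA_r[of w \<alpha>] by (intro bexI[of _ "\<lambda>y. snd y w"]) auto
next
  case False
  then obtain a where a: "a \<in> A" "a (fst x) \<noteq> a (fst y)"
    using A assms(1,2) unfolding uniform_algebra_def Y_iff by blast
  have "a \<in> sat (topspace X) A" using a(1) X_props mspace_cspace_iff[OF X_props(1)] by (intro sat_ext) auto
  then show ?thesis using AA_pi[of a \<alpha>] a(2) by (intro bexI[of _ "\<lambda>y. a (fst y)"]) auto
qed

lemma As_uniform: assumes \<alpha>: "\<alpha> \<in> Field r" shows "uniform_algebra (TT \<alpha>) (As \<alpha>)"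
  unfolding uniform_algebra_iff topspace_TT sat_As[OF \<alpha>]
proof (intro conjI ballI impI)
  fix x y assume "x \<in> Y \<alpha>" "y \<in> Y \<alpha>" "x \<noteq> y"
  then obtain f where f: "f \<in> AA \<alpha>" "f x \<noteq> f y" using AA_separates by blast
  then show "\<exists>f\<in>As \<alpha>. f x \<noteq> f y" using \<open>x \<in> Y \<alpha>\<close> \<open>y \<in> Y \<alpha>\<close>
    by (intro bexI[of _ "restrict f (Y \<alpha>)"]) (auto simp: As_restrict[OF \<alpha>])
qed (use TT_compact[OF \<alpha>] TT_Hausdorff As_mspace[OF \<alpha>] AA_fun_alg[OF \<alpha>] in auto)

lemma Is_closed_ideal: assumes \<alpha>: "\<alpha> \<in> Field r" shows "closed_ideal (TT \<alpha>) (As \<alpha>) (Is \<alpha>)"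
  unfolding closed_ideal_iff[OF As_uniform[OF \<alpha>]] topspace_TT sat_As[OF \<alpha>] sat_Is[OF \<alpha>]
proof
  have "Is \<alpha> \<subseteq> As \<alpha>" using fun_idealD(2)[OF II_fun_ideal[OF \<alpha>]] unfolding Is_def As_def by blast
  then show "Is \<alpha> \<subseteq> mspace (cspace (TT \<alpha>))" using As_mspace[OF \<alpha>] by blast
qed (rule II_fun_ideal[OF \<alpha>])

lemma TT_metrizable:
  assumes "metrizable_space X" "countable (W \<alpha>)" shows "metrizable_space (TT \<alpha>)"
  unfolding TT_def PT_def
proof (rule metrizable_space_subtopology)
  have "metrizable_space (product_topology (\<lambda>_. euclidean :: complex topology) (W \<alpha>))"
    unfolding metrizable_space_product_topology using assms(2) metrizable_space_euclidean
    by (auto intro: countable_subset)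
  then show "metrizable_space (prod_topology X (product_topology (\<lambda>_. euclidean :: complex topology) (W \<alpha>)))"
    using assms(1) by (simp add: metrizable_space_prod_topology)
qed

section \<open>The maps, successor steps and limit steps of the system\<close>

lemma pullback_pm: assumes "(\<alpha>, \<beta>) \<in> r" "f \<in> AA \<alpha>" shows "pullback (TT \<beta>) (trunc \<alpha>) f \<in> As \<beta>"
proof -
  have "(\<lambda>y. f (trunc \<alpha> y)) \<in> AA \<beta>" by (rule AA_mono[OF assms(2,1)])
  then show ?thesis using As_restrict[of \<beta>] rI[OF assms(1)] unfolding pullback_def by (simp add: comp_def)
qed

lemma pullback_ring_hom:
  assumes "(\<alpha>, \<beta>) \<in> r"
  shows "pullback (TT \<beta>) (trunc \<alpha>) \<in> ring_hom (function_algebra (topspace (TT \<alpha>)) (As \<alpha>)) (function_algebra (topspace (TT \<beta>)) (As \<beta>))"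
proof (rule ring_hom_memI)
  have p: "trunc \<alpha> y \<in> Y \<alpha>" if "y \<in> Y \<beta>" for y by (rule pm_Y[OF that assms])
  fix f g assume "f \<in> carrier (function_algebra (topspace (TT \<alpha>)) (As \<alpha>))"
  then show "pullback (TT \<beta>) (trunc \<alpha>) f \<in> carrier (function_algebra (topspace (TT \<beta>)) (As \<beta>))"
    using pullback_pm[OF assms] by (auto simp: function_algebra_def As_def[of \<alpha>])
qed (auto simp: function_algebra_def pullback_def pm_Y[OF _ assms] intro!: restrict_ext)

text \<open>\<open>h\<close> splits off the coordinates that are new at \<beta>, and
  \<open>k\<close> is its inverse. A continuous bijection from a compact space to a Hausdorff space
  is a homeomorphism; the algebras are compared on generators, along \<open>k\<close> in one
  direction and along \<open>h\<close> in the other.\<close>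

lemma root_step:
  assumes s: "immediate_successor r \<alpha> \<beta>" and \<alpha>: "\<alpha> \<in> Field r"
  shows "is_root_extension (TT \<alpha>) (As \<alpha>) (F \<alpha>) (TT \<beta>) (As \<beta>) (trunc \<alpha>)"
proof -
  have wor: "wo_rel r" using wo by (simp add: wo_rel_def)
  have b: "\<beta> \<in> aboveS r \<alpha>" "\<And>\<gamma>. \<gamma> \<in> aboveS r \<alpha> \<Longrightarrow> (\<beta>, \<gamma>) \<in> r"
    using s unfolding immediate_successor_def wo_rel.isMinim_def[OF wor] by auto
  have ab: "(\<alpha>, \<beta>) \<in> r" "\<alpha> \<noteq> \<beta>" "\<beta> \<in> Field r" using b(1) rI unfolding aboveS_def by auto
  \<comment> \<open>Nothing lies strictly between \<alpha> and its immediate successor, so the new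
    indices are exactly those of the form \<open>code \<alpha> f\<close>.\<close>
  have under: "underS r \<beta> = insert \<alpha> (underS r \<alpha>)"
  proof (intro equalityI subsetI)
    fix \<gamma> assume g: "\<gamma> \<in> underS r \<beta>"
    show "\<gamma> \<in> insert \<alpha> (underS r \<alpha>)"
    proof (rule ccontr)
      assume "\<not> ?thesis"
      then have "\<gamma> \<noteq> \<alpha>" "(\<gamma>, \<alpha>) \<notin> r" by (auto simp: underS_iff)
      then have "\<gamma> \<in> aboveS r \<alpha>" using r_total[OF underS_Field[OF g] \<alpha>] unfolding aboveS_def by auto
      then have "(\<beta>, \<gamma>) \<in> r" by (rule b(2))
      then show False using g r_props(3) unfolding underS_iff by (meson antisymD)
    qed
  next
    fix \<gamma> assume "\<gamma> \<in> insert \<alpha> (underS r \<alpha>)"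
    then show "\<gamma> \<in> underS r \<beta>" using ab underS_trans[of \<gamma> \<alpha> \<beta>] unfolding underS_iff[of \<alpha>] by (auto simp: underS_iff)
  qed
  have a\<tau>: "\<alpha> \<in> underS r \<tau>" by (rule underS_\<tau>[of _ \<beta>]) (simp add: under)
  have W\<beta>: "W \<beta> = W \<alpha> \<union> code \<alpha> ` F \<alpha>" unfolding tower_index_def under by blast
  have new: "code \<alpha> f \<notin> W \<alpha>" if "f \<in> F \<alpha>" for f
    using W_st[OF \<alpha>] st_fn_code[OF a\<tau> that] unfolding underS_iff by auto
  let ?R = "root_space (TT \<alpha>) (F \<alpha>)"
  let ?RP = "prod_topology (TT \<alpha>) (product_topology (\<lambda>_. euclidean :: complex topology) (F \<alpha>))"
  define h where "h y = (trunc \<alpha> y, \<lambda>f\<in>F \<alpha>. snd y (code \<alpha> f))" for y :: "'a \<times> ('w \<Rightarrow> complex)"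
  \<comment> \<open>A new index \<open>w\<close> equals \<open>code \<alpha> f\<close> with
    \<open>radicand w = f\<close>, so it reads the coordinate \<open>f\<close> of the point of the
    root space.\<close>
  define k where "k p = (fst (fst p), \<lambda>w\<in>W \<beta>. if w \<in> W \<alpha> then snd (fst p) w else snd p (radicand w))"
    for p :: "('a \<times> ('w \<Rightarrow> complex)) \<times> (('a \<times> ('w \<Rightarrow> complex) \<Rightarrow> complex) \<Rightarrow> complex)"
  have tR: "topspace ?R = {p. fst p \<in> Y \<alpha> \<and> snd p \<in> extensional (F \<alpha>) \<and> (\<forall>f\<in>F \<alpha>. (snd p f)\<^sup>2 = f (fst p))}"
    unfolding root_space_def by (auto simp: PiE_def)
  have hY: "h y \<in> topspace ?R" if y: "y \<in> Y \<beta>" for y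
  proof -
    have "(snd y (code \<alpha> f))\<^sup>2 = f (trunc \<alpha> y)" if "f \<in> F \<alpha>" for f
      using y that under unfolding Y_iff by blast
    then show ?thesis unfolding tR h_def using pm_Y[OF y ab(1)] by auto
  qed
  have kpm: "trunc \<alpha> (k p) = fst p" if "p \<in> topspace ?R" for p
  proof -
    have p: "fst p \<in> Y \<alpha>" using that unfolding tR by blast
    have "restrict (\<lambda>w\<in>W \<beta>. if w \<in> W \<alpha> then snd (fst p) w else snd p (radicand w)) (W \<alpha>) = restrict (snd (fst p)) (W \<alpha>)"
      by (rule restrict_ext) (auto simp: W\<beta>)
    then have "trunc \<alpha> (k p) = trunc \<alpha> (fst p)" unfolding trunc_def k_def by simp
    then show ?thesis using pm_id[OF p] by simp
  qed
  have kcode: "snd (k p) (code \<alpha> f) = snd p f" if "f \<in> F \<alpha>" for p f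
    using new[OF that] that st_fn_code(2)[OF a\<tau> that] unfolding k_def by (auto simp: W\<beta>)
  have kY: "k p \<in> Y \<beta>" if p: "p \<in> topspace ?R" for p
    unfolding Y_iff
  proof (intro conjI ballI)
    show "fst (k p) \<in> topspace X" using p unfolding tR k_def Y_iff by simp
    show "snd (k p) \<in> extensional (W \<beta>)" unfolding k_def by simp
    fix \<gamma> f assume g: "\<gamma> \<in> underS r \<beta>" "f \<in> F \<gamma>"
    show "(snd (k p) (code \<gamma> f))\<^sup>2 = f (trunc \<gamma> (k p))"
    proof (cases "\<gamma> = \<alpha>")
      case True
      then show ?thesis using kcode[of f p] kpm[OF p] g p unfolding tR by auto
    next
      case False
      then have gS: "\<gamma> \<in> underS r \<alpha>" using g(1) unfolding under by blast
      then have "(\<gamma>, \<alpha>) \<in> r" unfolding underS_iff by blast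
      then have 1: "trunc \<gamma> (k p) = trunc \<gamma> (fst p)" using pm_pm[of \<gamma> \<alpha> "k p"] kpm[OF p] by simp
      have "snd (k p) (code \<gamma> f) = snd (fst p) (code \<gamma> f)" using snd_pm_code[OF gS g(2), of "k p"] kpm[OF p] by simp
      moreover have "(snd (fst p) (code \<gamma> f))\<^sup>2 = f (trunc \<gamma> (fst p))" using p gS g(2) unfolding tR Y_iff by blast
      ultimately show ?thesis using 1 by simp
    qed
  qed
  have hk: "h (k p) = p" if p: "p \<in> topspace ?R" for p
  proof -
    have "(\<lambda>f\<in>F \<alpha>. snd (k p) (code \<alpha> f)) = snd p"
      by (rule extensionalityI[of _ "F \<alpha>"]) (use p kcode in \<open>auto simp: tR\<close>)
    then show ?thesis unfolding h_def kpm[OF p] by (simp add: prod_eq_iff)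
  qed
  have kh: "k (h y) = y" if y: "y \<in> Y \<beta>" for y
  proof (rule prod_eqI)
    show "fst (k (h y)) = fst y" unfolding k_def h_def by simp
    show "snd (k (h y)) = snd y"
    proof (rule extensionalityI)
      show "snd (k (h y)) \<in> extensional (W \<beta>)" unfolding k_def by simp
      show "snd y \<in> extensional (W \<beta>)" using y unfolding Y_iff by blast
      fix w assume w: "w \<in> W \<beta>"
      show "snd (k (h y)) w = snd y w"
      proof (cases "w \<in> W \<alpha>")
        case True then show ?thesis using w unfolding k_def h_def by (simp add: snd_pm)
      next
        case False
        then obtain f where f: "f \<in> F \<alpha>" "w = code \<alpha> f" using w unfolding W\<beta> by blast
        show ?thesis unfolding f(2) kcode[OF f(1)] using f(1) by (simp add: h_def)
      qed
    qed
  qed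
  have "homeomorphic_map (TT \<beta>) ?R h"
  proof (rule continuous_imp_homeomorphic_map[OF _ TT_compact[OF ab(3)]])
    show "Hausdorff_space ?R" unfolding root_space_def
      by (intro Hausdorff_space_subtopology) (simp add: Hausdorff_space_prod_topology Hausdorff_space_product_topology TT_Hausdorff)
    show "h ` topspace (TT \<beta>) = topspace ?R"
    proof
      show "h ` topspace (TT \<beta>) \<subseteq> topspace ?R" using hY by auto
      show "topspace ?R \<subseteq> h ` topspace (TT \<beta>)"
      proof
        fix p assume p: "p \<in> topspace ?R"
        show "p \<in> h ` topspace (TT \<beta>)" using hk[OF p] kY[OF p] by (intro image_eqI[of _ _ "k p"]) auto
      qed
    qed
    show "inj_on h (topspace (TT \<beta>))" using kh by (intro inj_on_inverseI[of _ k]) simp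
    have "continuous_map (TT \<beta>) ?RP h" unfolding h_def
    proof (rule continuous_map_pairedI[OF cont_pm[OF ab(1)]])
      show "continuous_map (TT \<beta>) (product_topology (\<lambda>_. euclidean) (F \<alpha>)) (\<lambda>y. \<lambda>f\<in>F \<alpha>. snd y (code \<alpha> f))"
        unfolding continuous_map_componentwise
      proof (intro conjI ballI)
        fix f assume f: "f \<in> F \<alpha>"
        then have "code \<alpha> f \<in> W \<beta>" unfolding W\<beta> by blast
        then show "continuous_map (TT \<beta>) euclidean (\<lambda>y. (\<lambda>f\<in>F \<alpha>. snd y (code \<alpha> f)) f)"
          using f cont_coord_TT by simp
      qed auto
    qed
    moreover have "h \<in> topspace (TT \<beta>) \<rightarrow> {p. \<forall>f\<in>F \<alpha>. (snd p f)\<^sup>2 = f (fst p)}"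
    proof
      fix y assume "y \<in> topspace (TT \<beta>)"
      then have "h y \<in> topspace ?R" using hY by simp
      then show "h y \<in> {p. \<forall>f\<in>F \<alpha>. (snd p f)\<^sup>2 = f (fst p)}" unfolding tR by blast
    qed
    ultimately show "continuous_map (TT \<beta>) ?R h"
      unfolding root_space_def by (rule continuous_map_into_subtopology)
  qed
  note homeo = this
  have Rc: "compact_space ?R" using homeo TT_compact[OF ab(3)] homeomorphic_map_imp_homeomorphic_space homeomorphic_compact_space by blast
  let ?G = "pullback ?R fst ` As \<alpha> \<union> (\<lambda>f. restrict (\<lambda>y. snd y f) (topspace ?R)) ` F \<alpha>"
  have cfst: "continuous_map ?R (TT \<alpha>) fst"
    unfolding root_space_def by (rule continuous_map_from_subtopology[OF continuous_map_fst])
  have csnd: "continuous_map ?R euclidean (\<lambda>p. snd p f)" if "f \<in> F \<alpha>" for f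
    using continuous_map_compose[OF continuous_map_snd continuous_map_product_projection[OF that], of "TT \<alpha>" "\<lambda>_. euclidean :: complex topology"]
    unfolding root_space_def by (intro continuous_map_from_subtopology) (simp add: comp_def)
  have G: "?G \<subseteq> mspace (cspace ?R)"
  proof (intro Un_least image_subsetI)
    fix a assume "a \<in> As \<alpha>"
    then have "continuous_map ?R euclidean (a \<circ> fst)"
      by (intro continuous_map_compose[OF cfst] AA_cont) (simp add: As_def)
    then show "pullback ?R fst a \<in> mspace (cspace ?R)" unfolding pullback_def by (simp add: restrict_mspace[OF Rc])
  next
    fix f assume "f \<in> F \<alpha>"
    then show "restrict (\<lambda>y. snd y f) (topspace ?R) \<in> mspace (cspace ?R)" using csnd by (simp add: restrict_mspace[OF Rc])
  qed
  have RA: "root_algebra (TT \<alpha>) (As \<alpha>) (F \<alpha>) = gen (topspace ?R) ?G \<inter> extensional (topspace ?R)"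
    unfolding root_algebra_def by (rule generated_eq[OF Rc G])
  have uR: "unif_closed (topspace ?R) (gen (topspace ?R) ?G)" by (rule unif_closed_gen)
  have genR: "(\<lambda>p. f (k p)) \<in> gen (topspace ?R) ?G" if f: "f \<in> AA \<beta>" for f
  proof (rule gen_map[where \<phi> = k and T = "Y \<beta>", OF _ _ f[unfolded tower_alg_def]])
    show "k p \<in> Y \<beta>" if "p \<in> topspace ?R" for p by (rule kY[OF that])
    fix g assume "g \<in> (\<lambda>a y. a (fst y)) ` sat (topspace X) A \<union> (\<lambda>w y. snd y w) ` W \<beta>"
    then consider a where "a \<in> sat (topspace X) A" "g = (\<lambda>y. a (fst y))" | w where "w \<in> W \<alpha>" "g = (\<lambda>y. snd y w)"
      | f where "f \<in> F \<alpha>" "g = (\<lambda>y. snd y (code \<alpha> f))" unfolding W\<beta> by blast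
    then show "(\<lambda>p. g (k p)) \<in> gen (topspace ?R) ?G"
    proof cases
      case 1
      have "pullback ?R fst (restrict (\<lambda>y. a (fst y)) (Y \<alpha>)) \<in> ?G"
        using AA_pi[OF 1(1), of \<alpha>] As_restrict[OF \<alpha>] by blast
      then have "pullback ?R fst (restrict (\<lambda>y. a (fst y)) (Y \<alpha>)) \<in> gen (topspace ?R) ?G" by (rule gen_base)
      then show ?thesis by (rule unif_closed_cong[OF uR]) (auto simp: pullback_def 1(2) k_def tR)
    next
      case 2
      have "pullback ?R fst (restrict (\<lambda>y. snd y w) (Y \<alpha>)) \<in> ?G"
        using AA_r[OF 2(1)] As_restrict[OF \<alpha>] by blast
      then have "pullback ?R fst (restrict (\<lambda>y. snd y w) (Y \<alpha>)) \<in> gen (topspace ?R) ?G" by (rule gen_base)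
      then show ?thesis by (rule unif_closed_cong[OF uR]) (use 2(1) in \<open>auto simp: pullback_def 2(2) k_def tR W\<beta>\<close>)
    next
      case 3
      have "restrict (\<lambda>y. snd y f) (topspace ?R) \<in> gen (topspace ?R) ?G" using 3(1) by (intro gen_base) blast
      then show ?thesis by (rule unif_closed_cong[OF uR]) (simp add: 3(2) kcode[OF 3(1)])
    qed
  qed
  have tb: "AA \<beta> = gen (Y \<beta>) ((\<lambda>a y. a (fst y)) ` sat (topspace X) A \<union> (\<lambda>w y. snd y w) ` W \<beta>)"
    by (rule tower_alg_def)
  have genY: "(\<lambda>y. g (h y)) \<in> AA \<beta>" if g: "g \<in> gen (topspace ?R) ?G" for g
    unfolding tb
  proof (rule gen_map[where \<phi> = h and T = "topspace ?R", OF _ _ g], unfold tb[symmetric])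
    show "h y \<in> topspace ?R" if "y \<in> Y \<beta>" for y by (rule hY[OF that])
    fix g assume "g \<in> ?G"
    then consider a where "a \<in> As \<alpha>" "g = pullback ?R fst a" | f where "f \<in> F \<alpha>" "g = restrict (\<lambda>y. snd y f) (topspace ?R)" by blast
    then show "(\<lambda>y. g (h y)) \<in> AA \<beta>"
    proof cases
      case 1
      have "(\<lambda>y. a (trunc \<alpha> y)) \<in> AA \<beta>" using 1(1) unfolding As_def by (intro AA_mono[OF _ ab(1)]) blast
      then show ?thesis by (rule unif_closed_cong[OF fun_algD(1)[OF AA_fun_alg[OF ab(3)]]])
         (use hY in \<open>auto simp: 1(2) pullback_def\<close>, simp add: h_def)
    next
      case 2
      have "(\<lambda>y. snd y (code \<alpha> f)) \<in> AA \<beta>" using 2(1) by (intro AA_r) (auto simp: W\<beta>)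
      then show ?thesis by (rule unif_closed_cong[OF fun_algD(1)[OF AA_fun_alg[OF ab(3)]]])
         (use hY 2(1) in \<open>auto simp: 2(2)\<close>, simp add: h_def)
    qed
  qed
  have "As \<beta> = pullback (TT \<beta>) h ` root_algebra (TT \<alpha>) (As \<alpha>) (F \<alpha>)"
    unfolding RA
  proof (intro equalityI subsetI)
    fix f assume f: "f \<in> As \<beta>"
    let ?g = "restrict (\<lambda>p. f (k p)) (topspace ?R)"
    have "?g \<in> gen (topspace ?R) ?G"
      using genR[of f] f unif_closed_restrict[OF uR] unfolding As_def by blast
    moreover have "f = pullback (TT \<beta>) h ?g"
      by (rule extensionalityI[of _ "Y \<beta>"]) (use f hY kh in \<open>auto simp: As_def pullback_def\<close>)
    ultimately show "f \<in> pullback (TT \<beta>) h ` (gen (topspace ?R) ?G \<inter> extensional (topspace ?R))" by blast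
  next
    fix f assume "f \<in> pullback (TT \<beta>) h ` (gen (topspace ?R) ?G \<inter> extensional (topspace ?R))"
    then obtain g where g: "g \<in> gen (topspace ?R) ?G" "f = pullback (TT \<beta>) h g" by blast
    show "f \<in> As \<beta>" using genY[OF g(1)] As_restrict[OF ab(3)] unfolding g(2) pullback_def by (simp add: comp_def)
  qed
  moreover have "F \<alpha> \<subseteq> As \<alpha>" using F_AA[OF a\<tau>] F_ext[OF a\<tau>] unfolding As_def by blast
  ultimately show ?thesis
    unfolding is_root_extension_def using homeo F_ne[OF a\<tau>] by (intro conjI exI[of _ h]) (auto simp: h_def)
qed

text \<open>If nothing lay strictly between \<beta> and \<gamma>, then \<gamma> would be the
  immediate successor of \<beta>. The lemmas on limits take the conclusion as hypothesis, since for
  the final \<tau> it is known directly.\<close>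

lemma limit_no_max:
  assumes g: "limit_element r \<gamma>" and b: "\<beta> \<in> underS r \<gamma>"
  shows "\<exists>\<delta>\<in>underS r \<gamma>. \<beta> \<in> underS r \<delta>"
proof (rule ccontr)
  assume neg: "\<not> ?thesis"
  have wor: "wo_rel r" using wo by (simp add: wo_rel_def)
  have "\<gamma> \<in> aboveS r \<beta>" using b unfolding underS_def aboveS_def by auto
  moreover have "(\<gamma>, \<delta>) \<in> r" if d: "\<delta> \<in> aboveS r \<beta>" for \<delta>
  proof (rule ccontr)
    assume "(\<gamma>, \<delta>) \<notin> r"
    moreover have "\<gamma> \<in> Field r" "\<delta> \<in> Field r" using b d rI unfolding underS_def aboveS_def by auto
    ultimately have "\<delta> \<in> underS r \<gamma>" using r_total[of \<gamma> \<delta>] r_refl unfolding underS_iff by blast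
    moreover have "\<beta> \<in> underS r \<delta>" using d unfolding underS_def aboveS_def by auto
    ultimately show False using neg by blast
  qed
  ultimately have "immediate_successor r \<beta> \<gamma>"
    unfolding immediate_successor_def wo_rel.isMinim_def[OF wor] by blast
  then show False using g unfolding limit_element_def by blast
qed

lemma W_limit:
  assumes g: "\<And>\<beta>. \<beta> \<in> underS r \<gamma> \<Longrightarrow> \<exists>\<delta>\<in>underS r \<gamma>. \<beta> \<in> underS r \<delta>"
  shows "W \<gamma> = (\<Union>\<delta>\<in>underS r \<gamma>. W \<delta>)"
proof
  show "W \<gamma> \<subseteq> (\<Union>\<delta>\<in>underS r \<gamma>. W \<delta>)"
  proof
    fix w assume "w \<in> W \<gamma>"
    then obtain \<beta> f where b: "\<beta> \<in> underS r \<gamma>" "f \<in> F \<beta>" "w = code \<beta> f" unfolding W_iff by blast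
    then show "w \<in> (\<Union>\<delta>\<in>underS r \<gamma>. W \<delta>)" using g[OF b(1)] unfolding tower_index_def by blast
  qed
  show "(\<Union>\<delta>\<in>underS r \<gamma>. W \<delta>) \<subseteq> W \<gamma>"
    by (rule UN_least, rule W_mono) (simp add: underS_iff)
qed

text \<open>The functions that can be approximated from earlier stages form a closed algebra, and it
  contains the generators of stage \<gamma>, since every coordinate is already present at some
  earlier stage.\<close>

lemma AA_limit:
  assumes g: "\<And>\<beta>. \<beta> \<in> underS r \<gamma> \<Longrightarrow> \<exists>\<delta>\<in>underS r \<gamma>. \<beta> \<in> underS r \<delta>" and ne: "underS r \<gamma> \<noteq> {}"
    and \<gamma>: "\<gamma> \<in> Field r" and f: "f \<in> AA \<gamma>" and e: "e > 0"
  shows "\<exists>\<alpha>\<in>underS r \<gamma>. \<exists>h\<in>AA \<alpha>. \<forall>y\<in>Y \<gamma>. cmod (f y - h (trunc \<alpha> y)) < e"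
proof -
  define Q where "Q = {f. \<forall>e>0. \<exists>\<alpha>\<in>underS r \<gamma>. \<exists>h\<in>AA \<alpha>. \<forall>y\<in>Y \<gamma>. cmod (f y - h (trunc \<alpha> y)) < e}"
  have base: "(\<lambda>y. h (trunc \<alpha> y)) \<in> Q" if "\<alpha> \<in> underS r \<gamma>" "h \<in> AA \<alpha>" for \<alpha> h
    unfolding Q_def
  proof (intro CollectI allI impI)
    fix e :: real assume "e > 0"
    then have "\<forall>y\<in>Y \<gamma>. cmod (h (trunc \<alpha> y) - h (trunc \<alpha> y)) < e" by simp
    then show "\<exists>\<alpha>'\<in>underS r \<gamma>. \<exists>h'\<in>AA \<alpha>'. \<forall>y\<in>Y \<gamma>. cmod (h (trunc \<alpha> y) - h' (trunc \<alpha>' y)) < e" using that by blast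
  qed
  have uQ: "unif_closed (Y \<gamma>) Q"
    unfolding unif_closed_def
  proof (intro allI impI)
    fix f assume f: "\<forall>e>0. \<exists>g\<in>Q. \<forall>x\<in>Y \<gamma>. cmod (f x - g x) < e"
    show "f \<in> Q" unfolding Q_def
    proof (intro CollectI allI impI)
      fix e :: real assume "e > 0"
      then have e2: "e / 2 > 0" by simp
      obtain g where g: "g \<in> Q" "\<forall>x\<in>Y \<gamma>. cmod (f x - g x) < e/2" using f[rule_format, OF e2] ..
      obtain \<alpha> h where h: "\<alpha> \<in> underS r \<gamma>" "h \<in> AA \<alpha>" "\<forall>y\<in>Y \<gamma>. cmod (g y - h (trunc \<alpha> y)) < e/2"
        using g(1) e2 unfolding Q_def by blast
      have "\<forall>y\<in>Y \<gamma>. cmod (f y - h (trunc \<alpha> y)) < e"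
        using g(2) h(3) norm_diff_triangle_less[of _ _ "e/2" _ "e/2"] by fastforce
      then show "\<exists>\<alpha>\<in>underS r \<gamma>. \<exists>h\<in>AA \<alpha>. \<forall>y\<in>Y \<gamma>. cmod (f y - h (trunc \<alpha> y)) < e" using h by blast
    qed
  qed
  let ?Z = "{\<lambda>y. h (trunc \<alpha> y) | \<alpha> h. \<alpha> \<in> underS r \<gamma> \<and> h \<in> AA \<alpha>}"
  \<comment> \<open>Two pullbacks can be written over the later of their two stages, which reduces
    sums and products to one stage.\<close>
  have common: "\<exists>\<alpha>\<in>underS r \<gamma>. \<exists>h\<in>AA \<alpha>. \<exists>k\<in>AA \<alpha>. (\<forall>y\<in>Y \<gamma>. f y = h (trunc \<alpha> y)) \<and> (\<forall>y\<in>Y \<gamma>. g y = k (trunc \<alpha> y))"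
    if fg: "f \<in> ?Z" "g \<in> ?Z" for f g
  proof -
    obtain \<alpha> h where h: "\<alpha> \<in> underS r \<gamma>" "h \<in> AA \<alpha>" "f = (\<lambda>y. h (trunc \<alpha> y))" using fg(1) by blast
    obtain \<beta> k where k: "\<beta> \<in> underS r \<gamma>" "k \<in> AA \<beta>" "g = (\<lambda>y. k (trunc \<beta> y))" using fg(2) by blast
    have "(\<alpha>, \<beta>) \<in> r \<or> (\<beta>, \<alpha>) \<in> r"
      using r_total[OF underS_Field[OF h(1)] underS_Field[OF k(1)]] r_refl[OF underS_Field[OF h(1)]] by blast
    then show ?thesis
    proof
      assume ab: "(\<alpha>, \<beta>) \<in> r"
      have "(\<lambda>y. h (trunc \<alpha> y)) \<in> AA \<beta>" by (rule AA_mono[OF h(2) ab])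
      then show ?thesis using h k pm_pm[OF ab] by (intro bexI[of _ \<beta>] bexI[of _ "\<lambda>y. h (trunc \<alpha> y)"] bexI[of _ k]) auto
    next
      assume ab: "(\<beta>, \<alpha>) \<in> r"
      have "(\<lambda>y. k (trunc \<beta> y)) \<in> AA \<alpha>" by (rule AA_mono[OF k(2) ab])
      then show ?thesis using h k pm_pm[OF ab] by (intro bexI[of _ \<alpha>] bexI[of _ "\<lambda>y. k (trunc \<beta> y)"] bexI[of _ h]) auto
    qed
  qed
  have ZA: "h \<in> AA \<gamma>" if "h \<in> ?Z" for h using that AA_mono unfolding underS_iff by blast
  have ZQ: "?Z \<subseteq> Q" using base by blast
  have Zop: "(\<lambda>y. f y + g y) \<in> Q" "(\<lambda>y. f y * g y) \<in> Q" if fg: "f \<in> ?Z" "g \<in> ?Z" for f g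
  proof -
    obtain \<alpha> h k where a: "\<alpha> \<in> underS r \<gamma>" "h \<in> AA \<alpha>" "k \<in> AA \<alpha>" "\<forall>y\<in>Y \<gamma>. f y = h (trunc \<alpha> y)" "\<forall>y\<in>Y \<gamma>. g y = k (trunc \<alpha> y)"
      using common[OF fg] by blast
    note fa = AA_fun_alg[OF underS_Field[OF a(1)]]
    have "(\<lambda>y. h (trunc \<alpha> y) + k (trunc \<alpha> y)) \<in> Q" by (rule base[OF a(1) fun_algD(3)[OF fa a(2,3)]])
    then show "(\<lambda>y. f y + g y) \<in> Q" by (rule unif_closed_cong[OF uQ]) (simp add: a)
    have "(\<lambda>y. h (trunc \<alpha> y) * k (trunc \<alpha> y)) \<in> Q" by (rule base[OF a(1) fun_algD(4)[OF fa a(2,3)]])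
    then show "(\<lambda>y. f y * g y) \<in> Q" by (rule unif_closed_cong[OF uQ]) (simp add: a)
  qed
  have QZ: "\<exists>h\<in>?Z. \<forall>y\<in>Y \<gamma>. cmod (f y - h y) < e" if fQ: "f \<in> Q" and e: "e > 0" for f e
  proof -
    obtain \<alpha> h where h: "\<alpha> \<in> underS r \<gamma>" "h \<in> AA \<alpha>" "\<forall>y\<in>Y \<gamma>. cmod (f y - h (trunc \<alpha> y)) < e"
      using fQ e unfolding Q_def by blast
    then show ?thesis by (intro bexI[of _ "\<lambda>y. h (trunc \<alpha> y)"]) auto
  qed
  have Zb: "\<exists>M. \<forall>y\<in>Y \<gamma>. cmod (h y) \<le> M" if "h \<in> ?Z" for h
    by (rule fun_algD(5)[OF AA_fun_alg[OF \<gamma>] ZA[OF that]])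
  have Qb: "\<exists>M. \<forall>y\<in>Y \<gamma>. cmod (f y) \<le> M" if fQ: "f \<in> Q" for f
  proof -
    obtain h where h: "h \<in> ?Z" "\<forall>y\<in>Y \<gamma>. cmod (f y - h y) < 1" using QZ[OF fQ zero_less_one] ..
    obtain M where "\<forall>y\<in>Y \<gamma>. cmod (h y) \<le> M" using Zb[OF h(1)] ..
    then show ?thesis using h(2) by (intro bounded_limit[of _ f 1]) blast
  qed
  \<comment> \<open>Applied twice: first one factor passes from pullbacks to their limits, then the
    other. The bound on the fixed factor controls the error.\<close>
  have mulZ: "(\<lambda>y. f y * g y) \<in> Q" if fQ: "f \<in> Q" and gb: "\<forall>y\<in>Y \<gamma>. cmod (g y) \<le> M" and hg: "\<And>h. h \<in> ?Z \<Longrightarrow> (\<lambda>y. h y * g y) \<in> Q" for f g M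
  proof (rule unif_closedD[OF uQ])
    fix e :: real assume e: "e > 0"
    define M' where "M' = max M 1"
    then have M': "M' > 0" by simp
    then have "e / M' > 0" using e by simp
    then obtain l where l: "l \<in> ?Z" "\<forall>y\<in>Y \<gamma>. cmod (f y - l y) < e / M'" using QZ[OF fQ] by blast
    have "\<forall>y\<in>Y \<gamma>. cmod (f y * g y - l y * g y) < e"
    proof
      fix y assume y: "y \<in> Y \<gamma>"
      have "cmod (f y - l y) * cmod (g y) \<le> cmod (f y - l y) * M'"
        using gb y unfolding M'_def by (intro mult_left_mono) (auto simp: le_max_iff_disj)
      also have "\<dots> < e" using l(2) y M' by (simp add: pos_less_divide_eq)
      finally show "cmod (f y * g y - l y * g y) < e" unfolding left_diff_distrib[symmetric] norm_mult .
    qed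
    then show "\<exists>h\<in>Q. \<forall>x\<in>Y \<gamma>. cmod (f x * g x - h x) < e" by (rule bexI[OF _ hg[OF l(1)]])
  qed
  have "fun_alg (Y \<gamma>) Q"
    unfolding fun_alg_def
  proof (intro conjI ballI allI)
    show "(\<lambda>x. c) \<in> Q" for c
    proof -
      obtain \<alpha> where "\<alpha> \<in> underS r \<gamma>" using ne by blast
      from base[OF this fun_algD(2)[OF AA_fun_alg[OF underS_Field[OF this]], of c]] show ?thesis .
    qed
    show "(\<lambda>x. f x + g x) \<in> Q" if fg: "f \<in> Q" "g \<in> Q" for f g
    proof (rule unif_closedD[OF uQ])
      fix e :: real assume "e > 0"
      then have e2: "e / 2 > 0" by simp
      obtain h where h: "h \<in> ?Z" "\<forall>x\<in>Y \<gamma>. cmod (f x - h x) < e/2" using QZ[OF fg(1) e2] ..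
      obtain k where k: "k \<in> ?Z" "\<forall>x\<in>Y \<gamma>. cmod (g x - k x) < e/2" using QZ[OF fg(2) e2] ..
      have "\<forall>x\<in>Y \<gamma>. cmod ((f x + g x) - (h x + k x)) < e"
      proof (intro ballI)
        fix x assume "x \<in> Y \<gamma>"
        then have "cmod (f x - h x) + cmod (g x - k x) < e" using h(2) k(2) by fastforce
        then show "cmod ((f x + g x) - (h x + k x)) < e" by (rule le_less_trans[OF norm_diff_triangle_ineq])
      qed
      then show "\<exists>l\<in>Q. \<forall>x\<in>Y \<gamma>. cmod ((f x + g x) - l x) < e" by (rule bexI[OF _ Zop(1)[OF h(1) k(1)]])
    qed
    show "(\<lambda>x. f x * g x) \<in> Q" if f: "f \<in> Q" and g: "g \<in> Q" for f g
    proof -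
      obtain M where M: "\<forall>y\<in>Y \<gamma>. cmod (g y) \<le> M" using Qb[OF g] ..
      show ?thesis
      proof (rule mulZ[OF f M])
        fix h assume h: "h \<in> ?Z"
        obtain N where N: "\<forall>y\<in>Y \<gamma>. cmod (h y) \<le> N" using Zb[OF h] ..
        have "(\<lambda>y. g y * h y) \<in> Q" by (rule mulZ[OF g N]) (rule Zop(2)[OF _ h])
        then show "(\<lambda>y. h y * g y) \<in> Q" by (simp add: mult.commute)
      qed
    qed
  qed (use uQ Qb in auto)
  then have "f \<in> Q"
  proof (rule gen_least[OF f[unfolded tower_alg_def]])
    show "(\<lambda>a y. a (fst y)) ` sat (topspace X) A \<union> (\<lambda>w y. snd y w) ` W \<gamma> \<subseteq> Q"
    proof (intro Un_least image_subsetI)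
      obtain \<alpha> where a: "\<alpha> \<in> underS r \<gamma>" using ne by blast
      show "(\<lambda>y. b (fst y)) \<in> Q" if "b \<in> sat (topspace X) A" for b using base[OF a AA_pi[OF that]] by simp
      show "(\<lambda>y. snd y w) \<in> Q" if w: "w \<in> W \<gamma>" for w
      proof -
        obtain \<delta> where d: "\<delta> \<in> underS r \<gamma>" "w \<in> W \<delta>" using w W_limit[OF g] by blast
        show ?thesis using base[OF d(1) AA_r[OF d(2)]] unfolding snd_pm_W[OF d(2)] .
      qed
    qed
  qed
  then show ?thesis using e unfolding Q_def by blast
qed

lemma limit_algebra:
  assumes g: "\<And>\<beta>. \<beta> \<in> underS r \<gamma> \<Longrightarrow> \<exists>\<delta>\<in>underS r \<gamma>. \<beta> \<in> underS r \<delta>" and ne: "underS r \<gamma> \<noteq> {}"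
    and \<gamma>: "\<gamma> \<in> Field r"
  shows "As \<gamma> = mtopology_of (cspace (TT \<gamma>)) closure_of (\<Union>\<alpha>\<in>underS r \<gamma>. pullback (TT \<gamma>) (trunc \<alpha>) ` As \<alpha>)"
proof -
  let ?U = "\<Union>\<alpha>\<in>underS r \<gamma>. pullback (TT \<gamma>) (trunc \<alpha>) ` As \<alpha>"
  have U: "?U \<subseteq> As \<gamma>"
    by (intro UN_least image_subsetI pullback_pm) (auto simp: underS_iff As_def)
  then have UM: "?U \<subseteq> mspace (cspace (TT \<gamma>))" using As_mspace[OF \<gamma>] by blast
  show ?thesis
  proof (intro equalityI subsetI)
    fix f assume f: "f \<in> As \<gamma>"
    show "f \<in> mtopology_of (cspace (TT \<gamma>)) closure_of ?U"
      unfolding closure_cspace[OF TT_compact[OF \<gamma>] UM]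
    proof (intro conjI allI impI)
      show "f \<in> mspace (cspace (TT \<gamma>))" using f As_mspace[OF \<gamma>] by blast
      fix e :: real assume "e > 0"
      obtain \<alpha> h where h: "\<alpha> \<in> underS r \<gamma>" "h \<in> AA \<alpha>" "\<forall>y\<in>Y \<gamma>. cmod (f y - h (trunc \<alpha> y)) < e"
        using AA_limit[OF g ne \<gamma> _ \<open>e > 0\<close>, of f] f unfolding As_def by blast
      have p: "trunc \<alpha> y \<in> Y \<alpha>" if "y \<in> Y \<gamma>" for y using pm_Y[OF that] h(1) unfolding underS_iff by blast
      have "restrict h (Y \<alpha>) \<in> As \<alpha>" using h As_restrict[OF underS_Field[OF h(1)]] by blast
      then have "pullback (TT \<gamma>) (trunc \<alpha>) (restrict h (Y \<alpha>)) \<in> ?U" using h(1) by blast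
      moreover have "\<forall>y\<in>topspace (TT \<gamma>). cmod (f y - pullback (TT \<gamma>) (trunc \<alpha>) (restrict h (Y \<alpha>)) y) < e"
        using h(3) p by (simp add: pullback_def)
      ultimately show "\<exists>g\<in>?U. \<forall>x\<in>topspace (TT \<gamma>). cmod (f x - g x) < e"
        by (intro bexI[of _ "pullback (TT \<gamma>) (trunc \<alpha>) (restrict h (Y \<alpha>))"])
    qed
  next
    fix f assume "f \<in> mtopology_of (cspace (TT \<gamma>)) closure_of ?U"
    then have f: "f \<in> mspace (cspace (TT \<gamma>))" "\<forall>e>0. \<exists>g\<in>?U. \<forall>x\<in>topspace (TT \<gamma>). cmod (f x - g x) < e"
      unfolding closure_cspace[OF TT_compact[OF \<gamma>] UM] by auto
    have "f \<in> AA \<gamma>"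
    proof (rule unif_closedD[OF fun_algD(1)[OF AA_fun_alg[OF \<gamma>]]])
      fix e :: real assume "e > 0"
      then obtain g where "g \<in> ?U" "\<forall>x\<in>topspace (TT \<gamma>). cmod (f x - g x) < e" using f(2) by blast
      then show "\<exists>g\<in>AA \<gamma>. \<forall>x\<in>Y \<gamma>. cmod (f x - g x) < e" using U unfolding As_def[of \<gamma>] by (intro bexI[of _ g]) auto
    qed
    then show "f \<in> As \<gamma>" using f(1) unfolding As_def mspace_cspace_iff[OF TT_compact[OF \<gamma>]] by simp
  qed
qed

text \<open>A thread determines a point by reading each coordinate at any stage that already has it;
  compatibility makes the stage immaterial. The map is thus a continuous bijection from a compact
  space to a Hausdorff space.\<close>

lemma limit_space:
  assumes g: "\<And>\<beta>. \<beta> \<in> underS r \<gamma> \<Longrightarrow> \<exists>\<delta>\<in>underS r \<gamma>. \<beta> \<in> underS r \<delta>" and ne: "underS r \<gamma> \<noteq> {}"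
    and \<gamma>: "\<gamma> \<in> Field r"
  shows "homeomorphic_map (TT \<gamma>) (inverse_limit r (underS r \<gamma>) TT (\<lambda>\<alpha> \<beta>. trunc \<alpha>)) (\<lambda>y. \<lambda>\<alpha>\<in>underS r \<gamma>. trunc \<alpha> y)"
    (is "homeomorphic_map _ ?L ?h")
proof (rule continuous_imp_homeomorphic_map[OF _ TT_compact[OF \<gamma>]])
  have Wl: "W \<gamma> = (\<Union>\<delta>\<in>underS r \<gamma>. W \<delta>)" by (rule W_limit) (rule g)
  let ?C = "{t. \<forall>\<alpha>\<in>underS r \<gamma>. \<forall>\<beta>\<in>underS r \<gamma>. (\<alpha>, \<beta>) \<in> r \<longrightarrow> trunc \<alpha> (t \<beta>) = t \<alpha>}"
  have tL: "topspace ?L = PiE (underS r \<gamma>) Y \<inter> ?C"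
    unfolding inverse_limit_def by simp
  have hP: "?h y \<in> PiE (underS r \<gamma>) Y \<inter> ?C" if y: "y \<in> Y \<gamma>" for y
    using pm_Y[OF y] pm_pm by (auto simp: underS_iff)
  show "Hausdorff_space ?L" unfolding inverse_limit_def
    by (intro Hausdorff_space_subtopology) (simp add: Hausdorff_space_product_topology TT_Hausdorff)
  have "continuous_map (TT \<gamma>) (product_topology TT (underS r \<gamma>)) ?h"
    unfolding continuous_map_componentwise using cont_pm by (auto simp: underS_iff)
  then show "continuous_map (TT \<gamma>) ?L ?h"
    unfolding inverse_limit_def by (rule continuous_map_into_subtopology) (use hP in auto)
  show "inj_on ?h (topspace (TT \<gamma>))"
  proof (rule inj_onI)
    fix x y assume xy: "x \<in> topspace (TT \<gamma>)" "y \<in> topspace (TT \<gamma>)" "?h x = ?h y"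
    have eq: "trunc \<alpha> x = trunc \<alpha> y" if "\<alpha> \<in> underS r \<gamma>" for \<alpha> using fun_cong[OF xy(3), of \<alpha>] that by simp
    obtain \<alpha> where "\<alpha> \<in> underS r \<gamma>" using ne by blast
    then have f: "fst x = fst y" using arg_cong[OF eq, of \<alpha> fst] by simp
    have "snd x = snd y"
    proof (rule extensionalityI)
      show "snd x \<in> extensional (W \<gamma>)" "snd y \<in> extensional (W \<gamma>)" using xy(1,2) unfolding topspace_TT Y_iff by auto
      fix w assume "w \<in> W \<gamma>"
      then obtain \<delta> where d: "\<delta> \<in> underS r \<gamma>" "w \<in> W \<delta>" unfolding Wl by blast
      show "snd x w = snd y w" using arg_cong[OF eq[OF d(1)], of "\<lambda>p. snd p w"] d(2) by (simp add: snd_pm)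
    qed
    then show "x = y" using f by (simp add: prod_eq_iff)
  qed
  show "?h ` topspace (TT \<gamma>) = topspace ?L"
  proof
    show "?h ` topspace (TT \<gamma>) \<subseteq> topspace ?L" unfolding tL topspace_TT by (rule image_subsetI) (rule hP)
    show "topspace ?L \<subseteq> ?h ` topspace (TT \<gamma>)"
    proof
      fix t assume "t \<in> topspace ?L"
      then have t: "t \<in> PiE (underS r \<gamma>) Y" "\<And>\<alpha> \<beta>. \<alpha> \<in> underS r \<gamma> \<Longrightarrow> \<beta> \<in> underS r \<gamma> \<Longrightarrow> (\<alpha>, \<beta>) \<in> r \<Longrightarrow> trunc \<alpha> (t \<beta>) = t \<alpha>"
        unfolding tL by auto
      obtain \<alpha>0 where a0: "\<alpha>0 \<in> underS r \<gamma>" using ne by blast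
      have cmp: "(\<alpha>, \<beta>) \<in> r \<or> (\<beta>, \<alpha>) \<in> r" if "\<alpha> \<in> underS r \<gamma>" "\<beta> \<in> underS r \<gamma>" for \<alpha> \<beta>
        using r_total[OF underS_Field[OF that(1)] underS_Field[OF that(2)]] r_refl[OF underS_Field[OF that(1)]] by blast
      have fs: "fst (t \<alpha>) = fst (t \<beta>)" if "\<alpha> \<in> underS r \<gamma>" "\<beta> \<in> underS r \<gamma>" for \<alpha> \<beta>
        using cmp[OF that] t(2)[OF that] t(2)[OF that(2,1)] by (metis fst_pm)
      have sn: "snd (t \<alpha>) w = snd (t \<beta>) w" if "\<alpha> \<in> underS r \<gamma>" "\<beta> \<in> underS r \<gamma>" "w \<in> W \<alpha>" "w \<in> W \<beta>" for \<alpha> \<beta> w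
        using cmp[OF that(1,2)] t(2)[OF that(1,2)] t(2)[OF that(2,1)] that(3,4) by (metis snd_pm restrict_apply')
      define l where "l w = (SOME \<delta>. \<delta> \<in> underS r \<gamma> \<and> w \<in> W \<delta>)" for w
      have l: "l w \<in> underS r \<gamma>" "w \<in> W (l w)" if "w \<in> W \<gamma>" for w
      proof -
        have "\<exists>\<delta>. \<delta> \<in> underS r \<gamma> \<and> w \<in> W \<delta>" using that unfolding Wl by blast
        from someI_ex[OF this] show "l w \<in> underS r \<gamma>" "w \<in> W (l w)" unfolding l_def by auto
      qed
      define y where "y = (fst (t \<alpha>0), \<lambda>w\<in>W \<gamma>. snd (t (l w)) w)"
      have pmy: "trunc \<alpha> y = t \<alpha>" if a: "\<alpha> \<in> underS r \<gamma>" for \<alpha>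
      proof (rule prod_eqI)
        show "fst (trunc \<alpha> y) = fst (t \<alpha>)" unfolding y_def using fs[OF a0 a] by simp
        have tY: "t \<alpha> \<in> Y \<alpha>" using t(1) a by blast
        have "restrict (\<lambda>w\<in>W \<gamma>. snd (t (l w)) w) (W \<alpha>) = snd (t \<alpha>)"
        proof (rule extensionalityI)
          show "snd (t \<alpha>) \<in> extensional (W \<alpha>)" using tY unfolding Y_iff by blast
          fix w assume w: "w \<in> W \<alpha>"
          then have wg: "w \<in> W \<gamma>" using W_mono[of \<alpha> \<gamma>] a unfolding underS_iff by blast
          show "restrict (\<lambda>w\<in>W \<gamma>. snd (t (l w)) w) (W \<alpha>) w = snd (t \<alpha>) w"
            using w wg sn[OF l(1)[OF wg] a l(2)[OF wg] w] by simp
        qed (rule restrict_extensional)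
        then show "snd (trunc \<alpha> y) = snd (t \<alpha>)" unfolding snd_pm y_def by simp
      qed
      have "y \<in> Y \<gamma>"
        unfolding Y_iff
      proof (intro conjI ballI)
        have "t \<alpha>0 \<in> Y \<alpha>0" using t(1) a0 by blast
        then show "fst y \<in> topspace X" unfolding y_def Y_iff by simp
        show "snd y \<in> extensional (W \<gamma>)" unfolding y_def by simp
        fix \<beta> f assume b: "\<beta> \<in> underS r \<gamma>" "f \<in> F \<beta>"
        obtain \<delta> where d: "\<delta> \<in> underS r \<gamma>" "\<beta> \<in> underS r \<delta>" using g[OF b(1)] by blast
        have "t \<delta> \<in> Y \<delta>" using t(1) d(1) by blast
        then have "(snd (t \<delta>) (code \<beta> f))\<^sup>2 = f (trunc \<beta> (t \<delta>))" using d(2) b(2) unfolding Y_iff by blast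
        moreover have "trunc \<beta> (t \<delta>) = trunc \<beta> y" using pmy[OF d(1)] pm_pm[of \<beta> \<delta> y] d(2) unfolding underS_iff by simp
        moreover have "snd (t \<delta>) (code \<beta> f) = snd y (code \<beta> f)" using snd_pm_code[OF d(2) b(2), of y] pmy[OF d(1)] by simp
        ultimately show "(snd y (code \<beta> f))\<^sup>2 = f (trunc \<beta> y)" by simp
      qed
      moreover have "t = ?h y"
        by (rule extensionalityI[of _ "underS r \<gamma>"]) (use t(1) pmy in \<open>auto simp: PiE_def\<close>)
      ultimately show "t \<in> ?h ` topspace (TT \<gamma>)" by simp
    qed
  qed
qed

lemma system:
  assumes "infinite (Field r)"
  shows "root_extension_system r \<tau> TT As (\<lambda>\<alpha> \<beta>. trunc \<alpha>)"
  unfolding root_extension_system_def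
proof (intro conjI ballI allI impI)
  show "continuous_map (TT \<beta>) (TT \<alpha>) (trunc \<alpha>)" if "(\<alpha>, \<beta>) \<in> r" for \<alpha> \<beta> by (rule cont_pm[OF that])
  show "trunc \<alpha> ` topspace (TT \<beta>) = topspace (TT \<alpha>)" if "(\<alpha>, \<beta>) \<in> r" for \<alpha> \<beta> using pm_image[OF that] by simp
  show "trunc \<alpha> (trunc \<beta> x) = trunc \<alpha> x" if "(\<alpha>, \<beta>) \<in> r \<and> (\<beta>, \<gamma>) \<in> r" for \<alpha> \<beta> \<gamma> x using that pm_pm by blast
  show "trunc \<alpha> x = x" if "x \<in> topspace (TT \<alpha>)" for \<alpha> x using that pm_id by simp
  show "\<exists>G\<subseteq>As \<alpha>. is_root_extension (TT \<alpha>) (As \<alpha>) G (TT \<beta>) (As \<beta>) (trunc \<alpha>)"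
    if "immediate_successor r \<alpha> \<beta> \<and> \<alpha> \<in> Field r" for \<alpha> \<beta>
  proof -
    have "is_root_extension (TT \<alpha>) (As \<alpha>) (F \<alpha>) (TT \<beta>) (As \<beta>) (trunc \<alpha>)" using root_step that by blast
    moreover from this have "F \<alpha> \<subseteq> As \<alpha>" unfolding is_root_extension_def by blast
    ultimately show ?thesis by blast
  qed
  fix \<gamma> assume g: "limit_element r \<gamma>"
  have "\<gamma> \<in> Field r" "underS r \<gamma> \<noteq> {}" using g unfolding limit_element_def by auto
  then show "homeomorphic_map (TT \<gamma>) (inverse_limit r (underS r \<gamma>) TT (\<lambda>\<alpha> \<beta>. trunc \<alpha>)) (\<lambda>y. \<lambda>\<alpha>\<in>underS r \<gamma>. trunc \<alpha> y)"
    "As \<gamma> = mtopology_of (cspace (TT \<gamma>)) closure_of (\<Union>\<alpha>\<in>underS r \<gamma>. pullback (TT \<gamma>) (trunc \<alpha>) ` As \<alpha>)"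
    using limit_space limit_algebra limit_no_max[OF g] by auto
qed (use wo \<tau> \<tau>_max assms As_uniform pullback_ring_hom in auto)

text \<open>The least stage has no roots, so its space is \<open>X\<close> times a single point and
  its algebra consists of the pullbacks of \<open>A\<close>.\<close>

lemma obtained:
  assumes "infinite (Field r)"
  shows "obtained_by_root_extensions r X A (TT \<tau>) (As \<tau>) fst"
proof -
  have "wo_rel r" using wo by (simp add: wo_rel_def)
  have "\<exists>o'\<in>Field r. \<forall>\<alpha>\<in>Field r. (o', \<alpha>) \<in> r"
  proof -
    obtain z where z: "z \<in> Field r" "\<And>y. (y, z) \<in> r - Id \<Longrightarrow> y \<notin> Field r"
      using wfE_min[OF r_props(5) \<tau>] by metis
    then have "(z, \<alpha>) \<in> r" if "\<alpha> \<in> Field r" for \<alpha> using r_total[OF z(1) that] r_refl[OF z(1)] that by blast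
    then show ?thesis using z(1) by blast
  qed
  then obtain o' where o: "o' \<in> Field r" "\<And>\<alpha>. \<alpha> \<in> Field r \<Longrightarrow> (o', \<alpha>) \<in> r" by blast
  have u: "underS r o' = {}" using o r_props(3) unfolding underS_def by (auto dest: antisymD rI)
  have Wo: "W o' = {}" unfolding tower_index_def u by simp
  have Yo: "Y o' = topspace X \<times> {\<lambda>w. undefined}" by (auto simp: Y_iff u Wo)
  have homeo: "homeomorphic_map (TT o') X fst"
    by (rule continuous_imp_homeomorphic_map[OF cont_fst_TT TT_compact[OF o(1)] X_props(2)]) (auto simp: Yo inj_on_def)
  have Aext: "A \<subseteq> extensional (topspace X)" using X_props(3) mspace_cspace_iff[OF X_props(1)] by blast
  have fA: "fun_alg (topspace X) (sat (topspace X) A)" by (rule PA)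
  have "As o' = pullback (TT o') fst ` A"
  proof (intro equalityI subsetI)
    fix f assume f: "f \<in> As o'"
    define s where "s x = (x, \<lambda>w :: 'w. undefined :: complex)" for x :: 'a
    have "(\<lambda>x. f (s x)) \<in> gen (topspace X) (sat (topspace X) A)"
    proof (rule gen_map[where \<phi> = s and T = "Y o'" and G = "(\<lambda>a y. a (fst y)) ` sat (topspace X) A"])
      show "s x \<in> Y o'" if "x \<in> topspace X" for x using that unfolding Yo s_def by simp
      show "f \<in> gen (Y o') ((\<lambda>a y. a (fst y)) ` sat (topspace X) A)" using f unfolding As_def tower_alg_def Wo by simp
      fix g :: "'a \<times> ('w \<Rightarrow> complex) \<Rightarrow> complex" assume "g \<in> (\<lambda>a y. a (fst y)) ` sat (topspace X) A"
      then obtain a where "a \<in> sat (topspace X) A" "g = (\<lambda>y. a (fst y))" by blast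
      then show "(\<lambda>y. g (s y)) \<in> gen (topspace X) (sat (topspace X) A)" by (simp add: s_def gen_base)
    qed
    then have "(\<lambda>x. f (s x)) \<in> sat (topspace X) A" by (rule gen_least[OF _ fA order_refl])
    then have a: "restrict (\<lambda>x. f (s x)) (topspace X) \<in> A" unfolding sat_def by simp
    have "f = pullback (TT o') fst (restrict (\<lambda>x. f (s x)) (topspace X))"
      by (rule extensionalityI[of _ "Y o'"]) (use f in \<open>auto simp: As_def pullback_def Yo s_def\<close>)
    then show "f \<in> pullback (TT o') fst ` A" using a by blast
  next
    fix f assume "f \<in> pullback (TT o') fst ` A"
    then obtain a where a: "a \<in> A" "f = pullback (TT o') fst a" by blast
    show "f \<in> As o'" using AA_pi[OF sat_ext[OF Aext a(1)], of o'] As_restrict[OF o(1)] unfolding a(2) pullback_def by (simp add: comp_def)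
  qed
  then show ?thesis unfolding obtained_by_root_extensions_def
    using system[OF assms] homeo o
    by (intro exI[of _ \<tau>] exI[of _ o'] exI[of _ TT] exI[of _ As] exI[of _ "\<lambda>\<alpha> \<beta>. trunc \<alpha>"] exI[of _ fst]) auto
qed

end

section \<open>Local units and normality\<close>

text \<open>Normality is treated pointwise: local units multiply, pull back along projections and
  can be assembled from finitely many coordinates, and compactness turns them into separation of
  closed sets.\<close>

definition locunit :: "'a topology \<Rightarrow> ('a \<Rightarrow> complex) \<Rightarrow> 'a \<Rightarrow> 'a set \<Rightarrow> bool" where
  "locunit X g x U \<longleftrightarrow> (\<exists>V. openin X V \<and> x \<in> V \<and> (\<forall>y\<in>V. g y = 1)) \<and> (\<forall>y\<in>topspace X - U. g y = 0)"

definition locreg :: "'a topology \<Rightarrow> ('a \<Rightarrow> complex) set \<Rightarrow> bool" where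
  "locreg X P \<longleftrightarrow> (\<forall>U x. openin X U \<longrightarrow> x \<in> U \<longrightarrow> (\<exists>g\<in>P. locunit X g x U))"

lemma locunit_mult:
  assumes "locunit X g x U" "locunit X h x V"
  shows "locunit X (\<lambda>y. g y * h y) x (U \<inter> V)"
proof -
  obtain G where G: "openin X G" "x \<in> G" "\<forall>y\<in>G. g y = 1" using assms(1) unfolding locunit_def by blast
  obtain H where H: "openin X H" "x \<in> H" "\<forall>y\<in>H. h y = 1" using assms(2) unfolding locunit_def by blast
  have "openin X (G \<inter> H)" using G H by blast
  moreover have "\<forall>y\<in>topspace X - U \<inter> V. g y * h y = 0" using assms unfolding locunit_def by auto
  ultimately show ?thesis unfolding locunit_def using G H by (intro conjI exI[of _ "G \<inter> H"]) auto
qed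

lemma locunit_mono: "locunit X g x U \<Longrightarrow> U \<inter> topspace X \<subseteq> V \<Longrightarrow> locunit X g x V"
  unfolding locunit_def by blast

lemma locunit_cong:
  assumes "locunit Z f y U" "\<And>z. z \<in> topspace Z \<Longrightarrow> g z = f z" shows "locunit Z g y U"
proof -
  obtain V where V: "openin Z V" "y \<in> V" "\<forall>z\<in>V. f z = 1" using assms(1) unfolding locunit_def by blast
  have "\<forall>z\<in>V. g z = 1" using V(3) assms(2) openin_subset[OF V(1)] by auto
  moreover have "\<forall>z\<in>topspace Z - U. g z = 0" using assms unfolding locunit_def by simp
  ultimately show ?thesis using V(1,2) unfolding locunit_def by blast
qed

lemma locunit_one: "x \<in> topspace X \<Longrightarrow> topspace X \<subseteq> U \<Longrightarrow> locunit X (\<lambda>_. 1) x U"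
  unfolding locunit_def by blast

lemma locunit_prod:
  assumes "finite N" "x \<in> topspace X" "\<And>i. i \<in> N \<Longrightarrow> locunit X (g i) x (U i)"
  shows "locunit X (\<lambda>y. \<Prod>i\<in>N. g i y) x {y\<in>topspace X. \<forall>i\<in>N. y \<in> U i}"
  using assms(1,3)
proof (induction N)
  case empty then show ?case using assms(2) by (simp add: locunit_one)
next
  case (insert i N)
  have "locunit X (\<lambda>y. g i y * (\<Prod>i\<in>N. g i y)) x (U i \<inter> {y\<in>topspace X. \<forall>i\<in>N. y \<in> U i})"
    by (rule locunit_mult) (use insert in auto)
  then show ?case using insert(1,2) by (simp) (erule locunit_mono, auto)
qed

text \<open>A local unit must be 1 on a neighbourhood of \<open>x\<close>, so regularity of the
  space first inserts a closed neighbourhood \<open>C\<close> of \<open>x\<close> inside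
  \<open>U\<close>.\<close>

lemma normal_imp_locreg:
  assumes "normal_algebra X A" shows "locreg X (sat (topspace X) A)"
  unfolding locreg_def
proof (intro allI impI)
  fix U x assume U: "openin X U" "x \<in> U"
  have ua: "uniform_algebra X A" using assms unfolding normal_algebra_def natural_algebra_def by blast
  then have X: "compact_space X" "Hausdorff_space X" "A \<subseteq> mspace (cspace X)" unfolding uniform_algebra_iff by auto
  have ext: "A \<subseteq> extensional (topspace X)" using X mspace_cspace_iff[OF X(1)] by blast
  have "regular_space X" using X compact_Hausdorff_imp_regular_space by blast
  moreover have cU: "closedin X (topspace X - U)" using U by blast
  moreover have "x \<in> topspace X - (topspace X - U)" using U openin_subset by blast
  ultimately obtain V H where VH: "openin X V" "openin X H" "x \<in> V" "topspace X - U \<subseteq> H" "disjnt V H"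
    unfolding regular_space_def by meson
  define C where "C = topspace X - H"
  have V: "openin X V" "closedin X C" "x \<in> V" "V \<subseteq> C" "C \<subseteq> U"
    using VH openin_subset[OF VH(1)] unfolding C_def disjnt_def by auto
  note cU
  moreover have "(topspace X - U) \<inter> C = {}" using V(5) by blast
  ultimately have "\<exists>f\<in>A. (\<forall>x\<in>C. f x = 1) \<and> (\<forall>x\<in>topspace X - U. f x = 0)"
    using assms V(2) unfolding normal_algebra_def by blast
  then obtain f where f: "f \<in> A" "\<forall>x\<in>C. f x = 1" "\<forall>x\<in>topspace X - U. f x = 0" by blast
  show "\<exists>g\<in>sat (topspace X) A. locunit X g x U"
    using f V sat_ext[OF ext f(1)] unfolding locunit_def by (intro bexI[of _ f]) auto
qed

text \<open>Finitely many units \<open>g x\<close>, each 0 on \<open>K0\<close>, have sets of value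
  1 covering \<open>K1\<close>; then 1 minus the product of the functions \<open>1 - g x\<close> is
  1 on \<open>K1\<close> and 0 on \<open>K0\<close>.\<close>

lemma locreg_imp_normal:
  assumes nat: "natural_algebra X A" and reg: "locreg X (sat (topspace X) A)"
  shows "normal_algebra X A"
  unfolding normal_algebra_def
proof (intro conjI allI impI)
  have ua: "uniform_algebra X A" using nat unfolding natural_algebra_def by blast
  then have X: "compact_space X" "Hausdorff_space X" "A \<subseteq> mspace (cspace X)" and fa: "fun_alg (topspace X) (sat (topspace X) A)"
    unfolding uniform_algebra_iff by auto
  fix K0 K1 assume K: "closedin X K0 \<and> closedin X K1 \<and> K0 \<inter> K1 = {}"
  let ?U = "topspace X - K0"
  have U: "openin X ?U" using K by blast
  have K1: "compactin X K1" using K X closedin_compact_space by blast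
  have K1U: "K1 \<subseteq> ?U" using K closedin_subset by blast
  let ?Q = "\<lambda>x p. fst p \<in> sat (topspace X) A \<and> openin X (snd p) \<and> x \<in> snd p \<and> (\<forall>y\<in>snd p. fst p y = 1) \<and> (\<forall>y\<in>K0. fst p y = 0)"
  have "\<exists>p. ?Q x p" if x: "x \<in> K1" for x
  proof -
    have "x \<in> ?U" using x K1U by blast
    then obtain g where g: "g \<in> sat (topspace X) A" "locunit X g x ?U" using reg U unfolding locreg_def by blast
    obtain V where V: "openin X V" "x \<in> V" "\<forall>y\<in>V. g y = 1" using g(2) unfolding locunit_def by blast
    have "topspace X - ?U = K0" using K closedin_subset by blast
    then have "\<forall>y\<in>K0. g y = 0" using g(2) unfolding locunit_def by simp
    then show ?thesis using g(1) V by (intro exI[of _ "(g, V)"]) simp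
  qed
  then have "\<forall>x\<in>K1. \<exists>p. ?Q x p" by blast
  then obtain p where p: "\<forall>x\<in>K1. ?Q x (p x)" using bchoice[of K1 ?Q] by blast
  define g V where "g x = fst (p x)" and "V x = snd (p x)" for x
  have gV: "\<And>x. x \<in> K1 \<Longrightarrow> g x \<in> sat (topspace X) A" "\<And>x. x \<in> K1 \<Longrightarrow> openin X (V x)" "\<And>x. x \<in> K1 \<Longrightarrow> x \<in> V x"
    "\<And>x y. x \<in> K1 \<Longrightarrow> y \<in> V x \<Longrightarrow> g x y = 1" "\<And>x y. x \<in> K1 \<Longrightarrow> y \<in> K0 \<Longrightarrow> g x y = 0"
    using p unfolding g_def V_def by auto
  have "\<exists>\<F>. finite \<F> \<and> \<F> \<subseteq> V ` K1 \<and> K1 \<subseteq> \<Union>\<F>"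
    by (rule compactinD[OF K1]) (use gV(2,3) in auto)
  then obtain \<F> where \<F>: "finite \<F>" "\<F> \<subseteq> V ` K1" "K1 \<subseteq> \<Union>\<F>" by blast
  obtain N where N: "finite N" "N \<subseteq> K1" "\<F> = V ` N" using finite_subset_image[OF \<F>(1,2)] by blast
  define f where "f = (\<lambda>y. 1 - (\<Prod>x\<in>N. 1 - g x y))"
  have "f \<in> sat (topspace X) A"
    unfolding f_def by (intro fun_alg_diff[OF fa] fun_algD(2)[OF fa] fun_alg_prod[OF fa]) (use gV(1) N(2) in auto)
  then have "restrict f (topspace X) \<in> A" unfolding sat_def by blast
  moreover have "f y = 1" if "y \<in> K1" for y
  proof -
    obtain x where "x \<in> N" "y \<in> V x" using \<F>(3) N(3) \<open>y \<in> K1\<close> by blast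
    then have "1 - g x y = 0" using gV(4)[of x y] N(2) by auto
    then have "(\<Prod>x\<in>N. 1 - g x y) = 0" using N(1) \<open>x \<in> N\<close> by (meson prod_zero)
    then show ?thesis unfolding f_def by simp
  qed
  moreover have "f y = 0" if "y \<in> K0" for y
  proof -
    have "(\<Prod>x\<in>N. 1 - g x y) = 1" by (rule prod.neutral) (use gV(5)[OF _ that] N(2) in auto)
    then show ?thesis unfolding f_def by simp
  qed
  ultimately show "\<exists>f\<in>A. (\<forall>x\<in>K1. f x = 1) \<and> (\<forall>x\<in>K0. f x = 0)"
    using K closedin_subset by (intro bexI[of _ "restrict f (topspace X)"]) (auto dest!: closedin_subset)
qed (rule nat)

text \<open>Provides powers inside a uniform algebra without a functional calculus: the binomial
  series converges uniformly on a smaller disc.\<close>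

lemma powr_polynomial_approx:
  fixes a :: complex
  assumes "e > 0"
  shows "\<exists>N. \<forall>t. cmod t \<le> 1/2 \<longrightarrow> cmod ((1 + t) powr a - (\<Sum>n<N. (a gchoose n) * t ^ n)) < e"
proof -
  \<comment> \<open>Any number strictly between \<open>1/2\<close> and 1 would serve for
    \<open>3/4\<close>: convergence there gives absolute convergence at \<open>1/2\<close>.\<close>
  have "summable (\<lambda>n. (a gchoose n) * (3/4 :: complex) ^ n)"
    using gen_binomial_complex[of "3/4 :: complex" a] by (auto simp: sums_iff)
  then have s: "summable (\<lambda>n. norm ((a gchoose n) * (1/2 :: complex) ^ n))"
    by (rule powser_insidea) simp
  have "uniform_limit (cball 0 (1/2)) (\<lambda>N t. \<Sum>n<N. (a gchoose n) * t ^ n) (\<lambda>t. \<Sum>n. (a gchoose n) * t ^ n) sequentially"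
  proof (rule Weierstrass_m_test[OF _ s])
    fix n and t :: complex assume "t \<in> cball 0 (1/2)"
    then have "cmod t ^ n \<le> (1/2) ^ n" by (intro power_mono) auto
    then show "norm ((a gchoose n) * t ^ n) \<le> norm ((a gchoose n) * (1/2) ^ n)"
      unfolding norm_mult norm_power by (intro mult_left_mono) (auto simp: norm_divide)
  qed
  then have "\<forall>\<^sub>F N in sequentially. \<forall>t\<in>cball 0 (1/2). dist (\<Sum>n<N. (a gchoose n) * t ^ n) (\<Sum>n. (a gchoose n) * t ^ n) < e"
    using assms unfolding uniform_limit_iff by blast
  then obtain N where N: "\<forall>t\<in>cball 0 (1/2). dist (\<Sum>n<N. (a gchoose n) * t ^ n) (\<Sum>n. (a gchoose n) * t ^ n) < e"
    unfolding eventually_sequentially by blast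
  have "cmod ((1 + t) powr a - (\<Sum>n<N. (a gchoose n) * t ^ n)) < e" if t: "cmod t \<le> 1/2" for t
  proof -
    have "(\<Sum>n. (a gchoose n) * t ^ n) = (1 + t) powr a"
      using gen_binomial_complex[of t a] t by (auto simp: sums_iff)
    moreover have "dist (\<Sum>n<N. (a gchoose n) * t ^ n) (\<Sum>n. (a gchoose n) * t ^ n) < e" using N t by simp
    ultimately show ?thesis by (metis dist_commute dist_norm)
  qed
  then show ?thesis by blast
qed

text \<open>The power matters only where the cut-off \<open>u\<close> is nonzero, and there
  \<open>f / c\<close> stays in the disc of the binomial series. Elsewhere the product is 0,
  whatever value \<open>powr\<close> has.\<close>

lemma unit_times_powr:
  assumes P: "fun_alg T P" and u: "u \<in> P" and f: "f \<in> P" and c: "c \<noteq> 0"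
    and near: "\<And>x. x \<in> T \<Longrightarrow> u x \<noteq> 0 \<Longrightarrow> cmod (f x / c - 1) \<le> 1/2"
  shows "(\<lambda>x. u x * (f x / c) powr a) \<in> P"
proof (rule unif_closedD[OF fun_algD(1)[OF P]])
  fix e :: real assume e: "e > 0"
  obtain M where M: "\<forall>x\<in>T. cmod (u x) \<le> M" using fun_algD(5)[OF P u] by blast
  define M' where "M' = max M 1"
  have M': "M' > 0" "\<And>x. x \<in> T \<Longrightarrow> cmod (u x) \<le> M'" using M unfolding M'_def by force+
  then obtain N where N: "\<And>t. cmod t \<le> 1/2 \<Longrightarrow> cmod ((1 + t) powr a - (\<Sum>n<N. (a gchoose n) * t ^ n)) < e / M'"
    using powr_polynomial_approx[of "e / M'" a] e by auto
  define g where "g = (\<lambda>x. u x * (\<Sum>n<N. (a gchoose n) * (f x * inverse c - 1) ^ n))"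
  have "g \<in> P" unfolding g_def
    by (intro fun_algD(4)[OF P u] fun_alg_sum[OF P] fun_algD(4)[OF P fun_algD(2)[OF P]] fun_alg_power[OF P] fun_alg_diff[OF P] fun_algD(4)[OF P f] fun_algD(2)[OF P])
  moreover have "cmod (u x * (f x / c) powr a - g x) < e" if x: "x \<in> T" for x
  proof (cases "u x = 0")
    case True then show ?thesis using e by (simp add: g_def)
  next
    case False
    define t where "t = f x / c - 1"
    have "cmod t \<le> 1/2" using near[OF x False] by (simp add: t_def)
    then have "cmod ((1 + t) powr a - (\<Sum>n<N. (a gchoose n) * t ^ n)) < e / M'" by (rule N)
    then have 1: "M' * cmod ((1 + t) powr a - (\<Sum>n<N. (a gchoose n) * t ^ n)) < e"
      using M'(1) by (simp add: pos_less_divide_eq mult.commute)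
    have "u x * (f x / c) powr a - g x = u x * ((1 + t) powr a - (\<Sum>n<N. (a gchoose n) * t ^ n))"
      unfolding g_def t_def by (simp add: divide_inverse right_diff_distrib)
    then have "cmod (u x * (f x / c) powr a - g x) = cmod (u x) * cmod ((1 + t) powr a - (\<Sum>n<N. (a gchoose n) * t ^ n))"
      by (simp only: norm_mult)
    also have "\<dots> \<le> M' * cmod ((1 + t) powr a - (\<Sum>n<N. (a gchoose n) * t ^ n))"
      using M'(2)[OF x] by (rule mult_right_mono) simp
    finally show ?thesis using 1 by linarith
  qed
  ultimately show "\<exists>g\<in>P. \<forall>x\<in>T. cmod (u x * (f x / c) powr a - g x) < e" by blast
qed

text \<open>A unit \<open>u\<close> that is nonzero only where \<open>f\<close> is close to
  \<open>f x\<close> can be divided by \<open>f\<close> within the algebra; multiplying the quotient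
  by \<open>f\<close> shows that \<open>u\<close> belongs to the ideal.\<close>

lemma locunit_in_ideal:
  assumes P: "fun_alg (topspace X) P" and Q: "fun_ideal (topspace X) P Q" and reg: "locreg X P"
    and cont: "\<And>f. f \<in> P \<Longrightarrow> continuous_map X euclidean f"
    and f: "f \<in> Q" "f x \<noteq> 0" and U: "openin X U" "x \<in> U"
  shows "\<exists>g\<in>Q. locunit X g x U"
proof -
  define c where "c = f x"
  have c: "c \<noteq> 0" using f c_def by simp
  have fP: "f \<in> P" using fun_idealD(2)[OF Q f(1)] .
  have xT: "x \<in> topspace X" using U openin_subset by blast
  define U1 where "U1 = U \<inter> {y\<in>topspace X. f y \<in> ball c (cmod c / 2)}"
  have "openin X U1" unfolding U1_def
    by (intro openin_Int U(1) openin_continuous_map_preimage[OF cont[OF fP]]) simp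
  moreover have "x \<in> U1" unfolding U1_def using U xT c by (simp add: c_def)
  ultimately obtain u where u: "u \<in> P" "locunit X u x U1" using reg unfolding locreg_def by blast
  have near: "cmod (f y / c - 1) \<le> 1/2 \<and> f y \<noteq> 0" if "y \<in> topspace X" "u y \<noteq> 0" for y
  proof -
    have "y \<in> U1" using u(2) that unfolding locunit_def by blast
    then have d: "cmod (c - f y) < cmod c / 2" unfolding U1_def by (simp add: dist_norm)
    have "f y / c - 1 = (f y - c) / c" using c by (simp add: field_simps)
    then have "cmod (f y / c - 1) = cmod (c - f y) / cmod c" by (simp add: norm_divide norm_minus_commute)
    also have "\<dots> \<le> 1/2" using d c by (simp add: pos_divide_le_eq)
    finally show ?thesis using d c by auto
  qed
  have "(\<lambda>y. u y * (f y / c) powr (-1)) \<in> P"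
    by (rule unit_times_powr[OF P u(1) fP c]) (use near in blast)
  then have "(\<lambda>y. (u y * (f y / c) powr (-1)) * inverse c) \<in> P" by (rule fun_algD(4)[OF P _ fun_algD(2)[OF P]])
  then have "(\<lambda>y. ((u y * (f y / c) powr (-1)) * inverse c) * f y) \<in> Q" by (rule fun_idealD(5)[OF Q _ f(1)])
  then have "u \<in> Q"
  proof (rule unif_closed_cong[OF fun_idealD(1)[OF Q]])
    fix y assume y: "y \<in> topspace X"
    show "((u y * (f y / c) powr (-1)) * inverse c) * f y = u y"
    proof (cases "u y = 0")
      case False
      then have "f y / c \<noteq> 0" using near[OF y] c by simp
      then have "(f y / c) powr (-1) = inverse (f y / c)" by (simp add: powr_minus)
      then show ?thesis using near[OF y False] c by (simp add: field_simps)
    qed simp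
  qed
  moreover have "locunit X u x U" by (rule locunit_mono[OF u(2)]) (auto simp: U1_def)
  ultimately show ?thesis by blast
qed

text \<open>Continuity is not part of \<open>character\<close>; contractivity, the last claim, comes
  from the Neumann series. If \<psi> exceeded the norm on \<open>f\<close>, then
  \<open>1 - f / \<psi> f\<close> would be invertible in the algebra although \<psi> maps it to
  0.\<close>

lemma character_sat:
  assumes ua: "uniform_algebra X A" and ch: "character X A \<phi>"
    and \<psi>_def: "\<And>g. \<psi> g = \<phi> (restrict g (topspace X))"
  shows "\<And>f g. f \<in> sat (topspace X) A \<Longrightarrow> g \<in> sat (topspace X) A \<Longrightarrow> \<psi> (\<lambda>x. f x + g x) = \<psi> f + \<psi> g"
    "\<And>f g. f \<in> sat (topspace X) A \<Longrightarrow> g \<in> sat (topspace X) A \<Longrightarrow> \<psi> (\<lambda>x. f x * g x) = \<psi> f * \<psi> g"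
    "\<And>c f. f \<in> sat (topspace X) A \<Longrightarrow> \<psi> (\<lambda>x. c * f x) = c * \<psi> f"
    "\<And>c. \<psi> (\<lambda>x. c) = c"
    "\<And>f M. f \<in> sat (topspace X) A \<Longrightarrow> (\<And>x. x \<in> topspace X \<Longrightarrow> cmod (f x) \<le> M) \<Longrightarrow> M \<ge> 0 \<Longrightarrow> cmod (\<psi> f) \<le> M"
proof -
  let ?T = "topspace X" let ?A = "sat (topspace X) A"
  have fa: "fun_alg ?T ?A" and ext: "A \<subseteq> extensional ?T"
    using ua mspace_cspace_iff unfolding uniform_algebra_iff by blast+
  have c1: "\<phi> (\<lambda>x\<in>?T. f x + g x) = \<phi> f + \<phi> g" "\<phi> (\<lambda>x\<in>?T. f x * g x) = \<phi> f * \<phi> g" if "f \<in> A" "g \<in> A" for f g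
    using ch that unfolding character_def by blast+
  have c2: "\<phi> (\<lambda>x\<in>?T. c * f x) = c * \<phi> f" if "f \<in> A" for f c using ch that unfolding character_def by blast
  show add: "\<psi> (\<lambda>x. f x + g x) = \<psi> f + \<psi> g" if "f \<in> ?A" "g \<in> ?A" for f g
    using c1(1)[of "restrict f ?T" "restrict g ?T"] that unfolding \<psi>_def sat_def by (simp cong: restrict_cong)
  show mult: "\<psi> (\<lambda>x. f x * g x) = \<psi> f * \<psi> g" if "f \<in> ?A" "g \<in> ?A" for f g
    using c1(2)[of "restrict f ?T" "restrict g ?T"] that unfolding \<psi>_def sat_def by (simp cong: restrict_cong)
  show smult: "\<psi> (\<lambda>x. c * f x) = c * \<psi> f" if "f \<in> ?A" for f c
    using c2[of "restrict f ?T" c] that unfolding \<psi>_def sat_def by (simp cong: restrict_cong)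
  obtain f0 where f0: "f0 \<in> A" "\<phi> f0 \<noteq> 0" using ch unfolding character_def by blast
  have f0': "\<psi> f0 \<noteq> 0" "f0 \<in> ?A" using f0 ext unfolding \<psi>_def sat_def by (auto simp: extensional_restrict subset_iff)
  have "\<psi> (\<lambda>x. 1 * f0 x) = \<psi> (\<lambda>x. 1) * \<psi> f0" by (rule mult[OF fun_algD(2)[OF fa] f0'(2)])
  then have one: "\<psi> (\<lambda>x. 1) = 1" using f0'(1) by simp
  show const: "\<psi> (\<lambda>x. c) = c" for c using smult[OF fun_algD(2)[OF fa, of 1], of c] one by simp
  show "cmod (\<psi> f) \<le> M" if f: "f \<in> ?A" and M: "\<And>x. x \<in> ?T \<Longrightarrow> cmod (f x) \<le> M" "M \<ge> 0" for f M
  proof (rule ccontr)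
    assume "\<not> ?thesis"
    then have gt: "cmod (\<psi> f) > M" by simp
    then have nz: "\<psi> f \<noteq> 0" using M(2) by auto
    define \<rho> where "\<rho> = M / cmod (\<psi> f)"
    have \<rho>: "0 \<le> \<rho>" "\<rho> < 1" unfolding \<rho>_def using gt M(2) nz by (auto simp: divide_less_eq)
    define k where "k = (\<lambda>x. inverse (\<psi> f) * f x)"
    have kA: "k \<in> ?A" unfolding k_def by (intro fun_algD(4)[OF fa] fun_algD(2)[OF fa] f)
    have k\<rho>: "cmod (k x) \<le> \<rho>" if "x \<in> ?T" for x
    proof -
      have "cmod (k x) = cmod (f x) / cmod (\<psi> f)" unfolding k_def norm_mult norm_inverse divide_inverse by (rule mult.commute)
      then show ?thesis unfolding \<rho>_def using M(1)[OF that] by (simp add: divide_right_mono)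
    qed
    have \<psi>k: "\<psi> k = 1" unfolding k_def smult[OF f] using nz by simp
    define h where "h = (\<lambda>x. 1 / (1 - k x))"
    have k1: "1 - k x \<noteq> 0" "cmod (1 - k x) \<ge> 1 - \<rho>" if "x \<in> ?T" for x
    proof -
      have "cmod (1 - k x) \<ge> 1 - cmod (k x)" using norm_triangle_ineq2[of 1 "k x"] by simp
      then show "cmod (1 - k x) \<ge> 1 - \<rho>" using k\<rho>[OF that] by linarith
      then show "1 - k x \<noteq> 0" using \<rho> by auto
    qed
    have hA: "h \<in> ?A"
    proof (rule unif_closedD[OF fun_algD(1)[OF fa]])
      fix e :: real assume e: "e > 0"
      have "(\<lambda>n. \<rho> ^ n) \<longlonglongrightarrow> 0" using \<rho> by (intro LIMSEQ_power_zero) auto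
      then have "\<forall>\<^sub>F n in sequentially. \<rho> ^ n < e * (1 - \<rho>)" using e \<rho> by (intro order_tendstoD(2)) auto
      then obtain N where N: "\<rho> ^ N < e * (1 - \<rho>)" unfolding eventually_sequentially by blast
      have "(\<lambda>x. \<Sum>n<N. k x ^ n) \<in> ?A" by (intro fun_alg_sum[OF fa] fun_alg_power[OF fa] kA)
      moreover have "cmod (h x - (\<Sum>n<N. k x ^ n)) < e" if x: "x \<in> ?T" for x
      proof -
        have "(\<Sum>n<N. k x ^ n) = (1 - k x ^ N) / (1 - k x)" using k1(1)[OF x] by (subst sum_gp_strict) auto
        then have "h x - (\<Sum>n<N. k x ^ n) = k x ^ N / (1 - k x)"
          unfolding h_def by (simp add: diff_divide_distrib)
        then have "cmod (h x - (\<Sum>n<N. k x ^ n)) = cmod (k x) ^ N / cmod (1 - k x)" by (simp add: norm_divide norm_power)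
        also have "\<dots> \<le> \<rho> ^ N / (1 - \<rho>)" using k1(2)[OF x] k\<rho>[OF x] \<rho> by (intro frac_le power_mono) auto
        also have "\<dots> < e" using N \<rho> by (simp add: pos_divide_less_eq)
        finally show ?thesis .
      qed
      ultimately show "\<exists>g\<in>?A. \<forall>x\<in>?T. cmod (h x - g x) < e" by (intro bexI[of _ "\<lambda>x. \<Sum>n<N. k x ^ n"] ballI)
    qed
    have d: "(\<lambda>x. 1 - k x) \<in> ?A" by (intro fun_alg_diff[OF fa] fun_algD(2)[OF fa] kA)
    have "\<psi> (\<lambda>x. (1 - k x) + k x) = \<psi> (\<lambda>x. 1 - k x) + \<psi> k" by (rule add[OF d kA])
    then have "\<psi> (\<lambda>x. 1 - k x) = 0" using \<psi>k const[of 1] by simp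
    then have "\<psi> (\<lambda>x. (1 - k x) * h x) = 0" using mult[OF d hA] by simp
    moreover have "\<psi> (\<lambda>x. (1 - k x) * h x) = \<psi> (\<lambda>x. 1)"
      unfolding \<psi>_def using k1(1) by (intro arg_cong[of _ _ \<phi>] restrict_ext) (simp add: h_def)
    ultimately show False using one by simp
  qed
qed

context root_tower
begin

lemma openin_TT: "openin (TT \<alpha>) U \<longleftrightarrow> (\<exists>U'. openin (PT \<alpha>) U' \<and> U = U' \<inter> Y \<alpha>)"
  unfolding TT_def openin_subtopology by blast

lemma locunit_pull:
  assumes r: "(\<beta>, \<alpha>) \<in> r" and y: "y \<in> Y \<alpha>" and u: "locunit (TT \<beta>) u (trunc \<beta> y) U"
  shows "locunit (TT \<alpha>) (\<lambda>z. u (trunc \<beta> z)) y {z\<in>Y \<alpha>. trunc \<beta> z \<in> U}"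
proof -
  obtain V where V: "openin (TT \<beta>) V" "trunc \<beta> y \<in> V" "\<forall>z\<in>V. u z = 1" using u unfolding locunit_def by blast
  have "openin (TT \<alpha>) {z \<in> topspace (TT \<alpha>). trunc \<beta> z \<in> V}"
    by (rule openin_continuous_map_preimage[OF cont_pm[OF r] V(1)])
  moreover have "u (trunc \<beta> z) = 0" if "z \<in> Y \<alpha>" "trunc \<beta> z \<notin> U" for z
    using u pm_Y[OF that(1) r] that(2) unfolding locunit_def by simp
  ultimately show ?thesis unfolding locunit_def using V y
    by (intro conjI exI[of _ "{z \<in> topspace (TT \<alpha>). trunc \<beta> z \<in> V}"]) auto
qed

lemma locunit_base:
  assumes y: "y \<in> Y \<alpha>" and u: "locunit X u (fst y) U"
  shows "locunit (TT \<alpha>) (\<lambda>z. u (fst z)) y {z\<in>Y \<alpha>. fst z \<in> U}"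
proof -
  obtain V where V: "openin X V" "fst y \<in> V" "\<forall>z\<in>V. u z = 1" using u unfolding locunit_def by blast
  have "openin (TT \<alpha>) {z \<in> topspace (TT \<alpha>). fst z \<in> V}"
    by (rule openin_continuous_map_preimage[OF cont_fst_TT V(1)])
  moreover have "u (fst z) = 0" if "z \<in> Y \<alpha>" "fst z \<notin> U" for z
    using u that unfolding locunit_def Y_iff by simp
  ultimately show ?thesis unfolding locunit_def using V y
    by (intro conjI exI[of _ "{z \<in> topspace (TT \<alpha>). fst z \<in> V}"]) auto
qed

text \<open>Near a point with \<open>f \<noteq> 0\<close>, the algebra contains a cut-off branch of \<open>1 / sqrt f\<close>; multiplied by
  the adjoined root it is locally \<open>\<plusminus>1\<close>, which separates the two sheets.\<close>

lemma locunit_coord: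
  assumes \<alpha>: "\<alpha> \<in> Field r" and w: "w \<in> W \<alpha>" and y: "y \<in> Y \<alpha>" and Oo: "open Oo" "snd y w \<in> Oo"
    and reg: "locreg (TT (stage w)) (AA (stage w))"
  shows "\<exists>g\<in>AA \<alpha>. locunit (TT \<alpha>) g y {z\<in>Y \<alpha>. snd z w \<in> Oo}"
proof -
  define \<beta> f where "\<beta> = stage w" and "f = radicand w"
  have wt: "w \<in> W \<tau>" "\<beta> \<in> underS r \<alpha>" using W_st[OF \<alpha>] w unfolding \<beta>_def by auto
  have ba: "(\<beta>, \<alpha>) \<in> r" "\<beta> \<in> Field r" using wt(2) underS_Field unfolding underS_iff by auto
  have fA: "f \<in> AA \<beta>" unfolding f_def \<beta>_def by (rule F_AA[OF decode_W(1,2)[OF wt(1)]])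
  have sq: "(snd z w)\<^sup>2 = f (trunc \<beta> z)" if "z \<in> Y \<alpha>" for z using Y_sq[OF that \<alpha> w] unfolding f_def \<beta>_def .
  define b where "b = trunc \<beta> y"
  have bY: "b \<in> Y \<beta>" unfolding b_def by (rule pm_Y[OF y ba(1)])
  note fb = AA_fun_alg[OF ba(2)] and fa = AA_fun_alg[OF \<alpha>]
  define z0 where "z0 = snd y w"
  obtain \<epsilon> where \<epsilon>: "\<epsilon> > 0" "ball z0 \<epsilon> \<subseteq> Oo" using Oo open_contains_ball unfolding z0_def by blast
  show ?thesis
  proof (cases "z0 = 0")
    case True
    \<comment> \<open>At a zero the root is small exactly where its radicand is, so a pulled back
      unit of the earlier stage suffices.\<close>
    define U1 where "U1 = {x\<in>topspace (TT \<beta>). f x \<in> ball 0 (\<epsilon>\<^sup>2)}"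
    have "openin (TT \<beta>) U1" unfolding U1_def by (rule openin_continuous_map_preimage[OF AA_cont[OF fA]]) simp
    moreover have "f b = 0" using sq[OF y] True unfolding b_def z0_def by simp
    then have "b \<in> U1" unfolding U1_def using bY \<epsilon> by simp
    ultimately obtain u where u: "u \<in> AA \<beta>" "locunit (TT \<beta>) u b U1" using reg unfolding locreg_def \<beta>_def by blast
    have "locunit (TT \<alpha>) (\<lambda>z. u (trunc \<beta> z)) y {z\<in>Y \<alpha>. trunc \<beta> z \<in> U1}"
      by (rule locunit_pull[OF ba(1) y u(2)[unfolded b_def]])
    moreover have "{z\<in>Y \<alpha>. trunc \<beta> z \<in> U1} \<inter> topspace (TT \<alpha>) \<subseteq> {z\<in>Y \<alpha>. snd z w \<in> Oo}"
    proof
      fix z assume "z \<in> {z\<in>Y \<alpha>. trunc \<beta> z \<in> U1} \<inter> topspace (TT \<alpha>)"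
      then have z: "z \<in> Y \<alpha>" "cmod (f (trunc \<beta> z)) < \<epsilon>\<^sup>2" unfolding U1_def by (auto simp: dist_norm)
      then have "(cmod (snd z w))\<^sup>2 < \<epsilon>\<^sup>2" using sq[OF z(1)] by (metis norm_power)
      then have "cmod (snd z w) < \<epsilon>" using \<epsilon>(1) power_less_imp_less_base by fastforce
      then show "z \<in> {z\<in>Y \<alpha>. snd z w \<in> Oo}" using z(1) \<epsilon>(2) True by (auto simp: dist_norm subset_iff)
    qed
    ultimately have "locunit (TT \<alpha>) (\<lambda>z. u (trunc \<beta> z)) y {z\<in>Y \<alpha>. snd z w \<in> Oo}" by (rule locunit_mono)
    then show ?thesis using AA_mono[OF u(1) ba(1)] by blast
  next
    case False
    define c where "c = z0\<^sup>2"
    have c: "c \<noteq> 0" using False c_def by simp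
    have fbc: "f b = c" using sq[OF y] unfolding b_def c_def z0_def by simp
    have "isCont csqrt 1" by (rule continuous_at_csqrt) (auto simp: complex_nonpos_Reals_iff)
    moreover have "\<epsilon> / cmod z0 > 0" using \<epsilon>(1) False by simp
    ultimately obtain d0 where d0: "d0 > 0" "\<And>\<zeta>. dist \<zeta> 1 < d0 \<Longrightarrow> dist (csqrt \<zeta>) (csqrt 1) < \<epsilon> / cmod z0"
      unfolding continuous_at_eps_delta by metis
    \<comment> \<open>Within \<open>d0\<close> of 1 the principal root is within
      \<open>\<epsilon> / |z0|\<close> of 1, which keeps the sheet of \<open>y\<close> inside the
      ball around \<open>z0\<close>; \<open>1/2\<close> is the radius of the disc used for the
      binomial series.\<close>
    define d where "d = min d0 (1/2)"
    have d: "d > 0" "d \<le> 1/2" using d0 unfolding d_def by auto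
    define U1 where "U1 = {x\<in>topspace (TT \<beta>). f x \<in> ball c (d * cmod c)}"
    have "openin (TT \<beta>) U1" unfolding U1_def by (rule openin_continuous_map_preimage[OF AA_cont[OF fA]]) simp
    moreover have "b \<in> U1" unfolding U1_def using bY fbc d c by simp
    ultimately obtain u where u: "u \<in> AA \<beta>" "locunit (TT \<beta>) u b U1" using reg unfolding locreg_def \<beta>_def by blast
    have near: "cmod (f x / c - 1) < d" if "x \<in> Y \<beta>" "u x \<noteq> 0" for x
    proof -
      have "x \<in> U1" using u(2) that unfolding locunit_def by auto
      then have dd: "cmod (c - f x) < d * cmod c" unfolding U1_def by (simp add: dist_norm)
      have "f x / c - 1 = (f x - c) / c" using c by (simp add: field_simps)
      then have "cmod (f x / c - 1) = cmod (c - f x) / cmod c" by (simp add: norm_divide norm_minus_commute)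
      then show ?thesis using dd c by (simp add: pos_divide_less_eq)
    qed
    define q where "q = (\<lambda>x. u x * (f x / c) powr (-1/2))"
    have qA: "q \<in> AA \<beta>" unfolding q_def
    proof (rule unit_times_powr[OF fb u(1) fA c])
      show "cmod (f x / c - 1) \<le> 1/2" if "x \<in> Y \<beta>" "u x \<noteq> 0" for x using near[OF that] d(2) by linarith
    qed
    \<comment> \<open>With \<open>q = u / s\<close> and the root equal to \<open>z0 s\<close> or
      \<open>- z0 s\<close>, this mean is \<open>u\<close> on the first sheet and 0 on the
      second.\<close>
    define g where "g = (\<lambda>z. (u (trunc \<beta> z) + snd z w * q (trunc \<beta> z) * inverse z0) * (1/2))"
    have gA: "g \<in> AA \<alpha>" unfolding g_def
      by (intro fun_algD(4)[OF fa _ fun_algD(2)[OF fa]] fun_algD(3)[OF fa] fun_algD(4)[OF fa AA_r[OF w]] AA_mono[OF u(1) ba(1)] AA_mono[OF qA ba(1)])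
    have key: "\<exists>s. Re s \<ge> 0 \<and> cmod (s - 1) < \<epsilon> / cmod z0 \<and> s \<noteq> 0 \<and> q (trunc \<beta> z) = u (trunc \<beta> z) / s \<and> (snd z w = z0 * s \<or> snd z w = - z0 * s)"
      if z: "z \<in> Y \<alpha>" and uz: "u (trunc \<beta> z) \<noteq> 0" for z
    proof -
      define \<zeta> where "\<zeta> = f (trunc \<beta> z) / c"
      have n: "cmod (\<zeta> - 1) < d" unfolding \<zeta>_def by (rule near[OF pm_Y[OF z ba(1)] uz])
      then have \<zeta>: "\<zeta> \<noteq> 0" using d by auto
      define s where "s = csqrt \<zeta>"
      have s2: "s\<^sup>2 = \<zeta>" unfolding s_def by simp
      have "s = \<zeta> powr (1/2)" unfolding s_def using \<zeta> by (simp add: csqrt_conv_powr)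
      then have "s * \<zeta> powr (-1/2) = 1" using \<zeta> by (simp flip: powr_add)
      then have inv: "\<zeta> powr (-1/2) = 1 / s" using \<zeta> by (metis mult_zero_left nonzero_eq_divide_eq mult.commute zero_neq_one)
      have "(snd z w)\<^sup>2 = (z0 * s)\<^sup>2"
        using sq[OF z] s2 c unfolding \<zeta>_def c_def[symmetric] power_mult_distrib by simp
      then have "snd z w = z0 * s \<or> snd z w = - (z0 * s)" by (simp only: power2_eq_iff)
      moreover have "Re s \<ge> 0" unfolding s_def by (rule csqrt_principal[THEN disjE, of \<zeta>]) auto
      moreover have "cmod (s - 1) < \<epsilon> / cmod z0"
        using d0(2)[of \<zeta>] n unfolding s_def d_def by (simp add: dist_norm)
      moreover have "s \<noteq> 0" using s2 \<zeta> by auto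
      moreover have "q (trunc \<beta> z) = u (trunc \<beta> z) / s" unfolding q_def \<zeta>_def[symmetric] inv by simp
      ultimately show ?thesis by (intro exI[of _ s]) auto
    qed
    have "locunit (TT \<alpha>) g y {z\<in>Y \<alpha>. snd z w \<in> Oo}"
      unfolding locunit_def
    proof (intro conjI ballI)
      obtain V where V: "openin (TT \<beta>) V" "b \<in> V" "\<forall>x\<in>V. u x = 1" using u(2) unfolding locunit_def by blast
      \<comment> \<open>The condition \<open>Re (snd z w / z0) > 0\<close> selects the sheet of
        \<open>y\<close>, because principal roots have nonnegative real part.\<close>
      define V' where "V' = {z \<in> topspace (TT \<alpha>). trunc \<beta> z \<in> V} \<inter> {z \<in> topspace (TT \<alpha>). snd z w \<in> (\<lambda>v. v / z0) -` {v. Re v > 0}}"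
      have "open ((\<lambda>v. v / z0) -` {v. Re v > 0})"
        by (intro open_vimage open_halfspace_Re_gt continuous_intros) (use False in auto)
      then have "openin (TT \<alpha>) V'"
        unfolding V'_def by (intro openin_Int openin_continuous_map_preimage[OF cont_pm[OF ba(1)] V(1)]
            openin_continuous_map_preimage[OF cont_coord_TT[OF w]]) auto
      moreover have "y \<in> V'" unfolding V'_def using y V(2) False by (simp add: b_def z0_def)
      moreover have "g z = 1" if "z \<in> V'" for z
      proof -
        have z: "z \<in> Y \<alpha>" "u (trunc \<beta> z) = 1" "Re (snd z w / z0) > 0" using that V(3) unfolding V'_def by auto
        obtain s where s: "Re s \<ge> 0" "s \<noteq> 0" "q (trunc \<beta> z) = u (trunc \<beta> z) / s" "snd z w = z0 * s \<or> snd z w = - z0 * s"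
          using key[OF z(1)] z(2) by auto
        have "snd z w = z0 * s"
        proof (rule ccontr)
          assume "snd z w \<noteq> z0 * s"
          then have "snd z w / z0 = - s" using s(4) False by auto
          then show False using z(3) s(1) by simp
        qed
        then show ?thesis unfolding g_def using z(2) s(2,3) False by simp
      qed
      ultimately show "\<exists>V. openin (TT \<alpha>) V \<and> y \<in> V \<and> (\<forall>z\<in>V. g z = 1)" by blast
      fix z assume "z \<in> topspace (TT \<alpha>) - {z \<in> Y \<alpha>. snd z w \<in> Oo}"
      then have z: "z \<in> Y \<alpha>" "snd z w \<notin> Oo" by auto
      show "g z = 0"
      proof (cases "u (trunc \<beta> z) = 0")
        case True then show ?thesis by (simp add: g_def q_def)
      next
        case uz: False
        obtain s where s: "cmod (s - 1) < \<epsilon> / cmod z0" "s \<noteq> 0" "q (trunc \<beta> z) = u (trunc \<beta> z) / s" "snd z w = z0 * s \<or> snd z w = - z0 * s"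
          using key[OF z(1) uz] by auto
        have "snd z w \<noteq> z0 * s"
        proof
          assume "snd z w = z0 * s"
          then have "cmod (z0 - snd z w) = cmod z0 * cmod (s - 1)"
            by (metis mult.right_neutral norm_minus_commute norm_mult right_diff_distrib)
          also have "\<dots> < \<epsilon>" using s(1) False by (simp add: pos_less_divide_eq mult.commute)
          finally show False using z(2) \<epsilon>(2) by (auto simp: dist_norm subset_iff)
        qed
        then have "snd z w = - z0 * s" using s(4) by blast
        then show ?thesis unfolding g_def using s(2,3) False by simp
      qed
    qed
    then show ?thesis using gA by blast
  qed
qed

text \<open>A basic neighbourhood restricts the base point and finitely many roots; the product of a
  base unit with one unit for each of these roots is supported in it. The unit for a root requires
  units at its own, earlier stage, hence the induction.\<close>

lemma locreg_AA:
  assumes X: "locreg X (sat (topspace X) A)"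
  shows "\<alpha> \<in> Field r \<Longrightarrow> locreg (TT \<alpha>) (AA \<alpha>)"
proof (induction \<alpha> rule: wf_induct_rule[OF r_props(5)])
  case (1 \<alpha>)
  note fa = AA_fun_alg[OF 1(2)]
  show ?case unfolding locreg_def
  proof (intro allI impI)
    fix U y assume U: "openin (TT \<alpha>) U" "y \<in> U"
    obtain U' where U': "openin (PT \<alpha>) U'" "U = U' \<inter> Y \<alpha>" using U(1) unfolding openin_TT by blast
    have y: "y \<in> Y \<alpha>" "y \<in> U'" using U U' by auto
    obtain V Q where VQ: "openin X V" "openin (product_topology (\<lambda>_. euclidean :: complex topology) (W \<alpha>)) Q" "fst y \<in> V" "snd y \<in> Q" "V \<times> Q \<subseteq> U'"
      using U'(1) y(2) unfolding PT_def openin_prod_topology_alt by (metis prod.collapse)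
    obtain R where R: "finite {i \<in> W \<alpha>. R i \<noteq> UNIV}" "\<And>i. i \<in> W \<alpha> \<Longrightarrow> open (R i)" "snd y \<in> PiE (W \<alpha>) R" "PiE (W \<alpha>) R \<subseteq> Q"
    proof -
      have "\<exists>R. finite {i \<in> W \<alpha>. R i \<noteq> topspace (euclidean :: complex topology)} \<and> (\<forall>i\<in>W \<alpha>. openin euclidean (R i)) \<and> snd y \<in> PiE (W \<alpha>) R \<and> PiE (W \<alpha>) R \<subseteq> Q"
        using VQ(2)[unfolded openin_product_topology_alt] VQ(4) by blast
      then show ?thesis using that by auto
    qed
    define N where "N = {i \<in> W \<alpha>. R i \<noteq> UNIV}"
    obtain u where u: "u \<in> sat (topspace X) A" "locunit X u (fst y) V" using X VQ(1,3) unfolding locreg_def by blast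
    have "\<exists>g\<in>AA \<alpha>. locunit (TT \<alpha>) g y {z\<in>Y \<alpha>. snd z w \<in> R w}" if w: "w \<in> N" for w
    proof (rule locunit_coord[OF 1(2) _ y(1)])
      show wW: "w \<in> W \<alpha>" using w unfolding N_def by blast
      show "open (R w)" "snd y w \<in> R w" using R(2,3) wW by auto
      have "stage w \<in> underS r \<alpha>" using W_st[OF 1(2)] wW by blast
      then show "locreg (TT (stage w)) (AA (stage w))" using 1(1)[of "stage w"] underS_Field unfolding underS_iff by blast
    qed
    then have "\<forall>w\<in>N. \<exists>g. g \<in> AA \<alpha> \<and> locunit (TT \<alpha>) g y {z\<in>Y \<alpha>. snd z w \<in> R w}" by blast
    then have "\<exists>g. \<forall>w\<in>N. g w \<in> AA \<alpha> \<and> locunit (TT \<alpha>) (g w) y {z\<in>Y \<alpha>. snd z w \<in> R w}" by (rule bchoice)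
    then obtain g where g: "\<And>w. w \<in> N \<Longrightarrow> g w \<in> AA \<alpha>" "\<And>w. w \<in> N \<Longrightarrow> locunit (TT \<alpha>) (g w) y {z\<in>Y \<alpha>. snd z w \<in> R w}" by blast
    define h where "h = (\<lambda>z. u (fst z) * (\<Prod>w\<in>N. g w z))"
    have "h \<in> AA \<alpha>" unfolding h_def
      by (intro fun_algD(4)[OF fa AA_pi[OF u(1)]] fun_alg_prod[OF fa] g(1))
    moreover have "locunit (TT \<alpha>) h y ({z\<in>Y \<alpha>. fst z \<in> V} \<inter> {z\<in>topspace (TT \<alpha>). \<forall>w\<in>N. z \<in> {z\<in>Y \<alpha>. snd z w \<in> R w}})"
      unfolding h_def
    proof (rule locunit_mult[OF locunit_base[OF y(1) u(2)] locunit_prod])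
      show "finite N" using R(1) N_def by simp
    qed (use y g(2) in auto)
    then have "locunit (TT \<alpha>) h y U"
    proof (rule locunit_mono)
      show "({z\<in>Y \<alpha>. fst z \<in> V} \<inter> {z\<in>topspace (TT \<alpha>). \<forall>w\<in>N. z \<in> {z\<in>Y \<alpha>. snd z w \<in> R w}}) \<inter> topspace (TT \<alpha>) \<subseteq> U"
      proof
        fix z assume "z \<in> ({z\<in>Y \<alpha>. fst z \<in> V} \<inter> {z\<in>topspace (TT \<alpha>). \<forall>w\<in>N. z \<in> {z\<in>Y \<alpha>. snd z w \<in> R w}}) \<inter> topspace (TT \<alpha>)"
        then have z: "z \<in> Y \<alpha>" "fst z \<in> V" "\<forall>w\<in>N. snd z w \<in> R w" by auto
        have "snd z \<in> extensional (W \<alpha>)" using z(1) unfolding Y_iff by blast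
        moreover have "snd z w \<in> R w" if "w \<in> W \<alpha>" for w using z(3) that unfolding N_def by (cases "R w = UNIV") auto
        ultimately have "snd z \<in> PiE (W \<alpha>) R" by (auto simp: PiE_def)
        then have "z \<in> V \<times> Q" using R(4) z(2) by (cases z) auto
        then show "z \<in> U" using VQ(5) z(1) U'(2) by blast
      qed
    qed
    ultimately show "\<exists>g\<in>AA \<alpha>. locunit (TT \<alpha>) g y U" by blast
  qed
qed

text \<open>On pullbacks of \<open>A\<close> the character is evaluation at some \<open>x\<close>;
  together with its values on the roots this leaves one candidate \<open>y\<close> for the point.
  That \<open>y\<close> satisfies the root equations, and that the character is evaluation at
  \<open>y\<close>, depend on each other from stage to stage.\<close>

lemma natural_As:
  assumes nat: "natural_algebra X A" and \<delta>: "\<delta> \<in> Field r"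
  shows "natural_algebra (TT \<delta>) (As \<delta>)"
  unfolding natural_algebra_def
proof (intro conjI allI impI)
  show ua: "uniform_algebra (TT \<delta>) (As \<delta>)" by (rule As_uniform[OF \<delta>])
  fix \<phi> assume ch: "character (TT \<delta>) (As \<delta>) \<phi>"
  define \<psi> where "\<psi> g = \<phi> (restrict g (topspace (TT \<delta>)))" for g
  note cs = character_sat[OF ua ch \<psi>_def, unfolded topspace_TT sat_As[OF \<delta>]]
  note fd = AA_fun_alg[OF \<delta>]
  have "character X A (\<lambda>a. \<psi> (\<lambda>y. a (fst y)))"
  proof -
    have ext: "A \<subseteq> extensional (topspace X)" using X_props(3) mspace_cspace_iff[OF X_props(1)] by blast
    have pA: "(\<lambda>y. a (fst y)) \<in> AA \<delta>" if "a \<in> A" for a by (rule AA_pi[OF sat_ext[OF ext that]])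
    have cg: "\<psi> f = \<psi> g" if "\<And>y. y \<in> Y \<delta> \<Longrightarrow> f y = g y" for f g
      unfolding \<psi>_def by (intro arg_cong[of _ _ \<phi>] restrict_ext) (use that in simp)
    have fX: "fst y \<in> topspace X" if "y \<in> Y \<delta>" for y using that unfolding Y_iff by blast
    show ?thesis unfolding character_def
    proof (intro conjI ballI allI)
      fix f g assume fg: "f \<in> A" "g \<in> A"
      have "\<psi> (\<lambda>y. (\<lambda>x\<in>topspace X. f x + g x) (fst y)) = \<psi> (\<lambda>y. f (fst y) + g (fst y))" by (rule cg) (use fX in simp)
      then show "\<psi> (\<lambda>y. (\<lambda>x\<in>topspace X. f x + g x) (fst y)) = \<psi> (\<lambda>y. f (fst y)) + \<psi> (\<lambda>y. g (fst y))" using cs(1)[OF pA[OF fg(1)] pA[OF fg(2)]] by simp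
      have "\<psi> (\<lambda>y. (\<lambda>x\<in>topspace X. f x * g x) (fst y)) = \<psi> (\<lambda>y. f (fst y) * g (fst y))" by (rule cg) (use fX in simp)
      then show "\<psi> (\<lambda>y. (\<lambda>x\<in>topspace X. f x * g x) (fst y)) = \<psi> (\<lambda>y. f (fst y)) * \<psi> (\<lambda>y. g (fst y))" using cs(2)[OF pA[OF fg(1)] pA[OF fg(2)]] by simp
    next
      fix c f assume f: "f \<in> A"
      have "\<psi> (\<lambda>y. (\<lambda>x\<in>topspace X. c * f x) (fst y)) = \<psi> (\<lambda>y. c * f (fst y))" by (rule cg) (use fX in simp)
      then show "\<psi> (\<lambda>y. (\<lambda>x\<in>topspace X. c * f x) (fst y)) = c * \<psi> (\<lambda>y. f (fst y))" using cs(3)[OF pA[OF f]] by simp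
    next
      have "\<psi> (\<lambda>y. (\<lambda>x\<in>topspace X. 1) (fst y)) = \<psi> (\<lambda>y. 1)" by (rule cg) (use fX in simp)
      then have "\<psi> (\<lambda>y. (\<lambda>x\<in>topspace X. 1) (fst y)) = 1" using cs(4) by simp
      moreover have "(\<lambda>x\<in>topspace X. 1) \<in> A" using fun_algD(2)[OF PA, of 1] unfolding sat_def by simp
      ultimately show "\<exists>f\<in>A. \<psi> (\<lambda>y. f (fst y)) \<noteq> 0" by (intro bexI[of _ "\<lambda>x\<in>topspace X. 1"]) auto
    qed
  qed
  then obtain x where x: "x \<in> topspace X" "\<And>a. a \<in> A \<Longrightarrow> \<psi> (\<lambda>y. a (fst y)) = a x"
    using nat unfolding natural_algebra_def by blast
  have xs: "\<psi> (\<lambda>y. a (fst y)) = a x" if "a \<in> sat (topspace X) A" for a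
  proof -
    have "\<psi> (\<lambda>y. a (fst y)) = \<psi> (\<lambda>y. restrict a (topspace X) (fst y))"
      unfolding \<psi>_def by (intro arg_cong[of _ _ \<phi>] restrict_ext) (simp add: Y_iff)
    also have "\<dots> = restrict a (topspace X) x" by (rule x(2)) (use that in \<open>unfold sat_def, blast\<close>)
    finally show ?thesis using x(1) by simp
  qed
  define y where "y = (x, \<lambda>w\<in>W \<delta>. \<psi> (\<lambda>y. snd y w))"
  \<comment> \<open>Membership of the truncated point is a premise. It is supplied by the induction
    in \<open>mem\<close>, which in turn uses this fact for the radicands of earlier stages.\<close>
  have eval: "\<psi> (\<lambda>z. g (trunc \<beta> z)) = g (trunc \<beta> y)" if b: "(\<beta>, \<delta>) \<in> r" "trunc \<beta> y \<in> Y \<beta>" and g: "g \<in> AA \<beta>" for \<beta> g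
    using g[unfolded tower_alg_def]
  proof (induction rule: gen.induct)
    case (gen_base h)
    then consider a where "a \<in> sat (topspace X) A" "h = (\<lambda>y. a (fst y))" | w where "w \<in> W \<beta>" "h = (\<lambda>y. snd y w)" by blast
    then show ?case
    proof cases
      case 1 then show ?thesis using xs[OF 1(1)] by (simp add: y_def)
    next
      case 2
      then have "w \<in> W \<delta>" using W_mono[OF b(1)] by blast
      then show ?thesis using 2 by (simp add: snd_pm y_def)
    qed
  next
    case (gen_const c) show ?case by (rule cs(4))
  next
    case (gen_add f g)
    then have "(\<lambda>z. f (trunc \<beta> z)) \<in> AA \<delta>" "(\<lambda>z. g (trunc \<beta> z)) \<in> AA \<delta>" using AA_mono[OF _ b(1)] unfolding tower_alg_def by blast+
    then show ?case using cs(1) gen_add by simp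
  next
    case (gen_mult f g)
    then have "(\<lambda>z. f (trunc \<beta> z)) \<in> AA \<delta>" "(\<lambda>z. g (trunc \<beta> z)) \<in> AA \<delta>" using AA_mono[OF _ b(1)] unfolding tower_alg_def by blast+
    then show ?case using cs(2) gen_mult by simp
  next
    case (gen_lim f)
    have fA: "f \<in> AA \<beta>" unfolding tower_alg_def by (rule gen.gen_lim) (use gen_lim in blast)
    show ?case
    proof (rule ccontr)
      \<comment> \<open>Characters are contractive, so an approximant within half of a supposed
        discrepancy rules the discrepancy out.\<close>
      define e where "e = cmod (\<psi> (\<lambda>z. f (trunc \<beta> z)) - f (trunc \<beta> y)) / 2"
      assume "\<not> ?case"
      then have e: "e > 0" unfolding e_def by simp
      from gen_lim[OF e] obtain g where g: "g \<in> gen (Y \<beta>) ((\<lambda>a y. a (fst y)) ` sat (topspace X) A \<union> (\<lambda>w y. snd y w) ` W \<beta>)"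
        "\<psi> (\<lambda>z. g (trunc \<beta> z)) = g (trunc \<beta> y)" "\<forall>x\<in>Y \<beta>. cmod (f x - g x) < e" by blast
      have gA: "g \<in> AA \<beta>" using g(1) unfolding tower_alg_def .
      have fgA: "(\<lambda>z. f (trunc \<beta> z) - g (trunc \<beta> z)) \<in> AA \<delta>"
        by (rule fun_alg_diff[OF fd AA_mono[OF fA b(1)] AA_mono[OF gA b(1)]])
      have "\<psi> (\<lambda>z. (f (trunc \<beta> z) - g (trunc \<beta> z)) + g (trunc \<beta> z)) = \<psi> (\<lambda>z. f (trunc \<beta> z) - g (trunc \<beta> z)) + \<psi> (\<lambda>z. g (trunc \<beta> z))"
        by (rule cs(1)[OF fgA AA_mono[OF gA b(1)]])
      then have 1: "\<psi> (\<lambda>z. f (trunc \<beta> z)) = \<psi> (\<lambda>z. f (trunc \<beta> z) - g (trunc \<beta> z)) + g (trunc \<beta> y)" using g(2) by simp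
      have "cmod (\<psi> (\<lambda>z. f (trunc \<beta> z) - g (trunc \<beta> z))) \<le> e"
        by (rule cs(5)[OF fgA]) (use g(3) pm_Y[OF _ b(1)] e in \<open>auto intro: less_imp_le\<close>)
      moreover have "cmod (g (trunc \<beta> y) - f (trunc \<beta> y)) < e" using g(3) b(2) by (simp add: norm_minus_commute)
      moreover have "cmod (\<psi> (\<lambda>z. f (trunc \<beta> z)) - f (trunc \<beta> y)) \<le> cmod (\<psi> (\<lambda>z. f (trunc \<beta> z) - g (trunc \<beta> z))) + cmod (g (trunc \<beta> y) - f (trunc \<beta> y))"
        unfolding 1 using norm_triangle_ineq[of "\<psi> (\<lambda>z. f (trunc \<beta> z) - g (trunc \<beta> z))" "g (trunc \<beta> y) - f (trunc \<beta> y)"] by (simp add: algebra_simps)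
      ultimately show False using e unfolding e_def by simp
    qed
  qed
  have mem: "(\<beta>, \<delta>) \<in> r \<Longrightarrow> trunc \<beta> y \<in> Y \<beta>" for \<beta>
  proof (induction \<beta> rule: wf_induct_rule[OF r_props(5)])
    case (1 \<beta>)
    show ?case unfolding Y_iff
    proof (intro conjI ballI)
      show "fst (trunc \<beta> y) \<in> topspace X" using x by (simp add: y_def)
      show "snd (trunc \<beta> y) \<in> extensional (W \<beta>)" by (simp add: snd_pm)
      fix \<gamma> f assume g: "\<gamma> \<in> underS r \<beta>" "f \<in> F \<gamma>"
      have gb: "(\<gamma>, \<beta>) \<in> r" using g unfolding underS_iff by blast
      have gd: "(\<gamma>, \<delta>) \<in> r" by (rule r_trans[OF gb 1(2)])
      have "trunc \<gamma> y \<in> Y \<gamma>" using 1(1)[OF _ gd] g(1) unfolding underS_iff by blast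
      then have ev: "\<psi> (\<lambda>z. f (trunc \<gamma> z)) = f (trunc \<gamma> y)" using eval[OF gd _ F_AA[OF underS_\<tau>[OF g(1)] g(2)]] by blast
      have gS: "\<gamma> \<in> underS r \<delta>" by (rule underS_trans[OF g(1) 1(2)])
      have cW: "code \<gamma> f \<in> W \<delta>" using gS g(2) unfolding W_iff by blast
      have "\<psi> (\<lambda>z. snd z (code \<gamma> f) * snd z (code \<gamma> f)) = \<psi> (\<lambda>z. f (trunc \<gamma> z))"
        unfolding \<psi>_def
      proof (intro arg_cong[of _ _ \<phi>] restrict_ext)
        fix z assume "z \<in> topspace (TT \<delta>)"
        then show "snd z (code \<gamma> f) * snd z (code \<gamma> f) = f (trunc \<gamma> z)"
          using gS g(2) unfolding topspace_TT Y_iff power2_eq_square by blast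
      qed
      then have "(\<psi> (\<lambda>z. snd z (code \<gamma> f)))\<^sup>2 = f (trunc \<gamma> y)"
        using cs(2)[OF AA_r[OF cW] AA_r[OF cW]] ev by (simp add: power2_eq_square)
      moreover have "snd (trunc \<beta> y) (code \<gamma> f) = \<psi> (\<lambda>z. snd z (code \<gamma> f))"
        using snd_pm_code[OF g] cW by (simp add: y_def)
      ultimately show "(snd (trunc \<beta> y) (code \<gamma> f))\<^sup>2 = f (trunc \<gamma> (trunc \<beta> y))" using pm_pm[OF gb] by simp
    qed
  qed
  have dd: "(\<delta>, \<delta>) \<in> r" by (rule r_refl[OF \<delta>])
  have pdy: "trunc \<delta> y \<in> Y \<delta>" by (rule mem[OF dd])
  show "\<exists>x\<in>topspace (TT \<delta>). \<forall>f\<in>As \<delta>. \<phi> f = f x"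
  proof (intro bexI[of _ "trunc \<delta> y"] ballI)
    fix f assume f: "f \<in> As \<delta>"
    have "\<phi> f = \<psi> (\<lambda>z. f (trunc \<delta> z))"
      unfolding \<psi>_def by (intro arg_cong[of _ _ \<phi>] extensionalityI[of _ "Y \<delta>"]) (use f pm_id in \<open>auto simp: As_def\<close>)
    then show "\<phi> f = f (trunc \<delta> y)" using eval[OF dd pdy] f unfolding As_def by simp
  qed (use pdy in simp)
qed

lemma normal_As:
  assumes "normal_algebra X A" "\<delta> \<in> Field r" shows "normal_algebra (TT \<delta>) (As \<delta>)"
proof (rule locreg_imp_normal)
  show "natural_algebra (TT \<delta>) (As \<delta>)" using natural_As assms unfolding normal_algebra_def by blast
  show "locreg (TT \<delta>) (sat (topspace (TT \<delta>)) (As \<delta>))"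
    using locreg_AA[OF normal_imp_locreg[OF assms(1)] assms(2)] by (simp add: sat_As[OF assms(2)])
qed

end

text \<open>Repeated square roots drive the norm of a local unit to \<open>1\<close>, while near the point they remain
  constant of modulus \<open>1\<close>.\<close>

lemma small_locunit:
  assumes cont: "\<And>f. f \<in> \<F> \<Longrightarrow> continuous_map Z euclidean f"
    and root: "\<And>f. f \<in> \<F> \<Longrightarrow> \<exists>g\<in>\<F>. \<forall>z\<in>topspace Z. (g z)\<^sup>2 = f z"
    and p: "p \<in> \<F>" "locunit Z p y U" and M: "\<And>z. z \<in> topspace Z \<Longrightarrow> cmod (p z) \<le> M"
  shows "\<exists>g\<in>\<F>. \<exists>c. c \<noteq> 0 \<and> locunit Z (\<lambda>z. g z * c) y U \<and> (\<forall>z\<in>topspace Z. cmod (g z * c) \<le> 3/2)"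
proof -
  have yT: "y \<in> topspace Z" using p(2) openin_subset unfolding locunit_def by blast
  have ex: "\<exists>g\<in>\<F>. \<exists>c. cmod c = 1 \<and> (\<exists>V. openin Z V \<and> y \<in> V \<and> (\<forall>z\<in>V. g z = c)) \<and> (\<forall>z\<in>topspace Z - U. g z = 0) \<and>
      (\<forall>z\<in>topspace Z. cmod (g z) ^ (2 ^ n) \<le> M)" for n
  proof (induction n)
    case 0
    show ?case using p M unfolding locunit_def by (intro bexI[of _ p] exI[of _ 1]) auto
  next
    case (Suc n)
    then obtain g c V where g: "g \<in> \<F>" "cmod c = 1" "openin Z V" "y \<in> V" "\<forall>z\<in>V. g z = c" "\<forall>z\<in>topspace Z - U. g z = 0"
      "\<forall>z\<in>topspace Z. cmod (g z) ^ (2 ^ n) \<le> M" by blast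
    obtain h where h: "h \<in> \<F>" "\<forall>z\<in>topspace Z. (h z)\<^sup>2 = g z" using root[OF g(1)] by blast
    define d where "d = h y"
    have d2: "d\<^sup>2 = c" using h(2) yT g(4,5) unfolding d_def by simp
    then have d1: "cmod d = 1" using g(2) by (metis norm_ge_zero norm_power power2_eq_1_iff abs_of_nonneg abs_square_eq_1)
    \<comment> \<open>The two square roots of \<open>c\<close> are at distance 2, so a continuous
      root that stays within 1 of \<open>d\<close> is constantly \<open>d\<close> there.\<close>
    define V' where "V' = V \<inter> {z \<in> topspace Z. h z \<in> ball d 1}"
    have "openin Z V'" unfolding V'_def by (intro openin_Int g(3) openin_continuous_map_preimage[OF cont[OF h(1)]]) simp
    moreover have "y \<in> V'" unfolding V'_def d_def using g(4) yT by simp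
    moreover have "h z = d" if "z \<in> V'" for z
    proof -
      have z: "z \<in> V" "z \<in> topspace Z" "cmod (d - h z) < 1" using that unfolding V'_def by (auto simp: dist_norm)
      have "(h z)\<^sup>2 = d\<^sup>2" using h(2) z g(5) d2 by simp
      then have "h z = d \<or> h z = - d" by (simp only: power2_eq_iff)
      moreover have "h z \<noteq> - d"
      proof
        assume "h z = - d"
        then have "cmod (d - h z) = 2" using d1 by (metis diff_minus_eq_add mult_2 norm_mult norm_numeral mult.right_neutral)
        then show False using z(3) by simp
      qed
      ultimately show ?thesis by blast
    qed
    moreover have "h z = 0" if "z \<in> topspace Z - U" for z
    proof -
      have "(h z)\<^sup>2 = 0" using h(2) g(6) that by simp
      then show ?thesis by simp
    qed
    moreover have "cmod (h z) ^ (2 ^ Suc n) \<le> M" if "z \<in> topspace Z" for z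
    proof -
      have "cmod (h z) ^ (2 ^ Suc n) = (cmod (g z)) ^ (2 ^ n)"
        using h(2) that by (metis norm_power power_Suc power_mult)
      then show ?thesis using g(7) that by simp
    qed
    ultimately show ?case using h(1) d1 by blast
  qed
  \<comment> \<open>Repeated roots push the norm below any given constant above 1. The series for
    the peaking function tolerates constants up to 2.\<close>
  obtain n where n: "M < (3/2 :: real) ^ n" using real_arch_pow[of "3/2" M] by auto
  have "n \<le> 2 ^ n" using less_exp[of n] by (rule less_imp_le)
  then have "(3/2 :: real) ^ n \<le> (3/2) ^ (2 ^ n)" by (rule power_increasing) simp
  then have n: "M < (3/2) ^ (2 ^ n)" using n by linarith
  obtain g c V where g: "g \<in> \<F>" "cmod c = 1" "openin Z V" "y \<in> V" "\<forall>z\<in>V. g z = c" "\<forall>z\<in>topspace Z - U. g z = 0"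
      "\<forall>z\<in>topspace Z. cmod (g z) ^ (2 ^ n) \<le> M" using ex[of n] by blast
  have c0: "c \<noteq> 0" using g(2) by auto
  have "cmod (g z * inverse c) \<le> 3/2" if "z \<in> topspace Z" for z
  proof -
    have "cmod (g z) ^ (2 ^ n) < (3/2) ^ (2 ^ n)" using g(7) that n by fastforce
    then have "cmod (g z) < 3/2" by (rule power_less_imp_less_base) simp
    then show ?thesis using g(2) by (simp add: norm_mult norm_inverse)
  qed
  moreover have "locunit Z (\<lambda>z. g z * inverse c) y U"
    unfolding locunit_def using g(3-6) c0 by (intro conjI exI[of _ V]) auto
  ultimately show ?thesis using g(1) c0 by (intro bexI[of _ g] exI[of _ "inverse c"]) auto
qed

section \<open>Bounded relative units and generalized peak points\<close>

lemma sup_norm_leI: "0 \<le> M \<Longrightarrow> (\<And>x. x \<in> S \<Longrightarrow> cmod (f x) \<le> M) \<Longrightarrow> sup_norm S f \<le> M"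
  unfolding sup_norm_def by (auto intro!: cSUP_least)

lemma sup_norm_upper: "x \<in> S \<Longrightarrow> (\<And>x. x \<in> S \<Longrightarrow> cmod (f x) \<le> M) \<Longrightarrow> cmod (f x) \<le> sup_norm S f"
  unfolding sup_norm_def by (auto intro!: cSUP_upper bdd_aboveI[of _ M])

lemma sup_norm_nonneg: assumes "\<And>x. x \<in> S \<Longrightarrow> cmod (f x) \<le> M" shows "0 \<le> sup_norm S f"
proof (cases "S = {}")
  case False
  then obtain x where x: "x \<in> S" by blast
  show ?thesis by (rule order_trans[OF norm_ge_zero sup_norm_upper[OF x assms]])
qed (simp add: sup_norm_def)

text \<open>If the unit \<open>h\<close> at \<open>y\<close> is 0 on \<open>E\<close>, then
  \<open>1 - h\<close> vanishes near \<open>y\<close> and is 1 on \<open>E\<close>. Its norm is at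
  most \<open>1 + 3/2\<close>, which is the constant \<open>5/2\<close>.\<close>

lemma bounded_relative_units_if:
  assumes ua: "uniform_algebra Z B" and y: "y \<in> topspace Z"
    and unit: "\<And>U. openin Z U \<Longrightarrow> y \<in> U \<Longrightarrow> \<exists>h\<in>sat (topspace Z) B. locunit Z h y U \<and> (\<forall>z\<in>topspace Z. cmod (h z) \<le> 3/2)"
  shows "bounded_relative_units_at Z B y"
  unfolding bounded_relative_units_at_def
proof (intro exI[of _ "5/2"] conjI allI impI)
  fix E assume E: "compactin Z E \<and> E \<subseteq> topspace Z - {y}"
  have fa: "fun_alg (topspace Z) (sat (topspace Z) B)" and H: "Hausdorff_space Z" using ua unfolding uniform_algebra_iff by auto
  have "openin Z (topspace Z - E)" using E H compactin_imp_closedin by blast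
  then obtain h where h: "h \<in> sat (topspace Z) B" "locunit Z h y (topspace Z - E)" "\<forall>z\<in>topspace Z. cmod (h z) \<le> 3/2"
    using unit[of "topspace Z - E"] y E by blast
  obtain V where V: "openin Z V" "y \<in> V" "\<forall>z\<in>V. h z = 1" using h(2) unfolding locunit_def by blast
  let ?f = "restrict (\<lambda>z. 1 - h z) (topspace Z)"
  have "(\<lambda>z. 1 - h z) \<in> sat (topspace Z) B" by (intro fun_alg_diff[OF fa] fun_algD(2)[OF fa] h(1))
  then have "?f \<in> B" unfolding sat_def by simp
  moreover have "\<forall>z\<in>V. ?f z = 0" using V(3) openin_subset[OF V(1)] by (simp add: subset_iff)
  moreover have "\<forall>z\<in>E. ?f z = 1" using E h(2) unfolding locunit_def by auto
  moreover have "sup_norm (topspace Z) ?f \<le> 5/2"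
  proof (rule sup_norm_leI)
    fix z assume "z \<in> topspace Z"
    then show "cmod (?f z) \<le> 5/2" using h(3) norm_triangle_ineq4[of 1 "h z"] by fastforce
  qed simp
  ultimately show "\<exists>f\<in>B. (\<exists>U. openin Z U \<and> y \<in> U \<and> (\<forall>z\<in>U. f z = 0)) \<and> (\<forall>z\<in>E. f z = 1) \<and> sup_norm (topspace Z) f \<le> 5/2"
    using V(1,2) by (intro bexI[of _ ?f] conjI exI[of _ V])
qed simp

text \<open>The peaking function is the sum of \<open>2^-(i+1) h i\<close> for units
  \<open>h i\<close> on shrinking neighbourhoods \<open>V i\<close>, each unit being 1 on the next
  neighbourhood. At a point of \<open>V n\<close> outside \<open>V (n+1)\<close> the first
  \<open>n\<close> terms add up to \<open>1 - 2^-n\<close>, the next has modulus at most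
  \<open>3/2\<close> times \<open>2^-(n+1)\<close>, and the later ones vanish; so the modulus never
  exceeds 1. Off \<open>U\<close> the sum is 0, and at \<open>y\<close> it is 1.\<close>

lemma generalized_peak_point_if:
  assumes ua: "uniform_algebra Z B" and y: "y \<in> topspace Z"
    and unit: "\<And>U. openin Z U \<Longrightarrow> y \<in> U \<Longrightarrow> \<exists>h\<in>sat (topspace Z) B. locunit Z h y U \<and> (\<forall>z\<in>topspace Z. cmod (h z) \<le> 3/2)"
  shows "generalized_peak_point Z B y"
  unfolding generalized_peak_point_def
proof (intro allI impI)
  fix U assume U: "openin Z U \<and> y \<in> U"
  let ?B = "sat (topspace Z) B"
  have fa: "fun_alg (topspace Z) ?B" using ua unfolding uniform_algebra_iff by auto
  \<comment> \<open>Dependent choice of a unit together with its neighbourhood; the first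
    neighbourhood is \<open>U\<close>, and by \<open>R\<close> each later one lies where the
    previous unit is 1.\<close>
  define Q where "Q n p \<longleftrightarrow> openin Z (snd p) \<and> y \<in> snd p \<and> fst p \<in> ?B \<and> locunit Z (fst p) y (snd p) \<and> (\<forall>z\<in>topspace Z. cmod (fst p z) \<le> 3/2)
    \<and> (n = (0::nat) \<longrightarrow> snd p = U)" for n p
  define R where "R p q \<longleftrightarrow> snd q \<subseteq> snd p \<and> (\<forall>z\<in>snd q. fst p z = 1)" for p q :: "('a \<Rightarrow> complex) \<times> 'a set"
  have "\<exists>p. Q 0 p"
  proof -
    obtain h where "h \<in> ?B" "locunit Z h y U" "\<forall>z\<in>topspace Z. cmod (h z) \<le> 3/2" using unit U by blast
    then show ?thesis using U unfolding Q_def by (intro exI[of _ "(h, U)"]) auto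
  qed
  moreover have "\<exists>q. Q (Suc n) q \<and> R p q" if Qp: "Q n p" for p n
  proof -
    obtain V where V: "openin Z V" "y \<in> V" "\<forall>z\<in>V. fst p z = 1" using Qp unfolding Q_def locunit_def by blast
    define V' where "V' = V \<inter> snd p"
    have V': "openin Z V'" "y \<in> V'" using V Qp unfolding V'_def Q_def by auto
    obtain h where "h \<in> ?B" "locunit Z h y V'" "\<forall>z\<in>topspace Z. cmod (h z) \<le> 3/2" using unit[OF V'] by blast
    then show ?thesis using V' V(3) unfolding Q_def R_def by (intro exI[of _ "(h, V')"]) (auto simp: V'_def)
  qed
  ultimately have "\<exists>p. \<forall>n. Q n (p n) \<and> R (p n) (p (Suc n))"
    by (rule dependent_nat_choice)
  then obtain p where p: "\<And>n. Q n (p n)" "\<And>n. R (p n) (p (Suc n))" by blast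
  define h V where "h n = fst (p n)" and "V n = snd (p n)" for n
  have hB: "h n \<in> ?B" and yV: "y \<in> V n" and h0: "z \<in> topspace Z \<Longrightarrow> z \<notin> V n \<Longrightarrow> h n z = 0"
    and hb: "z \<in> topspace Z \<Longrightarrow> cmod (h n z) \<le> 3/2" for n z
    using p(1)[of n] unfolding h_def V_def Q_def locunit_def by auto
  have V0: "V 0 = U" using p(1)[of 0] unfolding V_def Q_def by simp
  have Vs: "V (Suc n) \<subseteq> V n" and h1: "z \<in> V (Suc n) \<Longrightarrow> h n z = 1" for n z
    using p(2)[of n] unfolding h_def V_def R_def by auto
  have VU: "V n \<subseteq> U" for n by (induction n) (use V0 Vs in auto)
  define f where "f N z = (\<Sum>i<N. (1/2) ^ Suc i * h i z)" for N z
  have fB: "f N \<in> ?B" for N unfolding f_def by (intro fun_alg_sum[OF fa] fun_algD(4)[OF fa fun_algD(2)[OF fa] hB])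
  have fS: "f (Suc N) z = f N z + (1/2) ^ Suc N * h N z" for N z unfolding f_def by simp
  have fV: "z \<in> V n \<Longrightarrow> f n z = 1 - (1/2) ^ n" for n z
  proof (induction n)
    case 0 then show ?case by (simp add: f_def)
  next
    case (Suc n)
    then have "f n z = 1 - (1/2) ^ n" using Vs by blast
    then show ?case unfolding fS using h1[OF Suc(2)] by simp
  qed
  have f_le: "z \<in> topspace Z \<Longrightarrow> cmod (f n z) \<le> 1" for n z
  proof (induction n)
    case 0 then show ?case by (simp add: f_def)
  next
    case (Suc n)
    show ?case
    proof (cases "z \<in> V n")
      case True
      have "cmod (f (Suc n) z) \<le> cmod (1 - (1/2) ^ n) + cmod ((1/2) ^ Suc n * h n z)"
        unfolding fS fV[OF True] by (rule norm_triangle_ineq)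
      also have "cmod (1 - (1/2) ^ n) = 1 - (1/2) ^ n"
      proof -
        have "(1 - (1/2) ^ n :: complex) = complex_of_real (1 - (1/2) ^ n)" by simp
        moreover have "(1/2 :: real) ^ n \<le> 1" by (simp add: power_le_one)
        ultimately show ?thesis by (metis norm_of_real abs_of_nonneg diff_ge_0_iff_ge)
      qed
      also have "cmod ((1/2) ^ Suc n * h n z) \<le> (1/2) ^ Suc n * (3/2)"
        unfolding norm_mult norm_power using hb[OF Suc(2), of n] by (intro mult_mono) (auto simp: norm_divide)
      finally have "cmod (f (Suc n) z) \<le> 1 - (1/2) ^ n + (1/2) ^ Suc n * (3/2)" by simp
      also have "\<dots> = 1 - (1/2) ^ n * (1/4)" by simp
      also have "\<dots> \<le> 1" by simp
      finally show ?thesis .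
    next
      case False
      then show ?thesis unfolding fS h0[OF Suc(2) False] using Suc by simp
    qed
  qed
  have diff: "m \<ge> n \<Longrightarrow> z \<in> topspace Z \<Longrightarrow> cmod (f m z - f n z) \<le> (3/2) * ((1/2) ^ n - (1/2) ^ m)" for m n z
  proof (induction m rule: dec_induct)
    case base then show ?case by simp
  next
    case (step m)
    have "cmod (f (Suc m) z - f n z) \<le> cmod (f m z - f n z) + cmod ((1/2) ^ Suc m * h m z)"
      unfolding fS using norm_triangle_ineq[of "f m z - f n z" "(1/2) ^ Suc m * h m z"] by (simp add: algebra_simps)
    also have "cmod ((1/2) ^ Suc m * h m z) \<le> (1/2) ^ Suc m * (3/2)"
        unfolding norm_mult norm_power using hb[OF step(4), of m] by (intro mult_mono) (auto simp: norm_divide)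
    finally show ?case using step by simp
  qed
  have half: "\<exists>N. \<forall>n\<ge>N. (1/2 :: real) ^ n < e" if "e > 0" for e
  proof -
    have "(\<lambda>n. (1/2 :: real) ^ n) \<longlonglongrightarrow> 0" by (intro LIMSEQ_power_zero) auto
    then have "\<forall>\<^sub>F n in sequentially. (1/2 :: real) ^ n < e" using that by (rule order_tendstoD(2))
    then show ?thesis unfolding eventually_sequentially .
  qed
  have Cau: "\<exists>N. \<forall>m\<ge>N. \<forall>n\<ge>N. \<forall>z\<in>topspace Z. cmod (f m z - f n z) \<le> e" if e: "e > 0" for e
  proof -
    obtain N where N: "\<forall>n\<ge>N. (1/2 :: real) ^ n < e / 2" using half[of "e/2"] e by auto
    have le: "cmod (f m z - f n z) \<le> e" if "m \<ge> n" "n \<ge> N" "z \<in> topspace Z" for m n z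
    proof -
      have "(1/2 :: real) ^ n < e / 2" "(1/2 :: real) ^ m \<ge> 0" using N that by auto
      then show ?thesis using diff[OF that(1,3)] e by argo
    qed
    have "cmod (f m z - f n z) \<le> e" if "m \<ge> N" "n \<ge> N" "z \<in> topspace Z" for m n z
    proof (cases "m \<ge> n")
      case False
      then show ?thesis using le[of m n z] that by (subst norm_minus_commute) simp
    qed (use le that in blast)
    then show ?thesis by blast
  qed
  obtain g where g: "g \<in> ?B" "\<And>e. e > 0 \<Longrightarrow> \<exists>N. \<forall>n\<ge>N. \<forall>z\<in>topspace Z. cmod (f n z - g z) \<le> e"
    using unif_closed_limit[OF fun_algD(1)[OF fa] fB Cau] by blast
  have lim: "(\<lambda>n. f n z) \<longlonglongrightarrow> g z" if "z \<in> topspace Z" for z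
    unfolding LIMSEQ_iff
  proof (intro allI impI)
    fix e :: real assume "e > 0"
    then obtain N where "\<forall>n\<ge>N. \<forall>z\<in>topspace Z. cmod (f n z - g z) \<le> e/2" using g(2)[of "e/2"] by auto
    then have "\<forall>n\<ge>N. cmod (f n z - g z) < e" using that \<open>e > 0\<close> by fastforce
    then show "\<exists>N. \<forall>n\<ge>N. cmod (f n z - g z) < e" ..
  qed
  have gy: "g y = 1"
  proof (rule LIMSEQ_unique[OF lim[OF y]])
    have "(\<lambda>n. 1 - (1/2 :: complex) ^ n) \<longlonglongrightarrow> 1 - 0" by (intro tendsto_intros LIMSEQ_power_zero) (auto simp: norm_divide)
    then show "(\<lambda>n. f n y) \<longlonglongrightarrow> 1" using fV[OF yV] by simp
  qed
  have g1: "cmod (g z) \<le> 1" if "z \<in> topspace Z" for z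
    by (rule LIMSEQ_le_const2[OF tendsto_norm[OF lim[OF that]]]) (use f_le[OF that] in auto)
  have g0: "g z = 0" if "z \<in> topspace Z - U" for z
  proof (rule LIMSEQ_unique[OF lim])
    have "f n z = 0" for n unfolding f_def using h0 VU that by (intro sum.neutral) (auto simp: subset_iff)
    then show "(\<lambda>n. f n z) \<longlonglongrightarrow> 0" by simp
  qed (use that in blast)
  have "sup_norm (topspace Z) (restrict g (topspace Z)) = 1"
  proof (rule antisym)
    show "sup_norm (topspace Z) (restrict g (topspace Z)) \<le> 1" by (rule sup_norm_leI[OF zero_le_one]) (use g1 in simp)
    show "1 \<le> sup_norm (topspace Z) (restrict g (topspace Z))"
      using sup_norm_upper[OF y, of "restrict g (topspace Z)" 1] g1 gy y by simp
  qed
  then show "\<exists>f\<in>B. f y = 1 \<and> sup_norm (topspace Z) f = 1 \<and> (\<forall>z\<in>topspace Z - U. cmod (f z) < 1)"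
    using g(1) gy g0 y by (intro bexI[of _ "restrict g (topspace Z)"]) (auto simp: sat_def)
qed

section \<open>Quotients and closed ideals\<close>

locale uniform_ideal =
  fixes X :: "'a topology" and A I :: "('a \<Rightarrow> complex) set"
  assumes A: "uniform_algebra X A" and I: "closed_ideal X A I"
begin

abbreviation "T \<equiv> topspace X"
abbreviation "R \<equiv> function_algebra T A"

lemma X_facts: "compact_space X" "Hausdorff_space X" "A \<subseteq> mspace (cspace X)" "I \<subseteq> mspace (cspace X)"
  using A I closed_ideal_iff[OF A] unfolding uniform_algebra_iff by auto

lemma fun_alg_A: "fun_alg T (sat T A)" using A unfolding uniform_algebra_iff by blast

lemma fun_ideal_I: "fun_ideal T (sat T A) (sat T I)" using I closed_ideal_iff[OF A] by blast

lemma A_ext: "A \<subseteq> extensional T" and I_ext: "I \<subseteq> extensional T"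
  using X_facts mspace_cspace_iff[OF X_facts(1)] by blast+

lemma A_sat: "a \<in> A \<Longrightarrow> a \<in> sat T A" by (rule sat_ext[OF A_ext])

lemma I_sat: "a \<in> I \<Longrightarrow> a \<in> sat T I" by (rule sat_ext[OF I_ext])

lemma satD: "a \<in> sat T B \<Longrightarrow> restrict a T \<in> B" by (simp add: sat_def)

sublocale cring R by (rule cring_function_algebra[OF A])

sublocale ideal I R using I unfolding closed_ideal_def by blast

lemma carrier_R: "carrier R = A" by (simp add: function_algebra_def)

lemma coset_iff: "x \<in> I +>\<^bsub>R\<^esub> a \<longleftrightarrow> (\<exists>j\<in>I. x = (\<lambda>z\<in>T. j z + a z))"
  unfolding a_r_coset_def' by (simp add: function_algebra_def)

lemma coset_eq: assumes "a \<in> A" "b \<in> A" "(\<lambda>z. b z - a z) \<in> sat T I" shows "I +>\<^bsub>R\<^esub> b = I +>\<^bsub>R\<^esub> a"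
proof (rule a_repr_independence[symmetric])
  have "b = (\<lambda>z\<in>T. restrict (\<lambda>z. b z - a z) T z + a z)"
    by (rule extensionalityI[of _ T]) (use assms(2) A_ext in auto)
  then show "b \<in> I +>\<^bsub>R\<^esub> a" unfolding coset_iff using satD[OF assms(3)] by blast
  show "a \<in> carrier R" using assms(1) by (simp add: carrier_R)
  show "subgroup I (add_monoid R)" by (rule a_subgroup)
qed

lemma coset_mem: assumes "a \<in> A" "b \<in> A" shows "b \<in> I +>\<^bsub>R\<^esub> a \<longleftrightarrow> (\<lambda>z. b z - a z) \<in> sat T I"
proof
  assume "b \<in> I +>\<^bsub>R\<^esub> a"
  then obtain j where j: "j \<in> I" "b = (\<lambda>z\<in>T. j z + a z)" unfolding coset_iff by blast
  show "(\<lambda>z. b z - a z) \<in> sat T I"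
    by (rule unif_closed_cong[OF fun_idealD(1)[OF fun_ideal_I] I_sat[OF j(1)]]) (simp add: j(2))
next
  assume "(\<lambda>z. b z - a z) \<in> sat T I"
  moreover have "b = (\<lambda>z\<in>T. restrict (\<lambda>z. b z - a z) T z + a z)"
    by (rule extensionalityI[of _ T]) (use assms(2) A_ext in auto)
  ultimately show "b \<in> I +>\<^bsub>R\<^esub> a" unfolding coset_iff using satD by blast
qed

lemma coset_sub: "a \<in> A \<Longrightarrow> I +>\<^bsub>R\<^esub> a \<subseteq> A"
  using a_r_coset_subset_G[OF a_subset, of a] by (simp add: carrier_R)

abbreviation "N \<equiv> quotient_algebra R I"

lemma carrier_N: "carrier N = (\<lambda>a. I +>\<^bsub>R\<^esub> a) ` A"
  unfolding quotient_algebra_def FactRing_def A_RCOSETS_def' by (auto simp: carrier_R)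

lemma N_mult: "a \<in> A \<Longrightarrow> b \<in> A \<Longrightarrow> (I +>\<^bsub>R\<^esub> a) \<otimes>\<^bsub>N\<^esub> (I +>\<^bsub>R\<^esub> b) = I +>\<^bsub>R\<^esub> (\<lambda>x\<in>T. a x * b x)"
  using rcoset_mult_add[of a b] by (simp add: quotient_algebra_def FactRing_def carrier_R) (simp add: function_algebra_def)

lemma N_add: "a \<in> A \<Longrightarrow> b \<in> A \<Longrightarrow> (I +>\<^bsub>R\<^esub> a) \<oplus>\<^bsub>N\<^esub> (I +>\<^bsub>R\<^esub> b) = I +>\<^bsub>R\<^esub> (\<lambda>x\<in>T. a x + b x)"
  using a_rcos_sum[of a b] by (simp add: quotient_algebra_def FactRing_def carrier_R) (simp add: function_algebra_def)

lemma N_one: "\<one>\<^bsub>N\<^esub> = I +>\<^bsub>R\<^esub> (\<lambda>x\<in>T. 1)"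
  by (simp add: quotient_algebra_def FactRing_def) (simp add: function_algebra_def)

lemma A_ops: "a \<in> A \<Longrightarrow> b \<in> A \<Longrightarrow> (\<lambda>x\<in>T. a x * b x) \<in> A" "a \<in> A \<Longrightarrow> b \<in> A \<Longrightarrow> (\<lambda>x\<in>T. a x + b x) \<in> A"
  "(\<lambda>x\<in>T. c) \<in> A" "a \<in> A \<Longrightarrow> (\<lambda>x\<in>T. c * a x) \<in> A" "a \<in> A \<Longrightarrow> b \<in> A \<Longrightarrow> (\<lambda>x\<in>T. a x - b x) \<in> A"
  by (rule satD, intro fun_algD(4)[OF fun_alg_A] A_sat, assumption+)
     (rule satD, intro fun_algD(3)[OF fun_alg_A] A_sat, assumption+,
      rule satD, rule fun_algD(2)[OF fun_alg_A],
      rule satD, intro fun_algD(4)[OF fun_alg_A fun_algD(2)[OF fun_alg_A]] A_sat, assumption+,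
      rule satD, intro fun_alg_diff[OF fun_alg_A] A_sat, assumption+)

text \<open>In the quotient the scalar multiple is a union over all representatives. It is a single
  coset, since a constant times a difference of representatives stays in \<open>I\<close>.\<close>

lemma N_smult: assumes a: "a \<in> A" shows "c \<odot>\<^bsub>N\<^esub> (I +>\<^bsub>R\<^esub> a) = I +>\<^bsub>R\<^esub> (\<lambda>x\<in>T. c * a x)"
proof -
  have "I +>\<^bsub>R\<^esub> (c \<odot>\<^bsub>R\<^esub> f) = I +>\<^bsub>R\<^esub> (\<lambda>x\<in>T. c * a x)" if f: "f \<in> I +>\<^bsub>R\<^esub> a" for f
  proof -
    have fA: "f \<in> A" using f coset_sub[OF a] by blast
    have "(\<lambda>z. f z - a z) \<in> sat T I" using f coset_mem[OF a fA] by blast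
    then have "(\<lambda>z. c * (f z - a z)) \<in> sat T I" by (rule fun_idealD(5)[OF fun_ideal_I fun_algD(2)[OF fun_alg_A]])
    then have "(\<lambda>z. (\<lambda>x\<in>T. c * f x) z - (\<lambda>x\<in>T. c * a x) z) \<in> sat T I"
      by (rule unif_closed_cong[OF fun_idealD(1)[OF fun_ideal_I]]) (simp add: right_diff_distrib)
    then show ?thesis using coset_eq[OF A_ops(4)[OF a] A_ops(4)[OF fA]] by (simp add: function_algebra_def)
  qed
  moreover have "a \<in> I +>\<^bsub>R\<^esub> a" using a_rcos_self[of a] a by (simp add: carrier_R)
  ultimately show ?thesis unfolding quotient_algebra_def by auto
qed

lemma N_nrm: "nrm N K = (INF f\<in>K. sup_norm T f)"
  by (simp add: quotient_algebra_def function_algebra_def)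

lemma A_bounded: assumes "a \<in> A" obtains M where "\<And>x. x \<in> T \<Longrightarrow> cmod (a x) \<le> M"
  using fun_algD(5)[OF fun_alg_A A_sat[OF assms]] by blast

lemma A_nonneg: assumes "a \<in> A" shows "0 \<le> sup_norm T a"
proof -
  obtain M where "\<And>x. x \<in> T \<Longrightarrow> cmod (a x) \<le> M" using assms by (rule A_bounded) blast
  then show ?thesis by (rule sup_norm_nonneg)
qed

lemma A_upper: assumes "a \<in> A" "x \<in> T" shows "cmod (a x) \<le> sup_norm T a"
proof -
  obtain M where "\<And>x. x \<in> T \<Longrightarrow> cmod (a x) \<le> M" using assms(1) by (rule A_bounded) blast
  then show ?thesis by (rule sup_norm_upper[OF assms(2)])
qed

end

text \<open>The roots no longer appear: quotients and closed ideals are governed by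
  \<open>dec\<close>, every function is a base function modulo \<open>J\<close>, and by
  \<open>nrm_le\<close>, the quotient norm of a base function does not drop.\<close>

locale ideal_extension = base: uniform_ideal X A I + ext: uniform_ideal Z B J
  for X :: "'a topology" and A I and Z :: "'b topology" and B J +
  fixes p :: "'b \<Rightarrow> 'a"
  assumes p_image: "p ` topspace Z = topspace X"
    and pB: "\<And>a. a \<in> sat (topspace X) A \<Longrightarrow> (\<lambda>z. a (p z)) \<in> sat (topspace Z) B"
    and pJ: "\<And>a. a \<in> sat (topspace X) I \<Longrightarrow> (\<lambda>z. a (p z)) \<in> sat (topspace Z) J"
    and dec: "\<And>g. g \<in> sat (topspace Z) B \<Longrightarrow> \<exists>a\<in>sat (topspace X) A. (\<lambda>z. g z - a (p z)) \<in> sat (topspace Z) J"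
    and nrm_le: "\<And>a h C. a \<in> sat (topspace X) A \<Longrightarrow> h \<in> sat (topspace Z) J \<Longrightarrow>
      (\<And>z. z \<in> topspace Z \<Longrightarrow> cmod (a (p z) - h z) \<le> C) \<Longrightarrow> \<exists>k\<in>sat (topspace X) I. \<forall>x\<in>topspace X. cmod (a x - k x) \<le> C"
begin

abbreviation "TX \<equiv> topspace X"
abbreviation "TZ \<equiv> topspace Z"
abbreviation "sA \<equiv> sat TX A"
abbreviation "sI \<equiv> sat TX I"
abbreviation "sB \<equiv> sat TZ B"
abbreviation "sJ \<equiv> sat TZ J"

lemma p_in: "z \<in> TZ \<Longrightarrow> p z \<in> TX" using p_image by blast

lemma pb_sat: "pullback Z p a \<in> K \<longleftrightarrow> (\<lambda>z. a (p z)) \<in> sat TZ K"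
  unfolding pullback_def sat_def by (simp add: comp_def)

lemma pb_restrict: "pullback Z p (restrict a TX) = pullback Z p a"
  unfolding pullback_def by (rule restrict_ext) (simp add: p_in)

lemma pb_B: "a \<in> A \<Longrightarrow> pullback Z p a \<in> B"
  unfolding pb_sat by (rule pB[OF base.A_sat])

text \<open>The case \<open>C = 0\<close> of \<open>nrm_le\<close>: a base function whose pullback
  lies in \<open>J\<close> coincides on \<open>X\<close> with an element of
  \<open>I\<close>.\<close>

lemma pJ_iff: assumes a: "a \<in> sA" shows "(\<lambda>z. a (p z)) \<in> sJ \<longleftrightarrow> a \<in> sI"
proof
  assume h: "(\<lambda>z. a (p z)) \<in> sJ"
  obtain k where k: "k \<in> sI" "\<forall>x\<in>TX. cmod (a x - k x) \<le> 0" using nrm_le[OF a h, of 0] by auto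
  show "a \<in> sI" by (rule unif_closed_cong[OF fun_idealD(1)[OF base.fun_ideal_I] k(1)]) (use k(2) in auto)
qed (rule pJ)

lemma inter: "J \<inter> pullback Z p ` A = pullback Z p ` I"
proof
  show "J \<inter> pullback Z p ` A \<subseteq> pullback Z p ` I"
  proof
    fix g assume "g \<in> J \<inter> pullback Z p ` A"
    then obtain a where a: "a \<in> A" "g = pullback Z p a" "g \<in> J" by blast
    then have "a \<in> sI" using pJ_iff[OF base.A_sat[OF a(1)]] pb_sat by blast
    then have "a \<in> I" using a(1) base.A_ext by (auto simp: sat_def extensional_restrict subset_iff)
    then show "g \<in> pullback Z p ` I" using a(2) by blast
  qed
  have "I \<subseteq> A" using base.a_subset by (simp add: base.carrier_R)
  then show "pullback Z p ` I \<subseteq> J \<inter> pullback Z p ` A" using pb_sat pJ[OF base.I_sat] by blast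
qed

text \<open>The preimage under the pullback. On cosets of \<open>J\<close> it inverts the map that
  the pullback induces between the quotients; on closed ideals it gives the correspondence. One
  definition serves both, cosets and ideals being sets of functions.\<close>

definition \<Phi> :: "('b \<Rightarrow> complex) set \<Rightarrow> ('a \<Rightarrow> complex) set" where
  "\<Phi> K = {a \<in> A. pullback Z p a \<in> K}"

lemma \<Phi>_coset: assumes a: "a \<in> A" shows "\<Phi> (J +>\<^bsub>ext.R\<^esub> pullback Z p a) = I +>\<^bsub>base.R\<^esub> a"
proof -
  have "pullback Z p b \<in> J +>\<^bsub>ext.R\<^esub> pullback Z p a \<longleftrightarrow> b \<in> I +>\<^bsub>base.R\<^esub> a" if b: "b \<in> A" for b
  proof -
    have "pullback Z p b \<in> J +>\<^bsub>ext.R\<^esub> pullback Z p a \<longleftrightarrow> (\<lambda>z. pullback Z p b z - pullback Z p a z) \<in> sJ"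
      by (rule ext.coset_mem[OF pb_B[OF a] pb_B[OF b]])
    also have "\<dots> \<longleftrightarrow> (\<lambda>z. b (p z) - a (p z)) \<in> sJ"
      unfolding sat_def by (simp add: pullback_def cong: restrict_cong)
    also have "\<dots> \<longleftrightarrow> (\<lambda>x. b x - a x) \<in> sI"
      using pJ_iff[of "\<lambda>x. b x - a x"] fun_alg_diff[OF base.fun_alg_A base.A_sat[OF b] base.A_sat[OF a]] by simp
    also have "\<dots> \<longleftrightarrow> b \<in> I +>\<^bsub>base.R\<^esub> a" using base.coset_mem[OF a b] by simp
    finally show ?thesis .
  qed
  then show ?thesis unfolding \<Phi>_def using base.coset_sub[OF a] by blast
qed

lemma ext_coset: assumes "g \<in> B" shows "\<exists>a\<in>A. J +>\<^bsub>ext.R\<^esub> g = J +>\<^bsub>ext.R\<^esub> pullback Z p a"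
proof -
  obtain a where a: "a \<in> sA" "(\<lambda>z. g z - a (p z)) \<in> sJ" using dec[OF ext.A_sat[OF assms]] by blast
  have ra: "restrict a TX \<in> A" using a(1) by (rule base.satD)
  have "(\<lambda>z. g z - pullback Z p (restrict a TX) z) \<in> sJ"
    unfolding pb_restrict by (rule unif_closed_cong[OF fun_idealD(1)[OF ext.fun_ideal_I] a(2)]) (simp add: pullback_def)
  from ext.coset_eq[OF pb_B[OF ra] assms this] show ?thesis using ra by blast
qed

lemma ext_carrier: "carrier ext.N = (\<lambda>a. J +>\<^bsub>ext.R\<^esub> pullback Z p a) ` A"
  unfolding ext.carrier_N using ext_coset pb_B by blast

lemma pb_ops: 
  "pullback Z p (\<lambda>x\<in>TX. a x * b x) = (\<lambda>z\<in>TZ. pullback Z p a z * pullback Z p b z)"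
  "pullback Z p (\<lambda>x\<in>TX. a x + b x) = (\<lambda>z\<in>TZ. pullback Z p a z + pullback Z p b z)"
  "pullback Z p (\<lambda>x\<in>TX. c * a x) = (\<lambda>z\<in>TZ. c * pullback Z p a z)"
  "pullback Z p (\<lambda>x\<in>TX. c) = (\<lambda>z\<in>TZ. c)"
  unfolding pullback_def by (auto simp: p_in intro!: restrict_ext)

lemma quotient_iso: "isometric_isomorphism ext.N base.N \<Phi>"
  unfolding isometric_isomorphism_def
proof (intro conjI ballI allI)
  have "\<Phi> \<in> ring_hom ext.N base.N"
  proof (rule ring_hom_memI)
    show "\<Phi> \<one>\<^bsub>ext.N\<^esub> = \<one>\<^bsub>base.N\<^esub>"
      unfolding ext.N_one base.N_one using \<Phi>_coset[OF base.A_ops(3)[of 1]] by (simp add: pb_ops)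
    fix K assume "K \<in> carrier ext.N"
    then obtain a where a: "a \<in> A" "K = J +>\<^bsub>ext.R\<^esub> pullback Z p a" unfolding ext_carrier by blast
    show "\<Phi> K \<in> carrier base.N" unfolding a(2) \<Phi>_coset[OF a(1)] base.carrier_N using a(1) by blast
    fix L assume "L \<in> carrier ext.N"
    then obtain b where b: "b \<in> A" "L = J +>\<^bsub>ext.R\<^esub> pullback Z p b" unfolding ext_carrier by blast
    show "\<Phi> (K \<otimes>\<^bsub>ext.N\<^esub> L) = \<Phi> K \<otimes>\<^bsub>base.N\<^esub> \<Phi> L"
      unfolding a(2) b(2) ext.N_mult[OF pb_B[OF a(1)] pb_B[OF b(1)]] \<Phi>_coset[OF a(1)] \<Phi>_coset[OF b(1)]
        base.N_mult[OF a(1) b(1)] pb_ops(1)[symmetric] by (rule \<Phi>_coset[OF base.A_ops(1)[OF a(1) b(1)]])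
    show "\<Phi> (K \<oplus>\<^bsub>ext.N\<^esub> L) = \<Phi> K \<oplus>\<^bsub>base.N\<^esub> \<Phi> L"
      unfolding a(2) b(2) ext.N_add[OF pb_B[OF a(1)] pb_B[OF b(1)]] \<Phi>_coset[OF a(1)] \<Phi>_coset[OF b(1)]
        base.N_add[OF a(1) b(1)] pb_ops(2)[symmetric] by (rule \<Phi>_coset[OF base.A_ops(2)[OF a(1) b(1)]])
  qed
  moreover have "bij_betw \<Phi> (carrier ext.N) (carrier base.N)"
  proof (rule bij_betw_imageI)
    show "inj_on \<Phi> (carrier ext.N)"
    proof (rule inj_onI)
      fix K L assume KL: "K \<in> carrier ext.N" "L \<in> carrier ext.N" "\<Phi> K = \<Phi> L"
      obtain a where a: "a \<in> A" "K = J +>\<^bsub>ext.R\<^esub> pullback Z p a" using KL(1) unfolding ext_carrier by blast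
      obtain b where b: "b \<in> A" "L = J +>\<^bsub>ext.R\<^esub> pullback Z p b" using KL(2) unfolding ext_carrier by blast
      have "b \<in> I +>\<^bsub>base.R\<^esub> b" using base.a_rcos_self[of b] b(1) by (simp add: base.carrier_R)
      then have "b \<in> \<Phi> K" using KL(3) unfolding b(2) \<Phi>_coset[OF b(1)] by simp
      then have "pullback Z p b \<in> J +>\<^bsub>ext.R\<^esub> pullback Z p a" unfolding \<Phi>_def a(2) by simp
      then show "K = L" unfolding a(2) b(2)
        by (rule ext.a_repr_independence[OF _ _ ext.a_subgroup]) (simp add: ext.carrier_R pb_B a(1))
    qed
    show "\<Phi> ` carrier ext.N = carrier base.N"
      unfolding ext_carrier base.carrier_N image_image by (rule image_cong) (use \<Phi>_coset in auto)
  qed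
  ultimately show "\<Phi> \<in> ring_iso ext.N base.N" unfolding ring_iso_def by blast
  fix K assume "K \<in> carrier ext.N"
  then obtain a where a: "a \<in> A" "K = J +>\<^bsub>ext.R\<^esub> pullback Z p a" unfolding ext_carrier by blast
  show "\<Phi> (c \<odot>\<^bsub>ext.N\<^esub> K) = c \<odot>\<^bsub>base.N\<^esub> \<Phi> K" for c
    unfolding a(2) ext.N_smult[OF pb_B[OF a(1)]] \<Phi>_coset[OF a(1)] base.N_smult[OF a(1)] pb_ops(3)[symmetric]
    by (rule \<Phi>_coset[OF base.A_ops(4)[OF a(1)]])
  show "nrm base.N (\<Phi> K) = nrm ext.N K"
    unfolding a(2) \<Phi>_coset[OF a(1)] base.N_nrm ext.N_nrm
  proof (rule antisym)
    have ne1: "J +>\<^bsub>ext.R\<^esub> pullback Z p a \<noteq> {}"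
      using ext.a_rcos_self[of "pullback Z p a"] pb_B[OF a(1)] by (auto simp: ext.carrier_R)
    have ne2: "I +>\<^bsub>base.R\<^esub> a \<noteq> {}"
      using base.a_rcos_self[of a] a(1) by (auto simp: base.carrier_R)
    \<comment> \<open>\<open>nrm_le\<close> gives a bound without an additional error, so every
      representative above has a representative below of no larger norm.\<close>
    show "(INF f\<in>I +>\<^bsub>base.R\<^esub> a. sup_norm TX f) \<le> (INF f\<in>J +>\<^bsub>ext.R\<^esub> pullback Z p a. sup_norm TZ f)"
    proof (rule cINF_mono[OF ne1])
      show "bdd_below (sup_norm TX ` (I +>\<^bsub>base.R\<^esub> a))"
        by (rule bdd_belowI[of _ 0]) (use base.A_nonneg base.coset_sub[OF a(1)] in auto)
      fix g assume g: "g \<in> J +>\<^bsub>ext.R\<^esub> pullback Z p a"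
      then have gB: "g \<in> B" using ext.coset_sub[OF pb_B[OF a(1)]] by blast
      have 1: "(\<lambda>z. g z - pullback Z p a z) \<in> sJ" using g ext.coset_mem[OF pb_B[OF a(1)] gB] by blast
      have h: "(\<lambda>z. a (p z) - g z) \<in> sJ"
        by (rule unif_closed_cong[OF fun_idealD(1)[OF ext.fun_ideal_I] fun_idealD(5)[OF ext.fun_ideal_I fun_algD(2)[OF ext.fun_alg_A, of "-1"] 1]])
          (simp add: pullback_def)
      obtain k where k: "k \<in> sI" "\<forall>x\<in>TX. cmod (a x - k x) \<le> sup_norm TZ g"
        using nrm_le[OF base.A_sat[OF a(1)] h, of "sup_norm TZ g"] ext.A_upper[OF gB] by auto
      let ?n = "\<lambda>x\<in>TX. a x - k x"
      have kA: "k \<in> sA" using fun_idealD(2)[OF base.fun_ideal_I k(1)] .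
      have nA: "?n \<in> A" by (rule base.satD[OF fun_alg_diff[OF base.fun_alg_A base.A_sat[OF a(1)] kA]])
      have "(\<lambda>x. ?n x - a x) \<in> sI"
        by (rule unif_closed_cong[OF fun_idealD(1)[OF base.fun_ideal_I] fun_idealD(5)[OF base.fun_ideal_I fun_algD(2)[OF base.fun_alg_A, of "-1"] k(1)]]) simp
      then have "?n \<in> I +>\<^bsub>base.R\<^esub> a" using base.coset_mem[OF a(1) nA] by blast
      moreover have "sup_norm TX ?n \<le> sup_norm TZ g"
        by (rule sup_norm_leI[OF ext.A_nonneg[OF gB]]) (use k(2) in simp)
      ultimately show "\<exists>n\<in>I +>\<^bsub>base.R\<^esub> a. sup_norm TX n \<le> sup_norm TZ g" by blast
    qed
    show "(INF f\<in>J +>\<^bsub>ext.R\<^esub> pullback Z p a. sup_norm TZ f) \<le> (INF f\<in>I +>\<^bsub>base.R\<^esub> a. sup_norm TX f)"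
    proof (rule cINF_mono[OF ne2])
      show "bdd_below (sup_norm TZ ` (J +>\<^bsub>ext.R\<^esub> pullback Z p a))"
        by (rule bdd_belowI[of _ 0]) (use ext.A_nonneg ext.coset_sub[OF pb_B[OF a(1)]] in auto)
      fix m assume m: "m \<in> I +>\<^bsub>base.R\<^esub> a"
      then have mA: "m \<in> A" using base.coset_sub[OF a(1)] by blast
      have "pullback Z p m \<in> J +>\<^bsub>ext.R\<^esub> pullback Z p a" using m \<Phi>_coset[OF a(1)] unfolding \<Phi>_def by blast
      moreover have "sup_norm TZ (pullback Z p m) \<le> sup_norm TX m"
        by (rule sup_norm_leI[OF base.A_nonneg[OF mA]]) (simp add: pullback_def base.A_upper[OF mA] p_in)
      ultimately show "\<exists>n\<in>J +>\<^bsub>ext.R\<^esub> pullback Z p a. sup_norm TZ n \<le> sup_norm TX m" by blast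
    qed
  qed
qed

section \<open>The correspondence of closed ideals\<close>

lemma \<Phi>_sat: assumes "K \<subseteq> B" shows "f \<in> sat TX (\<Phi> K) \<longleftrightarrow> f \<in> sA \<and> (\<lambda>z. f (p z)) \<in> sat TZ K"
proof -
  have "pullback Z p (restrict f TX) \<in> K \<longleftrightarrow> (\<lambda>z. f (p z)) \<in> sat TZ K" unfolding pb_restrict pb_sat ..
  then show ?thesis unfolding \<Phi>_def sat_def[of TX] by simp
qed

lemma \<Phi>_closed_ideal:
  assumes K: "closed_ideal Z B K" "J \<subseteq> K" shows "closed_ideal X A (\<Phi> K)" "I \<subseteq> \<Phi> K"
proof -
  interpret K: uniform_ideal Z B K by unfold_locales (rule ext.A, rule K(1))
  have KB: "K \<subseteq> B" using K.a_subset by (simp add: K.carrier_R)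
  note s = \<Phi>_sat[OF KB]
  have "fun_ideal TX sA (sat TX (\<Phi> K))"
    unfolding fun_ideal_def
  proof (intro conjI ballI)
    show "unif_closed TX (sat TX (\<Phi> K))"
      unfolding unif_closed_def
    proof (intro allI impI)
      fix f assume f: "\<forall>e>0. \<exists>g\<in>sat TX (\<Phi> K). \<forall>x\<in>TX. cmod (f x - g x) < e"
      have "f \<in> sA" by (rule unif_closedD[OF fun_algD(1)[OF base.fun_alg_A]]) (use f s in blast)
      moreover have "(\<lambda>z. f (p z)) \<in> sat TZ K"
      proof (rule unif_closedD[OF fun_idealD(1)[OF K.fun_ideal_I]])
        fix e :: real assume "e > 0"
        then obtain g where g: "g \<in> sat TX (\<Phi> K)" "\<forall>x\<in>TX. cmod (f x - g x) < e" using f by blast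
        then have "(\<lambda>z. g (p z)) \<in> sat TZ K" using s by blast
        moreover have "\<forall>z\<in>TZ. cmod (f (p z) - g (p z)) < e" using g(2) p_in by blast
        ultimately show "\<exists>h\<in>sat TZ K. \<forall>z\<in>TZ. cmod (f (p z) - h z) < e" by (intro bexI[of _ "\<lambda>z. g (p z)"])
      qed
      ultimately show "f \<in> sat TX (\<Phi> K)" using s by blast
    qed
    show "sat TX (\<Phi> K) \<subseteq> sA" using s by blast
    show "(\<lambda>x. 0) \<in> sat TX (\<Phi> K)" unfolding s using fun_algD(2)[OF base.fun_alg_A] fun_idealD(3)[OF K.fun_ideal_I] by blast
    show "(\<lambda>x. f x + g x) \<in> sat TX (\<Phi> K)" if "f \<in> sat TX (\<Phi> K)" "g \<in> sat TX (\<Phi> K)" for f g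
      using that fun_algD(3)[OF base.fun_alg_A] fun_idealD(4)[OF K.fun_ideal_I] unfolding s by blast
    show "(\<lambda>x. f x * g x) \<in> sat TX (\<Phi> K)" if "f \<in> sA" "g \<in> sat TX (\<Phi> K)" for f g
    proof -
      have "g \<in> sA" "(\<lambda>z. g (p z)) \<in> sat TZ K" using that(2) s by auto
      then show ?thesis unfolding s using fun_algD(4)[OF base.fun_alg_A that(1)] fun_idealD(5)[OF K.fun_ideal_I pB[OF that(1)]] by blast
    qed
  qed
  moreover have "\<Phi> K \<subseteq> mspace (cspace X)" using base.X_facts unfolding \<Phi>_def by blast
  ultimately show "closed_ideal X A (\<Phi> K)" unfolding closed_ideal_iff[OF base.A] by blast
  have "I \<subseteq> A" using base.a_subset by (simp add: base.carrier_R)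
  then show "I \<subseteq> \<Phi> K" unfolding \<Phi>_def using inter K(2) by blast
qed

text \<open>An element of \<open>K\<close> is a base function plus an element of \<open>J\<close>,
  and \<open>J\<close> lies in both ideals, so comparing base functions suffices.\<close>

lemma \<Phi>_mono_iff:
  assumes K: "closed_ideal Z B K" "J \<subseteq> K" and L: "closed_ideal Z B L" "J \<subseteq> L"
  shows "K \<subseteq> L \<longleftrightarrow> \<Phi> K \<subseteq> \<Phi> L"
proof
  assume le: "\<Phi> K \<subseteq> \<Phi> L"
  interpret K: uniform_ideal Z B K by unfold_locales (rule ext.A, rule K(1))
  interpret L: uniform_ideal Z B L by unfold_locales (rule ext.A, rule L(1))
  show "K \<subseteq> L"
  proof
    fix g assume g: "g \<in> K"
    have gB: "g \<in> B" using g K.a_subset by (auto simp: K.carrier_R)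
    obtain a where a: "a \<in> sA" "(\<lambda>z. g z - a (p z)) \<in> sJ" using dec[OF ext.A_sat[OF gB]] by blast
    have hK: "(\<lambda>z. g z - a (p z)) \<in> sat TZ K" and hL: "(\<lambda>z. g z - a (p z)) \<in> sat TZ L" using a(2) K(2) L(2) unfolding sat_def by auto
    have "(\<lambda>z. g z - (g z - a (p z))) \<in> sat TZ K" by (rule fun_ideal_diff[OF ext.fun_alg_A K.fun_ideal_I K.I_sat[OF g] hK])
    then have "(\<lambda>z. a (p z)) \<in> sat TZ K" by simp
    then have "pullback Z p (restrict a TX) \<in> K" unfolding pb_restrict pb_sat .
    then have "restrict a TX \<in> \<Phi> K" unfolding \<Phi>_def using base.satD[OF a(1)] by blast
    then have "pullback Z p (restrict a TX) \<in> L" using le unfolding \<Phi>_def by blast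
    then have "(\<lambda>z. a (p z)) \<in> sat TZ L" by (simp add: pb_restrict pb_sat)
    then have "(\<lambda>z. (g z - a (p z)) + a (p z)) \<in> sat TZ L" by (rule fun_idealD(4)[OF L.fun_ideal_I hL])
    then show "g \<in> L" using gB ext.A_ext by (auto simp: sat_def extensional_restrict subset_iff)
  qed
qed (auto simp: \<Phi>_def)

text \<open>Pullbacks of \<open>K\<close> plus \<open>J\<close>: the inverse of \<Phi> on closed
  ideals.\<close>

definition \<Theta> :: "('a \<Rightarrow> complex) set \<Rightarrow> ('b \<Rightarrow> complex) set" where
  "\<Theta> K = {g \<in> B. \<exists>a\<in>sat TX K. (\<lambda>z. g z - a (p z)) \<in> sJ}"

text \<open>Closedness is the delicate point. The base part of a limit is approximated from
  \<open>K\<close>, because \<open>nrm_le\<close> turns closeness above modulo \<open>J\<close> into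
  closeness below modulo \<open>I\<close>, and \<open>I\<close> is contained in
  \<open>K\<close>.\<close>

lemma \<Theta>:
  assumes K: "closed_ideal X A K" "I \<subseteq> K" shows "closed_ideal Z B (\<Theta> K)" "J \<subseteq> \<Theta> K" "\<Phi> (\<Theta> K) = K"
proof -
  interpret K: uniform_ideal X A K by unfold_locales (rule base.A, rule K(1))
  have s: "f \<in> sat TZ (\<Theta> K) \<longleftrightarrow> f \<in> sB \<and> (\<exists>a\<in>sat TX K. (\<lambda>z. f z - a (p z)) \<in> sJ)" for f
  proof -
    have "(\<lambda>z. restrict f TZ z - a (p z)) \<in> sJ \<longleftrightarrow> (\<lambda>z. f z - a (p z)) \<in> sJ" for a
      unfolding sat_def by (simp cong: restrict_cong)
    then show ?thesis unfolding \<Theta>_def sat_def[of TZ B] sat_def[of TZ "{g \<in> B. _ g}"] by simp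
  qed
  have s_I: "f \<in> sat TZ (\<Theta> K)" if "f \<in> sB" "a \<in> sat TX K" "(\<lambda>z. f z - a (p z)) \<in> sJ" for f a
    unfolding s using that(1) bexI[of "\<lambda>a. (\<lambda>z. f z - a (p z)) \<in> sJ", OF that(3,2)] by blast
  have sIK: "sI \<subseteq> sat TX K" using K(2) unfolding sat_def by blast
  have uJ: "unif_closed TZ sJ" by (rule fun_idealD(1)[OF ext.fun_ideal_I])
  have "fun_ideal TZ sB (sat TZ (\<Theta> K))"
    unfolding fun_ideal_def
  proof (intro conjI ballI)
    show "unif_closed TZ (sat TZ (\<Theta> K))"
      unfolding unif_closed_def
    proof (intro allI impI)
      fix f assume f: "\<forall>e>0. \<exists>g\<in>sat TZ (\<Theta> K). \<forall>x\<in>TZ. cmod (f x - g x) < e"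
      have fB: "f \<in> sB" by (rule unif_closedD[OF fun_algD(1)[OF ext.fun_alg_A]]) (use f s in blast)
      obtain a where a: "a \<in> sA" "(\<lambda>z. f z - a (p z)) \<in> sJ" using dec[OF fB] by blast
      have "a \<in> sat TX K"
      proof (rule unif_closedD[OF fun_idealD(1)[OF K.fun_ideal_I]])
        fix e :: real assume e: "e > 0"
        then have "e / 2 > 0" by simp
        then obtain g where g: "g \<in> sat TZ (\<Theta> K)" "\<forall>x\<in>TZ. cmod (f x - g x) < e / 2" using f by blast
        obtain b where b: "b \<in> sat TX K" "(\<lambda>z. g z - b (p z)) \<in> sJ" using g(1) s by blast
        have ab: "(\<lambda>x. a x - b x) \<in> sA" by (rule fun_alg_diff[OF base.fun_alg_A a(1) fun_idealD(2)[OF K.fun_ideal_I b(1)]])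
        have h: "(\<lambda>z. (g z - b (p z)) - (f z - a (p z))) \<in> sJ" by (rule fun_ideal_diff[OF ext.fun_alg_A ext.fun_ideal_I b(2) a(2)])
        have "\<exists>k\<in>sI. \<forall>x\<in>TX. cmod ((a x - b x) - k x) \<le> e / 2"
        proof (rule nrm_le[OF ab h])
          fix z assume "z \<in> TZ"
          then have "cmod (f z - g z) \<le> e / 2" using g(2) less_imp_le by blast
          then show "cmod (a (p z) - b (p z) - ((g z - b (p z)) - (f z - a (p z)))) \<le> e / 2" by (simp add: algebra_simps)
        qed
        then obtain k where k: "k \<in> sI" "\<forall>x\<in>TX. cmod ((a x - b x) - k x) \<le> e / 2" by blast
        have "(\<lambda>x. b x + k x) \<in> sat TX K" using k(1) sIK by (intro fun_idealD(4)[OF K.fun_ideal_I b(1)]) blast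
        moreover have "cmod (a x - (b x + k x)) < e" if "x \<in> TX" for x
        proof -
          have "cmod ((a x - b x) - k x) \<le> e / 2" using k(2) that by blast
          moreover have "(a x - b x) - k x = a x - (b x + k x)" by simp
          ultimately show ?thesis using e by simp
        qed
        ultimately show "\<exists>g\<in>sat TX K. \<forall>x\<in>TX. cmod (a x - g x) < e" by (intro bexI[of _ "\<lambda>x. b x + k x"] ballI)
      qed
      then show "f \<in> sat TZ (\<Theta> K)" using s fB a(2) by blast
    qed
    show "sat TZ (\<Theta> K) \<subseteq> sB" using s by blast
    have "(\<lambda>z. 0 - (\<lambda>x. 0) (p z)) \<in> sJ" using fun_idealD(3)[OF ext.fun_ideal_I] by simp
    then show "(\<lambda>x. 0) \<in> sat TZ (\<Theta> K)" by (rule s_I[OF fun_algD(2)[OF ext.fun_alg_A] fun_idealD(3)[OF K.fun_ideal_I]])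
    fix f g assume g: "g \<in> sat TZ (\<Theta> K)"
    obtain b where b: "b \<in> sat TX K" "(\<lambda>z. g z - b (p z)) \<in> sJ" using g s by blast
    have gB: "g \<in> sB" using g s by blast
    show "(\<lambda>x. f x + g x) \<in> sat TZ (\<Theta> K)" if f: "f \<in> sat TZ (\<Theta> K)"
    proof -
      obtain a where a: "a \<in> sat TX K" "(\<lambda>z. f z - a (p z)) \<in> sJ" using f s by blast
      have "(\<lambda>z. (f z - a (p z)) + (g z - b (p z))) \<in> sJ" by (rule fun_idealD(4)[OF ext.fun_ideal_I a(2) b(2)])
      then have "(\<lambda>z. (f z + g z) - (\<lambda>x. a x + b x) (p z)) \<in> sJ" by (rule unif_closed_cong[OF uJ]) simp
      moreover have "(\<lambda>x. f x + g x) \<in> sB" using f s by (intro fun_algD(3)[OF ext.fun_alg_A _ gB]) blast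
      ultimately show ?thesis by (intro s_I[OF _ fun_idealD(4)[OF K.fun_ideal_I a(1) b(1)]])
    qed
    show "(\<lambda>x. f x * g x) \<in> sat TZ (\<Theta> K)" if f: "f \<in> sB"
    proof -
      obtain a where a: "a \<in> sA" "(\<lambda>z. f z - a (p z)) \<in> sJ" using dec[OF f] by blast
      have "(\<lambda>z. f z * (g z - b (p z)) + b (p z) * (f z - a (p z))) \<in> sJ"
        by (intro fun_idealD(4)[OF ext.fun_ideal_I] fun_idealD(5)[OF ext.fun_ideal_I f b(2)]
            fun_idealD(5)[OF ext.fun_ideal_I pB[OF fun_idealD(2)[OF K.fun_ideal_I b(1)]] a(2)])
      then have "(\<lambda>z. f z * g z - (\<lambda>x. a x * b x) (p z)) \<in> sJ" by (rule unif_closed_cong[OF uJ]) (simp add: algebra_simps)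
      then show ?thesis by (rule s_I[OF fun_algD(4)[OF ext.fun_alg_A f gB] fun_idealD(5)[OF K.fun_ideal_I a(1) b(1)]])
    qed
  qed
  moreover have "\<Theta> K \<subseteq> mspace (cspace Z)" using ext.X_facts unfolding \<Theta>_def by blast
  ultimately show "closed_ideal Z B (\<Theta> K)" unfolding closed_ideal_iff[OF ext.A] by blast
  have JB: "J \<subseteq> B" using ext.a_subset by (simp add: ext.carrier_R)
  show "J \<subseteq> \<Theta> K"
  proof
    fix g assume g: "g \<in> J"
    have "(\<lambda>z. g z - (\<lambda>x. 0) (p z)) \<in> sJ" using ext.I_sat[OF g] by simp
    moreover have "g \<in> B" using g JB by blast
    ultimately show "g \<in> \<Theta> K" unfolding \<Theta>_def
      by (intro CollectI conjI bexI[of _ "\<lambda>x. 0"] fun_idealD(3)[OF K.fun_ideal_I])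
  qed
  show "\<Phi> (\<Theta> K) = K"
  proof (intro equalityI subsetI)
    fix a assume "a \<in> \<Phi> (\<Theta> K)"
    then obtain b where ab: "a \<in> A" "b \<in> sat TX K" "(\<lambda>z. pullback Z p a z - b (p z)) \<in> sJ" unfolding \<Phi>_def \<Theta>_def by blast
    have "(\<lambda>z. (\<lambda>x. a x - b x) (p z)) \<in> sJ" by (rule unif_closed_cong[OF uJ ab(3)]) (simp add: pullback_def)
    then have "(\<lambda>x. a x - b x) \<in> sI"
      using pJ_iff[OF fun_alg_diff[OF base.fun_alg_A base.A_sat[OF ab(1)] fun_idealD(2)[OF K.fun_ideal_I ab(2)]]] by blast
    then have "(\<lambda>x. b x + (a x - b x)) \<in> sat TX K" using sIK by (intro fun_idealD(4)[OF K.fun_ideal_I ab(2)]) blast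
    then show "a \<in> K" using ab(1) base.A_ext by (auto simp: sat_def extensional_restrict subset_iff)
  next
    fix a assume a: "a \<in> K"
    have aA: "a \<in> A" using a K.a_subset by (auto simp: K.carrier_R)
    have "(\<lambda>z. pullback Z p a z - a (p z)) \<in> sJ"
      by (rule unif_closed_cong[OF uJ fun_idealD(3)[OF ext.fun_ideal_I]]) (simp add: pullback_def)
    then show "a \<in> \<Phi> (\<Theta> K)" unfolding \<Phi>_def \<Theta>_def using aA pb_B[OF aA] K.I_sat[OF a] by blast
  qed
qed

lemma ideal_correspondence:
  "bij_betw \<Phi> {K. closed_ideal Z B K \<and> J \<subseteq> K} {K. closed_ideal X A K \<and> I \<subseteq> K}"
proof (rule bij_betw_imageI)
  show "inj_on \<Phi> {K. closed_ideal Z B K \<and> J \<subseteq> K}"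
    by (rule inj_onI) (use \<Phi>_mono_iff in \<open>simp add: set_eq_subset\<close>)
  show "\<Phi> ` {K. closed_ideal Z B K \<and> J \<subseteq> K} = {K. closed_ideal X A K \<and> I \<subseteq> K}"
  proof (intro equalityI subsetI)
    fix K assume "K \<in> {K. closed_ideal X A K \<and> I \<subseteq> K}"
    then show "K \<in> \<Phi> ` {K. closed_ideal Z B K \<and> J \<subseteq> K}" using \<Theta>[of K] by (intro image_eqI[of _ _ "\<Theta> K"]) auto
  qed (use \<Phi>_closed_ideal in auto)
qed

end

section \<open>The choice of the roots\<close>

text \<open>The balls of radius \<open>1 / (n + 1)\<close> around finite nets, for all
  \<open>n\<close>, form a countable base.\<close>

lemma compact_metrizable_imp_second_countable:
  assumes c: "compact_space Z" and m: "metrizable_space Z"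
  shows "second_countable Z"
proof -
  obtain M d where Md: "Metric_space M d" "Z = Metric_space.mtopology M d"
    using m unfolding metrizable_space_def by blast
  interpret Metric_space M d by (rule Md(1))
  have "\<exists>C. finite C \<and> C \<subseteq> M \<and> M \<subseteq> (\<Union>x\<in>C. mball x (inverse (Suc n)))" for n
  proof -
    have cp: "compactin mtopology M" using c unfolding Md(2) compact_space_def by simp
    have "\<exists>\<F>. finite \<F> \<and> \<F> \<subseteq> (\<lambda>x. mball x (inverse (Suc n))) ` M \<and> M \<subseteq> \<Union>\<F>"
      by (rule compactinD[OF cp]) (use openin_mball in auto)
    then obtain \<F> where \<F>: "finite \<F>" "\<F> \<subseteq> (\<lambda>x. mball x (inverse (Suc n))) ` M" "M \<subseteq> \<Union>\<F>" by blast
    obtain C where "C \<subseteq> M" "finite C" "\<F> = (\<lambda>x. mball x (inverse (Suc n))) ` C" using finite_subset_image[OF \<F>(1,2)] by blast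
    then show ?thesis using \<F>(3) by blast
  qed
  then obtain C where C: "\<And>n. finite (C n)" "\<And>n. M \<subseteq> (\<Union>x\<in>C n. mball x (inverse (Suc n)))" by metis
  define \<B> where "\<B> = (\<Union>n. (\<lambda>x. mball x (inverse (Suc n))) ` C n)"
  show ?thesis unfolding second_countable_def
  proof (intro exI[of _ \<B>] conjI ballI allI impI)
    show "countable \<B>" unfolding \<B>_def using C(1) by (intro countable_UN) (auto intro: countable_finite)
    show "openin Z V" if "V \<in> \<B>" for V using that openin_mball unfolding \<B>_def Md(2) by auto
    fix U x assume "openin Z U \<and> x \<in> U"
    then have U: "openin mtopology U" "x \<in> U" unfolding Md(2) by auto
    then obtain e where e: "e > 0" "mball x e \<subseteq> U" "x \<in> M" unfolding openin_mtopology by blast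
    obtain n where n: "inverse (real (Suc n)) < e / 2" using reals_Archimedean[of "e/2"] e(1) by auto
    obtain c where c: "c \<in> C n" "x \<in> mball c (inverse (Suc n))" using C(2)[of n] e(3) by blast
    have "mball c (inverse (Suc n)) \<subseteq> U"
    proof
      fix z assume z: "z \<in> mball c (inverse (Suc n))"
      have "d x z \<le> d x c + d c z" by (rule triangle) (use z c e in auto)
      also have "\<dots> < e" using z c(2) n by (auto simp: commute)
      finally show "z \<in> U" using e z by auto
    qed
    then show "\<exists>V\<in>\<B>. x \<in> V \<and> V \<subseteq> U" using c unfolding \<B>_def by blast
  qed
qed

text \<open>A dense subset of an ideal need not contain functions equal to \<open>1\<close> near a point, so these are required
  separately.\<close>

definition adequate :: "'a topology \<Rightarrow> ('a \<Rightarrow> complex) set \<Rightarrow> ('a \<Rightarrow> complex) set \<Rightarrow> bool" where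
  "adequate Z Q G \<longleftrightarrow> (\<forall>g\<in>Q. \<forall>e>0. \<exists>f\<in>G. \<forall>z\<in>topspace Z. cmod (g z - f z) < e) \<and>
     (\<forall>y\<in>topspace Z. (\<forall>U. openin Z U \<longrightarrow> y \<in> U \<longrightarrow> (\<exists>g\<in>Q. locunit Z g y U)) \<longrightarrow>
        (\<forall>U. openin Z U \<longrightarrow> y \<in> U \<longrightarrow> (\<exists>f\<in>G. locunit Z f y U)))"

text \<open>One element of \<open>Q\<close> is selected from each satisfiable condition in a
  countable list. \<open>N1\<close> prescribes small balls as targets for finitely many basic sets
  and so controls the uniform distance; \<open>N2\<close> prescribes the exact values 1 on one basic
  set and 0 off another, which approximation alone could not provide.\<close>

lemma adequate_countable:
  assumes Z: "compact_space Z" "second_countable Z" and Q: "\<And>g. g \<in> Q \<Longrightarrow> continuous_map Z euclidean g"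
  shows "\<exists>G\<subseteq>Q. countable G \<and> adequate Z Q G"
proof -
  obtain \<B> where \<B>: "countable \<B>" "\<And>V. V \<in> \<B> \<Longrightarrow> openin Z V" "\<And>U x. openin Z U \<Longrightarrow> x \<in> U \<Longrightarrow> \<exists>V\<in>\<B>. x \<in> V \<and> V \<subseteq> U"
    using Z(2) unfolding second_countable_def by metis
  obtain D :: "complex set" where D: "countable D" "\<And>X. open X \<Longrightarrow> X \<noteq> {} \<Longrightarrow> \<exists>d\<in>D. d \<in> X"
    using countable_dense_exists by blast
  define \<S> where "\<S> = (\<lambda>(q, n). ball q (inverse (real (Suc n)))) ` (D \<times> (UNIV :: nat set))"
  have cS: "countable \<S>" unfolding \<S>_def using D(1) by (intro countable_image countable_SIGMA) auto
  define N1 where "N1 l = {f. \<forall>p\<in>set l. \<forall>z\<in>fst p. f z \<in> snd p}" for l :: "('a set \<times> complex set) list"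
  define N2 where "N2 p = {f :: 'a \<Rightarrow> complex. (\<forall>z\<in>fst p. f z = 1) \<and> (\<forall>z\<in>topspace Z - snd p. f z = 0)}" for p
  define \<N> where "\<N> = N1 ` lists (\<B> \<times> \<S>) \<union> N2 ` (\<B> \<times> \<B>)"
  have cN: "countable \<N>" unfolding \<N>_def using \<B>(1) cS by (intro countable_Un countable_image countable_lists countable_SIGMA) auto
  define G where "G = (\<lambda>N. SOME f. f \<in> N \<inter> Q) ` {N \<in> \<N>. N \<inter> Q \<noteq> {}}"
  have G: "\<exists>f\<in>G. f \<in> N" if "N \<in> \<N>" "g \<in> N" "g \<in> Q" for N g
  proof -
    have "(SOME f. f \<in> N \<inter> Q) \<in> N \<inter> Q" by (rule someI[of _ g]) (use that in blast)
    then show ?thesis unfolding G_def using that by blast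
  qed
  have GQ: "G \<subseteq> Q"
  proof
    fix f assume "f \<in> G"
    then obtain N where "N \<inter> Q \<noteq> {}" "f = (SOME f. f \<in> N \<inter> Q)" unfolding G_def by blast
    then show "f \<in> Q" using someI_ex[of "\<lambda>f. f \<in> N \<inter> Q"] by blast
  qed
  have dense: "\<exists>f\<in>G. \<forall>z\<in>topspace Z. cmod (g z - f z) < e" if g: "g \<in> Q" and e: "e > 0" for g e
  proof -
    obtain n where n: "inverse (real (Suc n)) < e / 2" using reals_Archimedean[of "e/2"] e by auto
    define \<rho> where "\<rho> = inverse (real (Suc n))"
    define \<C> where "\<C> = {V \<in> \<B>. \<exists>q\<in>D. \<forall>z\<in>V. g z \<in> ball q \<rho>}"
    have "\<exists>V\<in>\<C>. x \<in> V" if x: "x \<in> topspace Z" for x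
    proof -
      have "ball (g x) \<rho> \<noteq> {}" unfolding \<rho>_def by simp
      then obtain q where q: "q \<in> D" "q \<in> ball (g x) \<rho>" using D(2)[of "ball (g x) \<rho>"] by blast
      have "openin Z {z \<in> topspace Z. g z \<in> ball q \<rho>}" by (rule openin_continuous_map_preimage[OF Q[OF g]]) simp
      moreover have "x \<in> {z \<in> topspace Z. g z \<in> ball q \<rho>}" using x q(2) by (simp add: dist_commute)
      ultimately obtain V where "V \<in> \<B>" "x \<in> V" "V \<subseteq> {z \<in> topspace Z. g z \<in> ball q \<rho>}" using \<B>(3) by blast
      then show ?thesis unfolding \<C>_def using q(1) by blast
    qed
    then have cov: "topspace Z \<subseteq> \<Union>\<C>" by blast
    have "\<exists>\<F>. finite \<F> \<and> \<F> \<subseteq> \<C> \<and> topspace Z \<subseteq> \<Union>\<F>"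
      by (rule compactinD[OF Z(1)[unfolded compact_space_def] _ cov]) (use \<B>(2) \<C>_def in blast)
    then obtain \<F> where \<F>: "finite \<F>" "\<F> \<subseteq> \<C>" "topspace Z \<subseteq> \<Union>\<F>" by blast
    have "\<forall>V\<in>\<F>. \<exists>q. q \<in> D \<and> (\<forall>z\<in>V. g z \<in> ball q \<rho>)" using \<F>(2) unfolding \<C>_def by blast
    then have "\<exists>q. \<forall>V\<in>\<F>. q V \<in> D \<and> (\<forall>z\<in>V. g z \<in> ball (q V) \<rho>)" by (rule bchoice)
    then obtain q where q: "\<And>V. V \<in> \<F> \<Longrightarrow> q V \<in> D" "\<And>V z. V \<in> \<F> \<Longrightarrow> z \<in> V \<Longrightarrow> g z \<in> ball (q V) \<rho>" by blast
    obtain L where L: "set L = \<F>" using finite_list[OF \<F>(1)] by blast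
    define l where "l = map (\<lambda>V. (V, ball (q V) \<rho>)) L"
    have "ball (q V) \<rho> \<in> \<S>" if "V \<in> \<F>" for V unfolding \<S>_def \<rho>_def using q(1)[OF that] by force
    then have "l \<in> lists (\<B> \<times> \<S>)" unfolding l_def using L \<F>(2) \<C>_def by auto
    then have "N1 l \<in> \<N>" unfolding \<N>_def by blast
    moreover have "g \<in> N1 l" unfolding N1_def l_def using q(2) L by auto
    ultimately obtain f where f: "f \<in> G" "f \<in> N1 l" using G g by blast
    have "cmod (g z - f z) < e" if z: "z \<in> topspace Z" for z
    proof -
      obtain V where V: "V \<in> \<F>" "z \<in> V" using \<F>(3) z by blast
      have "f z \<in> ball (q V) \<rho>" using f(2) V L unfolding N1_def l_def by auto
      moreover have "g z \<in> ball (q V) \<rho>" by (rule q(2)[OF V])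
      ultimately have "dist (g z) (f z) < \<rho> + \<rho>" by (metis dist_commute dist_triangle_less_add mem_ball)
      then show ?thesis using n unfolding \<rho>_def by (simp add: dist_norm)
    qed
    then show ?thesis using f(1) by blast
  qed
  have unit: "\<exists>f\<in>G. locunit Z f y U"
    if y: "\<forall>U. openin Z U \<longrightarrow> y \<in> U \<longrightarrow> (\<exists>g\<in>Q. locunit Z g y U)" and U: "openin Z U" "y \<in> U" for y U
  proof -
    obtain B where B: "B \<in> \<B>" "y \<in> B" "B \<subseteq> U" using \<B>(3)[OF U] by blast
    obtain g where g: "g \<in> Q" "locunit Z g y B" using y \<B>(2)[OF B(1)] B(2) by blast
    obtain V where V: "openin Z V" "y \<in> V" "\<forall>z\<in>V. g z = 1" using g(2) unfolding locunit_def by blast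
    obtain C where C: "C \<in> \<B>" "y \<in> C" "C \<subseteq> V" using \<B>(3)[OF V(1,2)] by blast
    have "g \<in> N2 (C, B)" using g(2) V(3) C(3) unfolding N2_def locunit_def by auto
    moreover have "N2 (C, B) \<in> \<N>" unfolding \<N>_def using B(1) C(1) by blast
    ultimately obtain f where f: "f \<in> G" "f \<in> N2 (C, B)" using G g(1) by blast
    have "locunit Z f y U"
      unfolding locunit_def using f(2) \<B>(2)[OF C(1)] C(2) B(3) unfolding N2_def by auto
    then show ?thesis using f(1) by blast
  qed
  have "countable G" unfolding G_def using cN by (intro countable_image countable_Collect)
  moreover have "adequate Z Q G" unfolding adequate_def using dense unit by blast
  ultimately show ?thesis using GQ by blast
qed

lemma adequate_mono: "adequate Z Q G \<Longrightarrow> G \<subseteq> H \<Longrightarrow> adequate Z Q H"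
  unfolding adequate_def by (meson subsetD)

text \<open>The flag of a leaf tells a base function from the index of a root. For a divergent
  sequence \<open>lim\<close> is arbitrary, but the terms produced below describe convergent
  ones.\<close>

primrec tr_eval :: "(('a \<Rightarrow> complex) \<times> bool) alg_term \<Rightarrow> 'a \<times> (('a \<Rightarrow> complex) \<Rightarrow> complex) \<Rightarrow> complex" where
  "tr_eval (Bs k) = (\<lambda>y. if snd k then fst k (fst y) else snd y (fst k))"
| "tr_eval (Ad s t) = (\<lambda>y. tr_eval s y + tr_eval t y)"
| "tr_eval (Ml s t) = (\<lambda>y. tr_eval s y * tr_eval t y)"
| "tr_eval (Lm s) = (\<lambda>y. lim (\<lambda>n. tr_eval (s n) y))"

text \<open>Sequences suffice for uniform limits, with errors \<open>1 / (n + 1)\<close>; a constant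
  is a leaf carrying a constant base function.\<close>

lemma gen_tr_eval:
  fixes Y :: "('a \<times> (('a \<Rightarrow> complex) \<Rightarrow> complex)) set"
  assumes "f \<in> gen Y ((\<lambda>a y. a (fst y)) ` P \<union> (\<lambda>w y. snd y w) ` W)"
  shows "\<exists>t. \<forall>y\<in>Y. f y = tr_eval t y"
  using assms
proof (induction rule: gen.induct)
  case (gen_base f)
  then consider a where "f = (\<lambda>y. a (fst y))" | w where "f = (\<lambda>y. snd y w)" by blast
  then show ?case
  proof cases
    case 1 then show ?thesis by (intro exI[of _ "Bs (a, True)"]) simp
  next
    case 2 then show ?thesis by (intro exI[of _ "Bs (w, False)"]) simp
  qed
next
  case (gen_const c)
  show ?case by (intro exI[of _ "Bs (\<lambda>_. c, True)"]) simp
next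
  case (gen_add f g)
  then obtain s t where "\<forall>y\<in>Y. f y = tr_eval s y" "\<forall>y\<in>Y. g y = tr_eval t y" by blast
  then show ?case by (intro exI[of _ "Ad s t"]) simp
next
  case (gen_mult f g)
  then obtain s t where "\<forall>y\<in>Y. f y = tr_eval s y" "\<forall>y\<in>Y. g y = tr_eval t y" by blast
  then show ?case by (intro exI[of _ "Ml s t"]) simp
next
  case (gen_lim f)
  have "\<exists>t. \<forall>y\<in>Y. cmod (f y - tr_eval t y) < inverse (Suc n)" for n
  proof -
    have "inverse (real (Suc n)) > 0" by simp
    from gen_lim[OF this] obtain g t where "\<forall>y\<in>Y. g y = tr_eval t y" "\<forall>y\<in>Y. cmod (f y - g y) < inverse (Suc n)" by blast
    then show ?thesis by (intro exI[of _ t]) auto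
  qed
  then obtain t where t: "\<And>n y. y \<in> Y \<Longrightarrow> cmod (f y - tr_eval (t n) y) < inverse (Suc n)" by metis
  have "f y = tr_eval (Lm t) y" if y: "y \<in> Y" for y
  proof -
    have "(\<lambda>n. tr_eval (t n) y - f y) \<longlonglongrightarrow> 0"
    proof (rule Lim_null_comparison[OF _ LIMSEQ_inverse_real_of_nat])
      show "\<forall>\<^sub>F n in sequentially. norm (tr_eval (t n) y - f y) \<le> inverse (real (Suc n))"
        using t[OF y] by (auto simp: norm_minus_commute intro!: always_eventually less_imp_le)
    qed
    then have "(\<lambda>n. tr_eval (t n) y) \<longlonglongrightarrow> f y" by (rule LIM_zero_cancel)
    then show ?thesis by (simp add: limI)
  qed
  then show ?case by blast
qed

text \<open>Bounds the size of the algebra of a stage independently of how many roots have been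
  adjoined; this keeps the type of indices fixed along the tower.\<close>

lemma gen_inj:
  fixes Y :: "('a \<times> (('a \<Rightarrow> complex) \<Rightarrow> complex)) set"
  shows "\<exists>e :: _ \<Rightarrow> ('a \<Rightarrow> complex). inj_on e (gen Y ((\<lambda>a y. a (fst y)) ` P \<union> (\<lambda>w y. snd y w) ` W) \<inter> extensional Y)"
proof -
  let ?G = "gen Y ((\<lambda>a y. a (fst y)) ` P \<union> (\<lambda>w y. snd y w) ` W)"
  obtain e :: "(('a \<Rightarrow> complex) \<times> bool) alg_term \<Rightarrow> ('a \<Rightarrow> complex)" where e: "inj e" by (rule alg_term_inj)
  have "\<forall>f\<in>?G. \<exists>t. \<forall>y\<in>Y. f y = tr_eval t y" using gen_tr_eval by blast
  then have "\<exists>t. \<forall>f\<in>?G. \<forall>y\<in>Y. f y = tr_eval (t f) y" by (rule bchoice)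
  then obtain t where t: "\<forall>f\<in>?G. \<forall>y\<in>Y. f y = tr_eval (t f) y" ..
  have "inj_on (\<lambda>f. e (t f)) (?G \<inter> extensional Y)"
  proof (rule inj_onI)
    fix f g assume fg: "f \<in> ?G \<inter> extensional Y" "g \<in> ?G \<inter> extensional Y" "e (t f) = e (t g)"
    then have "t f = t g" using e by (simp add: inj_eq)
    have "f y = g y" if y: "y \<in> Y" for y
    proof -
      have "f y = tr_eval (t f) y" "g y = tr_eval (t g) y" using t fg(1,2) y by blast+
      then show ?thesis by (simp only: \<open>t f = t g\<close>)
    qed
    then show "f = g" using fg extensionalityI[of f Y g] by blast
  qed
  then show ?thesis by blast
qed

text \<open>\<open>H\<close> reads its argument only below \<alpha>, so the truncation performed by
  \<open>wfrec\<close> does not affect it.\<close>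

lemma recursive_choice:
  assumes "wf R" and H: "\<And>F G \<alpha>. (\<And>\<beta>. (\<beta>, \<alpha>) \<in> R \<Longrightarrow> F \<beta> = G \<beta>) \<Longrightarrow> H F \<alpha> = H G \<alpha>"
  shows "\<exists>F. \<forall>\<alpha>. F \<alpha> = H F \<alpha>"
proof (intro exI allI)
  fix \<alpha>
  have "wfrec R H \<alpha> = H (cut (wfrec R H) R \<alpha>) \<alpha>" by (rule wfrec[OF assms(1)])
  also have "\<dots> = H (wfrec R H) \<alpha>" by (rule H) (simp add: cut_apply)
  finally show "wfrec R H \<alpha> = H (wfrec R H) \<alpha>" .
qed

definition enc :: "'f set \<Rightarrow> 'f \<Rightarrow> 'w" where "enc S = (SOME e. inj_on e S)"

lemma enc_inj: "(\<exists>e :: 'f \<Rightarrow> 'w. inj_on e S) \<Longrightarrow> inj_on (enc S :: 'f \<Rightarrow> 'w) S"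
proof -
  assume "\<exists>e :: 'f \<Rightarrow> 'w. inj_on e S"
  from someI_ex[OF this] show ?thesis unfolding enc_def .
qed

text \<open>The code at \<beta> depends on \<open>F \<beta>\<close> alone, so index set and space of
  a stage depend only on the families before it, as the recursion demands. The stage component
  separates equal codes from different stages.\<close>

definition stage_code :: "('i \<times> 'w \<Rightarrow> 'w) \<Rightarrow> ('i \<Rightarrow> 'f set) \<Rightarrow> 'i \<Rightarrow> 'f \<Rightarrow> 'w" where
  "stage_code pr F \<beta> f = pr (\<beta>, enc (F \<beta>) f)"

definition tower_top :: "'a topology \<Rightarrow> 'i rel \<Rightarrow> ('i \<Rightarrow> ('a \<times> ('w \<Rightarrow> complex) \<Rightarrow> complex) \<Rightarrow> 'w) \<Rightarrow>
    ('i \<Rightarrow> ('a \<times> ('w \<Rightarrow> complex) \<Rightarrow> complex) set) \<Rightarrow> 'i \<Rightarrow> ('a \<times> ('w \<Rightarrow> complex)) topology" where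
  "tower_top X r code F \<alpha> = subtopology (prod_topology X (product_topology (\<lambda>_. euclidean) (tower_index r code F \<alpha>))) (tower_set (topspace X) r code F \<alpha>)"

lemma tower_index_cong:
  assumes "\<And>\<beta>. \<beta> \<in> underS r \<alpha> \<Longrightarrow> F \<beta> = G \<beta>"
  shows "tower_index r (stage_code pr F) F \<alpha> = tower_index r (stage_code pr G) G \<alpha>"
  using assms unfolding tower_index_def stage_code_def by (metis (no_types, lifting))

lemma tower_set_cong:
  assumes r: "trans r" "antisym r" and eq: "\<And>\<beta>. \<beta> \<in> underS r \<alpha> \<Longrightarrow> F \<beta> = G \<beta>"
  shows "tower_set X r (stage_code pr F) F \<alpha> = tower_set X r (stage_code pr G) G \<alpha>"
proof -
  have w: "tower_index r (stage_code pr F) F \<beta> = tower_index r (stage_code pr G) G \<beta>" if b: "\<beta> \<in> underS r \<alpha>" for \<beta>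
  proof (rule tower_index_cong)
    fix \<gamma> assume "\<gamma> \<in> underS r \<beta>"
    then have "\<gamma> \<in> underS r \<alpha>" using r b unfolding underS_def by (auto dest: transD antisymD)
    then show "F \<gamma> = G \<gamma>" by (rule eq)
  qed
  have "tower_index r (stage_code pr F) F \<alpha> = tower_index r (stage_code pr G) G \<alpha>" by (rule tower_index_cong[OF eq])
  then show ?thesis unfolding tower_set_def using w eq by (simp add: stage_code_def cong: conj_cong)
qed

text \<open>\<open>pick\<close> sees the space, the ideal and the index set of a stage, all of them
  determined by earlier choices, so the families arise by recursion. The codes are injective because
  a family lies in the algebra of its stage, which \<open>gen_inj\<close> embeds into the index
  type.\<close>

lemma tower_choice:
  fixes X :: "'a topology" and r :: "nat set rel"
    and pick :: "('a \<times> (('a \<Rightarrow> complex) \<Rightarrow> complex)) topology \<Rightarrow> (_ \<Rightarrow> complex) set \<Rightarrow> ('a \<Rightarrow> complex) set \<Rightarrow> (_ \<Rightarrow> complex) set"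
  assumes A: "uniform_algebra X A" and I: "closed_ideal X A I" and wo: "Well_order r"
    and \<tau>: "\<tau> \<in> Field r" "\<And>\<alpha>. \<alpha> \<in> Field r \<Longrightarrow> (\<alpha>, \<tau>) \<in> r"
    and pick: "\<And>Z Q W. (\<lambda>y. 0) \<in> Q \<Longrightarrow> unif_closed (topspace Z) Q \<Longrightarrow> pick Z Q W \<noteq> {} \<and> pick Z Q W \<subseteq> Q \<inter> extensional (topspace Z)"
  shows "\<exists>F code. root_tower X A I r \<tau> F code \<and>
    (\<forall>\<alpha>. F \<alpha> = pick (tower_top X r code F \<alpha>) (tower_ideal (topspace X) (sat (topspace X) A) (sat (topspace X) I) r code F \<alpha>) (tower_index r code F \<alpha>))"
proof -
  obtain pr :: "nat set \<times> ('a \<Rightarrow> complex) \<Rightarrow> ('a \<Rightarrow> complex)" where pr: "inj pr" by (rule pair_inj)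
  let ?T = "topspace X" let ?A = "sat ?T A" let ?I = "sat ?T I"
  define H where "H F \<alpha> = pick (tower_top X r (stage_code pr F) F \<alpha>) (tower_ideal ?T ?A ?I r (stage_code pr F) F \<alpha>) (tower_index r (stage_code pr F) F \<alpha>)" for F \<alpha>
  have r: "trans r" "antisym r" and wf: "wf (r - Id)"
    using wo unfolding well_order_on_def linear_order_on_def partial_order_on_def preorder_on_def by auto
  have "\<exists>F. \<forall>\<alpha>. F \<alpha> = H F \<alpha>"
  proof (rule recursive_choice[OF wf])
    fix F G :: "nat set \<Rightarrow> ('a \<times> (('a \<Rightarrow> complex) \<Rightarrow> complex) \<Rightarrow> complex) set" and \<alpha>
    assume eq: "\<And>\<beta>. (\<beta>, \<alpha>) \<in> r - Id \<Longrightarrow> F \<beta> = G \<beta>"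
    then have eq': "F \<beta> = G \<beta>" if "\<beta> \<in> underS r \<alpha>" for \<beta> using that unfolding underS_def by auto
    have "tower_index r (stage_code pr F) F \<alpha> = tower_index r (stage_code pr G) G \<alpha>" by (rule tower_index_cong[OF eq'])
    moreover have "tower_set ?T r (stage_code pr F) F \<alpha> = tower_set ?T r (stage_code pr G) G \<alpha>" by (rule tower_set_cong[OF r eq'])
    ultimately show "H F \<alpha> = H G \<alpha>" unfolding H_def tower_top_def tower_ideal_def tower_alg_def by simp
  qed
  then obtain F where F: "\<And>\<alpha>. F \<alpha> = H F \<alpha>" by blast
  define code where "code = stage_code pr F"
  have F': "F \<alpha> = pick (tower_top X r code F \<alpha>) (tower_ideal ?T ?A ?I r code F \<alpha>) (tower_index r code F \<alpha>)" for \<alpha>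
    using F[of \<alpha>] unfolding H_def code_def .
  have top: "topspace (tower_top X r code F \<alpha>) = tower_set ?T r code F \<alpha>" for \<alpha>
    unfolding tower_top_def by (auto simp: tower_set_def PiE_def)
  have root_family: "F \<alpha> \<noteq> {} \<and> F \<alpha> \<subseteq> tower_ideal ?T ?A ?I r code F \<alpha> \<inter> extensional (tower_set ?T r code F \<alpha>)" for \<alpha>
  proof -
    have "(\<lambda>y. 0) \<in> tower_ideal ?T ?A ?I r code F \<alpha>" unfolding tower_ideal_def by (rule igen_zero)
    moreover have "unif_closed (topspace (tower_top X r code F \<alpha>)) (tower_ideal ?T ?A ?I r code F \<alpha>)" unfolding top tower_ideal_def by (rule unif_closed_igen)
    ultimately show ?thesis using pick[of "tower_ideal ?T ?A ?I r code F \<alpha>" "tower_top X r code F \<alpha>" "tower_index r code F \<alpha>"] unfolding F'[symmetric] top by blast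
  qed
  have FF1: "F \<alpha> \<subseteq> tower_ideal ?T ?A ?I r code F \<alpha>" and FF2: "F \<alpha> \<subseteq> extensional (tower_set ?T r code F \<alpha>)" and FF3: "F \<alpha> \<noteq> {}" for \<alpha>
    using root_family[of \<alpha>] by simp_all
  have fA: "fun_alg ?T ?A" using A unfolding uniform_algebra_iff by blast
  have fI: "fun_ideal ?T ?A ?I" using I closed_ideal_iff[OF A] by blast
  have sub: "tower_ideal ?T ?A ?I r code F \<alpha> \<subseteq> tower_alg ?T ?A r code F \<alpha>" for \<alpha>
  proof
    fix f assume "f \<in> tower_ideal ?T ?A ?I r code F \<alpha>"
    then show "f \<in> tower_alg ?T ?A r code F \<alpha>"
      unfolding tower_ideal_def
    proof (induction rule: igen.induct)
      case (igen_base f)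
      then show ?case unfolding tower_alg_def using fun_idealD(2)[OF fI] by (intro gen_base) blast
    next
      case igen_zero show ?case unfolding tower_alg_def by (rule gen_const)
    next
      case (igen_add f g) then show ?case unfolding tower_alg_def using gen_add by blast
    next
      case (igen_mult f g) then show ?case unfolding tower_alg_def using gen_mult by blast
    next
      case (igen_lim f)
      show ?case unfolding tower_alg_def by (rule gen_lim) (use igen_lim in \<open>unfold tower_alg_def, blast\<close>)
    qed
  qed
  have inj: "inj_on (enc (F \<beta>) :: _ \<Rightarrow> 'a \<Rightarrow> complex) (F \<beta>)" for \<beta>
  proof (rule enc_inj)
    obtain e :: "_ \<Rightarrow> ('a \<Rightarrow> complex)" where "inj_on e (tower_alg ?T ?A r code F \<beta> \<inter> extensional (tower_set ?T r code F \<beta>))"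
      using gen_inj unfolding tower_alg_def by blast
    then have "inj_on e (F \<beta>)" by (rule inj_on_subset) (use root_family sub in blast)
    then show "\<exists>e :: _ \<Rightarrow> ('a \<Rightarrow> complex). inj_on e (F \<beta>)" by blast
  qed
  have tower_index: "tower ?T ?A ?I r \<tau> F code"
  proof (rule tower.intro[OF fA fI wo \<tau>(1) \<tau>(2)])
    fix \<beta> \<gamma> f g assume fg: "f \<in> F \<beta>" "g \<in> F \<gamma>" "code \<beta> f = code \<gamma> g"
    then have "(\<beta>, enc (F \<beta>) f :: 'a \<Rightarrow> complex) = (\<gamma>, enc (F \<gamma>) g)" using pr unfolding code_def stage_code_def by (simp only: inj_eq)
    then show "\<beta> = \<gamma> \<and> f = g" using inj[of \<beta>] fg(1,2) by (auto dest: inj_onD)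
  qed (assumption | rule FF1)+
  have "root_tower X A I r \<tau> F code"
    by (rule root_tower.intro[OF A I tower_index]) (rule FF2 FF3)+
  then show ?thesis using F' by blast
qed

section \<open>The limit of the tower\<close>

lemma openin_gt: assumes "continuous_map Z euclidean f" shows "openin Z {z\<in>topspace Z. cmod (f z) > c}"
proof -
  have "open {w :: complex. cmod w > c}" by (intro open_Collect_less continuous_intros)
  then have "openin euclidean {w :: complex. cmod w > c}" by (rule open_openin[THEN iffD1])
  from openin_continuous_map_preimage[OF assms this] show ?thesis by simp
qed

lemma (in root_tower) tower_top_TT: "tower_top X r code F \<alpha> = TT \<alpha>"
  unfolding tower_top_def TT_def PT_def ..

text \<open>\<open>F_root\<close> puts the roots adjoined so far among the later radicands, so that
  roots have roots. \<open>F_adequate\<close> is what both the full ideal and a suitable countable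
  part of it satisfy, so the two constructions are treated together.\<close>

locale good_tower = root_tower X A I r \<tau> F code
  for X :: "'a topology" and A I and r :: "'i rel" and \<tau> and F :: "'i \<Rightarrow> ('a \<times> ('w \<Rightarrow> complex) \<Rightarrow> complex) set" and code +
  assumes no_max: "\<And>\<beta>. \<beta> \<in> underS r \<tau> \<Longrightarrow> \<exists>\<delta>\<in>underS r \<tau>. \<beta> \<in> underS r \<delta>"
    and inf: "infinite (Field r)"
    and F_root: "\<And>\<beta> w. \<beta> \<in> underS r \<tau> \<Longrightarrow> w \<in> tower_index r code F \<beta> \<Longrightarrow>
      restrict (\<lambda>y. snd y w) (tower_set (topspace X) r code F \<beta>) \<in> F \<beta>"
    and F_adequate: "\<And>\<beta>. \<beta> \<in> underS r \<tau> \<Longrightarrow> adequate (tower_top X r code F \<beta>)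
      (tower_ideal (topspace X) (sat (topspace X) A) (sat (topspace X) I) r code F \<beta>) (F \<beta>)"
begin

lemma ne: "underS r \<tau> \<noteq> {}"
proof
  assume "underS r \<tau> = {}"
  then have "Field r \<subseteq> {\<tau>}" using \<tau>_max unfolding underS_def by blast
  then show False using inf finite_subset by blast
qed

lemma limit: "f \<in> AA \<tau> \<Longrightarrow> e > 0 \<Longrightarrow> \<exists>\<alpha>\<in>underS r \<tau>. \<exists>h\<in>AA \<alpha>. \<forall>y\<in>Y \<tau>. cmod (f y - h (trunc \<alpha> y)) < e"
  by (rule AA_limit[OF no_max ne \<tau>])

lemma II_sub: "\<alpha> \<in> Field r \<Longrightarrow> f \<in> II \<alpha> \<Longrightarrow> f \<in> AA \<alpha>"
  by (rule fun_idealD(2)[OF II_fun_ideal])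

definition root_family :: "('a \<times> ('w \<Rightarrow> complex) \<Rightarrow> complex) set" where
  "root_family = (\<Union>\<beta>\<in>underS r \<tau>. (\<lambda>f. pullback (TT \<tau>) (trunc \<beta>) f) ` F \<beta>)"

lemma root_family_I: "\<beta> \<in> underS r \<tau> \<Longrightarrow> f \<in> F \<beta> \<Longrightarrow> pullback (TT \<tau>) (trunc \<beta>) f \<in> root_family"
  unfolding root_family_def by blast

lemma root_family_E: assumes "g \<in> root_family" obtains \<beta> f where "\<beta> \<in> underS r \<tau>" "f \<in> F \<beta>" "g = pullback (TT \<tau>) (trunc \<beta>) f"
  using assms unfolding root_family_def by blast

lemma pb_apply: "y \<in> Y \<tau> \<Longrightarrow> pullback (TT \<tau>) (trunc \<beta>) f y = f (trunc \<beta> y)"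
  by (simp add: pullback_def)

lemma root_family_Is: "root_family \<subseteq> Is \<tau>"
proof
  fix g assume "g \<in> root_family"
  then obtain \<beta> f where b: "\<beta> \<in> underS r \<tau>" "f \<in> F \<beta>" "g = pullback (TT \<tau>) (trunc \<beta>) f" by (rule root_family_E)
  have r: "(\<beta>, \<tau>) \<in> r" using b(1) unfolding underS_iff by blast
  have "f \<in> II \<beta>" using F_sub[OF b(1)] b(2) by blast
  then have "(\<lambda>y. f (trunc \<beta> y)) \<in> II \<tau>" by (rule II_mono[OF _ r])
  then have "restrict (\<lambda>y. f (trunc \<beta> y)) (Y \<tau>) \<in> II \<tau>" using unif_closed_restrict[OF fun_idealD(1)[OF II_fun_ideal[OF \<tau>]]] by blast
  then show "g \<in> Is \<tau>" unfolding b(3) Is_def pullback_def by (simp add: comp_def)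
qed

text \<open>The root of a radicand of stage \<beta> is a coordinate at some later stage \<delta>;
  \<open>F_root\<close> makes it a radicand there, hence a member of the family.\<close>

lemma root_family_root: assumes "g \<in> root_family" shows "\<exists>h\<in>root_family. \<forall>z\<in>topspace (TT \<tau>). (h z)\<^sup>2 = g z"
proof -
  obtain \<beta> f where b: "\<beta> \<in> underS r \<tau>" "f \<in> F \<beta>" "g = pullback (TT \<tau>) (trunc \<beta>) f" using assms by (rule root_family_E)
  obtain \<delta> where d: "\<delta> \<in> underS r \<tau>" "\<beta> \<in> underS r \<delta>" using no_max[OF b(1)] by blast
  have w: "code \<beta> f \<in> W \<delta>" using d(2) b(2) unfolding W_iff by blast
  have rd: "(\<delta>, \<tau>) \<in> r" using d(1) unfolding underS_iff by blast
  define h where "h = pullback (TT \<tau>) (trunc \<delta>) (restrict (\<lambda>y. snd y (code \<beta> f)) (Y \<delta>))"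
  have "h \<in> root_family" unfolding h_def by (rule root_family_I[OF d(1) F_root[OF d(1) w]])
  moreover have "(h z)\<^sup>2 = g z" if z: "z \<in> Y \<tau>" for z
  proof -
    have "h z = snd (trunc \<delta> z) (code \<beta> f)" unfolding h_def using z pm_Y[OF z rd] by (simp add: pb_apply)
    also have "\<dots> = snd z (code \<beta> f)" by (rule snd_pm_code[OF d(2) b(2)])
    finally show ?thesis using z b unfolding Y_iff by (simp add: pb_apply[OF z])
  qed
  ultimately show ?thesis by (intro bexI[of _ h]) simp_all
qed

text \<open>A function near \<open>g\<close> from an earlier stage need not lie in the ideal of that
  stage. Its base part \<open>a\<close> is within \<open>e / 2\<close> of the top ideal, hence by
  \<open>quotient_norm\<close> within \<open>e / 2\<close> of \<open>I\<close>; replacing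
  \<open>a\<close> by an element of \<open>I\<close> repairs the defect at the cost of another
  \<open>e / 2\<close>.\<close>

lemma dense_below:
  assumes g: "g \<in> II \<tau>" and e: "e > 0"
  shows "\<exists>\<alpha>\<in>underS r \<tau>. \<exists>h\<in>II \<alpha>. \<forall>y\<in>Y \<tau>. cmod (g y - h (trunc \<alpha> y)) \<le> e"
proof -
  obtain \<alpha> h where h: "\<alpha> \<in> underS r \<tau>" "h \<in> AA \<alpha>" "\<forall>y\<in>Y \<tau>. cmod (g y - h (trunc \<alpha> y)) < e / 2"
    using limit[OF II_sub[OF \<tau> g], of "e / 2"] e by auto
  have \<alpha>: "\<alpha> \<in> Field r" "(\<alpha>, \<tau>) \<in> r" using underS_Field[OF h(1)] h(1) unfolding underS_iff by auto
  obtain a where a: "a \<in> sat (topspace X) A" "(\<lambda>y. h y - a (fst y)) \<in> II \<alpha>" using quotient_surj[OF \<alpha>(1) h(2)] by blast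
  have "(\<lambda>y. h (trunc \<alpha> y) - a (fst (trunc \<alpha> y))) \<in> II \<tau>" by (rule II_mono[OF a(2) \<alpha>(2)])
  then have i: "(\<lambda>y. h (trunc \<alpha> y) - a (fst y)) \<in> II \<tau>" by simp
  have j: "(\<lambda>y. g y - (h (trunc \<alpha> y) - a (fst y))) \<in> II \<tau>" by (rule fun_ideal_diff[OF AA_fun_alg[OF \<tau>] II_fun_ideal[OF \<tau>] g i])
  have "\<exists>k\<in>sat (topspace X) I. \<forall>x\<in>topspace X. cmod (a x - k x) \<le> e / 2"
  proof (rule quotient_norm[OF \<tau> a(1) j])
    fix y assume "y \<in> Y \<tau>"
    then have "cmod (g y - h (trunc \<alpha> y)) < e / 2" using h(3) by blast
    then show "cmod (a (fst y) - (g y - (h (trunc \<alpha> y) - a (fst y)))) \<le> e / 2" by (simp add: norm_minus_commute)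
  qed
  then obtain k where k: "k \<in> sat (topspace X) I" "\<forall>x\<in>topspace X. cmod (a x - k x) \<le> e / 2" by blast
  have "(\<lambda>y. (h y - a (fst y)) + k (fst y)) \<in> II \<alpha>" by (rule fun_idealD(4)[OF II_fun_ideal[OF \<alpha>(1)] a(2) II_pi[OF k(1)]])
  moreover have "cmod (g y - ((h (trunc \<alpha> y) - a (fst (trunc \<alpha> y))) + k (fst (trunc \<alpha> y)))) \<le> e" if y: "y \<in> Y \<tau>" for y
  proof -
    have "fst y \<in> topspace X" using y unfolding Y_iff by blast
    then have "cmod (a (fst y) - k (fst y)) \<le> e / 2" using k(2) by blast
    moreover have "cmod (g y - h (trunc \<alpha> y)) < e / 2" using h(3) y by blast
    moreover have "cmod (g y - ((h (trunc \<alpha> y) - a (fst y)) + k (fst y))) \<le> cmod (g y - h (trunc \<alpha> y)) + cmod (a (fst y) - k (fst y))"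
      using norm_triangle_ineq[of "g y - h (trunc \<alpha> y)" "a (fst y) - k (fst y)"] by (simp add: algebra_simps)
    ultimately show ?thesis by simp
  qed
  ultimately show ?thesis using h(1) by (intro bexI[of _ \<alpha>] bexI[of _ "\<lambda>y. (h y - a (fst y)) + k (fst y)"]) auto
qed

lemma root_family_dense: "Is \<tau> \<subseteq> mtopology_of (cspace (TT \<tau>)) closure_of root_family"
proof
  fix g assume g: "g \<in> Is \<tau>"
  have sub: "Is \<tau> \<subseteq> mspace (cspace (TT \<tau>))"
    using Is_closed_ideal[OF \<tau>] closed_ideal_iff[OF As_uniform[OF \<tau>]] by blast
  show "g \<in> mtopology_of (cspace (TT \<tau>)) closure_of root_family"
    unfolding closure_cspace[OF TT_compact[OF \<tau>] order_trans[OF root_family_Is sub]]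
  proof (intro conjI allI impI)
    show "g \<in> mspace (cspace (TT \<tau>))" using g sub by blast
    fix e :: real assume e: "e > 0"
    have "g \<in> II \<tau>" using g unfolding Is_def by blast
    from dense_below[OF this, of "e / 2"] e obtain \<alpha> h where
      h: "\<alpha> \<in> underS r \<tau>" "h \<in> II \<alpha>" "\<forall>y\<in>Y \<tau>. cmod (g y - h (trunc \<alpha> y)) \<le> e / 2" by auto
    obtain f where f: "f \<in> F \<alpha>" "\<forall>z\<in>topspace (TT \<alpha>). cmod (h z - f z) < e / 2"
      using F_adequate[OF h(1)] h(2) e unfolding adequate_def tower_top_TT by (meson half_gt_zero)
    have r: "(\<alpha>, \<tau>) \<in> r" using h(1) unfolding underS_iff by blast
    have "\<forall>x\<in>topspace (TT \<tau>). cmod (g x - pullback (TT \<tau>) (trunc \<alpha>) f x) < e"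
    proof
      fix x assume "x \<in> topspace (TT \<tau>)"
      then have x: "x \<in> Y \<tau>" by simp
      have "cmod (h (trunc \<alpha> x) - f (trunc \<alpha> x)) < e / 2" using f(2) pm_Y[OF x r] by simp
      moreover have "cmod (g x - h (trunc \<alpha> x)) \<le> e / 2" using h(3) x by blast
      ultimately show "cmod (g x - pullback (TT \<tau>) (trunc \<alpha>) f x) < e"
        unfolding pb_apply[OF x] using norm_triangle_ineq[of "g x - h (trunc \<alpha> x)" "h (trunc \<alpha> x) - f (trunc \<alpha> x)"] by simp
    qed
    then show "\<exists>f\<in>root_family. \<forall>x\<in>topspace (TT \<tau>). cmod (g x - f x) < e" using root_family_I[OF h(1) f(1)] by blast
  qed
qed

text \<open>The unit must come from a family \<open>F \<alpha>\<close>, whose members have all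
  iterated roots. So the neighbourhood is first shrunk to one defined at an earlier stage; there the
  ideal contains units because some function of \<open>I\<close> is nonzero at the base point, and
  \<open>F_adequate\<close> provides one in the family. Repeated roots then lower its norm.\<close>

lemma unit:
  assumes nrm: "normal_algebra X A" and y: "y \<in> Y \<tau>" "fst y \<notin> hull_of X I" and U: "openin (TT \<tau>) U" "y \<in> U"
  shows "\<exists>h\<in>AA \<tau>. locunit (TT \<tau>) h y U \<and> (\<forall>z\<in>topspace (TT \<tau>). cmod (h z) \<le> 3/2)"
proof -
  note reg = locreg_AA[OF normal_imp_locreg[OF nrm]]
  have xX: "fst y \<in> topspace X" using y(1) unfolding Y_iff by blast
  obtain k where k: "k \<in> I" "k (fst y) \<noteq> 0" using y(2) xX unfolding hull_of_def by blast
  have ksat: "k \<in> sat (topspace X) I"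
    using sat_ext[OF _ k(1)] X_props(4) mspace_cspace_iff[OF X_props(1)] by blast
  obtain h0 where h0: "h0 \<in> AA \<tau>" "locunit (TT \<tau>) h0 y U" using reg[OF \<tau>] U unfolding locreg_def by blast
  \<comment> \<open>Error \<open>1/4\<close> separates values: \<open>|h|\<close> exceeds
    \<open>3/4\<close> at \<open>y\<close> and is below \<open>1/4\<close> off \<open>U\<close>, so
    the threshold \<open>1/2\<close> defines a neighbourhood inside \<open>U\<close>.\<close>
  obtain \<alpha> h where h: "\<alpha> \<in> underS r \<tau>" "h \<in> AA \<alpha>" "\<forall>z\<in>Y \<tau>. cmod (h0 z - h (trunc \<alpha> z)) < 1/4"
    using limit[OF h0(1), of "1/4"] by auto
  have \<alpha>: "\<alpha> \<in> Field r" "(\<alpha>, \<tau>) \<in> r" using underS_Field[OF h(1)] h(1) unfolding underS_iff by auto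
  define V where "V = {z \<in> Y \<alpha>. cmod (h z) > 1/2}"
  have V: "openin (TT \<alpha>) V" using openin_gt[OF AA_cont[OF h(2)], of "1/2"] unfolding V_def by simp
  have "h0 y = 1" using h0(2) unfolding locunit_def by blast
  then have "cmod (1 - h (trunc \<alpha> y)) < 1/4" using h(3) y(1) by metis
  then have "cmod (h (trunc \<alpha> y)) > 1/2" using norm_triangle_ineq2[of 1 "h (trunc \<alpha> y)"] norm_triangle_ineq2[of 1 "1 - h (trunc \<alpha> y)"] by simp
  then have yV: "trunc \<alpha> y \<in> V" using pm_Y[OF y(1) \<alpha>(2)] unfolding V_def by blast
  have VU: "z \<in> U" if z: "z \<in> Y \<tau>" "trunc \<alpha> z \<in> V" for z
  proof (rule ccontr)
    assume "z \<notin> U"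
    then have "h0 z = 0" using h0(2) z(1) unfolding locunit_def by simp
    then have "cmod (h (trunc \<alpha> z)) < 1/4" using h(3) z(1) by (metis diff_0 norm_minus_cancel)
    then show False using z(2) unfolding V_def by simp
  qed
  have units: "\<exists>g\<in>II \<alpha>. locunit (TT \<alpha>) g (trunc \<alpha> y) V'" if "openin (TT \<alpha>) V'" "trunc \<alpha> y \<in> V'" for V'
  proof (rule locunit_in_ideal[where P = "AA \<alpha>" and f = "\<lambda>z. k (fst z)"])
    show "fun_alg (topspace (TT \<alpha>)) (AA \<alpha>)" using AA_fun_alg[OF \<alpha>(1)] by simp
    show "fun_ideal (topspace (TT \<alpha>)) (AA \<alpha>) (II \<alpha>)" using II_fun_ideal[OF \<alpha>(1)] by simp
    show "(\<lambda>z. k (fst z)) \<in> II \<alpha>" by (rule II_pi[OF ksat])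
    show "k (fst (trunc \<alpha> y)) \<noteq> 0" using k(2) by simp
  qed (use reg[OF \<alpha>(1)] AA_cont that in auto)
  have "trunc \<alpha> y \<in> topspace (tower_top X r code F \<alpha>)" using yV unfolding V_def tower_top_TT by simp
  then have "\<exists>f\<in>F \<alpha>. locunit (TT \<alpha>) f (trunc \<alpha> y) V"
    using F_adequate[OF h(1)] units V yV unfolding adequate_def tower_top_TT by blast
  then obtain f where f: "f \<in> F \<alpha>" "locunit (TT \<alpha>) f (trunc \<alpha> y) V" by blast
  define p where "p = pullback (TT \<tau>) (trunc \<alpha>) f"
  have pF: "p \<in> root_family" unfolding p_def by (rule root_family_I[OF h(1) f(1)])
  have "locunit (TT \<tau>) (\<lambda>z. f (trunc \<alpha> z)) y {z\<in>Y \<tau>. trunc \<alpha> z \<in> V}" by (rule locunit_pull[OF \<alpha>(2) y(1) f(2)])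
  then have "locunit (TT \<tau>) (\<lambda>z. f (trunc \<alpha> z)) y U" by (rule locunit_mono) (use VU in auto)
  moreover have "p z = f (trunc \<alpha> z)" if "z \<in> topspace (TT \<tau>)" for z using that unfolding p_def by (simp add: pb_apply)
  ultimately have pU: "locunit (TT \<tau>) p y U" by (rule locunit_cong)
  have FA: "g \<in> AA \<tau>" if "g \<in> root_family" for g using that root_family_Is II_sub[OF \<tau>] unfolding Is_def by blast
  obtain M where M: "\<forall>z\<in>Y \<tau>. cmod (p z) \<le> M" using fun_algD(5)[OF AA_fun_alg[OF \<tau>] FA[OF pF]] by blast
  obtain g c where g: "g \<in> root_family" "locunit (TT \<tau>) (\<lambda>z. g z * c) y U" "\<forall>z\<in>topspace (TT \<tau>). cmod (g z * c) \<le> 3/2"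
    using small_locunit[of root_family "TT \<tau>", OF AA_cont[OF FA] root_family_root pF pU, of M] M by auto
  have "(\<lambda>z. g z * c) \<in> AA \<tau>" by (rule fun_algD(4)[OF AA_fun_alg[OF \<tau>] FA[OF g(1)] fun_algD(2)[OF AA_fun_alg[OF \<tau>]]])
  then show ?thesis using g(2,3) by (intro bexI[of _ "\<lambda>z. g z * c"]) auto
qed

lemma units_peaks:
  assumes nrm: "normal_algebra X A" and y: "y \<in> Y \<tau>" "fst y \<notin> hull_of X I"
  shows "bounded_relative_units_at (TT \<tau>) (As \<tau>) y" "generalized_peak_point (TT \<tau>) (As \<tau>) y"
proof -
  have u: "\<exists>h\<in>sat (topspace (TT \<tau>)) (As \<tau>). locunit (TT \<tau>) h y U \<and> (\<forall>z\<in>topspace (TT \<tau>). cmod (h z) \<le> 3/2)"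
    if "openin (TT \<tau>) U" "y \<in> U" for U
    unfolding topspace_TT sat_As[OF \<tau>] using unit[OF nrm y that] by simp
  have yT: "y \<in> topspace (TT \<tau>)" using y(1) by simp
  show "bounded_relative_units_at (TT \<tau>) (As \<tau>) y" by (rule bounded_relative_units_if[OF As_uniform[OF \<tau>] yT u])
  show "generalized_peak_point (TT \<tau>) (As \<tau>) y" by (rule generalized_peak_point_if[OF As_uniform[OF \<tau>] yT u])
qed

lemma extn: assumes \<delta>: "\<delta> \<in> Field r" shows "ideal_extension X A I (TT \<delta>) (As \<delta>) (Is \<delta>) fst"
proof (intro ideal_extension.intro uniform_ideal.intro ideal_extension_axioms.intro A I As_uniform[OF \<delta>] Is_closed_ideal[OF \<delta>])
  show "fst ` topspace (TT \<delta>) = topspace X" using fst_image[OF \<delta>] by simp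
  fix a assume a: "a \<in> sat (topspace X) A"
  show "(\<lambda>z. a (fst z)) \<in> sat (topspace (TT \<delta>)) (As \<delta>)" using AA_pi[OF a] by (simp add: sat_As[OF \<delta>])
next
  fix a assume a: "a \<in> sat (topspace X) I"
  show "(\<lambda>z. a (fst z)) \<in> sat (topspace (TT \<delta>)) (Is \<delta>)" using II_pi[OF a] by (simp add: sat_Is[OF \<delta>])
next
  fix g assume "g \<in> sat (topspace (TT \<delta>)) (As \<delta>)"
  then have "g \<in> AA \<delta>" by (simp add: sat_As[OF \<delta>])
  from quotient_surj[OF \<delta> this]
  show "\<exists>a\<in>sat (topspace X) A. (\<lambda>z. g z - a (fst z)) \<in> sat (topspace (TT \<delta>)) (Is \<delta>)" by (simp add: sat_Is[OF \<delta>])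
next
  fix a h C assume a: "a \<in> sat (topspace X) A" "h \<in> sat (topspace (TT \<delta>)) (Is \<delta>)"
    "\<And>z. z \<in> topspace (TT \<delta>) \<Longrightarrow> cmod (a (fst z) - h z) \<le> C"
  have "h \<in> II \<delta>" using a(2) by (simp add: sat_Is[OF \<delta>])
  from quotient_norm[OF \<delta> a(1) this, of C] a(3)
  show "\<exists>k\<in>sat (topspace X) I. \<forall>x\<in>topspace X. cmod (a x - k x) \<le> C" by simp
qed

section \<open>The part of the tower over the hull\<close>

definition S' :: "('a \<times> ('w \<Rightarrow> complex)) set" where
  "S' = {y \<in> topspace (TT \<tau>). fst y \<in> hull_of X I}"

lemma vanish_S': assumes "y \<in> S'" "f \<in> II \<tau>" shows "f y = 0"
proof (rule vanish[OF \<tau> _ _ assms(2)])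
  show "y \<in> Y \<tau>" using assms(1) unfolding S'_def by simp
  have S: "fst y \<in> hull_of X I" using assms(1) unfolding S'_def by simp
  fix k assume k: "k \<in> sat (topspace X) I"
  then have "restrict k (topspace X) \<in> I" unfolding sat_def by simp
  then have "restrict k (topspace X) (fst y) = 0" "fst y \<in> topspace X" using S unfolding hull_of_def by auto
  then show "k (fst y) = 0" by simp
qed

lemma hull: "hull_of (TT \<tau>) (Is \<tau>) = S'"
proof
  show "S' \<subseteq> hull_of (TT \<tau>) (Is \<tau>)" using vanish_S' unfolding hull_of_def Is_def S'_def by auto
  show "hull_of (TT \<tau>) (Is \<tau>) \<subseteq> S'"
  proof
    fix y assume y: "y \<in> hull_of (TT \<tau>) (Is \<tau>)"
    then have yY: "y \<in> Y \<tau>" unfolding hull_of_def by simp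
    have "k (fst y) = 0" if k: "k \<in> I" for k
    proof -
      have "k \<in> sat (topspace X) I" using sat_ext[OF _ k] X_props(4) mspace_cspace_iff[OF X_props(1)] by blast
      then have "(\<lambda>y. k (fst y)) \<in> II \<tau>" by (rule II_pi)
      then have "restrict (\<lambda>y. k (fst y)) (Y \<tau>) \<in> Is \<tau>"
        unfolding Is_def using unif_closed_restrict[OF fun_idealD(1)[OF II_fun_ideal[OF \<tau>]]] by simp
      then have "restrict (\<lambda>y. k (fst y)) (Y \<tau>) y = 0" using y unfolding hull_of_def by blast
      then show ?thesis using yY by simp
    qed
    moreover have "fst y \<in> topspace X" using yY unfolding Y_iff by blast
    ultimately show "y \<in> S'" using yY unfolding S'_def hull_of_def by simp
  qed
qed

lemma fst_S': "fst ` S' = hull_of X I"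
proof
  show "hull_of X I \<subseteq> fst ` S'"
  proof
    fix x assume x: "x \<in> hull_of X I"
    then have "x \<in> fst ` Y \<tau>" unfolding fst_image[OF \<tau>] hull_of_def by blast
    then show "x \<in> fst ` S'" using x unfolding S'_def by auto
  qed
qed (auto simp: S'_def)

text \<open>All roots vanish over the hull, so a point of \<open>S'\<close> is determined by its
  base point. \<open>S'\<close> is compact, being an intersection of zero sets of continuous
  functions.\<close>

lemma homeo: "homeomorphic_map (subtopology (TT \<tau>) S') (subtopology X (hull_of X I)) fst"
proof (rule continuous_imp_homeomorphic_map)
  have SY: "S' \<subseteq> topspace (TT \<tau>)" unfolding S'_def by blast
  have SX: "hull_of X I \<subseteq> topspace X" unfolding hull_of_def by blast
  have cont: "continuous_map (TT \<tau>) X fst" by (rule cont_fst_TT)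
  show "continuous_map (subtopology (TT \<tau>) S') (subtopology X (hull_of X I)) fst"
    by (rule continuous_map_into_subtopology[OF continuous_map_from_subtopology[OF cont]]) (auto simp: S'_def)
  have "closedin (TT \<tau>) {y \<in> topspace (TT \<tau>). f y = 0}" if f: "f \<in> Is \<tau>" for f
  proof -
    have "continuous_map (TT \<tau>) euclidean f" using f II_sub[OF \<tau>] AA_cont unfolding Is_def by blast
    from closedin_continuous_map_preimage[OF this, of "{0}"] show ?thesis by (simp add: closed_closedin[symmetric])
  qed
  then have "closedin (TT \<tau>) (\<Inter>(insert (topspace (TT \<tau>)) ((\<lambda>f. {y \<in> topspace (TT \<tau>). f y = 0}) ` Is \<tau>)))"
    by (intro closedin_Inter) (auto simp del: topspace_TT)
  moreover have "\<Inter>(insert (topspace (TT \<tau>)) ((\<lambda>f. {y \<in> topspace (TT \<tau>). f y = 0}) ` Is \<tau>)) = S'"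
    unfolding hull[symmetric] hull_of_def by auto
  ultimately have "closedin (TT \<tau>) S'" by simp
  then show "compact_space (subtopology (TT \<tau>) S')"
    using TT_compact[OF \<tau>] closedin_compact_space compact_space_subtopology by blast
  show "Hausdorff_space (subtopology X (hull_of X I))" by (rule Hausdorff_space_subtopology[OF X_props(2)])
  show "fst ` topspace (subtopology (TT \<tau>) S') = topspace (subtopology X (hull_of X I))"
    using fst_S' SY SX by (simp add: Int_absorb1)
  show "inj_on fst (topspace (subtopology (TT \<tau>) S'))"
  proof (rule inj_onI)
    fix y z assume yz: "y \<in> topspace (subtopology (TT \<tau>) S')" "z \<in> topspace (subtopology (TT \<tau>) S')" "fst y = fst z"
    then have S: "y \<in> S'" "z \<in> S'" "y \<in> Y \<tau>" "z \<in> Y \<tau>" by auto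
    have "snd y = snd z"
    proof (rule extensionalityI[of _ "W \<tau>"])
      show "snd y \<in> extensional (W \<tau>)" "snd z \<in> extensional (W \<tau>)" using S(3,4) unfolding Y_iff by auto
      fix w assume "w \<in> W \<tau>"
      then show "snd y w = snd z w" using vanish_S'[OF S(1) II_r] vanish_S'[OF S(2) II_r] by simp
    qed
    then show "y = z" using yz(3) by (simp add: prod_eq_iff)
  qed
qed

text \<open>Every function above is a base function modulo the ideal, and the ideal vanishes on
  \<open>S'\<close>, so the restrictions from above are those from below. The norms agree because
  \<open>fst\<close> maps \<open>S'\<close> onto the hull.\<close>

lemma restrictions_iso:
  defines "S \<equiv> hull_of X I"
  shows "\<exists>\<phi>. isometric_isomorphism (function_algebra S (restrictions A S)) (function_algebra S' (restrictions (As \<tau>) S')) \<phi> \<and>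
             (\<forall>f\<in>A. \<phi> (restrict f S) = restrict (pullback (TT \<tau>) fst f) S')"
proof (intro exI conjI ballI)
  let ?\<phi> = "\<lambda>g. \<lambda>y\<in>S'. g (fst y)"
  have SX: "S \<subseteq> topspace X" unfolding S_def hull_of_def by blast
  have fS: "fst y \<in> S" "y \<in> Y \<tau>" if "y \<in> S'" for y using that unfolding S'_def S_def by auto
  have Sf: "\<exists>y\<in>S'. x = fst y" if "x \<in> S" for x using that fst_S' unfolding S_def by blast
  have \<phi>: "?\<phi> (restrict f S) = restrict (pullback (TT \<tau>) fst f) S'" for f :: "'a \<Rightarrow> complex"
    by (rule restrict_ext) (use fS in \<open>simp add: pullback_def\<close>)
  then show "\<And>f. f \<in> A \<Longrightarrow> ?\<phi> (restrict f S) = restrict (pullback (TT \<tau>) fst f) S'" by simp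
  have Aext: "A \<subseteq> extensional (topspace X)" using X_props(3) mspace_cspace_iff[OF X_props(1)] by blast
  have pbA: "pullback (TT \<tau>) fst a \<in> As \<tau>" if a: "a \<in> A" for a
    using AA_pi[OF sat_ext[OF Aext a], of \<tau>] As_restrict[OF \<tau>] unfolding pullback_def by (simp add: comp_def)
  have ri: "?\<phi> \<in> ring_iso (function_algebra S (restrictions A S)) (function_algebra S' (restrictions (As \<tau>) S'))"
    unfolding ring_iso_def
  proof (intro CollectI conjI)
    have im: "?\<phi> ` restrictions A S = restrictions (As \<tau>) S'"
    proof
      show "?\<phi> ` restrictions A S \<subseteq> restrictions (As \<tau>) S'"
      proof (rule image_subsetI)
        fix g assume "g \<in> restrictions A S"
        then obtain a where a: "a \<in> A" "g = restrict a S" unfolding restrictions_def by blast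
        show "?\<phi> g \<in> restrictions (As \<tau>) S'" unfolding a(2) \<phi> restrictions_def using pbA[OF a(1)] by blast
      qed
      show "restrictions (As \<tau>) S' \<subseteq> ?\<phi> ` restrictions A S"
      proof
        fix g assume "g \<in> restrictions (As \<tau>) S'"
        then obtain b where b: "b \<in> As \<tau>" "g = restrict b S'" unfolding restrictions_def by blast
        have "b \<in> AA \<tau>" using b(1) unfolding As_def by blast
        from quotient_surj[OF \<tau> this] obtain a where a: "a \<in> sat (topspace X) A" "(\<lambda>y. b y - a (fst y)) \<in> II \<tau>" by blast
        have "b y = a (fst y)" if "y \<in> S'" for y using vanish_S'[OF that a(2)] by simp
        then have "g = ?\<phi> (restrict (restrict a (topspace X)) S)"
          unfolding b(2) by (intro restrict_ext) (use fS(1) SX in \<open>simp add: subset_iff\<close>)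
        then show "g \<in> ?\<phi> ` restrictions A S" using a(1) unfolding restrictions_def sat_def by blast
      qed
    qed
    show "?\<phi> \<in> ring_hom (function_algebra S (restrictions A S)) (function_algebra S' (restrictions (As \<tau>) S'))"
    proof (rule ring_hom_memI)
      fix g h
      show "?\<phi> (g \<otimes>\<^bsub>function_algebra S (restrictions A S)\<^esub> h) = ?\<phi> g \<otimes>\<^bsub>function_algebra S' (restrictions (As \<tau>) S')\<^esub> ?\<phi> h"
        "?\<phi> (g \<oplus>\<^bsub>function_algebra S (restrictions A S)\<^esub> h) = ?\<phi> g \<oplus>\<^bsub>function_algebra S' (restrictions (As \<tau>) S')\<^esub> ?\<phi> h"
        unfolding function_algebra_def by (simp_all add: fS(1) cong: restrict_cong)
      show "?\<phi> \<one>\<^bsub>function_algebra S (restrictions A S)\<^esub> = \<one>\<^bsub>function_algebra S' (restrictions (As \<tau>) S')\<^esub>"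
        unfolding function_algebra_def by (simp_all add: fS(1) cong: restrict_cong)
    next
      fix g assume "g \<in> carrier (function_algebra S (restrictions A S))"
      then show "?\<phi> g \<in> carrier (function_algebra S' (restrictions (As \<tau>) S'))" using im by (auto simp: function_algebra_def)
    qed
    have "inj_on ?\<phi> (restrictions A S)"
    proof (rule inj_onI)
      fix g h assume gh: "g \<in> restrictions A S" "h \<in> restrictions A S" "?\<phi> g = ?\<phi> h"
      show "g = h"
      proof (rule extensionalityI[of _ S])
        show "g \<in> extensional S" "h \<in> extensional S" using gh(1,2) unfolding restrictions_def by auto
        fix x assume "x \<in> S"
        then obtain y where y: "y \<in> S'" "x = fst y" using Sf by blast
        show "g x = h x" using fun_cong[OF gh(3), of y] y by simp
      qed
    qed
    then show "bij_betw ?\<phi> (carrier (function_algebra S (restrictions A S))) (carrier (function_algebra S' (restrictions (As \<tau>) S')))"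
      unfolding function_algebra_def using im by (simp add: bij_betw_def)
  qed
  have sn: "sup_norm S' (?\<phi> g) = sup_norm S g" for g
  proof -
    have "(\<lambda>y. cmod (?\<phi> g y)) ` S' = (\<lambda>x. cmod (g x)) ` S"
    proof -
      have "(\<lambda>y. cmod (?\<phi> g y)) ` S' = (\<lambda>y. cmod (g (fst y))) ` S'" by (rule image_cong) auto
      also have "\<dots> = (\<lambda>x. cmod (g x)) ` fst ` S'" by (simp add: image_image)
      finally show ?thesis unfolding fst_S' S_def .
    qed
    moreover have "S' = {} \<longleftrightarrow> S = {}" using fst_S' unfolding S_def by blast
    ultimately show ?thesis unfolding sup_norm_def by simp
  qed
  show "isometric_isomorphism (function_algebra S (restrictions A S)) (function_algebra S' (restrictions (As \<tau>) S')) ?\<phi>"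
    unfolding isometric_isomorphism_def
  proof (intro conjI ballI allI ri)
    show "?\<phi> (c \<odot>\<^bsub>function_algebra S (restrictions A S)\<^esub> f) = c \<odot>\<^bsub>function_algebra S' (restrictions (As \<tau>) S')\<^esub> ?\<phi> f" for c f
      unfolding function_algebra_def by (simp_all add: fS(1) cong: restrict_cong)
    show "nrm (function_algebra S' (restrictions (As \<tau>) S')) (?\<phi> f) = nrm (function_algebra S (restrictions A S)) f" for f
      unfolding function_algebra_def using sn[of f] by simp
  qed
qed

text \<open>Collects what both constructions share; only square roots in the ideal and metrizability
  are left to the two cases.\<close>

lemma properties:
  "uniform_algebra (TT \<tau>) (As \<tau>) \<and>
   continuous_map (TT \<tau>) X fst \<and> fst ` topspace (TT \<tau>) = topspace X \<and>
   obtained_by_root_extensions r X A (TT \<tau>) (As \<tau>) fst \<and>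
   homeomorphic_map (subtopology (TT \<tau>) S') (subtopology X (hull_of X I)) fst \<and>
   (\<exists>\<phi>. isometric_isomorphism (function_algebra (hull_of X I) (restrictions A (hull_of X I)))
      (function_algebra S' (restrictions (As \<tau>) S')) \<phi> \<and>
      (\<forall>f\<in>A. \<phi> (restrict f (hull_of X I)) = restrict (pullback (TT \<tau>) fst f) S')) \<and>
   closed_ideal (TT \<tau>) (As \<tau>) (Is \<tau>) \<and> hull_of (TT \<tau>) (Is \<tau>) = S' \<and>
   Is \<tau> \<inter> pullback (TT \<tau>) fst ` A = pullback (TT \<tau>) fst ` I \<and>
   (\<exists>\<phi>. isometric_isomorphism (quotient_algebra (function_algebra (topspace (TT \<tau>)) (As \<tau>)) (Is \<tau>))
      (quotient_algebra (function_algebra (topspace X) A) I) \<phi>) \<and>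
   (\<exists>\<Psi>. bij_betw \<Psi> {J. closed_ideal (TT \<tau>) (As \<tau>) J \<and> Is \<tau> \<subseteq> J} {J. closed_ideal X A J \<and> I \<subseteq> J} \<and>
      (\<forall>J1 J2. closed_ideal (TT \<tau>) (As \<tau>) J1 \<and> Is \<tau> \<subseteq> J1 \<and> closed_ideal (TT \<tau>) (As \<tau>) J2 \<and> Is \<tau> \<subseteq> J2 \<longrightarrow>
         (J1 \<subseteq> J2 \<longleftrightarrow> \<Psi> J1 \<subseteq> \<Psi> J2))) \<and>
   (normal_algebra X A \<longrightarrow> normal_algebra (TT \<tau>) (As \<tau>) \<and>
      (\<forall>x\<in>topspace (TT \<tau>) - S'. bounded_relative_units_at (TT \<tau>) (As \<tau>) x) \<and>
      (\<forall>x\<in>topspace (TT \<tau>) - S'. generalized_peak_point (TT \<tau>) (As \<tau>) x))"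
proof -
  interpret E: ideal_extension X A I "TT \<tau>" "As \<tau>" "Is \<tau>" fst by (rule extn[OF \<tau>])
  have out: "x \<in> Y \<tau> \<and> fst x \<notin> hull_of X I" if "x \<in> topspace (TT \<tau>) - S'" for x using that unfolding S'_def by simp
  show ?thesis
  proof (intro conjI impI ballI)
    show "\<exists>\<phi>. isometric_isomorphism (quotient_algebra (function_algebra (topspace (TT \<tau>)) (As \<tau>)) (Is \<tau>))
      (quotient_algebra (function_algebra (topspace X) A) I) \<phi>" using E.quotient_iso by blast
    show "\<exists>\<Psi>. bij_betw \<Psi> {J. closed_ideal (TT \<tau>) (As \<tau>) J \<and> Is \<tau> \<subseteq> J} {J. closed_ideal X A J \<and> I \<subseteq> J} \<and>
      (\<forall>J1 J2. closed_ideal (TT \<tau>) (As \<tau>) J1 \<and> Is \<tau> \<subseteq> J1 \<and> closed_ideal (TT \<tau>) (As \<tau>) J2 \<and> Is \<tau> \<subseteq> J2 \<longrightarrow>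
         (J1 \<subseteq> J2 \<longleftrightarrow> \<Psi> J1 \<subseteq> \<Psi> J2))"
      using E.ideal_correspondence E.\<Phi>_mono_iff by blast
    show "fst ` topspace (TT \<tau>) = topspace X" using fst_image[OF \<tau>] by simp
    show "bounded_relative_units_at (TT \<tau>) (As \<tau>) x" if "normal_algebra X A" "x \<in> topspace (TT \<tau>) - S'" for x
      using units_peaks(1)[OF that(1)] out[OF that(2)] by blast
    show "generalized_peak_point (TT \<tau>) (As \<tau>) x" if "normal_algebra X A" "x \<in> topspace (TT \<tau>) - S'" for x
      using units_peaks(2)[OF that(1)] out[OF that(2)] by blast
  qed (rule As_uniform[OF \<tau>] cont_fst_TT obtained[OF inf] homeo restrictions_iso Is_closed_ideal[OF \<tau>] hull E.inter normal_As[OF _ \<tau>] | assumption)+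
qed

text \<open>The countably many stages of a sequence of approximants lie below one \<beta>. There the
  sequence is uniformly Cauchy, because the projection onto \<open>Y \<beta>\<close> is surjective,
  and its limit lies in the ideal of stage \<beta>, all of whose functions are radicands.\<close>

lemma all_roots:
  assumes bnd: "\<And>C. countable C \<Longrightarrow> C \<subseteq> underS r \<tau> \<Longrightarrow> \<exists>\<beta>\<in>underS r \<tau>. \<forall>\<alpha>\<in>C. (\<alpha>, \<beta>) \<in> r"
    and full: "\<And>\<beta>. \<beta> \<in> underS r \<tau> \<Longrightarrow> F \<beta> = II \<beta> \<inter> extensional (Y \<beta>)"
  shows "Is \<tau> \<subseteq> root_family"
proof
  fix g assume g: "g \<in> Is \<tau>"
  then have gI: "g \<in> II \<tau>" unfolding Is_def by blast
  have "\<exists>\<alpha> h. \<alpha> \<in> underS r \<tau> \<and> h \<in> II \<alpha> \<and> (\<forall>y\<in>Y \<tau>. cmod (g y - h (trunc \<alpha> y)) \<le> inverse (Suc n))" for n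
    using dense_below[OF gI, of "inverse (Suc n)"] by fastforce
  then obtain \<alpha> h where h: "\<And>n. \<alpha> n \<in> underS r \<tau>" "\<And>n. h n \<in> II (\<alpha> n)"
    "\<And>n y. y \<in> Y \<tau> \<Longrightarrow> cmod (g y - h n (trunc (\<alpha> n) y)) \<le> inverse (Suc n)" by metis
  obtain \<beta> where b: "\<beta> \<in> underS r \<tau>" "\<And>n. (\<alpha> n, \<beta>) \<in> r" using bnd[of "range \<alpha>"] h(1) by auto
  have \<beta>: "\<beta> \<in> Field r" "(\<beta>, \<tau>) \<in> r" using underS_Field[OF b(1)] b(1) unfolding underS_iff by auto
  define k where "k n = (\<lambda>y. h n (trunc (\<alpha> n) y))" for n
  have k: "k n \<in> II \<beta>" for n unfolding k_def by (rule II_mono[OF h(2) b(2)])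
  have kg: "cmod (g y - k n (trunc \<beta> y)) \<le> inverse (Suc n)" if "y \<in> Y \<tau>" for n y
    unfolding k_def pm_pm[OF b(2)] by (rule h(3)[OF that])
  have small: "\<exists>N. \<forall>n\<ge>N. inverse (real (Suc n)) \<le> e" if e: "e > 0" for e
  proof -
    obtain N where N: "inverse (real (Suc N)) < e" using reals_Archimedean[OF e] by blast
    have "inverse (real (Suc n)) \<le> e" if "n \<ge> N" for n
    proof -
      have "inverse (real (Suc n)) \<le> inverse (real (Suc N))" using that by (simp add: field_simps)
      then show ?thesis using N by linarith
    qed
    then show ?thesis by blast
  qed
  have lift: "\<exists>y'\<in>Y \<tau>. y = trunc \<beta> y'" if "y \<in> Y \<beta>" for y using that pm_image[OF \<beta>(2)] by blast
  have "\<exists>N. \<forall>m\<ge>N. \<forall>n\<ge>N. \<forall>x\<in>Y \<beta>. cmod (k m x - k n x) \<le> e" if e: "e > 0" for e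
  proof -
    obtain N where N: "\<forall>n\<ge>N. inverse (real (Suc n)) \<le> e / 2" using small[of "e / 2"] e by auto
    have "cmod (k m x - k n x) \<le> e" if mn: "m \<ge> N" "n \<ge> N" and x: "x \<in> Y \<beta>" for m n x
    proof -
      obtain y where y: "y \<in> Y \<tau>" "x = trunc \<beta> y" using lift[OF x] by blast
      have "cmod (g y - k n x) \<le> e / 2" "cmod (g y - k m x) \<le> e / 2"
        using kg[OF y(1), of n] kg[OF y(1), of m] N mn unfolding y(2) by (meson order_trans)+
      then show ?thesis using norm_triangle_ineq4[of "g y - k n x" "g y - k m x"] by simp
    qed
    then show ?thesis by blast
  qed
  from unif_closed_limit[OF fun_idealD(1)[OF II_fun_ideal[OF \<beta>(1)]] k this]
  obtain f where f: "f \<in> II \<beta>" "\<And>e. e > 0 \<Longrightarrow> \<exists>N. \<forall>n\<ge>N. \<forall>x\<in>Y \<beta>. cmod (k n x - f x) \<le> e" by blast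
  have gf: "g y = f (trunc \<beta> y)" if y: "y \<in> Y \<tau>" for y
  proof -
    have "cmod (g y - f (trunc \<beta> y)) \<le> 0 + e" if e: "e > 0" for e
    proof -
      obtain N1 where N1: "\<forall>n\<ge>N1. inverse (real (Suc n)) \<le> e / 2" using small[of "e / 2"] e by auto
      obtain N2 where N2: "\<forall>n\<ge>N2. \<forall>x\<in>Y \<beta>. cmod (k n x - f x) \<le> e / 2" using f(2)[of "e / 2"] e by auto
      let ?n = "max N1 N2"
      have "cmod (k ?n (trunc \<beta> y) - f (trunc \<beta> y)) \<le> e / 2" using N2 pm_Y[OF y \<beta>(2)] by simp
      moreover have "cmod (g y - k ?n (trunc \<beta> y)) \<le> e / 2" using kg[OF y, of ?n] N1 by (meson order_trans max.cobounded1)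
      ultimately show ?thesis using norm_triangle_ineq[of "g y - k ?n (trunc \<beta> y)" "k ?n (trunc \<beta> y) - f (trunc \<beta> y)"] by simp
    qed
    then have "cmod (g y - f (trunc \<beta> y)) \<le> 0" by (rule field_le_epsilon)
    then show ?thesis by simp
  qed
  have "restrict f (Y \<beta>) \<in> F \<beta>" unfolding full[OF b(1)] using f(1) unif_closed_restrict[OF fun_idealD(1)[OF II_fun_ideal[OF \<beta>(1)]]] by simp
  from root_family_I[OF b(1) this] have "pullback (TT \<tau>) (trunc \<beta>) (restrict f (Y \<beta>)) \<in> root_family" .
  moreover have "g = pullback (TT \<tau>) (trunc \<beta>) (restrict f (Y \<beta>))"
    by (rule extensionalityI[of _ "Y \<tau>"]) (use g gf pm_Y[OF _ \<beta>(2)] in \<open>auto simp: Is_def pullback_def\<close>)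
  ultimately show "g \<in> root_family" by simp
qed

end

section \<open>Families of radicands for the two constructions\<close>

lemma adequate_restrict_image:
  assumes G: "adequate Z Q G" shows "adequate Z Q ((\<lambda>g. restrict g (topspace Z)) ` G)"
  unfolding adequate_def
proof (intro conjI ballI allI impI)
  fix g and e :: real assume "g \<in> Q" "e > 0"
  then obtain f where f: "f \<in> G" "\<forall>z\<in>topspace Z. cmod (g z - f z) < e" using G unfolding adequate_def by blast
  then have "\<forall>z\<in>topspace Z. cmod (g z - restrict f (topspace Z) z) < e" by simp
  then show "\<exists>f\<in>(\<lambda>g. restrict g (topspace Z)) ` G. \<forall>z\<in>topspace Z. cmod (g z - f z) < e"
    using imageI[OF f(1), of "\<lambda>g. restrict g (topspace Z)"] by (rule bexI)
next
  fix y U assume y: "y \<in> topspace Z" "\<forall>U. openin Z U \<longrightarrow> y \<in> U \<longrightarrow> (\<exists>g\<in>Q. locunit Z g y U)" "openin Z U" "y \<in> U"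
  then have "\<exists>f\<in>G. locunit Z f y U" using G unfolding adequate_def by simp
  then obtain f where f: "f \<in> G" "locunit Z f y U" by blast
  have "locunit Z (restrict f (topspace Z)) y U" by (rule locunit_cong[OF f(2)]) simp
  then show "\<exists>f\<in>(\<lambda>g. restrict g (topspace Z)) ` G. locunit Z f y U" using imageI[OF f(1), of "\<lambda>g. restrict g (topspace Z)"] by (rule bexI)
qed

lemma restrict_image_sub: "unif_closed T Q \<Longrightarrow> G \<subseteq> Q \<Longrightarrow> (\<lambda>g. restrict g T) ` G \<subseteq> Q \<inter> extensional T"
  using unif_closed_restrict by blast

lemma adequate_restrict:
  assumes "unif_closed (topspace Z) Q" shows "adequate Z Q (Q \<inter> extensional (topspace Z))"
proof (rule adequate_mono[OF adequate_restrict_image restrict_image_sub[OF assms order_refl]])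
  show "adequate Z Q Q" unfolding adequate_def
  proof (intro conjI ballI allI impI)
    fix g and e :: real assume "g \<in> Q" "e > 0"
    then show "\<exists>f\<in>Q. \<forall>z\<in>topspace Z. cmod (g z - f z) < e" by (intro bexI[of _ g]) auto
  qed blast
qed

lemma adequate_countable_restrict:
  assumes Z: "compact_space Z" "second_countable Z" and Q: "\<And>g. g \<in> Q \<Longrightarrow> continuous_map Z euclidean g"
    and u: "unif_closed (topspace Z) Q"
  shows "\<exists>G. G \<subseteq> Q \<inter> extensional (topspace Z) \<and> countable G \<and> adequate Z Q G"
proof -
  obtain G where G: "G \<subseteq> Q" "countable G" "adequate Z Q G" using adequate_countable[OF Z Q] by blast
  then show ?thesis
    using adequate_restrict_image[OF G(3)] restrict_image_sub[OF u G(1)]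
    by (intro exI[of _ "(\<lambda>g. restrict g (topspace Z)) ` G"]) simp
qed

definition good_family :: "'b topology \<Rightarrow> ('b \<Rightarrow> complex) set \<Rightarrow> ('b \<Rightarrow> complex) set \<Rightarrow> ('b \<Rightarrow> complex) set \<Rightarrow> bool" where
  "good_family Z Q R G \<longleftrightarrow> G \<noteq> {} \<and> G \<subseteq> Q \<inter> extensional (topspace Z) \<and> countable G \<and> adequate Z Q G \<and> R \<subseteq> G"

text \<open>The second alternative never occurs in a tower over a metrizable space; it makes the choice
  unconditional, as the recursion that builds the tower requires.\<close>

definition countable_pick :: "'b topology \<Rightarrow> ('b \<Rightarrow> complex) set \<Rightarrow> ('b \<Rightarrow> complex) set \<Rightarrow> ('b \<Rightarrow> complex) set" where
  "countable_pick Z Q R = (if \<exists>G. good_family Z Q R G then SOME G. good_family Z Q R G else Q \<inter> extensional (topspace Z))"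

lemma countable_pick: "\<exists>G. good_family Z Q R G \<Longrightarrow> good_family Z Q R (countable_pick Z Q R)"
proof -
  assume ex: "\<exists>G. good_family Z Q R G"
  from someI_ex[OF this] show ?thesis unfolding countable_pick_def using ex by simp
qed

lemma restrict_zero: "(\<lambda>y. 0) \<in> Q \<Longrightarrow> unif_closed (topspace Z) Q \<Longrightarrow> Q \<inter> extensional (topspace Z) \<noteq> {}"
  using unif_closed_restrict[of "topspace Z" Q "\<lambda>y. 0"] by blast

lemma countable_pick_sub:
  assumes "(\<lambda>y. 0) \<in> Q" "unif_closed (topspace Z) Q"
  shows "countable_pick Z Q R \<noteq> {} \<and> countable_pick Z Q R \<subseteq> Q \<inter> extensional (topspace Z)"
proof (cases "\<exists>G. good_family Z Q R G")
  case True
  from countable_pick[OF this] show ?thesis unfolding good_family_def by blast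
next
  case False
  then have "countable_pick Z Q R = Q \<inter> extensional (topspace Z)" unfolding countable_pick_def by (rule if_not_P)
  then show ?thesis using restrict_zero[OF assms] by blast
qed

context root_tower
begin

lemma roots_II: assumes "\<alpha> \<in> Field r" shows "(\<lambda>w. restrict (\<lambda>y. snd y w) (Y \<alpha>)) ` W \<alpha> \<subseteq> II \<alpha> \<inter> extensional (Y \<alpha>)"
  using II_r unif_closed_restrict[OF fun_idealD(1)[OF II_fun_ideal[OF assms]]] by auto

lemma II_cont: "\<alpha> \<in> Field r \<Longrightarrow> g \<in> II \<alpha> \<Longrightarrow> continuous_map (TT \<alpha>) euclidean g"
  by (rule AA_cont[OF fun_idealD(2)[OF II_fun_ideal]])

lemma good_stage:
  assumes F: "\<And>\<alpha>. F \<alpha> = countable_pick (TT \<alpha>) (II \<alpha>) ((\<lambda>w. restrict (\<lambda>y. snd y w) (Y \<alpha>)) ` W \<alpha>)"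
    and X: "metrizable_space X" and c: "countable (W \<alpha>)" and \<alpha>: "\<alpha> \<in> Field r"
  shows "good_family (TT \<alpha>) (II \<alpha>) ((\<lambda>w. restrict (\<lambda>y. snd y w) (Y \<alpha>)) ` W \<alpha>) (F \<alpha>)"
proof -
  let ?R = "(\<lambda>w. restrict (\<lambda>y. snd y w) (Y \<alpha>)) ` W \<alpha>"
  have u: "unif_closed (topspace (TT \<alpha>)) (II \<alpha>)" using fun_idealD(1)[OF II_fun_ideal[OF \<alpha>]] by simp
  have sc: "second_countable (TT \<alpha>)"
    by (rule compact_metrizable_imp_second_countable[OF TT_compact[OF \<alpha>] TT_metrizable[OF X c]])
  obtain G where G: "G \<subseteq> II \<alpha> \<inter> extensional (topspace (TT \<alpha>))" "countable G" "adequate (TT \<alpha>) (II \<alpha>) G"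
    using adequate_countable_restrict[OF TT_compact[OF \<alpha>] sc II_cont[OF \<alpha>] u] by blast
  have "restrict (\<lambda>y. 0) (topspace (TT \<alpha>)) \<in> II \<alpha>"
    using unif_closed_restrict[OF u, of "\<lambda>y. 0"] fun_idealD(3)[OF II_fun_ideal[OF \<alpha>]] by blast
  then have "good_family (TT \<alpha>) (II \<alpha>) ?R (insert (restrict (\<lambda>y. 0) (topspace (TT \<alpha>))) (G \<union> ?R))"
    unfolding good_family_def using G(1,2) c roots_II[OF \<alpha>] adequate_mono[OF G(3) subset_trans[OF Un_upper1 subset_insertI]]
    by (intro conjI) auto
  then have "\<exists>G. good_family (TT \<alpha>) (II \<alpha>) ?R G" by blast
  from countable_pick[OF this] show ?thesis unfolding F[symmetric] .
qed

text \<open>Countability climbs with the stages: countably many roots make a stage compact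
  metrizable, hence second countable, which yields a countable family there; and every stage has
  countably many predecessors.\<close>

lemma countable_W:
  assumes F: "\<And>\<alpha>. F \<alpha> = countable_pick (TT \<alpha>) (II \<alpha>) ((\<lambda>w. restrict (\<lambda>y. snd y w) (Y \<alpha>)) ` W \<alpha>)"
    and X: "metrizable_space X" and c: "\<And>\<alpha>. \<alpha> \<in> Field r \<Longrightarrow> countable (underS r \<alpha>)"
  shows "\<alpha> \<in> Field r \<Longrightarrow> countable (W \<alpha>)"
proof (induction \<alpha> rule: wf_induct_rule[OF r_props(5)])
  case (1 \<alpha>)
  have "countable (F \<beta>)" if b: "\<beta> \<in> underS r \<alpha>" for \<beta>
  proof -
    have "(\<beta>, \<alpha>) \<in> r - Id" using b unfolding underS_iff by blast
    from good_stage[OF F X 1(1)[OF this underS_Field[OF b]] underS_Field[OF b]] show ?thesis unfolding good_family_def by blast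
  qed
  then have "countable (\<Union>\<beta>\<in>underS r \<alpha>. code \<beta> ` F \<beta>)" using c[OF 1(2)] by blast
  moreover have "W \<alpha> = (\<Union>\<beta>\<in>underS r \<alpha>. code \<beta> ` F \<beta>)" unfolding tower_index_def by blast
  ultimately show ?case by simp
qed

end

lemma root_tower_good:
  assumes T: "root_tower X A I r \<tau> F code" and inf: "infinite (Field r)"
    and no_max: "\<And>\<beta>. \<beta> \<in> underS r \<tau> \<Longrightarrow> \<exists>\<delta>\<in>underS r \<tau>. \<beta> \<in> underS r \<delta>"
    and F: "\<And>\<beta>. \<beta> \<in> underS r \<tau> \<Longrightarrow> adequate (tower_top X r code F \<beta>) (tower_ideal (topspace X) (sat (topspace X) A) (sat (topspace X) I) r code F \<beta>) (F \<beta>)"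
    "\<And>\<beta>. \<beta> \<in> underS r \<tau> \<Longrightarrow> (\<lambda>w. restrict (\<lambda>y. snd y w) (tower_set (topspace X) r code F \<beta>)) ` tower_index r code F \<beta> \<subseteq> F \<beta>"
  shows "good_tower X A I r \<tau> F code"
  by (intro good_tower.intro good_tower_axioms.intro T inf no_max F(1)) (assumption | use F(2) in blast)+

theorem theorem6p9:
  fixes X :: "'a topology" and A I :: "('a \<Rightarrow> complex) set" and S :: "'a set"
  assumes "uniform_algebra X A"
    and "closed_ideal X A I"
    and "S = hull_of X I"
  shows
    "(\<exists>(r :: nat set rel) (X' :: ('a \<times> (('a \<Rightarrow> complex) \<Rightarrow> complex)) topology) A' p' I' S'.
        uniform_algebra X' A' \<and>
        continuous_map X' X p' \<and> p' ` topspace X' = topspace X \<and>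
        obtained_by_root_extensions r X A X' A' p' \<and>
        S' = {y \<in> topspace X'. p' y \<in> S} \<and>
        \<comment> \<open>(i)\<close>
        homeomorphic_map (subtopology X' S') (subtopology X S) p' \<and>
        \<comment> \<open>(ii)\<close>
        (\<exists>\<phi>. isometric_isomorphism (function_algebra S (restrictions A S))
                                   (function_algebra S' (restrictions A' S')) \<phi> \<and>
             (\<forall>f\<in>A. \<phi> (restrict f S) = restrict (pullback X' p' f) S')) \<and>
        \<comment> \<open>(iii)\<close>
        closed_ideal X' A' I' \<and> hull_of X' I' = S' \<and>
        I' \<inter> pullback X' p' ` A = pullback X' p' ` I \<and>
        (\<exists>\<phi>. isometric_isomorphism (quotient_algebra (function_algebra (topspace X') A') I')
                                   (quotient_algebra (function_algebra (topspace X) A) I) \<phi>) \<and>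
        (\<exists>\<Psi>. bij_betw \<Psi> {J. closed_ideal X' A' J \<and> I' \<subseteq> J} {J. closed_ideal X A J \<and> I \<subseteq> J} \<and>
             (\<forall>J1 J2. closed_ideal X' A' J1 \<and> I' \<subseteq> J1 \<and> closed_ideal X' A' J2 \<and> I' \<subseteq> J2 \<longrightarrow>
                (J1 \<subseteq> J2 \<longleftrightarrow> \<Psi> J1 \<subseteq> \<Psi> J2))) \<and>
        \<comment> \<open>(iv)\<close>
        (\<forall>f\<in>I'. \<exists>g\<in>I'. \<forall>x\<in>topspace X'. (g x)\<^sup>2 = f x) \<and>
        \<comment> \<open>(v)\<close>
        (normal_algebra X A \<longrightarrow>
           normal_algebra X' A' \<and>
           (\<forall>x\<in>topspace X' - S'. bounded_relative_units_at X' A' x) \<and>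
           (\<forall>x\<in>topspace X' - S'. generalized_peak_point X' A' x)))
     \<and>
     (metrizable_space X \<longrightarrow>
      (\<exists>(r :: nat set rel) (X' :: ('a \<times> (('a \<Rightarrow> complex) \<Rightarrow> complex)) topology) A' p' I' S'.
        uniform_algebra X' A' \<and>
        metrizable_space X' \<and>
        continuous_map X' X p' \<and> p' ` topspace X' = topspace X \<and>
        obtained_by_root_extensions r X A X' A' p' \<and>
        S' = {y \<in> topspace X'. p' y \<in> S} \<and>
        \<comment> \<open>(i)\<close>
        homeomorphic_map (subtopology X' S') (subtopology X S) p' \<and>
        \<comment> \<open>(ii)\<close>
        (\<exists>\<phi>. isometric_isomorphism (function_algebra S (restrictions A S))
                                   (function_algebra S' (restrictions A' S')) \<phi> \<and>
             (\<forall>f\<in>A. \<phi> (restrict f S) = restrict (pullback X' p' f) S')) \<and>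
        \<comment> \<open>(iii)\<close>
        closed_ideal X' A' I' \<and> hull_of X' I' = S' \<and>
        I' \<inter> pullback X' p' ` A = pullback X' p' ` I \<and>
        (\<exists>\<phi>. isometric_isomorphism (quotient_algebra (function_algebra (topspace X') A') I')
                                   (quotient_algebra (function_algebra (topspace X) A) I) \<phi>) \<and>
        (\<exists>\<Psi>. bij_betw \<Psi> {J. closed_ideal X' A' J \<and> I' \<subseteq> J} {J. closed_ideal X A J \<and> I \<subseteq> J} \<and>
             (\<forall>J1 J2. closed_ideal X' A' J1 \<and> I' \<subseteq> J1 \<and> closed_ideal X' A' J2 \<and> I' \<subseteq> J2 \<longrightarrow>
                (J1 \<subseteq> J2 \<longleftrightarrow> \<Psi> J1 \<subseteq> \<Psi> J2))) \<and>
        \<comment> \<open>(iv')\<close>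
        (\<exists>F\<subseteq>I'. I' \<subseteq> mtopology_of (cspace X') closure_of F \<and>
                (\<forall>f\<in>F. \<exists>g\<in>F. \<forall>x\<in>topspace X'. (g x)\<^sup>2 = f x)) \<and>
        \<comment> \<open>(v)\<close>
        (normal_algebra X A \<longrightarrow>
           normal_algebra X' A' \<and>
           (\<forall>x\<in>topspace X' - S'. bounded_relative_units_at X' A' x) \<and>
           (\<forall>x\<in>topspace X' - S'. generalized_peak_point X' A' x))))"
proof (intro conjI impI, goal_cases)
  case 1
  obtain r :: "nat set rel" and \<tau> where r: "Well_order r" "\<tau> \<in> Field r" "\<And>\<alpha>. \<alpha> \<in> Field r \<Longrightarrow> (\<alpha>, \<tau>) \<in> r"
    "infinite (Field r)" "\<And>\<alpha>. \<alpha> \<in> underS r \<tau> \<Longrightarrow> \<exists>\<beta>\<in>underS r \<tau>. (\<alpha>, \<beta>) \<in> r \<and> \<alpha> \<noteq> \<beta>"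
    "\<And>C. countable C \<Longrightarrow> C \<subseteq> underS r \<tau> \<Longrightarrow> \<exists>\<beta>\<in>underS r \<tau>. \<forall>\<alpha>\<in>C. (\<alpha>, \<beta>) \<in> r"
    by (rule omega1_order) blast
  \<comment> \<open>Every function of the ideal becomes a radicand, so earlier roots and local units
    of the ideal are included automatically.\<close>
  define pick where "pick Z Q W = Q \<inter> extensional (topspace Z)"
    for Z :: "('a \<times> (('a \<Rightarrow> complex) \<Rightarrow> complex)) topology" and Q :: "(_ \<Rightarrow> complex) set" and W :: "('a \<Rightarrow> complex) set"
  have pick: "pick Z Q W \<noteq> {} \<and> pick Z Q W \<subseteq> Q \<inter> extensional (topspace Z)"
    if "(\<lambda>y. 0) \<in> Q" "unif_closed (topspace Z) Q" for Z Q W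
    using restrict_zero[OF that] unfolding pick_def by blast
  obtain F code where RT: "root_tower X A I r \<tau> F code"
    and F: "\<And>\<alpha>. F \<alpha> = pick (tower_top X r code F \<alpha>) (tower_ideal (topspace X) (sat (topspace X) A) (sat (topspace X) I) r code F \<alpha>) (tower_index r code F \<alpha>)"
    using tower_choice[where pick = pick, OF assms(1,2) r(1-3) pick] by blast
  interpret root_tower X A I r \<tau> F code by (rule RT)
  have full: "F \<alpha> = II \<alpha> \<inter> extensional (Y \<alpha>)" for \<alpha>
    using F[of \<alpha>] unfolding pick_def tower_top_TT by simp
  interpret good_tower X A I r \<tau> F code
  proof (rule root_tower_good[OF RT r(4)])
    fix \<beta> assume b: "\<beta> \<in> underS r \<tau>"
    have \<beta>: "\<beta> \<in> Field r" by (rule underS_Field[OF b])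
    show "\<exists>\<delta>\<in>underS r \<tau>. \<beta> \<in> underS r \<delta>" using r(5)[OF b] by (simp add: underS_iff)
    have "adequate (TT \<beta>) (II \<beta>) (II \<beta> \<inter> extensional (Y \<beta>))"
      using adequate_restrict[of "TT \<beta>" "II \<beta>"] fun_idealD(1)[OF II_fun_ideal[OF \<beta>]] by simp
    then show "adequate (tower_top X r code F \<beta>) (II \<beta>) (F \<beta>)" unfolding tower_top_TT full[symmetric] .
    show "(\<lambda>w. restrict (\<lambda>y. snd y w) (Y \<beta>)) ` W \<beta> \<subseteq> F \<beta>" using roots_II[OF \<beta>] unfolding full[symmetric] .
  qed
  \<comment> \<open>With \<open>all_roots\<close> the top ideal coincides with
    \<open>root_family\<close>, which is closed under square roots.\<close>
  have "\<forall>f\<in>Is \<tau>. \<exists>g\<in>Is \<tau>. \<forall>x\<in>topspace (TT \<tau>). (g x)\<^sup>2 = f x"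
    using all_roots[OF r(6) full] root_family_Is root_family_root by (meson subsetD)
  with properties show ?case
    unfolding assms(3)
    by (intro exI[of _ r] exI[of _ "TT \<tau>"] exI[of _ "As \<tau>"] exI[of _ "fst"] exI[of _ "Is \<tau>"] exI[of _ "S'"]) (simp add: S'_def)
next
  case X: 2
  obtain r :: "nat set rel" and \<tau> where r: "Well_order r" "\<tau> \<in> Field r" "\<And>\<alpha>. \<alpha> \<in> Field r \<Longrightarrow> (\<alpha>, \<tau>) \<in> r"
    "infinite (Field r)" "\<And>\<alpha>. \<alpha> \<in> underS r \<tau> \<Longrightarrow> \<exists>\<beta>\<in>underS r \<tau>. (\<alpha>, \<beta>) \<in> r \<and> \<alpha> \<noteq> \<beta>"
    "countable (underS r \<tau>)" "\<And>\<alpha>. \<alpha> \<in> underS r \<tau> \<Longrightarrow> countable (underS r \<alpha>)"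
    by (rule omega_order) blast
  \<comment> \<open>The image in the last argument consists of the roots adjoined before; the chosen
    countable family has to contain them.\<close>
  define pick where "pick Z Q W = countable_pick Z Q ((\<lambda>w. restrict (\<lambda>y. snd y w) (topspace Z)) ` W)"
    for Z :: "('a \<times> (('a \<Rightarrow> complex) \<Rightarrow> complex)) topology" and Q :: "(_ \<Rightarrow> complex) set" and W :: "('a \<Rightarrow> complex) set"
  have pick: "pick Z Q W \<noteq> {} \<and> pick Z Q W \<subseteq> Q \<inter> extensional (topspace Z)"
    if "(\<lambda>y. 0) \<in> Q" "unif_closed (topspace Z) Q" for Z Q W
    unfolding pick_def by (rule countable_pick_sub[OF that])
  obtain F code where RT: "root_tower X A I r \<tau> F code"
    and F: "\<And>\<alpha>. F \<alpha> = pick (tower_top X r code F \<alpha>) (tower_ideal (topspace X) (sat (topspace X) A) (sat (topspace X) I) r code F \<alpha>) (tower_index r code F \<alpha>)"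
    using tower_choice[where pick = pick, OF assms(1,2) r(1-3) pick] by blast
  interpret root_tower X A I r \<tau> F code by (rule RT)
  have F': "F \<alpha> = countable_pick (TT \<alpha>) (II \<alpha>) ((\<lambda>w. restrict (\<lambda>y. snd y w) (Y \<alpha>)) ` W \<alpha>)" for \<alpha>
    using F[of \<alpha>] unfolding pick_def tower_top_TT by simp
  have cu: "countable (underS r \<alpha>)" if "\<alpha> \<in> Field r" for \<alpha>
    using r(3)[OF that] r(6) r(7)[of \<alpha>] unfolding underS_iff by (cases "\<alpha> = \<tau>") auto
  have cW: "countable (W \<alpha>)" if "\<alpha> \<in> Field r" for \<alpha> by (rule countable_W[OF F' X cu that])
  interpret good_tower X A I r \<tau> F code
  proof (rule root_tower_good[OF RT r(4)])
    fix \<beta> assume b: "\<beta> \<in> underS r \<tau>"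
    have \<beta>: "\<beta> \<in> Field r" by (rule underS_Field[OF b])
    show "\<exists>\<delta>\<in>underS r \<tau>. \<beta> \<in> underS r \<delta>" using r(5)[OF b] by (simp add: underS_iff)
    have g: "good_family (TT \<beta>) (II \<beta>) ((\<lambda>w. restrict (\<lambda>y. snd y w) (Y \<beta>)) ` W \<beta>) (F \<beta>)"
      by (rule good_stage[OF F' X cW[OF \<beta>] \<beta>])
    show "adequate (tower_top X r code F \<beta>) (II \<beta>) (F \<beta>)" using g unfolding good_family_def tower_top_TT by blast
    show "(\<lambda>w. restrict (\<lambda>y. snd y w) (Y \<beta>)) ` W \<beta> \<subseteq> F \<beta>" using g unfolding good_family_def by blast
  qed
  have "\<exists>G\<subseteq>Is \<tau>. Is \<tau> \<subseteq> mtopology_of (cspace (TT \<tau>)) closure_of G \<and> (\<forall>f\<in>G. \<exists>g\<in>G. \<forall>x\<in>topspace (TT \<tau>). (g x)\<^sup>2 = f x)"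
    using root_family_Is root_family_dense root_family_root by (intro exI[of _ root_family]) blast
  with properties TT_metrizable[OF X cW[OF \<tau>]] show ?case
    unfolding assms(3)
    by (intro exI[of _ r] exI[of _ "TT \<tau>"] exI[of _ "As \<tau>"] exI[of _ "fst"] exI[of _ "Is \<tau>"] exI[of _ "S'"]) (simp add: S'_def)
qed

end
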